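(* Let $v_\epsilon\in L^2((0,T)\times\Omega_\epsilon)\cap H^1((0,T),\mathcal{H}_\epsilon')$. Then $\mathcal{T}_\epsilon v_\epsilon\in H^1((0,T),L^2(\Omega,\mathcal{H}_0^1(Y^* ))')$ with $$\langle\partial_t\mathcal{T}_\epsilon v_\epsilon,\phi\rangle_{L^2(\Omega,\mathcal{H}_0^1(Y^* ))',L^2(\Omega,\mathcal{H}_0^1(Y^* ))}=\langle\partial_tv_\epsilon,\mathcal{U}_\epsilon(\phi)\rangle_{\Omega_\epsilon}$$ for all $\phi\in L^2(\Omega,\mathcal{H}_0^1(Y^* ))$ and almost everywhere in $(0,T)$. Additionally, $$\|\partial_t\mathcal{T}_\epsilon v_\epsilon\|_{L^2((0,T),L^2(\Omega,\mathcal{H}_0^1(Y^* ))')}\le\|\partial_tv_\epsilon\|_{L^2((0,T),\mathcal{H}_\epsilon')}.$$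
   Context: **Geometry.** $n\in\mathbb{N}$, $n>1$; $a,b\in\mathbb{N}^n$ with $a_i<b_i$ for all $i$; $\Omega=(a,b)=\prod_i(a_i,b_i)\subset\mathbb{R}^n$; $T>0$; $\epsilon>0$ with $\epsilon^{-1}\in\mathbb{N}$. $Y=(0,1)^n$; $Y^*\subset Y$ is a connected subdomain with Lipschitz boundary and matching opposite faces: $\partial Y^*\cap\{x_i=0\}+e_i=\partial Y^*\cap\{x_i=1\}$, $i=1,\dots,n$. $\Gamma:=\partial Y^*\setminus\partial Y$ is assumed to be a Lipschitz boundary. $K_\epsilon:=\{k\in\mathbb{Z}^n:\epsilon(Y+k)\subset\Omega\}$, $\Omega_\epsilon:=\mathrm{int}\big(\bigcup_{k\in K_\epsilon}\epsilon(\overline{Y^*}+k)\big)$, assumed connected with Lipschitz boundary. **Spaces.** $\mathcal{H}_\epsilon$ is $H^1(\Omega_\epsilon)$ with inner product $(u,w)_{\mathcal{H}_\epsilon}=(u,w)_{L^2(\Omega_\epsilon)}+\epsilon^2(\nabla u,\nabla w)_{L^2(\Omega_\epsilon)}$ and the associated norm; $L^2(\Omega_\epsilon)$ is embedded in $\mathcal{H}_\epsilon'$ via the $L^2$ inner product. $\langle\cdot,\cdot\rangle_{\Omega_\epsilon}$ is the duality pairing of $H^1(\Omega_\epsilon)'$ and $H^1(\Omega_\epsilon)$ (which agrees with that of $\mathcal{H}_\epsilon'$ and $\mathcal{H}_\epsilon$). $\mathcal{H}_0^1(Y^* ):=\{\phi\in H^1(Y^* ):\phi=0\text{ on }\partial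 Y\cap\partial Y^*\}$ with the $H^1(Y^* )$-norm; $L^2(\Omega\times Y^* )$ is embedded in $L^2(\Omega,\mathcal{H}_0^1(Y^* ))'$ via the $L^2$ inner product. Time derivatives are generalized (distributional, Banach-space valued). **Operators.** Unfolding operator: $\mathcal{T}_\epsilon:L^2((0,T)\times\Omega_\epsilon)\to L^2((0,T)\times\Omega\times Y^* )$, $\mathcal{T}_\epsilon u(t,x,y)=u\big(t,\epsilon[\tfrac{x}{\epsilon}]+\epsilon y\big)$, where $[\cdot]$ is the (componentwise) integer part and $\{z\}=z-[z]$. Averaging operator: $\mathcal{U}_\epsilon:L^2((0,T)\times\Omega\times Y^* )\to L^2((0,T)\times\Omega_\epsilon)$ is the $L^2$-adjoint of $\mathcal{T}_\epsilon$; explicitly $\mathcal{U}_\epsilon(\phi)(t,x)=\int_Y\phi\big(t,\epsilon(z+[\tfrac{x}{\epsilon}]),\{\tfrac{x}{\epsilon}\}\big)dz$. The same formula is used for time-independent $\phi$. *)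

theory Defs
  imports "HOL-Analysis.Analysis"
begin

(* Conventions.
   Elements of L2- and Sobolev spaces are represented by Lebesgue measurable functions on the
   whole type; only their values (up to null sets) on the domain matter, and every norm below
   is a seminorm on representatives whose null space is equality almost everywhere.
   Since the spaces depend on sets (the domains), they are sets of functions, not types. *)

section \<open>Lebesgue and Sobolev spaces\<close>

definition L2_on :: "'a::euclidean_space set \<Rightarrow> ('a \<Rightarrow> real) set" where
  "L2_on U = {u. u \<in> borel_measurable (lebesgue_on U) \<and>
                 integrable (lebesgue_on U) (\<lambda>x. (u x)\<^sup>2)}"

primrec Ck_fun :: "nat \<Rightarrow> ('a::euclidean_space \<Rightarrow> real) \<Rightarrow> bool" where
  "Ck_fun 0 f \<longleftrightarrow> continuous_on UNIV f"
| "Ck_fun (Suc k) f \<longleftrightarrow>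
     (\<exists>f'. (\<forall>x. (f has_derivative f' x) (at x)) \<and> (\<forall>i\<in>Basis. Ck_fun k (\<lambda>x. f' x i)))"

definition smooth_fun :: "('a::euclidean_space \<Rightarrow> real) \<Rightarrow> bool" where
  "smooth_fun f \<longleftrightarrow> (\<forall>k. Ck_fun k f)"

definition test_functions :: "'a::euclidean_space set \<Rightarrow> ('a \<Rightarrow> real) set" where
  "test_functions U = {\<theta>. smooth_fun \<theta> \<and> compact (closure {x. \<theta> x \<noteq> 0}) \<and>
                          closure {x. \<theta> x \<noteq> 0} \<subseteq> U}"

definition is_weak_gradient ::
  "'a::euclidean_space set \<Rightarrow> ('a \<Rightarrow> real) \<Rightarrow> ('a \<Rightarrow> 'a) \<Rightarrow> bool" where
  "is_weak_gradient U u g \<longleftrightarrow>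
     (\<forall>i\<in>Basis. (\<lambda>x. g x \<bullet> i) \<in> L2_on U \<and>
        (\<forall>\<theta>\<in>test_functions U.
           (LINT x|lebesgue_on U. u x * frechet_derivative \<theta> (at x) i) =
           - (LINT x|lebesgue_on U. (g x \<bullet> i) * \<theta> x)))"

definition H1 :: "'a::euclidean_space set \<Rightarrow> ('a \<Rightarrow> real) set" where
  "H1 U = {u \<in> L2_on U. \<exists>g. is_weak_gradient U u g}"

(* for open U, unique up to null sets of U *)
definition weak_gradient :: "'a::euclidean_space set \<Rightarrow> ('a \<Rightarrow> real) \<Rightarrow> 'a \<Rightarrow> 'a" where
  "weak_gradient U u = (SOME g. is_weak_gradient U u g)"

definition scaled_H1_inner ::
  "real \<Rightarrow> 'a::euclidean_space set \<Rightarrow> ('a \<Rightarrow> real) \<Rightarrow> ('a \<Rightarrow> real) \<Rightarrow> real" where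
  "scaled_H1_inner \<epsilon> U u w =
     (LINT x|lebesgue_on U. u x * w x) +
     \<epsilon>\<^sup>2 * (LINT x|lebesgue_on U. weak_gradient U u x \<bullet> weak_gradient U w x)"

definition scaled_H1_norm :: "real \<Rightarrow> 'a::euclidean_space set \<Rightarrow> ('a \<Rightarrow> real) \<Rightarrow> real" where
  "scaled_H1_norm \<epsilon> U u = sqrt (scaled_H1_inner \<epsilon> U u u)"

definition H1_norm :: "'a::euclidean_space set \<Rightarrow> ('a \<Rightarrow> real) \<Rightarrow> real" where
  "H1_norm U u = scaled_H1_norm 1 U u"

section \<open>Surface measure and traces\<close>

definition hausdorff_premeasure :: "nat \<Rightarrow> real \<Rightarrow> 'a::metric_space set \<Rightarrow> ennreal" where
  "hausdorff_premeasure d \<delta> A =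
     (INF S\<in>{S :: nat \<Rightarrow> 'a set. A \<subseteq> (\<Union>i. S i) \<and> (\<forall>i. bounded (S i) \<and> diameter (S i) \<le> \<delta>)}.
        \<Sum>i. if S i = {} then 0
             else ennreal (unit_ball_vol (real d) * (diameter (S i) / 2) ^ d))"

definition hausdorff_outer :: "nat \<Rightarrow> 'a::metric_space set \<Rightarrow> ennreal" where
  "hausdorff_outer d A = (SUP \<delta>\<in>{0<..}. hausdorff_premeasure d \<delta> A)"

(* the Hausdorff measure of codimension 1; a metric outer measure is countably additive on the
   Borel sets, so measure_of does not degenerate *)
definition surface_measure :: "'a::euclidean_space measure" where
  "surface_measure = measure_of UNIV (sets borel) (hausdorff_outer (DIM('a) - 1))"

(* The trace operator from H1 to L2 of the boundary is the continuous extension of the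
   restriction map on functions that are smooth up to the boundary: g is the trace of u. *)
definition has_trace :: "'a::euclidean_space set \<Rightarrow> ('a \<Rightarrow> real) \<Rightarrow> ('a \<Rightarrow> real) \<Rightarrow> bool" where
  "has_trace U u g \<longleftrightarrow>
     g \<in> borel_measurable borel \<and>
     (\<exists>s :: nat \<Rightarrow> 'a \<Rightarrow> real.
        (\<forall>k. smooth_fun (s k)) \<and>
        (\<lambda>k. H1_norm U (s k - u)) \<longlonglongrightarrow> 0 \<and>
        (\<lambda>k. \<integral>\<^sup>+x\<in>frontier U. ennreal ((s k x - g x)\<^sup>2) \<partial>surface_measure) \<longlonglongrightarrow> 0)"

definition H1_vanishing_on :: "'a::euclidean_space set \<Rightarrow> 'a set \<Rightarrow> ('a \<Rightarrow> real) set" where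
  "H1_vanishing_on U S =
     {u \<in> H1 U. \<exists>g. has_trace U u g \<and> (AE x in surface_measure. x \<in> S \<longrightarrow> g x = 0)}"

section \<open>Bochner spaces, dual spaces and generalized time derivatives\<close>

(* V is the set of (representatives of) elements and N the norm of a Banach space. *)
definition strongly_measurable ::
  "'t measure \<Rightarrow> 'v::minus set \<Rightarrow> ('v \<Rightarrow> real) \<Rightarrow> ('t \<Rightarrow> 'v) \<Rightarrow> bool" where
  "strongly_measurable M V N u \<longleftrightarrow>
     (\<exists>s :: nat \<Rightarrow> 't \<Rightarrow> 'v.
        (\<forall>k. simple_function M (s k) \<and> s k ` space M \<subseteq> V) \<and>
        (AE t in M. u t \<in> V \<and> (\<lambda>k. N (s k t - u t)) \<longlonglongrightarrow> 0))"

definition bochner_L2 ::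
  "'t measure \<Rightarrow> 'v::minus set \<Rightarrow> ('v \<Rightarrow> real) \<Rightarrow> ('t \<Rightarrow> 'v) set" where
  "bochner_L2 M V N = {u. strongly_measurable M V N u \<and> integrable M (\<lambda>t. (N (u t))\<^sup>2)}"

definition bochner_L2_norm :: "'t measure \<Rightarrow> ('v \<Rightarrow> real) \<Rightarrow> ('t \<Rightarrow> 'v) \<Rightarrow> real" where
  "bochner_L2_norm M N u = sqrt (LINT t|M. (N (u t))\<^sup>2)"

(* Bounded linear functionals on a space V of real functions. Boundedness makes a functional
   constant on classes of functions that are equal almost everywhere; its values outside V
   are irrelevant. *)
definition dual_space ::
  "('x \<Rightarrow> real) set \<Rightarrow> (('x \<Rightarrow> real) \<Rightarrow> real) \<Rightarrow> (('x \<Rightarrow> real) \<Rightarrow> real) set" where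
  "dual_space V N =
     {F. (\<forall>u\<in>V. \<forall>w\<in>V. F (\<lambda>x. u x + w x) = F u + F w) \<and>
         (\<forall>c. \<forall>u\<in>V. F (\<lambda>x. c * u x) = c * F u) \<and>
         (\<exists>C. \<forall>u\<in>V. \<bar>F u\<bar> \<le> C * N u)}"

definition dual_norm ::
  "('x \<Rightarrow> real) set \<Rightarrow> (('x \<Rightarrow> real) \<Rightarrow> real) \<Rightarrow> (('x \<Rightarrow> real) \<Rightarrow> real) \<Rightarrow> real" where
  "dual_norm V N F = (SUP u\<in>{u\<in>V. N u \<le> 1}. \<bar>F u\<bar>)"

(* L2((0,T), V') *)
definition L2_time_dual ::
  "real \<Rightarrow> ('x \<Rightarrow> real) set \<Rightarrow> (('x \<Rightarrow> real) \<Rightarrow> real) \<Rightarrow> (real \<Rightarrow> ('x \<Rightarrow> real) \<Rightarrow> real) set" where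
  "L2_time_dual T V N = bochner_L2 (lebesgue_on {0<..<T}) (dual_space V N) (dual_norm V N)"

definition L2_time_dual_norm ::
  "real \<Rightarrow> ('x \<Rightarrow> real) set \<Rightarrow> (('x \<Rightarrow> real) \<Rightarrow> real) \<Rightarrow> (real \<Rightarrow> ('x \<Rightarrow> real) \<Rightarrow> real) \<Rightarrow> real" where
  "L2_time_dual_norm T V N u = bochner_L2_norm (lebesgue_on {0<..<T}) (dual_norm V N) u"

(* u' in L2((0,T), V') is the distributional derivative of u. The Bochner integrals of
   u * deriv psi and u' * psi are functionals on V, compared by evaluating them at each w in V;
   evaluation at w commutes with the Bochner integral. *)
definition is_time_derivative ::
  "real \<Rightarrow> ('x \<Rightarrow> real) set \<Rightarrow> (('x \<Rightarrow> real) \<Rightarrow> real) \<Rightarrow>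
   (real \<Rightarrow> ('x \<Rightarrow> real) \<Rightarrow> real) \<Rightarrow> (real \<Rightarrow> ('x \<Rightarrow> real) \<Rightarrow> real) \<Rightarrow> bool" where
  "is_time_derivative T V N u u' \<longleftrightarrow>
     u' \<in> L2_time_dual T V N \<and>
     (\<forall>\<psi>\<in>test_functions {0<..<T}. \<forall>w\<in>V.
        (LINT t|lebesgue_on {0<..<T}. u t w * deriv \<psi> t) =
        - (LINT t|lebesgue_on {0<..<T}. u' t w * \<psi> t))"

(* H1((0,T), V') *)
definition H1_time_dual ::
  "real \<Rightarrow> ('x \<Rightarrow> real) set \<Rightarrow> (('x \<Rightarrow> real) \<Rightarrow> real) \<Rightarrow> (real \<Rightarrow> ('x \<Rightarrow> real) \<Rightarrow> real) set" where
  "H1_time_dual T V N = {u \<in> L2_time_dual T V N. \<exists>u'. is_time_derivative T V N u u'}"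

(* a function of time and space as a function of time with values in a dual space,
   via the inner product of L2(D) *)
definition L2_embed ::
  "'x::euclidean_space set \<Rightarrow> (real \<times> 'x \<Rightarrow> real) \<Rightarrow> real \<Rightarrow> ('x \<Rightarrow> real) \<Rightarrow> real" where
  "L2_embed D u t = (\<lambda>w. LINT x|lebesgue_on D. u (t, x) * w x)"

(* L2(Omega, V) for a space V of functions with norm N, V inside L2(Z). An element is given by
   a jointly measurable representative, under the identification of L2(Omega, L2(Z)) with
   L2(Omega x Z). *)
definition L2_fun_valued ::
  "'x::euclidean_space set \<Rightarrow> 'z::euclidean_space set \<Rightarrow> ('z \<Rightarrow> real) set \<Rightarrow>
   (('z \<Rightarrow> real) \<Rightarrow> real) \<Rightarrow> ('x \<times> 'z \<Rightarrow> real) set" where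
  "L2_fun_valued \<Omega> Z V N =
     {\<phi> \<in> L2_on (\<Omega> \<times> Z). (\<lambda>x y. \<phi> (x, y)) \<in> bochner_L2 (lebesgue_on \<Omega>) V N}"

definition L2_fun_valued_norm ::
  "'x::euclidean_space set \<Rightarrow> (('z \<Rightarrow> real) \<Rightarrow> real) \<Rightarrow> ('x \<times> 'z \<Rightarrow> real) \<Rightarrow> real" where
  "L2_fun_valued_norm \<Omega> N \<phi> = bochner_L2_norm (lebesgue_on \<Omega>) N (\<lambda>x y. \<phi> (x, y))"

section \<open>Lipschitz boundaries\<close>

definition tangential :: "'a::euclidean_space \<Rightarrow> 'a \<Rightarrow> 'a" where
  "tangential \<nu> z = z - (z \<bullet> \<nu>) *\<^sub>R \<nu>"

definition cylinder :: "'a::euclidean_space \<Rightarrow> 'a \<Rightarrow> real \<Rightarrow> real \<Rightarrow> 'a set" where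
  "cylinder p \<nu> r h = {z. norm (tangential \<nu> (z - p)) < r \<and> \<bar>(z - p) \<bullet> \<nu>\<bar> < h}"

definition lipschitz_boundary :: "'a::euclidean_space set \<Rightarrow> bool" where
  "lipschitz_boundary U \<longleftrightarrow>
     (\<forall>p\<in>frontier U. \<exists>\<nu> r h L \<gamma>.
        norm \<nu> = 1 \<and> r > 0 \<and> h > 0 \<and> L-lipschitz_on {w. w \<bullet> \<nu> = 0 \<and> norm w < r} \<gamma> \<and>
        U \<inter> cylinder p \<nu> r h =
          {z \<in> cylinder p \<nu> r h. (z - p) \<bullet> \<nu> < \<gamma> (tangential \<nu> (z - p))})"

(* for a set G that is only a part of the boundary of an open set *)
definition lipschitz_hypersurface :: "'a::euclidean_space set \<Rightarrow> bool" where
  "lipschitz_hypersurface G \<longleftrightarrow>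
     (\<forall>p\<in>G. \<exists>\<nu> r h L \<gamma>.
        norm \<nu> = 1 \<and> r > 0 \<and> h > 0 \<and> L-lipschitz_on {w. w \<bullet> \<nu> = 0 \<and> norm w < r} \<gamma> \<and>
        G \<inter> cylinder p \<nu> r h =
          {z \<in> cylinder p \<nu> r h. (z - p) \<bullet> \<nu> = \<gamma> (tangential \<nu> (z - p))})"

section \<open>Perforated domain, unfolding and averaging\<close>

definition unit_cell :: "(real ^ 'n) set" where
  "unit_cell = box 0 1"

definition int_vec :: "int ^ 'n \<Rightarrow> real ^ 'n" where
  "int_vec k = (\<chi> i. real_of_int (k $ i))"

definition box_domain :: "nat ^ 'n \<Rightarrow> nat ^ 'n \<Rightarrow> (real ^ 'n) set" where
  "box_domain a b = box (\<chi> i. real (a $ i)) (\<chi> i. real (b $ i))"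

definition cell_indices :: "real \<Rightarrow> (real ^ 'n) set \<Rightarrow> (int ^ 'n) set" where
  "cell_indices \<epsilon> \<Omega> = {k. (\<lambda>y. \<epsilon> *\<^sub>R (y + int_vec k)) ` unit_cell \<subseteq> \<Omega>}"

definition perforated :: "real \<Rightarrow> (real ^ 'n) set \<Rightarrow> (real ^ 'n) set \<Rightarrow> (real ^ 'n) set" where
  "perforated \<epsilon> \<Omega> Ystar =
     interior (\<Union>k\<in>cell_indices \<epsilon> \<Omega>. (\<lambda>y. \<epsilon> *\<^sub>R (y + int_vec k)) ` closure Ystar)"

definition floor_vec :: "real ^ 'n \<Rightarrow> real ^ 'n" where
  "floor_vec z = (\<chi> i. real_of_int \<lfloor>z $ i\<rfloor>)"

definition frac_vec :: "real ^ 'n \<Rightarrow> real ^ 'n" where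
  "frac_vec z = z - floor_vec z"

definition unfolding_op ::
  "real \<Rightarrow> (real \<times> (real ^ 'n) \<Rightarrow> real) \<Rightarrow> real \<times> (real ^ 'n) \<times> (real ^ 'n) \<Rightarrow> real" where
  "unfolding_op \<epsilon> u = (\<lambda>(t, x, y). u (t, \<epsilon> *\<^sub>R floor_vec (x /\<^sub>R \<epsilon>) + \<epsilon> *\<^sub>R y))"

(* for time-independent arguments *)
definition averaging_op ::
  "real \<Rightarrow> ((real ^ 'n) \<times> (real ^ 'n) \<Rightarrow> real) \<Rightarrow> real ^ 'n \<Rightarrow> real" where
  "averaging_op \<epsilon> \<phi> x =
     (LINT z|lebesgue_on unit_cell.
        \<phi> (\<epsilon> *\<^sub>R (z + floor_vec (x /\<^sub>R \<epsilon>)), frac_vec (x /\<^sub>R \<epsilon>)))"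

definition H10_cell :: "(real ^ 'n) set \<Rightarrow> (real ^ 'n \<Rightarrow> real) set" where
  "H10_cell Ystar = H1_vanishing_on Ystar (frontier unit_cell \<inter> frontier Ystar)"

definition L2_H10 ::
  "(real ^ 'n) set \<Rightarrow> (real ^ 'n) set \<Rightarrow> ((real ^ 'n) \<times> (real ^ 'n) \<Rightarrow> real) set" where
  "L2_H10 \<Omega> Ystar = L2_fun_valued \<Omega> Ystar (H10_cell Ystar) (H1_norm Ystar)"

definition L2_H10_norm ::
  "(real ^ 'n) set \<Rightarrow> (real ^ 'n) set \<Rightarrow> ((real ^ 'n) \<times> (real ^ 'n) \<Rightarrow> real) \<Rightarrow> real" where
  "L2_H10_norm \<Omega> Ystar = L2_fun_valued_norm \<Omega> (H1_norm Ystar)"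

end

theory Submission
  imports Defs
begin

text \<open>Unfolding and averaging are adjoint: the integral of (T w) f over \<Omega> \<times> Ystar is the integral of
  w (U f) over the perforated domain. So for almost every time the functional given by T v is the
  functional given by v composed with U, and testing the time derivative of T v with \<phi> amounts to
  testing that of v with U \<phi>. The derivative of T v is therefore dv composed with U. Composition
  with an operator of norm at most one preserves strong measurability and does not increase dual
  norms (\<open>L2_time_dual_transpose\<close>). All claims thus follow once U is known to map
  L2(\<Omega>, H10(Ystar)) into the Sobolev space of the perforated domain with norm at most one
  (\<open>averaging_op_H1\<close>).

  On a cell with index k the function U \<phi> is the average of \<phi>(x,.) over all x in the cell. Its
  gradient is 1/\<epsilon> times the average of the gradient of \<phi> in y; Jensen's inequality bounds both
  averages, and the weight of the scaled norm absorbs 1/\<epsilon>. What has to be shown is that no jumps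
  occur at the interfaces of cells. Let \<theta> be a test function on the perforated domain. Adjointness
  (\<open>averaging_op_adjoint\<close>) turns the integral of U \<phi> times a derivative of \<theta> into an integral of \<phi>
  times the unfolded derivative, and for fixed x one integrates by parts on Ystar
  (\<open>cell_integration_by_parts\<close>). The inner boundary does not contribute because \<theta> vanishes near it,
  and the flat faces do not contribute because the trace of \<phi>(x,.) vanishes there. Only flat faces
  enter, so the divergence theorem is replaced by the fundamental theorem of calculus on the lines
  parallel to the axes (\<open>integral_lborel_line\<close>, \<open>integral_cell_line\<close>).

  The trace is a limit of smooth functions in L2 of the boundary with respect to Hausdorff measure.
  To exploit it one needs that Hausdorff measure is countably additive on the Borel sets
  (\<open>measure_space_hausdorff\<close>) and dominates Lebesgue measure of flat faces up to a constant
  (\<open>emeasure_prism_le_surface_measure\<close>). The Lipschitz condition is used in two ways: the boundary of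
  Ystar is a null set, and Ystar is the interior of its closure.

  The gradient of \<phi> in y has to be a jointly measurable function. It is obtained as the limit of the
  gradients of approximating simple functions (\<open>bochner_L2_joint_gradient\<close>), which rests on the
  completeness of L2 (\<open>L2_complete\<close>). That the norm can be computed from any weak gradient is the
  fundamental lemma of the calculus of variations (\<open>fundamental_lemma_variations\<close>).\<close>

section \<open>Square integrable functions\<close>

text \<open>The minimum over t is attained at -B/C. Both Cauchy-Schwarz inequalities below,
  for square integrable functions and for the scaled Sobolev inner product, are instances.\<close>

lemma discriminant_bound:
  fixes A B C :: real
  assumes nonneg: "\<And>t. 0 \<le> A + 2 * t * B + t\<^sup>2 * C" and C: "0 \<le> C"
  shows "B\<^sup>2 \<le> A * C"
proof (cases "C = 0")
  case True
  have "B = 0"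
  proof (rule ccontr)
    assume "B \<noteq> 0"
    then have "A + 2 * (-(A + 1) / (2 * B)) * B + (-(A + 1) / (2 * B))\<^sup>2 * C = -1"
      using True by (simp add: field_simps)
    then show False using nonneg[of "-(A + 1) / (2 * B)"] by linarith
  qed
  then show ?thesis using True by simp
next
  case False
  have "0 \<le> A + 2 * (-B / C) * B + (-B / C)\<^sup>2 * C" by (rule nonneg)
  then have "0 \<le> (A + 2 * (-B / C) * B + (-B / C)\<^sup>2 * C) * C" using C by simp
  also have "\<dots> = A * C - B\<^sup>2" using False by (simp add: field_simps power2_eq_square)
  finally show ?thesis by simp
qed

definition L2 :: "'a measure \<Rightarrow> ('a \<Rightarrow> real) set" where
  "L2 M = {f \<in> borel_measurable M. integrable M (\<lambda>x. (f x)\<^sup>2)}"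

lemma L2_on_eq: "L2_on U = L2 (lebesgue_on U)"
  by (simp add: L2_on_def L2_def)

lemma L2_measurable: "f \<in> L2 M \<Longrightarrow> f \<in> borel_measurable M"
  and L2_square_integrable: "f \<in> L2 M \<Longrightarrow> integrable M (\<lambda>x. (f x)\<^sup>2)"
  by (auto simp: L2_def)

lemma L2_mult_integrable:
  assumes "f \<in> L2 M" "g \<in> L2 M"
  shows "integrable M (\<lambda>x. f x * g x)"
proof (rule Bochner_Integration.integrable_bound)
  show "integrable M (\<lambda>x. (f x)\<^sup>2 + (g x)\<^sup>2)"
    using assms by (auto simp: L2_def)
  show "(\<lambda>x. f x * g x) \<in> borel_measurable M"
    using assms by (auto simp: L2_def)
  have "\<bar>a * b\<bar> \<le> a\<^sup>2 + b\<^sup>2" for a b :: real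
  proof -
    have "2 * (\<bar>a\<bar> * \<bar>b\<bar>) \<le> a\<^sup>2 + b\<^sup>2" using sum_squares_bound[of "\<bar>a\<bar>" "\<bar>b\<bar>"] by (simp add: mult.assoc)
    moreover have "0 \<le> \<bar>a\<bar> * \<bar>b\<bar>" by simp
    ultimately show ?thesis unfolding abs_mult by linarith
  qed
  then show "AE x in M. norm (f x * g x) \<le> norm ((f x)\<^sup>2 + (g x)\<^sup>2)"
    by (auto simp: abs_of_nonneg)
qed

lemma L2_add:
  assumes f: "f \<in> L2 M" and g: "g \<in> L2 M"
  shows "(\<lambda>x. f x + g x) \<in> L2 M"
proof -
  have "integrable M (\<lambda>x. ((f x)\<^sup>2 + (g x)\<^sup>2) + 2 * (f x * g x))"
    using L2_mult_integrable[OF f g] f g unfolding L2_def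
    by (intro Bochner_Integration.integrable_add integrable_mult_right) auto
  then have "integrable M (\<lambda>x. (f x + g x)\<^sup>2)"
    by (simp add: power2_sum mult.assoc)
  then show ?thesis using f g by (auto simp: L2_def)
qed

lemma L2_cmult: "f \<in> L2 M \<Longrightarrow> (\<lambda>x. c * f x) \<in> L2 M"
  by (auto simp: L2_def power_mult_distrib)

lemma L2_diff: "f \<in> L2 M \<Longrightarrow> g \<in> L2 M \<Longrightarrow> (\<lambda>x. f x - g x) \<in> L2 M"
  using L2_add[of f M "\<lambda>x. -1 * g x"] L2_cmult[of g M "-1"] by simp

lemma L2_zero: "(\<lambda>x. 0) \<in> L2 M"
  by (auto simp: L2_def)

lemma L2_sum: "finite I \<Longrightarrow> (\<And>i. i \<in> I \<Longrightarrow> f i \<in> L2 M) \<Longrightarrow> (\<lambda>x. \<Sum>i\<in>I. f i x) \<in> L2 M"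
  by (induction I rule: finite_induct) (auto intro!: L2_add L2_zero)

lemma L2_cong_AE:
  assumes "f \<in> L2 M" "g \<in> borel_measurable M" "AE x in M. f x = g x"
  shows "g \<in> L2 M"
proof -
  have "integrable M (\<lambda>x. (f x)\<^sup>2) \<longleftrightarrow> integrable M (\<lambda>x. (g x)\<^sup>2)"
    using assms by (intro integrable_cong_AE) (auto simp: L2_def)
  then show ?thesis using assms by (auto simp: L2_def)
qed

lemma L2_bounded_mult:
  assumes f: "f \<in> L2 M" and h: "h \<in> borel_measurable M" and b: "\<And>x. x \<in> space M \<Longrightarrow> \<bar>h x\<bar> \<le> C"
  shows "(\<lambda>x. f x * h x) \<in> L2 M"
proof -
  have "integrable M (\<lambda>x. (f x * h x)\<^sup>2)"
  proof (rule Bochner_Integration.integrable_bound)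
    show "integrable M (\<lambda>x. C\<^sup>2 * (f x)\<^sup>2)" using f by (auto simp: L2_def)
    show "(\<lambda>x. (f x * h x)\<^sup>2) \<in> borel_measurable M" using f h by (auto simp: L2_def)
    show "AE x in M. norm ((f x * h x)\<^sup>2) \<le> norm (C\<^sup>2 * (f x)\<^sup>2)"
    proof (rule AE_I2)
      fix x assume "x \<in> space M"
      from b[OF this] have "(h x)\<^sup>2 \<le> C\<^sup>2" by (metis abs_ge_zero power2_abs power_mono)
      then show "norm ((f x * h x)\<^sup>2) \<le> norm (C\<^sup>2 * (f x)\<^sup>2)"
        using mult_left_mono[of "(h x)\<^sup>2" "C\<^sup>2" "(f x)\<^sup>2"] by (simp add: power_mult_distrib mult.commute)
    qed
  qed
  then show ?thesis using f h by (auto simp: L2_def)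
qed

lemma L2_cauchy_schwarz:
  assumes f: "f \<in> L2 M" and g: "g \<in> L2 M"
  shows "(LINT x|M. f x * g x)\<^sup>2 \<le> (LINT x|M. (f x)\<^sup>2) * (LINT x|M. (g x)\<^sup>2)"
proof (rule discriminant_bound)
  fix t :: real
  have "0 \<le> (LINT x|M. (f x + t * g x)\<^sup>2)" by (rule integral_nonneg_AE) simp
  also have "(LINT x|M. (f x + t * g x)\<^sup>2) = (LINT x|M. (f x)\<^sup>2 + 2 * t * (f x * g x) + t\<^sup>2 * (g x)\<^sup>2)"
    by (simp add: power2_sum power_mult_distrib algebra_simps)
  also have "\<dots> = (LINT x|M. (f x)\<^sup>2) + 2 * t * (LINT x|M. f x * g x) + t\<^sup>2 * (LINT x|M. (g x)\<^sup>2)"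
    using f g L2_mult_integrable[OF f g] by (simp add: L2_def)
  finally show "0 \<le> (LINT x|M. (f x)\<^sup>2) + 2 * t * (LINT x|M. f x * g x) + t\<^sup>2 * (LINT x|M. (g x)\<^sup>2)" .
qed (rule integral_nonneg_AE, simp)

lemma L2_tendsto_integral_mult:
  assumes f: "\<And>n. f n \<in> L2 M" and g: "g \<in> L2 M" and h: "h \<in> L2 M"
    and lim: "(\<lambda>n. LINT x|M. (f n x - g x)\<^sup>2) \<longlonglongrightarrow> 0"
  shows "(\<lambda>n. LINT x|M. f n x * h x) \<longlonglongrightarrow> (LINT x|M. g x * h x)"
proof -
  have "(\<lambda>n. ((LINT x|M. f n x * h x) - (LINT x|M. g x * h x))\<^sup>2) \<longlonglongrightarrow> 0"
  proof (rule real_tendsto_sandwich[where f="\<lambda>_. 0"])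
    show "\<forall>\<^sub>F n in sequentially. ((LINT x|M. f n x * h x) - (LINT x|M. g x * h x))\<^sup>2
        \<le> (LINT x|M. (f n x - g x)\<^sup>2) * (LINT x|M. (h x)\<^sup>2)"
    proof (rule always_eventually, rule allI)
      fix n
      have "(LINT x|M. f n x * h x) - (LINT x|M. g x * h x) = (LINT x|M. (f n x - g x) * h x)"
        using L2_mult_integrable[OF f h] L2_mult_integrable[OF g h]
        by (simp add: left_diff_distrib)
      then show "((LINT x|M. f n x * h x) - (LINT x|M. g x * h x))\<^sup>2
        \<le> (LINT x|M. (f n x - g x)\<^sup>2) * (LINT x|M. (h x)\<^sup>2)"
        using L2_cauchy_schwarz[OF L2_diff[OF f g] h] by simp
    qed
    show "(\<lambda>n. (LINT x|M. (f n x - g x)\<^sup>2) * (LINT x|M. (h x)\<^sup>2)) \<longlonglongrightarrow> 0"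
      using tendsto_mult_right[OF lim, of "LINT x|M. (h x)\<^sup>2"] by simp
  qed auto
  then have "(\<lambda>n. (LINT x|M. f n x * h x) - (LINT x|M. g x * h x)) \<longlonglongrightarrow> 0"
    by (subst (asm) power_tendsto_0_iff) auto
  then show ?thesis by (simp add: LIM_zero_iff)
qed

lemma L2_tendsto_integral_square:
  assumes f: "\<And>n. f n \<in> L2 M" and g: "g \<in> L2 M"
    and lim: "(\<lambda>n. LINT x|M. (f n x - g x)\<^sup>2) \<longlonglongrightarrow> 0"
  shows "(\<lambda>n. LINT x|M. (f n x)\<^sup>2) \<longlonglongrightarrow> (LINT x|M. (g x)\<^sup>2)"
proof -
  have "(LINT x|M. (f n x)\<^sup>2) = (LINT x|M. (f n x - g x)\<^sup>2) + 2 * (LINT x|M. f n x * g x) - (LINT x|M. (g x)\<^sup>2)" for n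
  proof -
    have "(LINT x|M. (f n x)\<^sup>2) = (LINT x|M. ((f n x - g x)\<^sup>2 + 2 * (f n x * g x)) - (g x)\<^sup>2)"
      by (rule Bochner_Integration.integral_cong) (auto simp: power2_eq_square algebra_simps)
    also have "\<dots> = (LINT x|M. (f n x - g x)\<^sup>2) + 2 * (LINT x|M. f n x * g x) - (LINT x|M. (g x)\<^sup>2)"
      using L2_diff[OF f[of n] g] L2_mult_integrable[OF f[of n] g] g
      by (simp add: L2_def)
    finally show ?thesis .
  qed
  moreover have "(\<lambda>n. (LINT x|M. (f n x - g x)\<^sup>2) + 2 * (LINT x|M. f n x * g x) - (LINT x|M. (g x)\<^sup>2))
     \<longlonglongrightarrow> 0 + 2 * (LINT x|M. g x * g x) - (LINT x|M. (g x)\<^sup>2)"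
    by (intro tendsto_intros lim L2_tendsto_integral_mult f g)
  ultimately show ?thesis by (simp add: power2_eq_square)
qed

lemma nn_integral_square_eq:
  "f \<in> L2 M \<Longrightarrow> (\<integral>\<^sup>+x. ennreal ((f x)\<^sup>2) \<partial>M) = ennreal (LINT x|M. (f x)\<^sup>2)"
  by (rule nn_integral_eq_integral) (auto simp: L2_def)

lemma L2_I_nn_integral:
  assumes "f \<in> borel_measurable M" "(\<integral>\<^sup>+x. ennreal ((f x)\<^sup>2) \<partial>M) \<le> ennreal C"
  shows "f \<in> L2 M" "0 \<le> C \<Longrightarrow> (LINT x|M. (f x)\<^sup>2) \<le> C"
proof -
  show f: "f \<in> L2 M"
    using assms by (auto simp: L2_def integrable_iff_bounded intro: le_less_trans)
  show "(LINT x|M. (f x)\<^sup>2) \<le> C" if "0 \<le> C"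
    using assms(2) that unfolding nn_integral_square_eq[OF f] by (simp add: ennreal_le_iff)
qed

text \<open>The rate (1/8)^k leaves room for the weights 2^k in the proof of completeness.\<close>

lemma rapid_subsequence:
  fixes d :: "nat \<Rightarrow> nat \<Rightarrow> real"
  assumes "\<And>e. e > 0 \<Longrightarrow> \<exists>N. \<forall>m\<ge>N. \<forall>n\<ge>N. d m n < e"
  shows "\<exists>r. strict_mono r \<and> (\<forall>k. d (r (Suc k)) (r k) \<le> (1/8) ^ k)"
proof -
  have "\<forall>k. \<exists>N. \<forall>m\<ge>N. \<forall>n\<ge>N. d m n < (1/8) ^ k"
    using assms by simp
  then obtain N where N: "\<And>k m n. m \<ge> N k \<Longrightarrow> n \<ge> N k \<Longrightarrow> d m n < (1/8) ^ k" by metis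
  define r where "r = rec_nat (N 0) (\<lambda>k x. max (Suc x) (N (Suc k)))"
  have r0: "r 0 = N 0" and rS: "\<And>k. r (Suc k) = max (Suc (r k)) (N (Suc k))"
    by (auto simp: r_def)
  have mono: "strict_mono r" by (rule strict_monoI_Suc) (auto simp: rS)
  have ge: "r k \<ge> N k" for k by (cases k) (auto simp: r0 rS)
  have "d (r (Suc k)) (r k) \<le> (1/8) ^ k" for k
    using N[of k "r (Suc k)" "r k"] ge[of k] strict_mono_less[OF mono, of k "Suc k"] by auto
  with mono show ?thesis by auto
qed

text \<open>Along a rapid subsequence the increments h_k satisfy \<Sum> 2^k \<integral>
  h_k^2 < \<infinity>, so \<Sum> 2^k h_k(x)^2 is finite for almost every x, and
  \<bar>h_k(x)\<bar> \<le> (1/2)^k + 2^k h_k(x)^2 makes the increments summable there.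
  Fatou's lemma turns the pointwise limit into a limit in the mean square.\<close>

theorem L2_complete:
  assumes f: "\<And>n. f n \<in> L2 M"
    and cauchy: "\<And>e. e > 0 \<Longrightarrow> \<exists>N. \<forall>m\<ge>N. \<forall>n\<ge>N. (LINT x|M. (f m x - f n x)\<^sup>2) < e"
  shows "\<exists>g\<in>L2 M. (\<lambda>n. LINT x|M. (f n x - g x)\<^sup>2) \<longlonglongrightarrow> 0"
proof -
  obtain r where r: "strict_mono r"
    and rapid: "\<And>k. (LINT x|M. (f (r (Suc k)) x - f (r k) x)\<^sup>2) \<le> (1/8) ^ k"
    using rapid_subsequence[of "\<lambda>m n. LINT x|M. (f m x - f n x)\<^sup>2"] cauchy by blast
  define h where "h k x = f (r (Suc k)) x - f (r k) x" for k x
  have h: "h k \<in> L2 M" for k unfolding h_def by (intro L2_diff f)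
  have [measurable]: "f n \<in> borel_measurable M" "h n \<in> borel_measurable M" for n
    using f h by (auto simp: L2_def)
  have "(\<integral>\<^sup>+x. (\<Sum>k. ennreal (2^k * (h k x)\<^sup>2)) \<partial>M) = (\<Sum>k. \<integral>\<^sup>+x. ennreal (2^k * (h k x)\<^sup>2) \<partial>M)"
    by (rule nn_integral_suminf) measurable
  also have "\<dots> \<le> (\<Sum>k. ennreal ((1/4)^k))"
  proof (rule suminf_le)
    fix k
    have "(\<integral>\<^sup>+x. ennreal (2^k * (h k x)\<^sup>2) \<partial>M) = (\<integral>\<^sup>+x. ennreal (2^k) * ennreal ((h k x)\<^sup>2) \<partial>M)"
      by (simp add: ennreal_mult)
    also have "\<dots> = ennreal (2^k) * ennreal (LINT x|M. (h k x)\<^sup>2)"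
      by (subst nn_integral_cmult) (auto simp: nn_integral_square_eq[OF h])
    also have "\<dots> \<le> ennreal (2^k) * ennreal ((1/8)^k)"
      using rapid[of k] by (intro mult_left_mono ennreal_leI) (auto simp: h_def)
    also have "\<dots> = ennreal ((1/4)^k)"
      by (simp add: ennreal_mult[symmetric] power_mult_distrib[symmetric])
    finally show "(\<integral>\<^sup>+x. ennreal (2^k * (h k x)\<^sup>2) \<partial>M) \<le> ennreal ((1/4)^k)" .
  qed auto
  also have "\<dots> < \<infinity>"
    by (subst suminf_ennreal_eq[of "\<lambda>k. (1/4)^k" "1 / (1 - 1/4)"]) (use geometric_sums[of "1/4::real"] in auto)
  finally have "AE x in M. (\<Sum>k. ennreal (2^k * (h k x)\<^sup>2)) \<noteq> \<infinity>"
    by (intro nn_integral_PInf_AE) auto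
  then have conv: "AE x in M. convergent (\<lambda>k. f (r k) x)"
  proof (rule AE_mp, intro AE_I2 impI)
    fix x assume fin: "(\<Sum>k. ennreal (2^k * (h k x)\<^sup>2)) \<noteq> \<infinity>"
    have s1: "summable (\<lambda>k. 2^k * (h k x)\<^sup>2)"
      by (rule summable_suminf_not_top) (use fin in auto)
    have s2: "summable (\<lambda>k. (1/2::real)^k + 2^k * (h k x)\<^sup>2)"
      by (intro summable_add s1 summable_geometric) auto
    have "summable (\<lambda>k. h k x)"
    proof (rule summable_comparison_test'[OF s2])
      fix k :: nat assume "k \<ge> 0"
      \<comment> \<open>The product of (1/2)^(k/2) and 2^(k/2) \<bar>h k x\<bar> is at most
        half the sum of the squares.\<close>
      have "0 \<le> ((2::real)^k) * ((1/2)^k - \<bar>h k x\<bar>)\<^sup>2" by simp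
      also have "\<dots> = 2^k * ((1/2)^k * (1/2)^k) - 2 * (2^k * (1/2)^k) * \<bar>h k x\<bar> + 2^k * (h k x)\<^sup>2"
        by (simp add: power2_diff algebra_simps power2_eq_square)
      also have "\<dots> = (1/2)^k - 2 * \<bar>h k x\<bar> + 2^k * (h k x)\<^sup>2"
      proof -
        have "(2::real)^k * (1/2)^k = 1" by (simp add: power_mult_distrib[symmetric])
        then show ?thesis by (simp add: mult.assoc[symmetric])
      qed
      finally show "norm (h k x) \<le> (1/2)^k + 2^k * (h k x)\<^sup>2" by auto
    qed
    then have "convergent (\<lambda>n. f (r 0) x + (\<Sum>k<n. h k x))"
      by (intro convergent_add convergent_const) (simp add: summable_iff_convergent)
    moreover have "f (r 0) x + (\<Sum>k<n. h k x) = f (r n) x" for n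
      by (induction n) (auto simp: h_def)
    ultimately show "convergent (\<lambda>k. f (r k) x)" by simp
  qed
  define g where "g x = lim (\<lambda>k. f (r k) x)" for x
  have g_meas[measurable]: "g \<in> borel_measurable M"
    unfolding g_def by (rule borel_measurable_lim_metric) measurable
  have fatou: "(\<integral>\<^sup>+x. ennreal ((f n x - g x)\<^sup>2) \<partial>M) \<le> ennreal e"
    if n: "\<And>m. m \<ge> N \<Longrightarrow> (LINT x|M. (f n x - f m x)\<^sup>2) \<le> e" for n N e
  proof -
    have "(\<integral>\<^sup>+x. ennreal ((f n x - g x)\<^sup>2) \<partial>M) = (\<integral>\<^sup>+x. liminf (\<lambda>k. ennreal ((f n x - f (r k) x)\<^sup>2)) \<partial>M)"
    proof (rule nn_integral_cong_AE, rule AE_mp[OF conv], intro AE_I2 impI)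
      fix x assume "convergent (\<lambda>k. f (r k) x)"
      then have "(\<lambda>k. f (r k) x) \<longlonglongrightarrow> g x" by (simp add: g_def convergent_LIMSEQ_iff)
      then have "(\<lambda>k. ennreal ((f n x - f (r k) x)\<^sup>2)) \<longlonglongrightarrow> ennreal ((f n x - g x)\<^sup>2)"
        by (intro tendsto_ennrealI tendsto_intros)
      then show "ennreal ((f n x - g x)\<^sup>2) = liminf (\<lambda>k. ennreal ((f n x - f (r k) x)\<^sup>2))"
        by (intro lim_imp_Liminf[symmetric]) auto
    qed
    also have "\<dots> \<le> liminf (\<lambda>k. \<integral>\<^sup>+x. ennreal ((f n x - f (r k) x)\<^sup>2) \<partial>M)"
      by (rule nn_integral_liminf) measurable
    also have "\<dots> \<le> liminf (\<lambda>k. ennreal e)"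
    proof (rule Liminf_mono, rule eventually_sequentiallyI[of N])
      fix k assume "N \<le> k"
      then have "N \<le> r k" using seq_suble[OF r, of k] by simp
      then show "(\<integral>\<^sup>+x. ennreal ((f n x - f (r k) x)\<^sup>2) \<partial>M) \<le> ennreal e"
        using n[of "r k"] by (subst nn_integral_square_eq[OF L2_diff[OF f f]]) (auto intro: ennreal_leI)
    qed
    also have "\<dots> = ennreal e" by (simp add: Liminf_const)
    finally show ?thesis .
  qed
  have ev: "\<exists>N. \<forall>n\<ge>N. (\<lambda>x. f n x - g x) \<in> L2 M \<and> (LINT x|M. (f n x - g x)\<^sup>2) \<le> e" if "e > 0" for e
  proof -
    obtain N where "\<forall>m\<ge>N. \<forall>n\<ge>N. (LINT x|M. (f m x - f n x)\<^sup>2) < e" using cauchy[OF \<open>e > 0\<close>] by blast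
    then have "(\<integral>\<^sup>+x. ennreal ((f n x - g x)\<^sup>2) \<partial>M) \<le> ennreal e" if "n \<ge> N" for n
      using that by (intro fatou[of N]) (auto simp: less_imp_le)
    then show ?thesis
      using \<open>e > 0\<close> by (intro exI[of _ N]) (auto intro!: L2_I_nn_integral)
  qed
  obtain n where "(\<lambda>x. f n x - g x) \<in> L2 M" using ev[of 1] by auto
  from L2_diff[OF f[of n] this] have g: "g \<in> L2 M" by simp
  have "(\<lambda>n. LINT x|M. (f n x - g x)\<^sup>2) \<longlonglongrightarrow> 0"
  proof (rule LIMSEQ_I)
    fix e :: real assume "e > 0"
    then obtain N where N: "\<forall>n\<ge>N. (LINT x|M. (f n x - g x)\<^sup>2) \<le> e / 2" using ev[of "e/2"] by auto
    have "norm ((LINT x|M. (f n x - g x)\<^sup>2) - 0) < e" if "n \<ge> N" for n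
    proof -
      have "0 \<le> (LINT x|M. (f n x - g x)\<^sup>2)" by (rule integral_nonneg_AE) simp
      then show ?thesis using N that \<open>e > 0\<close> by (auto simp: abs_of_nonneg intro: le_less_trans[of _ "e/2"])
    qed
    then show "\<exists>N. \<forall>n\<ge>N. norm ((LINT x|M. (f n x - g x)\<^sup>2) - 0) < e" by auto
  qed
  with g show ?thesis by auto
qed

section \<open>Borel versions of Lebesgue measurable functions\<close>

lemma AE_lebesgue_on_iff:
  "S \<in> sets borel \<Longrightarrow> (AE x in lebesgue_on S. P x) \<longleftrightarrow> (AE x in lborel. x \<in> S \<longrightarrow> P x)"
  by (subst AE_restrict_space_iff) (auto simp: AE_completion_iff)

text \<open>The function classes consist of Lebesgue measurable functions, whereas theorems
  on products and images of measures speak about Borel functions. A Borel function that is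
  equal almost everywhere mediates between the two.\<close>

lemma borel_version:
  fixes u :: "'a::euclidean_space \<Rightarrow> real"
  assumes S: "S \<in> sets borel" and u: "u \<in> borel_measurable (lebesgue_on S)"
  obtains u' where "u' \<in> borel_measurable borel" "AE x in lborel. x \<in> S \<longrightarrow> u x = u' x"
    "\<And>x. x \<notin> S \<Longrightarrow> u' x = 0"
proof -
  have "(\<lambda>x. if x \<in> S then u x else 0) \<in> borel_measurable lebesgue"
    using u S by (intro borel_measurable_if_I) auto
  from completion_ex_borel_measurable_real[OF this]
  obtain w where w: "w \<in> borel_measurable lborel" "AE x in lborel. (if x \<in> S then u x else 0) = w x" by blast
  show ?thesis
  proof
    show "(\<lambda>x. indicator S x * w x) \<in> borel_measurable borel" using w S by auto
    show "AE x in lborel. x \<in> S \<longrightarrow> u x = indicator S x * w x" using w(2) by eventually_elim auto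
  qed auto
qed

lemma (in complete_measure) measurable_cong_AE:
  assumes f: "f \<in> M \<rightarrow>\<^sub>M N" and ae: "AE x in M. f x = g x" and g: "\<And>x. x \<in> space M \<Longrightarrow> g x \<in> space N"
  shows "g \<in> M \<rightarrow>\<^sub>M N"
proof (rule measurableI)
  fix A assume "A \<in> sets N"
  then have A: "f -` A \<inter> space M \<in> sets M" using f by auto
  have "AE x in M. x \<in> f -` A \<inter> space M \<longleftrightarrow> x \<in> g -` A \<inter> space M"
    using ae by eventually_elim auto
  from this A show "g -` A \<inter> space M \<in> sets M" by (rule in_sets_AE) auto
qed (use g in auto)

lemma borel_measurable_lebesgue_onI:
  fixes u' :: "'a::euclidean_space \<Rightarrow> real"
  assumes S: "S \<in> sets borel" and u': "u' \<in> borel_measurable borel" and ae: "AE x in lborel. x \<in> S \<longrightarrow> u x = u' x"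
  shows "u \<in> borel_measurable (lebesgue_on S)"
proof -
  have "(\<lambda>x. if x \<in> S then u x else 0) \<in> borel_measurable lebesgue"
  proof (rule completion.measurable_cong_AE)
    show "(\<lambda>x. if x \<in> S then u' x else 0) \<in> borel_measurable lebesgue"
      using u' S by (intro measurable_completion) auto
    show "AE x in lebesgue. (if x \<in> S then u' x else 0) = (if x \<in> S then u x else 0)"
      using ae by (auto simp: AE_completion_iff elim: eventually_mono)
  qed auto
  then show ?thesis using S by (subst borel_measurable_if[symmetric]) auto
qed

text \<open>These equations move an integral from the completed measure on a subset to the
  Borel measure of the whole space, where Tonelli's theorem and translation invariance are
  at hand.\<close>

lemma integral_lebesgue_on_cong_AE:
  fixes u :: "'a::euclidean_space \<Rightarrow> real"
  assumes S: "S \<in> sets borel" and u': "u' \<in> borel_measurable borel" and ae: "AE x in lborel. x \<in> S \<longrightarrow> u x = u' x"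
  shows "integrable (lebesgue_on S) u \<longleftrightarrow> integrable lborel (\<lambda>x. indicator S x * u' x)"
    and "integral\<^sup>L (lebesgue_on S) u = (LINT x|lborel. indicator S x * u' x)"
proof -
  have m: "(\<lambda>x. indicator S x * u' x) \<in> borel_measurable lborel" using u' S by auto
  have u: "u \<in> borel_measurable (lebesgue_on S)" by (rule borel_measurable_lebesgue_onI[OF assms])
  have u'2: "u' \<in> borel_measurable (lebesgue_on S)"
    using u' by (intro measurable_restrict_space1 measurable_completion) auto
  have ae2: "AE x in lebesgue_on S. u x = u' x" using ae S by (simp add: AE_lebesgue_on_iff)
  have "integrable (lebesgue_on S) u \<longleftrightarrow> integrable (lebesgue_on S) u'"
    using u u'2 ae2 by (rule integrable_cong_AE)
  also have "\<dots> \<longleftrightarrow> integrable lborel (\<lambda>x. indicator S x * u' x)"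
    using S integrable_completion[OF m] by (subst integrable_restrict_space) (auto simp: mult.commute)
  finally show "integrable (lebesgue_on S) u \<longleftrightarrow> integrable lborel (\<lambda>x. indicator S x * u' x)" .
  have "integral\<^sup>L (lebesgue_on S) u = integral\<^sup>L (lebesgue_on S) u'"
    using u u'2 ae2 by (rule integral_cong_AE)
  also have "\<dots> = (LINT x|lborel. indicator S x * u' x)"
    using S integral_completion[OF m] by (subst integral_restrict_space) (auto simp: mult.commute)
  finally show "integral\<^sup>L (lebesgue_on S) u = (LINT x|lborel. indicator S x * u' x)" .
qed

section \<open>Differentiability classes\<close>

declare Ck_fun.simps(2) [simp del]

lemma Ck_fun_SucI:
  assumes "\<And>x. (f has_derivative f' x) (at x)" "\<And>i. i \<in> Basis \<Longrightarrow> Ck_fun k (\<lambda>x. f' x i)"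
  shows "Ck_fun (Suc k) f"
  unfolding Ck_fun.simps(2) using assms by (intro exI[of _ f']) simp

lemma Ck_fun_SucE:
  assumes "Ck_fun (Suc k) f"
  obtains f' where "\<And>x. (f has_derivative f' x) (at x)" "\<And>i. i \<in> Basis \<Longrightarrow> Ck_fun k (\<lambda>x. f' x i)"
  using assms that unfolding Ck_fun.simps(2) by metis

lemma Ck_fun_imp_continuous:
  assumes "Ck_fun k f"
  shows "continuous_on UNIV f"
proof (cases k)
  case (Suc l)
  with assms have "Ck_fun (Suc l) f" by simp
  then obtain f' where "\<And>x. (f has_derivative f' x) (at x)" by (rule Ck_fun_SucE) blast
  then show ?thesis by (auto simp: continuous_on_eq_continuous_at intro: has_derivative_continuous)
qed (use assms in auto)

lemma Ck_fun_SucD: "Ck_fun (Suc k) f \<Longrightarrow> Ck_fun k f"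
proof (induction k arbitrary: f)
  case 0 then show ?case by (simp add: Ck_fun_imp_continuous)
next
  case (Suc k)
  from Suc.prems obtain f' where "\<And>x. (f has_derivative f' x) (at x)" "\<And>i. i \<in> Basis \<Longrightarrow> Ck_fun (Suc k) (\<lambda>x. f' x i)"
    by (rule Ck_fun_SucE) blast
  then show ?case using Suc.IH by (intro Ck_fun_SucI[of _ f']) auto
qed

lemma Ck_fun_const: "Ck_fun k (\<lambda>x. c)"
proof (induction k arbitrary: c)
  case (Suc k)
  show ?case by (rule Ck_fun_SucI[where f'="\<lambda>_ _. 0"]) (auto intro: Suc)
qed auto

lemma Ck_fun_add: "Ck_fun k f \<Longrightarrow> Ck_fun k g \<Longrightarrow> Ck_fun k (\<lambda>x. f x + g x)"
proof (induction k arbitrary: f g)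
  case 0 then show ?case by (auto intro: continuous_intros)
next
  case (Suc k)
  from Suc.prems(1) obtain f' where f': "\<And>x. (f has_derivative f' x) (at x)" "\<And>i. i \<in> Basis \<Longrightarrow> Ck_fun k (\<lambda>x. f' x i)"
    by (rule Ck_fun_SucE) blast
  from Suc.prems(2) obtain g' where g': "\<And>x. (g has_derivative g' x) (at x)" "\<And>i. i \<in> Basis \<Longrightarrow> Ck_fun k (\<lambda>x. g' x i)"
    by (rule Ck_fun_SucE) blast
  show ?case
    by (rule Ck_fun_SucI[where f'="\<lambda>x h. f' x h + g' x h"]) (use f' g' in \<open>auto intro: Suc.IH has_derivative_add\<close>)
qed

lemma Ck_fun_mult: "Ck_fun k f \<Longrightarrow> Ck_fun k g \<Longrightarrow> Ck_fun k (\<lambda>x. f x * g x)"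
proof (induction k arbitrary: f g)
  case 0 then show ?case by (auto intro: continuous_intros)
next
  case (Suc k)
  note fg = Suc.prems[THEN Ck_fun_SucD]
  from Suc.prems(1) obtain f' where f': "\<And>x. (f has_derivative f' x) (at x)" "\<And>i. i \<in> Basis \<Longrightarrow> Ck_fun k (\<lambda>x. f' x i)"
    by (rule Ck_fun_SucE) blast
  from Suc.prems(2) obtain g' where g': "\<And>x. (g has_derivative g' x) (at x)" "\<And>i. i \<in> Basis \<Longrightarrow> Ck_fun k (\<lambda>x. g' x i)"
    by (rule Ck_fun_SucE) blast
  show ?case
    by (rule Ck_fun_SucI[where f'="\<lambda>x h. f x * g' x h + f' x h * g x"])
       (use f' g' fg in \<open>auto intro!: Suc.IH Ck_fun_add has_derivative_mult\<close>)
qed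

lemma Ck_fun_prod: "finite I \<Longrightarrow> (\<And>i. i \<in> I \<Longrightarrow> Ck_fun k (f i)) \<Longrightarrow> Ck_fun k (\<lambda>x. \<Prod>i\<in>I. f i x)"
  by (induction I rule: finite_induct) (auto intro: Ck_fun_const Ck_fun_mult)

lemma Ck_fun_affine: "Ck_fun k f \<Longrightarrow> Ck_fun k (\<lambda>y. f (c + r *\<^sub>R y))"
proof (induction k arbitrary: f)
  case 0 then show ?case
    by (auto intro!: continuous_intros continuous_on_compose2[of UNIV f])
next
  case (Suc k)
  from Suc.prems obtain f' where f': "\<And>x. (f has_derivative f' x) (at x)" "\<And>i. i \<in> Basis \<Longrightarrow> Ck_fun k (\<lambda>x. f' x i)"
    by (rule Ck_fun_SucE) blast
  show ?case
  proof (rule Ck_fun_SucI)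
    fix y
    have "((\<lambda>y. c + r *\<^sub>R y) has_derivative (\<lambda>h. r *\<^sub>R h)) (at y)"
      by (auto intro!: derivative_eq_intros)
    from has_derivative_compose[OF this f'(1)]
    show "((\<lambda>y. f (c + r *\<^sub>R y)) has_derivative (\<lambda>h. f' (c + r *\<^sub>R y) (r *\<^sub>R h))) (at y)" .
  next
    fix i :: 'a assume "i \<in> Basis"
    have "f' x (r *\<^sub>R i) = r * f' x i" for x
      using linear_cmul[OF has_derivative_linear[OF f'(1)]] by simp
    then show "Ck_fun k (\<lambda>x. f' (c + r *\<^sub>R x) (r *\<^sub>R i))"
      using Suc.IH[OF f'(2)[OF \<open>i \<in> Basis\<close>]] by (auto intro: Ck_fun_mult Ck_fun_const)
  qed
qed

lemma Ck_fun_inner: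
  fixes g :: "real \<Rightarrow> real"
  shows "Ck_fun k g \<Longrightarrow> Ck_fun k (\<lambda>x::'a::euclidean_space. g (c + x \<bullet> v))"
proof (induction k arbitrary: g)
  case 0 then show ?case
    by (auto intro!: continuous_intros continuous_on_compose2[of UNIV g])
next
  case (Suc k)
  from Suc.prems obtain g' where g': "\<And>x. (g has_derivative g' x) (at x)" "\<And>i. i \<in> Basis \<Longrightarrow> Ck_fun k (\<lambda>x. g' x i)"
    by (rule Ck_fun_SucE) blast
  show ?case
  proof (rule Ck_fun_SucI)
    fix y :: 'a
    have "((\<lambda>y. c + y \<bullet> v) has_derivative (\<lambda>h. h \<bullet> v)) (at y)"
      by (auto intro!: derivative_eq_intros)
    from has_derivative_compose[OF this g'(1)]
    show "((\<lambda>y. g (c + y \<bullet> v)) has_derivative (\<lambda>h. g' (c + y \<bullet> v) (h \<bullet> v))) (at y)" .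
  next
    fix i :: 'a assume "i \<in> Basis"
    have "g' x (i \<bullet> v) = (i \<bullet> v) * g' x 1" for x
      using linear_cmul[OF has_derivative_linear[OF g'(1)[of x]], of "i \<bullet> v" 1] by simp
    then show "Ck_fun k (\<lambda>x. g' (c + x \<bullet> v) (i \<bullet> v))"
      using Suc.IH[OF g'(2)] by (auto intro: Ck_fun_mult Ck_fun_const)
  qed
qed

lemma smooth_fun_has_derivative:
  assumes "smooth_fun f"
  shows "(f has_derivative frechet_derivative f (at x)) (at x)"
proof -
  have "Ck_fun (Suc 0) f" using assms by (simp only: smooth_fun_def)
  then obtain f' where "(f has_derivative f') (at x)" by (rule Ck_fun_SucE) blast
  then have "f differentiable (at x)" unfolding differentiable_def by blast
  then show ?thesis by (simp add: frechet_derivative_works)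
qed

lemma smooth_fun_partial:
  assumes "smooth_fun f" "i \<in> Basis"
  shows "smooth_fun (\<lambda>x. frechet_derivative f (at x) i)"
  unfolding smooth_fun_def
proof
  fix k
  have "Ck_fun (Suc k) f" using assms by (simp only: smooth_fun_def)
  then obtain f' where f': "\<And>x. (f has_derivative f' x) (at x)" "\<And>i. i \<in> Basis \<Longrightarrow> Ck_fun k (\<lambda>x. f' x i)"
    by (rule Ck_fun_SucE) blast
  have "frechet_derivative f (at x) = f' x" for x using f'(1) by (rule frechet_derivative_at[symmetric])
  then show "Ck_fun k (\<lambda>x. frechet_derivative f (at x) i)" using f'(2)[OF assms(2)] by simp
qed

lemma smooth_fun_continuous: "smooth_fun f \<Longrightarrow> continuous_on UNIV f"
  using Ck_fun_imp_continuous by (auto simp: smooth_fun_def)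

lemma smooth_fun_partial_continuous:
  "smooth_fun f \<Longrightarrow> i \<in> Basis \<Longrightarrow> continuous_on UNIV (\<lambda>x. frechet_derivative f (at x) i)"
  by (intro smooth_fun_continuous smooth_fun_partial)

lemma smooth_fun_mult: "smooth_fun f \<Longrightarrow> smooth_fun g \<Longrightarrow> smooth_fun (\<lambda>x. f x * g x)"
  by (simp add: smooth_fun_def Ck_fun_mult)

lemma smooth_fun_affine: "smooth_fun f \<Longrightarrow> smooth_fun (\<lambda>x. f (c + r *\<^sub>R x))"
  by (simp add: smooth_fun_def Ck_fun_affine)

lemma frechet_derivative_mult:
  assumes "smooth_fun f" "smooth_fun g"
  shows "frechet_derivative (\<lambda>x. f x * g x) (at x) i
    = f x * frechet_derivative g (at x) i + frechet_derivative f (at x) i * g x"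
  using frechet_derivative_at[OF has_derivative_mult[OF assms[THEN smooth_fun_has_derivative]], of x, symmetric]
  by simp

lemma frechet_derivative_affine:
  assumes "smooth_fun f"
  shows "frechet_derivative (\<lambda>y. f (c + r *\<^sub>R y)) (at y) i = r * frechet_derivative f (at (c + r *\<^sub>R y)) i"
proof -
  note f = smooth_fun_has_derivative[OF assms]
  have "((\<lambda>y. c + r *\<^sub>R y) has_derivative (\<lambda>h. r *\<^sub>R h)) (at y)"
    by (auto intro!: derivative_eq_intros)
  from frechet_derivative_at[OF has_derivative_compose[OF this f], symmetric]
  have "frechet_derivative (\<lambda>y. f (c + r *\<^sub>R y)) (at y) i = frechet_derivative f (at (c + r *\<^sub>R y)) (r *\<^sub>R i)"
    by simp
  then show ?thesis using linear_cmul[OF has_derivative_linear[OF f]] by simp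
qed

section \<open>A smooth cut-off\<close>

text \<open>The functions t^(-n) exp (-1/t), extended by zero to the left, are closed under
  differentiation: the derivative of member n is member n+2 minus n times member n+1.
  Smoothness of all of them follows by one induction on the order of differentiability.\<close>

definition flat_exp :: "nat \<Rightarrow> real \<Rightarrow> real" where
  "flat_exp n t = (if t > 0 then (1 / t) ^ n * exp (- (1 / t)) else 0)"

lemma flat_exp_tendsto_0: "(flat_exp n \<longlongrightarrow> 0) (at 0)"
proof -
  have "((\<lambda>t. (inverse t) ^ n / exp (inverse t)) \<longlongrightarrow> (0::real)) (at_right 0)"
    using filterlim_compose[OF tendsto_power_div_exp_0 filterlim_inverse_at_top_right] by simp
  moreover have "\<forall>\<^sub>F t in at_right 0. (inverse t) ^ n / exp (inverse t) = flat_exp n t"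
    by (rule eventually_at_rightI[of 0 1]) (auto simp: flat_exp_def exp_minus field_simps)
  ultimately have "(flat_exp n \<longlongrightarrow> 0) (at_right 0)" by (rule Lim_transform_eventually)
  moreover have "\<forall>\<^sub>F t in at_left 0. 0 = flat_exp n t"
    by (rule eventually_at_leftI[of "-1" 0]) (auto simp: flat_exp_def)
  then have "(flat_exp n \<longlongrightarrow> 0) (at_left 0)" by (rule Lim_transform_eventually[OF tendsto_const])
  ultimately show ?thesis by (simp add: filterlim_split_at)
qed

lemma flat_exp_deriv: "(flat_exp n has_real_derivative (flat_exp (n + 2) t - real n * flat_exp (n + 1) t)) (at t)"
proof (cases t "0::real" rule: linorder_cases)
  case less
  have "((\<lambda>_. 0) has_real_derivative 0) (at t)" by simp
  moreover have "\<forall>\<^sub>F s in nhds t. 0 = flat_exp n s"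
    using eventually_nhds_in_open[of "{..<0}" t] less by (auto simp: flat_exp_def elim: eventually_mono)
  ultimately show ?thesis
    using less by (subst (asm) DERIV_cong_ev[OF refl _ refl]) (auto simp: flat_exp_def)
next
  case equal
  have "((\<lambda>h. (flat_exp n (0 + h) - flat_exp n 0) / h) \<longlongrightarrow> 0) (at 0)"
  proof (rule Lim_transform_eventually[OF flat_exp_tendsto_0[of "Suc n"]])
    show "\<forall>\<^sub>F h in at 0. flat_exp (Suc n) h = (flat_exp n (0 + h) - flat_exp n 0) / h"
      by (rule always_eventually) (auto simp: flat_exp_def)
  qed
  then show ?thesis using equal by (simp add: DERIV_def flat_exp_def)
next
  case greater
  have "((\<lambda>s. (1 / s) ^ n * exp (- (1 / s))) has_real_derivative
     (1/t)^(n+2) * exp (-(1/t)) - real n * ((1/t)^(n+1) * exp (-(1/t)))) (at t)"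
  proof -
    define u where "u = 1 / t"
    have 1: "((\<lambda>s. 1 / s) has_real_derivative - (u * u)) (at t)"
      unfolding u_def using greater by (auto intro!: derivative_eq_intros)
    have 2: "((\<lambda>s. (1 / s) ^ n) has_real_derivative - real n * u ^ (n + 1)) (at t)"
      by (rule DERIV_cong[OF DERIV_power[OF 1, of n]]) (unfold u_def[symmetric], cases n, auto simp: algebra_simps)
    have 3: "((\<lambda>s. exp (- (1 / s))) has_real_derivative exp (- u) * (u * u)) (at t)"
      using DERIV_chain2[OF DERIV_exp DERIV_minus[OF 1]] by (simp add: u_def)
    have 4: "- real n * u ^ (n + 1) * exp (- u) + exp (- u) * (u * u) * u ^ n
      = u ^ (n + 2) * exp (- u) - real n * (u ^ (n + 1) * exp (- u))"
      by (simp add: algebra_simps)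
    show ?thesis using DERIV_cong[OF DERIV_mult[OF 2 3]] 4 by (simp add: u_def)
  qed
  moreover have "\<forall>\<^sub>F s in nhds t. (1 / s) ^ n * exp (- (1 / s)) = flat_exp n s"
    using eventually_nhds_in_open[of "{0<..}" t] greater by (auto simp: flat_exp_def elim: eventually_mono)
  ultimately show ?thesis
    using greater by (subst (asm) DERIV_cong_ev[OF refl _ refl]) (auto simp: flat_exp_def)
qed

lemma Ck_fun_flat_exp: "Ck_fun k (flat_exp n)"
proof (induction k arbitrary: n)
  case 0
  show ?case using flat_exp_deriv[of n] by (auto simp: continuous_on_eq_continuous_at intro: DERIV_isCont)
next
  case (Suc k)
  show ?case
  proof (rule Ck_fun_SucI)
    show "(flat_exp n has_derivative (\<lambda>h. (flat_exp (n + 2) t - real n * flat_exp (n + 1) t) * h)) (at t)" for t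
      using flat_exp_deriv[of n t] unfolding has_field_derivative_def .
    have "Ck_fun k (\<lambda>t. flat_exp (n + 2) t + (- real n) * flat_exp (n + 1) t)"
      by (intro Ck_fun_add Ck_fun_mult Ck_fun_const Suc)
    then show "Ck_fun k (\<lambda>t. (flat_exp (n + 2) t - real n * flat_exp (n + 1) t) * i)" if "i \<in> Basis" for i
      using that by (auto intro!: Ck_fun_mult Ck_fun_const)
  qed
qed

text \<open>The shift by 1 keeps the support at distance 1/m from the boundary of the box.
  Inside the box every factor tends to exp 0 = 1 as m tends to infinity.\<close>

definition box_cutoff :: "'a::euclidean_space \<Rightarrow> 'a \<Rightarrow> nat \<Rightarrow> 'a \<Rightarrow> real" where
  "box_cutoff a b m x = (\<Prod>i\<in>Basis. flat_exp 0 (real m * (x \<bullet> i - a \<bullet> i) - 1) * flat_exp 0 (real m * (b \<bullet> i - x \<bullet> i) - 1))"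

lemma flat_exp_0_bounds: "0 \<le> flat_exp 0 t" "flat_exp 0 t \<le> 1"
  by (auto simp: flat_exp_def)

lemma box_cutoff_smooth: "smooth_fun (box_cutoff a b m)"
  unfolding smooth_fun_def
proof
  fix k
  have 1: "Ck_fun k (\<lambda>x. flat_exp 0 (real m * (x \<bullet> i - a \<bullet> i) - 1))" for i :: 'a
    using Ck_fun_inner[OF Ck_fun_flat_exp, of k 0 "- real m * (a \<bullet> i) - 1" "real m *\<^sub>R i"]
    by (simp add: algebra_simps)
  have 2: "Ck_fun k (\<lambda>x. flat_exp 0 (real m * (b \<bullet> i - x \<bullet> i) - 1))" for i :: 'a
    using Ck_fun_inner[OF Ck_fun_flat_exp, of k 0 "real m * (b \<bullet> i) - 1" "- real m *\<^sub>R i"]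
    by (simp add: algebra_simps)
  show "Ck_fun k (box_cutoff a b m)"
    unfolding box_cutoff_def[abs_def] by (intro Ck_fun_prod Ck_fun_mult 1 2) auto
qed

lemma box_cutoff_bounds: "0 \<le> box_cutoff a b m x" "box_cutoff a b m x \<le> 1"
  unfolding box_cutoff_def
  by (auto intro!: prod_nonneg prod_le_1 mult_nonneg_nonneg mult_le_one flat_exp_0_bounds)

lemma box_cutoff_test_function:
  assumes "box a b \<subseteq> U"
  shows "box_cutoff a b m \<in> test_functions U"
proof -
  define C where "C = cbox (a + (1 / real m) *\<^sub>R One) (b - (1 / real m) *\<^sub>R One)"
  have sub: "{x. box_cutoff a b m x \<noteq> 0} \<subseteq> C \<inter> {x. m \<noteq> 0}"
  proof
    fix x assume "x \<in> {x. box_cutoff a b m x \<noteq> 0}"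
    then have *: "real m * (x \<bullet> i - a \<bullet> i) > 1" "real m * (b \<bullet> i - x \<bullet> i) > 1" if "i \<in> Basis" for i
      using that by (auto simp: box_cutoff_def flat_exp_def split: if_splits)
    obtain i :: 'a where "i \<in> Basis" using nonempty_Basis by blast
    with *(1)[of i] have m: "m \<noteq> 0" by (intro notI) simp
    show "x \<in> C \<inter> {x. m \<noteq> 0}"
      using * m by (auto simp: C_def mem_box inner_simps field_simps less_imp_le)
  qed
  have "closed (C \<inter> {x. m \<noteq> 0})" by (cases "m = 0") (auto simp: C_def)
  then have cl: "closure {x. box_cutoff a b m x \<noteq> 0} \<subseteq> C \<inter> {x. m \<noteq> 0}" using sub by (rule closure_minimal[rotated])
  moreover have "C \<inter> {x. m \<noteq> 0} \<subseteq> box a b"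
  proof (cases "m = 0")
    case False
    then have "a \<bullet> i < x \<bullet> i" "x \<bullet> i < b \<bullet> i"
      if "a \<bullet> i + 1 / real m \<le> x \<bullet> i" "x \<bullet> i \<le> b \<bullet> i - 1 / real m" for i x
      using that by (smt (verit) divide_pos_pos of_nat_0_less_iff zero_less_iff_neq_zero)+
    then show ?thesis by (auto simp: C_def mem_box inner_simps)
  qed auto
  moreover have "compact (closure {x. box_cutoff a b m x \<noteq> 0})"
  proof -
    have "bounded (closure {x. box_cutoff a b m x \<noteq> 0})"
      by (rule bounded_subset[OF bounded_cbox]) (use cl in \<open>auto simp: C_def\<close>)
    then show ?thesis by (simp add: compact_eq_bounded_closed)
  qed
  ultimately show ?thesis using assms box_cutoff_smooth by (auto simp: test_functions_def)
qed

lemma box_cutoff_tendsto: "(\<lambda>m. box_cutoff a b m x) \<longlonglongrightarrow> indicator (box a b) x"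
proof -
  have one: "(\<lambda>m. flat_exp 0 (real m * d - 1)) \<longlonglongrightarrow> (if d > 0 then 1 else 0)" for d
  proof (cases "d > 0")
    case True
    have "filterlim (\<lambda>m. -1 + d * real m) at_top sequentially"
      using True by (intro filterlim_tendsto_add_at_top[OF tendsto_const]
          filterlim_tendsto_pos_mult_at_top[OF tendsto_const _ filterlim_real_sequentially])
    then have top: "filterlim (\<lambda>m. real m * d - 1) at_top sequentially"
      by (simp add: algebra_simps)
    have "(\<lambda>m. exp (- (1 / (real m * d - 1)))) \<longlonglongrightarrow> exp (- 0)"
      by (intro tendsto_intros tendsto_divide_0[OF tendsto_const filterlim_at_top_imp_at_infinity[OF top]])
    moreover have "\<forall>\<^sub>F m in sequentially. exp (- (1 / (real m * d - 1))) = flat_exp 0 (real m * d - 1)"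
      using filterlim_at_top_dense[THEN iffD1, OF top, rule_format, of 0] by eventually_elim (simp add: flat_exp_def)
    ultimately show ?thesis using True by (auto intro: Lim_transform_eventually)
  next
    case False
    then have "flat_exp 0 (real m * d - 1) = 0" for m
      using mult_nonneg_nonpos[of "real m" d] by (auto simp: flat_exp_def)
    then show ?thesis using False by simp
  qed
  have "(\<lambda>m. box_cutoff a b m x) \<longlonglongrightarrow>
     (\<Prod>i\<in>Basis. (if x \<bullet> i - a \<bullet> i > 0 then 1 else 0) * (if b \<bullet> i - x \<bullet> i > 0 then 1 else 0))"
    unfolding box_cutoff_def by (intro tendsto_intros one)
  also have "(\<Prod>i\<in>Basis. (if x \<bullet> i - a \<bullet> i > 0 then 1 else 0) * (if b \<bullet> i - x \<bullet> i > 0 then 1 else 0)) = (indicator (box a b) x :: real)"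
    by (auto simp: indicator_def mem_box intro!: prod.neutral)
  finally show ?thesis .
qed

section \<open>The fundamental lemma of the calculus of variations\<close>

text \<open>Open boxes form an intersection-stable generator of the Borel sets, and the sets
  over which f has integral zero form a Dynkin system. For complements this uses that the
  box which carries f is one of the boxes.\<close>

lemma AE_zero_if_integral_boxes_zero:
  fixes f :: "'a::euclidean_space \<Rightarrow> real"
  assumes f: "integrable lborel f" and supp: "\<And>x. x \<notin> box p q \<Longrightarrow> f x = 0"
    and boxes: "\<And>a b. (LINT x|lborel. indicator (box a b) x * f x) = 0"
  shows "AE x in lborel. f x = 0"
proof (rule sigma_finite_measure.density_zero[OF sigma_finite_lborel f])
  fix A :: "'a set" assume "A \<in> sets lborel"
  have tot: "(LINT x|lborel. f x) = 0"
    using boxes[of p q] supp by (subst Bochner_Integration.integral_cong[OF refl, where g="\<lambda>x. indicator (box p q) x * f x"])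
      (auto simp: indicator_def)
  have "Int_stable (range (\<lambda>(a, b). box a b :: 'a set))"
    by (auto simp: Int_stable_def box_Int_box)
  moreover have "range (\<lambda>(a, b). box a b) \<subseteq> Pow (UNIV :: 'a set)" by auto
  moreover have "A \<in> sigma_sets UNIV (range (\<lambda>(a, b). box a b))"
    using \<open>A \<in> sets lborel\<close> by (simp add: borel_eq_box)
  ultimately show "set_lebesgue_integral lborel A f = 0"
  proof (induction rule: sigma_sets_induct_disjoint[consumes 3])
    case (basic A)
    then show ?case using boxes by (auto simp: set_lebesgue_integral_def)
  next
    case empty
    show ?case by (simp add: set_lebesgue_integral_def)
  next
    case (compl A)
    then have A: "A \<in> sets lborel" by (simp add: borel_eq_box)
    have "set_lebesgue_integral lborel (UNIV - A) f = (LINT x|lborel. f x - indicator A x * f x)"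
      unfolding set_lebesgue_integral_def
      by (rule Bochner_Integration.integral_cong) (auto simp: indicator_def)
    also have "\<dots> = 0 - set_lebesgue_integral lborel A f"
      using A f tot integrable_mult_indicator[OF A f] unfolding set_lebesgue_integral_def
      by (subst Bochner_Integration.integral_diff) auto
    finally show ?case using compl by simp
  next
    case (union B)
    then have B: "\<And>i. B i \<in> sets lborel" by (auto simp: borel_eq_box)
    have "set_lebesgue_integral lborel (\<Union>i. B i) f = (\<Sum>i. set_lebesgue_integral lborel (B i) f)"
    proof (rule lebesgue_integral_countable_add)
      show "set_integrable lborel (\<Union>i. B i) f"
        unfolding set_integrable_def using B by (intro integrable_mult_indicator f) auto
      show "i \<noteq> j \<Longrightarrow> B i \<inter> B j = {}" for i j using union(1) by (auto simp: disjoint_family_on_def)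
    qed (use B in auto)
    then show ?case using union by simp
  qed
qed

text \<open>The cut-offs are test functions that converge boundedly to the indicator of a
  box, so f has integral zero over every box in U, and U is a countable union of such boxes.\<close>

lemma fundamental_lemma_variations:
  fixes f :: "'a::euclidean_space \<Rightarrow> real"
  assumes U: "open U" and f: "integrable (lebesgue_on U) f"
    and test: "\<And>\<theta>. \<theta> \<in> test_functions U \<Longrightarrow> (LINT x|lebesgue_on U. f x * \<theta> x) = 0"
  shows "AE x in lebesgue_on U. f x = 0"
proof -
  have Ub: "U \<in> sets borel" using U by auto
  obtain f' where f': "f' \<in> borel_measurable borel" "AE x in lborel. x \<in> U \<longrightarrow> f x = f' x" "\<And>x. x \<notin> U \<Longrightarrow> f' x = 0"
    using borel_version[OF Ub borel_measurable_integrable[OF f]] by blast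
  have int: "integrable lborel f'"
  proof -
    have "(\<lambda>x. indicator U x * f' x) = f'" using f'(3) by (auto simp: indicator_def fun_eq_iff)
    then show ?thesis using f integral_lebesgue_on_cong_AE(1)[OF Ub f'(1,2)] by metis
  qed
  have box0: "(LINT x|lborel. indicator (box a b) x * f' x) = 0" if ab: "box a b \<subseteq> U" for a b
  proof -
    have "(\<lambda>m. LINT x|lborel. f' x * box_cutoff a b m x) \<longlonglongrightarrow> (LINT x|lborel. f' x * indicator (box a b) x)"
    proof -
      have [measurable]: "box_cutoff a b m \<in> borel_measurable borel" for m
        by (rule borel_measurable_continuous_onI[OF smooth_fun_continuous[OF box_cutoff_smooth]])
      note f'(1)[measurable]
      show ?thesis
      proof (rule integral_dominated_convergence[where w="\<lambda>x. \<bar>f' x\<bar>"])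
        show "(\<lambda>x. f' x * box_cutoff a b m x) \<in> borel_measurable lborel" for m
          by measurable
        show "AE x in lborel. norm (f' x * box_cutoff a b m x) \<le> \<bar>f' x\<bar>" for m
          using box_cutoff_bounds[of a b m] by (auto simp: abs_mult abs_of_nonneg intro!: mult_left_le)
      qed (use f' int in \<open>auto intro!: AE_I2 tendsto_intros box_cutoff_tendsto\<close>)
    qed
    moreover have "(LINT x|lborel. f' x * box_cutoff a b m x) = 0" for m
    proof -
      have "(LINT x|lebesgue_on U. f x * box_cutoff a b m x) = (LINT x|lborel. indicator U x * (f' x * box_cutoff a b m x))"
      proof (rule integral_lebesgue_on_cong_AE(2)[OF Ub])
        show "(\<lambda>x. f' x * box_cutoff a b m x) \<in> borel_measurable borel"
          by (intro borel_measurable_times f'(1) borel_measurable_continuous_onI[OF smooth_fun_continuous[OF box_cutoff_smooth]])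
      qed (use f'(2) in \<open>auto elim: eventually_mono\<close>)
      also have "\<dots> = (LINT x|lborel. f' x * box_cutoff a b m x)"
        by (rule Bochner_Integration.integral_cong) (use f'(3) in \<open>auto simp: indicator_def\<close>)
      finally show ?thesis using test[OF box_cutoff_test_function[OF ab], of m] by simp
    qed
    ultimately show ?thesis by (simp add: LIMSEQ_const_iff mult.commute)
  qed
  obtain \<D> where D: "countable \<D>" "\<D> \<subseteq> Pow U" "\<And>X. X \<in> \<D> \<Longrightarrow> \<exists>a b. X = box a b" "\<Union>\<D> = U"
    using open_countable_Union_open_box[OF U] by blast
  have "AE x in lborel. indicator X x * f' x = 0" if X: "X \<in> \<D>" for X
  proof -
    obtain p q where pq: "X = box p q" using D(3)[OF X] by blast
    show ?thesis
    proof (rule AE_zero_if_integral_boxes_zero)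
      show "integrable lborel (\<lambda>x. indicator X x * f' x)"
        using integrable_mult_indicator[OF _ int, of X] pq by simp
      show "indicator X x * f' x = 0" if "x \<notin> box p q" for x using that pq by auto
      fix a b
      have "box a b \<inter> X \<subseteq> U" using D(2) X by auto
      then show "(LINT x|lborel. indicator (box a b) x * (indicator X x * f' x)) = 0"
        using box0 unfolding pq box_Int_box
        by (simp add: mult.assoc[symmetric] indicator_inter_arith[symmetric] box_Int_box)
    qed
  qed
  then have "AE x in lborel. \<forall>X\<in>\<D>. indicator X x * f' x = 0" unfolding AE_ball_countable[OF D(1)] by blast
  then have "AE x in lborel. x \<in> U \<longrightarrow> f x = 0"
    using f'(2) by eventually_elim (use D(4) in \<open>auto simp: indicator_def split: if_splits\<close>)
  then show ?thesis using Ub by (simp add: AE_lebesgue_on_iff)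
qed

section \<open>Integration along lines\<close>

lemma nn_integral_lborel_translate:
  fixes f :: "'a::euclidean_space \<Rightarrow> ennreal"
  assumes "f \<in> borel_measurable borel"
  shows "(\<integral>\<^sup>+x. f (c + x) \<partial>lborel) = (\<integral>\<^sup>+x. f x \<partial>lborel)"
proof -
  have "(\<integral>\<^sup>+x. f x \<partial>distr lborel borel ((+) c)) = (\<integral>\<^sup>+x. f (c + x) \<partial>lborel)"
    by (rule nn_integral_distr) (use assms in auto)
  then show ?thesis by (simp add: lborel_distr_plus)
qed

lemma integral_lborel_translate:
  fixes f :: "'a::euclidean_space \<Rightarrow> real"
  assumes "f \<in> borel_measurable borel"
  shows "(LINT x|lborel. f (c + x)) = (LINT x|lborel. f x)"
proof -
  have "(LINT x|distr lborel borel ((+) c). f x) = (LINT x|lborel. f (c + x))"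
    by (rule integral_distr) (use assms in auto)
  then show ?thesis by (simp add: lborel_distr_plus)
qed

text \<open>Fubini's theorem in the direction i without a splitting of the coordinates:
  translating by s times i does not change the integral of F, and for every point x the
  numbers s for which x - s i lies in the slab W form an interval of length 1.\<close>

lemma integral_lborel_line:
  fixes F :: "'a::euclidean_space \<Rightarrow> real"
  assumes F: "integrable lborel F" and Fb[measurable]: "F \<in> borel_measurable borel" and i: "i \<in> Basis"
  defines "W \<equiv> {x. 0 < x \<bullet> i \<and> x \<bullet> i < 1}"
  shows "integrable lborel (\<lambda>x. indicator W x * (LINT s|lborel. F (x + s *\<^sub>R i)))"
    and "(LINT x|lborel. F x) = (LINT x|lborel. indicator W x * (LINT s|lborel. F (x + s *\<^sub>R i)))"
proof -
  have [measurable]: "W \<in> sets borel"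
    unfolding W_def by measurable
  define K0 where "K0 = (\<lambda>(s::real, x). F x * indicator W (x - s *\<^sub>R i))"
  define K where "K = (\<lambda>(s::real, x). F (x + s *\<^sub>R i) * indicator W x)"
  have m0[measurable]: "K0 \<in> borel_measurable (lborel \<Otimes>\<^sub>M lborel)"
    unfolding K0_def by measurable
  have m[measurable]: "K \<in> borel_measurable (lborel \<Otimes>\<^sub>M lborel)"
    unfolding K_def by measurable
  have W_line: "x - s *\<^sub>R i \<in> W \<longleftrightarrow> s \<in> {x \<bullet> i - 1 <..< x \<bullet> i}" for x s
    using i by (auto simp: W_def inner_simps)
  have nn0: "(\<integral>\<^sup>+z. ennreal (norm (K0 z)) \<partial>(lborel \<Otimes>\<^sub>M lborel)) = (\<integral>\<^sup>+x. ennreal (norm (F x)) \<partial>lborel)"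
  proof -
    have "(\<integral>\<^sup>+z. ennreal (norm (K0 z)) \<partial>(lborel \<Otimes>\<^sub>M lborel))
       = (\<integral>\<^sup>+x. \<integral>\<^sup>+s. ennreal (norm (K0 (s, x))) \<partial>lborel \<partial>lborel)"
      by (rule lborel_pair.nn_integral_snd[symmetric]) measurable
    also have "\<dots> = (\<integral>\<^sup>+x. \<integral>\<^sup>+s. ennreal (norm (F x)) * indicator {x \<bullet> i - 1 <..< x \<bullet> i} s \<partial>lborel \<partial>lborel)"
      unfolding K0_def
      by (intro nn_integral_cong) (simp add: W_line indicator_def)
    also have "\<dots> = (\<integral>\<^sup>+x. ennreal (norm (F x)) \<partial>lborel)"
      by (intro nn_integral_cong) (simp add: nn_integral_cmult)
    finally show ?thesis .
  qed
  have shift: "(\<integral>\<^sup>+x. ennreal (norm (K (s, x))) \<partial>lborel) = (\<integral>\<^sup>+x. ennreal (norm (K0 (s, x))) \<partial>lborel)" for s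
    using nn_integral_lborel_translate[of "\<lambda>x. ennreal (norm (K0 (s, x)))" "s *\<^sub>R i"]
    by (simp add: K_def K0_def add.commute)
  have shift2: "(LINT x|lborel. K (s, x)) = (LINT x|lborel. K0 (s, x))" for s
    using integral_lborel_translate[of "\<lambda>x. K0 (s, x)" "s *\<^sub>R i"]
    by (simp add: K_def K0_def add.commute)
  have fin: "(\<integral>\<^sup>+x. ennreal (norm (F x)) \<partial>lborel) < \<infinity>"
    using F by (simp add: integrable_iff_bounded)
  have i0: "integrable (lborel \<Otimes>\<^sub>M lborel) K0"
    unfolding integrable_iff_bounded using nn0 fin m0 by simp
  have "(\<integral>\<^sup>+z. ennreal (norm (K z)) \<partial>(lborel \<Otimes>\<^sub>M lborel)) = (\<integral>\<^sup>+z. ennreal (norm (K0 z)) \<partial>(lborel \<Otimes>\<^sub>M lborel))"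
    using shift by (simp add: lborel.nn_integral_fst[symmetric])
  then have iK: "integrable (lborel \<Otimes>\<^sub>M lborel) K"
    unfolding integrable_iff_bounded using nn0 fin m by simp
  have eqK: "(LINT s|lborel. K (s, x)) = indicator W x * (LINT s|lborel. F (x + s *\<^sub>R i))" for x
    by (simp add: K_def mult.commute)
  show "integrable lborel (\<lambda>x. indicator W x * (LINT s|lborel. F (x + s *\<^sub>R i)))"
    using lborel_pair.integrable_snd[of "\<lambda>s x. K (s, x)"] iK by (simp add: eqK)
  have "(LINT x|lborel. F x) = (LINT x|lborel. LINT s|lborel. K0 (s, x))"
  proof (rule Bochner_Integration.integral_cong[OF refl])
    fix x
    have "(LINT s|lborel. K0 (s, x)) = F x * (LINT s|lborel. indicator {x \<bullet> i - 1 <..< x \<bullet> i} s)"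
      unfolding K0_def by (simp add: W_line indicator_def)
    then show "F x = (LINT s|lborel. K0 (s, x))" by simp
  qed
  also have "\<dots> = (LINT s|lborel. LINT x|lborel. K0 (s, x))"
    using lborel_pair.Fubini_integral[of "\<lambda>s x. K0 (s, x)"] i0 by simp
  also have "\<dots> = (LINT s|lborel. LINT x|lborel. K (s, x))" by (simp add: shift2)
  also have "\<dots> = (LINT x|lborel. LINT s|lborel. K (s, x))"
    using lborel_pair.Fubini_integral[of "\<lambda>s x. K (s, x)"] iK by simp
  finally show "(LINT x|lborel. F x) = (LINT x|lborel. indicator W x * (LINT s|lborel. F (x + s *\<^sub>R i)))"
    by (simp add: eqK)
qed

lemma has_derivative_line:
  assumes "(f has_derivative f') (at (x + s *\<^sub>R i))"
  shows "((\<lambda>s. f (x + s *\<^sub>R i)) has_real_derivative f' i) (at s)"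
proof -
  have "((\<lambda>s. x + s *\<^sub>R i) has_derivative (\<lambda>h. h *\<^sub>R i)) (at s)"
    by (auto intro!: derivative_eq_intros)
  from has_derivative_compose[OF this assms]
  have "((\<lambda>s. f (x + s *\<^sub>R i)) has_derivative (\<lambda>h. f' (h *\<^sub>R i))) (at s)" .
  moreover have "(\<lambda>h. f' (h *\<^sub>R i)) = (*) (f' i)"
    using linear_cmul[OF has_derivative_linear[OF assms]] by (simp add: fun_eq_iff)
  ultimately show ?thesis by (simp add: has_field_derivative_def)
qed

lemma frechet_derivative_zero_on_open:
  assumes "open V" "x \<in> V" "\<And>y. y \<in> V \<Longrightarrow> h y = 0"
  shows "frechet_derivative h (at x) i = (0::real)"
proof -
  have "(h has_derivative (\<lambda>_. 0)) (at x)"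
    by (rule has_derivative_transform_within_open[OF has_derivative_const assms(1,2)]) (simp add: assms(3))
  then have "(\<lambda>_. 0) = frechet_derivative h (at x)" by (rule frechet_derivative_at)
  then show ?thesis by metis
qed

text \<open>On each line the fundamental theorem of calculus gives zero.\<close>

lemma integral_partial_derivative_compact_support:
  fixes h :: "'a::euclidean_space \<Rightarrow> real"
  assumes h: "smooth_fun h" and supp: "\<And>x. h x \<noteq> 0 \<Longrightarrow> norm x \<le> R" and i: "i \<in> Basis"
  shows "(LINT x|lborel. frechet_derivative h (at x) i) = 0"
proof -
  define D where "D x = frechet_derivative h (at x) i" for x
  have cont: "continuous_on UNIV D" unfolding D_def by (rule smooth_fun_partial_continuous[OF h i])
  have D0: "D x = 0" if "norm x > R" for x
    unfolding D_def by (rule frechet_derivative_zero_on_open[of "- cball 0 R"]) (use that supp in force)+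
  have [measurable]: "D \<in> borel_measurable borel" by (rule borel_measurable_continuous_onI[OF cont])
  have "integrable lborel (\<lambda>x. indicator (cball 0 R) x *\<^sub>R D x)"
    by (rule borel_integrable_compact) (auto intro: continuous_on_subset[OF cont])
  moreover have "(\<lambda>x. indicator (cball 0 R) x *\<^sub>R D x) = D"
    using D0 by (auto simp: indicator_def fun_eq_iff not_le)
  ultimately have int: "integrable lborel D" by metis
  have "(LINT s|lborel. D (x + s *\<^sub>R i)) = 0" for x
  proof -
    define B where "B = \<bar>R\<bar> + norm x + 1"
    have far: "norm (x + s *\<^sub>R i) > R" if "\<bar>s\<bar> \<ge> B" for s
      using norm_triangle_ineq2[of "s *\<^sub>R i" "- x"] that i by (auto simp: B_def add.commute)
    have "has_bochner_integral lborel (\<lambda>s. D (x + s *\<^sub>R i) * indicator {-B..B} s) (h (x + B *\<^sub>R i) - h (x + (-B) *\<^sub>R i))"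
    proof (rule has_bochner_integral_FTC_Icc_real)
      show "-B \<le> B" by (simp add: B_def)
      show "((\<lambda>s. h (x + s *\<^sub>R i)) has_real_derivative D (x + s *\<^sub>R i)) (at s)" for s
        unfolding D_def by (rule has_derivative_line[OF smooth_fun_has_derivative[OF h]])
      show "isCont (\<lambda>s. D (x + s *\<^sub>R i)) s" for s
      proof (rule isCont_o2[where g=D])
        show "isCont (\<lambda>s. x + s *\<^sub>R i) s" by (intro continuous_intros)
        show "isCont D (x + s *\<^sub>R i)" using cont by (simp add: continuous_on_eq_continuous_at)
      qed
    qed
    then have "(LINT s|lborel. D (x + s *\<^sub>R i) * indicator {-B..B} s) = h (x + B *\<^sub>R i) - h (x + (-B) *\<^sub>R i)"
      by (rule has_bochner_integral_integral_eq)
    moreover have hB: "h (x + s *\<^sub>R i) = 0" if "\<bar>s\<bar> \<ge> B" for s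
      using far[OF that] supp[of "x + s *\<^sub>R i"] linorder_not_le by blast
    have "h (x + B *\<^sub>R i) = 0" "h (x + (-B) *\<^sub>R i) = 0"
      by (rule hB; simp add: B_def)+
    moreover have "D (x + s *\<^sub>R i) * indicator {-B..B} s = D (x + s *\<^sub>R i)" for s
    proof (cases "\<bar>s\<bar> \<le> B")
      case False
      then show ?thesis using D0[OF far[of s]] by simp
    qed (simp add: abs_le_iff)
    ultimately show ?thesis by simp
  qed
  then show ?thesis
    using integral_lborel_line(2)[OF int _ i] by (simp add: D_def)
qed

section \<open>Weak gradients\<close>

lemma test_functionsD:
  assumes "\<theta> \<in> test_functions U"
  shows "smooth_fun \<theta>" "x \<notin> U \<Longrightarrow> \<theta> x = 0" "x \<notin> U \<Longrightarrow> frechet_derivative \<theta> (at x) i = 0"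
    "\<exists>C. \<forall>x. \<bar>\<theta> x\<bar> \<le> C" "i \<in> Basis \<Longrightarrow> \<exists>C. \<forall>x. \<bar>frechet_derivative \<theta> (at x) i\<bar> \<le> C"
    "\<exists>R. \<forall>x. \<theta> x \<noteq> 0 \<longrightarrow> norm x \<le> R"
proof -
  define S where "S = closure {x. \<theta> x \<noteq> 0}"
  have \<theta>: "smooth_fun \<theta>" and comp: "compact S" and sub: "S \<subseteq> U"
    using assms by (auto simp: test_functions_def S_def)
  have out: "\<theta> x = 0" if "x \<notin> S" for x
    using that closure_subset[of "{x. \<theta> x \<noteq> 0}"] by (auto simp: S_def)
  have outD: "frechet_derivative \<theta> (at x) i = 0" if "x \<notin> S" for x i
  proof (rule frechet_derivative_zero_on_open)
    show "open (- S)" by (simp add: S_def open_Compl)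
    show "x \<in> - S" using that by simp
  qed (simp add: out)
  have bdd: "\<exists>C. \<forall>x. \<bar>g x\<bar> \<le> C" if "continuous_on UNIV g" "\<And>x. x \<notin> S \<Longrightarrow> g x = 0" for g :: "'a \<Rightarrow> real"
  proof -
    have "bounded (g ` S)" using comp that(1) by (intro compact_imp_bounded compact_continuous_image continuous_on_subset[OF that(1)]) auto
    then obtain C where "\<forall>y\<in>g ` S. \<bar>y\<bar> \<le> C" unfolding bounded_real by blast
    then have C: "\<bar>g x\<bar> \<le> C" if "x \<in> S" for x using that by blast
    have "\<bar>g x\<bar> \<le> max C 0" for x using that(2)[of x] C[of x] by (cases "x \<in> S") auto
    then show ?thesis by blast
  qed
  show "smooth_fun \<theta>" by fact
  show "x \<notin> U \<Longrightarrow> \<theta> x = 0" using out sub by blast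
  show "x \<notin> U \<Longrightarrow> frechet_derivative \<theta> (at x) i = 0" using outD sub by blast
  show "\<exists>C. \<forall>x. \<bar>\<theta> x\<bar> \<le> C" by (rule bdd[OF smooth_fun_continuous[OF \<theta>] out])
  show "\<exists>C. \<forall>x. \<bar>frechet_derivative \<theta> (at x) i\<bar> \<le> C" if "i \<in> Basis"
    by (rule bdd[OF smooth_fun_partial_continuous[OF \<theta> that] outD])
  show "\<exists>R. \<forall>x. \<theta> x \<noteq> 0 \<longrightarrow> norm x \<le> R"
    using compact_imp_bounded[OF comp] out unfolding bounded_iff by blast
qed

lemma continuous_measurable_lebesgue_on:
  "continuous_on UNIV f \<Longrightarrow> f \<in> borel_measurable (lebesgue_on U)" for f :: "'a::euclidean_space \<Rightarrow> real"
  by (intro measurable_restrict_space1 measurable_completion) (simp add: borel_measurable_continuous_onI)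

lemma L2_on_continuous:
  fixes f :: "'a::euclidean_space \<Rightarrow> real"
  assumes U: "open U" "bounded U" and f: "continuous_on UNIV f"
  shows "f \<in> L2_on U"
proof -
  have "compact (closure U)" using U by (simp add: compact_closure)
  then have "bounded (f ` closure U)"
    by (intro compact_imp_bounded compact_continuous_image continuous_on_subset[OF f]) auto
  then obtain C where C: "\<And>x. x \<in> U \<Longrightarrow> \<bar>f x\<bar> \<le> C"
    using closure_subset[of U] by (force simp: bounded_iff)
  have fin: "finite_measure (lebesgue_on U)" using U by (intro finite_measure_lebesgue_on lmeasurable_open) auto
  have "(\<lambda>x. 1) \<in> L2 (lebesgue_on U)" using fin by (auto simp: L2_def finite_measure.integrable_const)
  from L2_bounded_mult[OF this continuous_measurable_lebesgue_on[OF f], of C] C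
  show ?thesis by (simp add: L2_on_eq)
qed

lemma L2_on_test_function:
  assumes "open U" "bounded U" "\<theta> \<in> test_functions U"
  shows "\<theta> \<in> L2_on U" "i \<in> Basis \<Longrightarrow> (\<lambda>x. frechet_derivative \<theta> (at x) i) \<in> L2_on U"
  by (intro L2_on_continuous smooth_fun_continuous smooth_fun_partial_continuous assms(1,2) test_functionsD(1)[OF assms(3)]; assumption)+

lemma L2_on_imp_integrable:
  assumes "open U" "bounded U" "u \<in> L2_on U"
  shows "integrable (lebesgue_on U) u"
  using L2_mult_integrable[of u "lebesgue_on U" "\<lambda>_. 1"] L2_on_continuous[OF assms(1,2), of "\<lambda>_. 1"] assms(3)
  by (simp add: L2_on_eq)

text \<open>The Sobolev norms are defined through an arbitrarily chosen weak gradient.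
  Uniqueness allows one to compute them from any weak gradient at hand.\<close>

lemma weak_gradient_unique:
  fixes u :: "'a::euclidean_space \<Rightarrow> real"
  assumes U: "open U" "bounded U"
    and g: "is_weak_gradient U u g" and h: "is_weak_gradient U u h"
  shows "AE x in lebesgue_on U. g x = h x"
proof -
  have comp: "AE x in lebesgue_on U. g x \<bullet> i = h x \<bullet> i" if i: "i \<in> Basis" for i
  proof -
    have gi: "(\<lambda>x. g x \<bullet> i) \<in> L2_on U" and hi: "(\<lambda>x. h x \<bullet> i) \<in> L2_on U"
      using g h i by (auto simp: is_weak_gradient_def)
    have "AE x in lebesgue_on U. g x \<bullet> i - h x \<bullet> i = 0"
    proof (rule fundamental_lemma_variations[OF U(1)])
      show "integrable (lebesgue_on U) (\<lambda>x. g x \<bullet> i - h x \<bullet> i)"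
        by (intro Bochner_Integration.integrable_diff L2_on_imp_integrable U gi hi)
      fix \<theta> assume \<theta>: "\<theta> \<in> test_functions U"
      have "(LINT x|lebesgue_on U. (g x \<bullet> i - h x \<bullet> i) * \<theta> x)
        = (LINT x|lebesgue_on U. (g x \<bullet> i) * \<theta> x) - (LINT x|lebesgue_on U. (h x \<bullet> i) * \<theta> x)"
        unfolding left_diff_distrib using gi hi L2_on_test_function(1)[OF U \<theta>]
        by (intro Bochner_Integration.integral_diff L2_mult_integrable) (auto simp: L2_on_eq)
      also have "\<dots> = 0"
      proof -
        have "(LINT x|lebesgue_on U. u x * frechet_derivative \<theta> (at x) i) = - (LINT x|lebesgue_on U. (g x \<bullet> i) * \<theta> x)"
          using g i \<theta> by (simp add: is_weak_gradient_def)
        moreover have "(LINT x|lebesgue_on U. u x * frechet_derivative \<theta> (at x) i) = - (LINT x|lebesgue_on U. (h x \<bullet> i) * \<theta> x)"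
          using h i \<theta> by (simp add: is_weak_gradient_def)
        ultimately show ?thesis by linarith
      qed
      finally show "(LINT x|lebesgue_on U. (g x \<bullet> i - h x \<bullet> i) * \<theta> x) = 0" .
    qed
    then show ?thesis by eventually_elim simp
  qed
  have "AE x in lebesgue_on U. \<forall>i\<in>Basis. g x \<bullet> i = h x \<bullet> i"
    using comp by (simp add: AE_ball_countable countable_finite)
  then show ?thesis by eventually_elim (auto intro: euclidean_eqI)
qed

lemma H1_imp_L2: "u \<in> H1 U \<Longrightarrow> u \<in> L2_on U"
  by (simp add: H1_def)

lemma H1_weak_gradient: "u \<in> H1 U \<Longrightarrow> is_weak_gradient U u (weak_gradient U u)"
  unfolding H1_def weak_gradient_def by (auto simp: someI)

lemma H1_I: "u \<in> L2_on U \<Longrightarrow> is_weak_gradient U u g \<Longrightarrow> u \<in> H1 U"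
  unfolding H1_def by blast

lemma is_weak_gradient_L2: "is_weak_gradient U u g \<Longrightarrow> i \<in> Basis \<Longrightarrow> (\<lambda>x. g x \<bullet> i) \<in> L2_on U"
  by (simp add: is_weak_gradient_def)

lemma is_weak_gradient_add:
  assumes U: "open U" "bounded U" and u: "u \<in> L2_on U" and w: "w \<in> L2_on U"
    and g: "is_weak_gradient U u g" and h: "is_weak_gradient U w h"
  shows "is_weak_gradient U (\<lambda>x. u x + w x) (\<lambda>x. g x + h x)"
  unfolding is_weak_gradient_def
proof (intro ballI conjI)
  fix i :: 'a assume i: "i \<in> Basis"
  note gi = is_weak_gradient_L2[OF g i] and hi = is_weak_gradient_L2[OF h i]
  show "(\<lambda>x. (g x + h x) \<bullet> i) \<in> L2_on U"
    using gi hi by (simp add: L2_on_eq L2_add inner_add_left)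
  fix \<theta> assume \<theta>: "\<theta> \<in> test_functions U"
  have "(LINT x|lebesgue_on U. (u x + w x) * frechet_derivative \<theta> (at x) i)
      = (LINT x|lebesgue_on U. u x * frechet_derivative \<theta> (at x) i) + (LINT x|lebesgue_on U. w x * frechet_derivative \<theta> (at x) i)"
    unfolding distrib_right using u w L2_on_test_function(2)[OF U \<theta> i]
    by (intro Bochner_Integration.integral_add L2_mult_integrable) (auto simp: L2_on_eq)
  also have "\<dots> = - ((LINT x|lebesgue_on U. (g x \<bullet> i) * \<theta> x) + (LINT x|lebesgue_on U. (h x \<bullet> i) * \<theta> x))"
    using g h i \<theta> by (simp add: is_weak_gradient_def)
  also have "\<dots> = - (LINT x|lebesgue_on U. ((g x + h x) \<bullet> i) * \<theta> x)"
    unfolding inner_add_left distrib_right using gi hi L2_on_test_function(1)[OF U \<theta>]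
    by (subst Bochner_Integration.integral_add) (auto intro!: L2_mult_integrable simp: L2_on_eq)
  finally show "(LINT x|lebesgue_on U. (u x + w x) * frechet_derivative \<theta> (at x) i)
    = - (LINT x|lebesgue_on U. ((g x + h x) \<bullet> i) * \<theta> x)" .
qed

lemma is_weak_gradient_cmult:
  assumes g: "is_weak_gradient U u g"
  shows "is_weak_gradient U (\<lambda>x. c * u x) (\<lambda>x. c *\<^sub>R g x)"
  using g L2_cmult[of _ "lebesgue_on U" c] by (auto simp: is_weak_gradient_def L2_on_eq mult.assoc)

lemma is_weak_gradient_cong_AE:
  assumes g: "is_weak_gradient U u g" and u: "u \<in> borel_measurable (lebesgue_on U)" "w \<in> borel_measurable (lebesgue_on U)"
    and ae: "AE x in lebesgue_on U. u x = w x"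
  shows "is_weak_gradient U w g"
  unfolding is_weak_gradient_def
proof (intro ballI conjI)
  fix i :: 'a assume i: "i \<in> Basis"
  show "(\<lambda>x. g x \<bullet> i) \<in> L2_on U" using g i by (simp add: is_weak_gradient_def)
  fix \<theta> assume \<theta>: "\<theta> \<in> test_functions U"
  have m: "(\<lambda>x. frechet_derivative \<theta> (at x) i) \<in> borel_measurable (lebesgue_on U)"
    using i by (intro continuous_measurable_lebesgue_on smooth_fun_partial_continuous test_functionsD(1)[OF \<theta>])
  have "(LINT x|lebesgue_on U. w x * frechet_derivative \<theta> (at x) i) = (LINT x|lebesgue_on U. u x * frechet_derivative \<theta> (at x) i)"
    by (rule integral_cong_AE) (use u m ae in \<open>auto elim!: eventually_mono\<close>)
  then show "(LINT x|lebesgue_on U. w x * frechet_derivative \<theta> (at x) i) = - (LINT x|lebesgue_on U. g x \<bullet> i * \<theta> x)"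
    using g i \<theta> by (simp add: is_weak_gradient_def)
qed

lemma H1_add:
  assumes U: "open U" "bounded U" and u: "u \<in> H1 U" and w: "w \<in> H1 U"
  shows "(\<lambda>x. u x + w x) \<in> H1 U"
  using L2_add[of u "lebesgue_on U" w] is_weak_gradient_add[OF U] u[THEN H1_imp_L2] w[THEN H1_imp_L2]
    u[THEN H1_weak_gradient] w[THEN H1_weak_gradient] by (intro H1_I) (simp_all add: L2_on_eq)

lemma H1_cmult:
  assumes u: "u \<in> H1 U"
  shows "(\<lambda>x. c * u x) \<in> H1 U"
  using L2_cmult[of u "lebesgue_on U" c] is_weak_gradient_cmult[OF H1_weak_gradient[OF u]] u[THEN H1_imp_L2]
  by (intro H1_I) (simp_all add: L2_on_eq)

lemma H1_diff: "open U \<Longrightarrow> bounded U \<Longrightarrow> u \<in> H1 U \<Longrightarrow> w \<in> H1 U \<Longrightarrow> (\<lambda>x. u x - w x) \<in> H1 U"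
  using H1_add[of U u "\<lambda>x. -1 * w x"] H1_cmult[of w U "-1"] by simp

lemma is_weak_gradient_diff:
  assumes U: "open U" "bounded U" and u: "u \<in> L2_on U" and w: "w \<in> L2_on U"
    and g: "is_weak_gradient U u g" and h: "is_weak_gradient U w h"
  shows "is_weak_gradient U (\<lambda>x. u x - w x) (\<lambda>x. g x - h x)"
  using is_weak_gradient_add[OF U u _ g is_weak_gradient_cmult[OF h, of "-1"]] L2_cmult[of w "lebesgue_on U" "-1"] w
  by (simp add: L2_on_eq)

lemma H1_cong_AE:
  assumes "u \<in> H1 U" "w \<in> borel_measurable (lebesgue_on U)" "AE x in lebesgue_on U. u x = w x"
  shows "w \<in> H1 U"
proof -
  have u: "u \<in> L2 (lebesgue_on U)" using H1_imp_L2[OF assms(1)] by (simp add: L2_on_eq)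
  have "w \<in> L2_on U" unfolding L2_on_eq by (rule L2_cong_AE[OF u assms(2,3)])
  then show ?thesis
    by (rule H1_I) (rule is_weak_gradient_cong_AE[OF H1_weak_gradient[OF assms(1)] L2_measurable[OF u] assms(2,3)])
qed

text \<open>The product of s with a test function has compact support, so the integral of
  its derivative vanishes.\<close>

lemma smooth_fun_weak_gradient:
  fixes s :: "'a::euclidean_space \<Rightarrow> real"
  assumes U: "open U" "bounded U" and s: "smooth_fun s"
  shows "is_weak_gradient U s (\<lambda>x. \<Sum>i\<in>Basis. frechet_derivative s (at x) i *\<^sub>R i)"
  unfolding is_weak_gradient_def
proof (intro ballI conjI)
  fix i :: 'a assume i: "i \<in> Basis"
  have coord: "(\<Sum>i\<in>Basis. frechet_derivative s (at x) i *\<^sub>R i) \<bullet> i = frechet_derivative s (at x) i" for x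
    using i by (simp add: inner_sum_left inner_Basis if_distrib cong: if_cong)
  note ci = smooth_fun_partial_continuous[OF s i]
  show "(\<lambda>x. (\<Sum>i\<in>Basis. frechet_derivative s (at x) i *\<^sub>R i) \<bullet> i) \<in> L2_on U"
    unfolding coord by (rule L2_on_continuous[OF U ci])
  fix \<theta> assume \<theta>: "\<theta> \<in> test_functions U"
  note t = test_functionsD[OF \<theta>]
  obtain R where R: "\<And>x. \<theta> x \<noteq> 0 \<Longrightarrow> norm x \<le> R" using t(6) by blast
  define D where "D x = s x * frechet_derivative \<theta> (at x) i + frechet_derivative s (at x) i * \<theta> x" for x
  have "(LINT x|lborel. frechet_derivative (\<lambda>x. s x * \<theta> x) (at x) i) = 0"
    by (rule integral_partial_derivative_compact_support[OF smooth_fun_mult[OF s t(1)] _ i, of R]) (use R in auto)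
  then have "(LINT x|lborel. D x) = 0" by (simp add: frechet_derivative_mult[OF s t(1)] D_def)
  moreover have "(\<lambda>x. indicator U x * D x) = D" using t(2,3) by (auto simp: D_def indicator_def fun_eq_iff)
  moreover have "D \<in> borel_measurable borel"
    unfolding D_def by (intro borel_measurable_continuous_onI continuous_intros ci smooth_fun_continuous s t(1) smooth_fun_partial_continuous i)
  ultimately have "(LINT x|lebesgue_on U. D x) = 0"
    using integral_lebesgue_on_cong_AE(2)[of U D D] U(1) by (metis AE_I2 borel_open)
  moreover have "(LINT x|lebesgue_on U. D x) = (LINT x|lebesgue_on U. s x * frechet_derivative \<theta> (at x) i)
      + (LINT x|lebesgue_on U. frechet_derivative s (at x) i * \<theta> x)"
    unfolding D_def using L2_on_continuous[OF U smooth_fun_continuous[OF s]] L2_on_continuous[OF U ci] L2_on_test_function[OF U \<theta>] i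
    by (intro Bochner_Integration.integral_add L2_mult_integrable) (auto simp: L2_on_eq)
  ultimately show "(LINT x|lebesgue_on U. s x * frechet_derivative \<theta> (at x) i)
    = - (LINT x|lebesgue_on U. (\<Sum>i\<in>Basis. frechet_derivative s (at x) i *\<^sub>R i) \<bullet> i * \<theta> x)"
    unfolding coord by simp
qed

lemma smooth_fun_H1: "open U \<Longrightarrow> bounded U \<Longrightarrow> smooth_fun s \<Longrightarrow> s \<in> H1 U"
  by (rule H1_I[OF L2_on_continuous smooth_fun_weak_gradient]) (auto intro: smooth_fun_continuous)

section \<open>The scaled Sobolev norm\<close>

lemma integrable_inner_weak_gradients:
  assumes "is_weak_gradient U u g" "is_weak_gradient U w h"
  shows "integrable (lebesgue_on U) (\<lambda>x. g x \<bullet> h x)"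
    "(LINT x|lebesgue_on U. g x \<bullet> h x) = (\<Sum>i\<in>Basis. LINT x|lebesgue_on U. (g x \<bullet> i) * (h x \<bullet> i))"
proof -
  have i: "integrable (lebesgue_on U) (\<lambda>x. (g x \<bullet> i) * (h x \<bullet> i))" if "i \<in> Basis" for i
    using assms that by (intro L2_mult_integrable) (auto simp: is_weak_gradient_def L2_on_eq)
  have eq: "(\<lambda>x. g x \<bullet> h x) = (\<lambda>x. \<Sum>i\<in>Basis. (g x \<bullet> i) * (h x \<bullet> i))"
    by (rule ext) (rule euclidean_inner)
  show "integrable (lebesgue_on U) (\<lambda>x. g x \<bullet> h x)"
    unfolding eq by (intro Bochner_Integration.integrable_sum i)
  show "(LINT x|lebesgue_on U. g x \<bullet> h x) = (\<Sum>i\<in>Basis. LINT x|lebesgue_on U. (g x \<bullet> i) * (h x \<bullet> i))"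
    unfolding eq by (intro Bochner_Integration.integral_sum i)
qed

lemma scaled_H1_inner_eq:
  assumes U: "open U" "bounded U" and g: "is_weak_gradient U u g" and h: "is_weak_gradient U w h"
  shows "scaled_H1_inner \<epsilon> U u w = (LINT x|lebesgue_on U. u x * w x) + \<epsilon>\<^sup>2 * (LINT x|lebesgue_on U. g x \<bullet> h x)"
proof -
  have g': "is_weak_gradient U u (weak_gradient U u)" unfolding weak_gradient_def using g by (intro someI_ex[of "is_weak_gradient U u"] exI)
  have h': "is_weak_gradient U w (weak_gradient U w)" unfolding weak_gradient_def using h by (intro someI_ex[of "is_weak_gradient U w"] exI)
  have "(LINT x|lebesgue_on U. weak_gradient U u x \<bullet> weak_gradient U w x) = (LINT x|lebesgue_on U. g x \<bullet> h x)"
  proof (rule integral_cong_AE)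
    show "AE x in lebesgue_on U. weak_gradient U u x \<bullet> weak_gradient U w x = g x \<bullet> h x"
      using weak_gradient_unique[OF U g' g] weak_gradient_unique[OF U h' h] by eventually_elim simp
  qed (use integrable_inner_weak_gradients(1)[OF g' h'] integrable_inner_weak_gradients(1)[OF g h] in auto)
  then show ?thesis by (simp add: scaled_H1_inner_def)
qed

lemma scaled_H1_inner_commute: "scaled_H1_inner \<epsilon> U u w = scaled_H1_inner \<epsilon> U w u"
  by (simp add: scaled_H1_inner_def mult.commute inner_commute)

lemma scaled_H1_inner_nonneg: "0 \<le> scaled_H1_inner \<epsilon> U u u"
  by (simp add: scaled_H1_inner_def integral_nonneg_AE)

lemma scaled_H1_norm_nonneg: "0 \<le> scaled_H1_norm \<epsilon> U u"
  by (simp add: scaled_H1_norm_def scaled_H1_inner_nonneg)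

lemma scaled_H1_norm_square: "(scaled_H1_norm \<epsilon> U u)\<^sup>2 = scaled_H1_inner \<epsilon> U u u"
  by (simp add: scaled_H1_norm_def scaled_H1_inner_nonneg)

lemma scaled_H1_inner_add_cmult:
  assumes U: "open U" "bounded U" and u: "u \<in> H1 U" and w: "w \<in> H1 U" and z: "z \<in> H1 U"
  shows "scaled_H1_inner \<epsilon> U (\<lambda>x. u x + t * w x) z = scaled_H1_inner \<epsilon> U u z + t * scaled_H1_inner \<epsilon> U w z"
proof -
  note g = u[THEN H1_weak_gradient] and h = w[THEN H1_weak_gradient] and k = z[THEN H1_weak_gradient]
  let ?g = "weak_gradient U u" and ?h = "weak_gradient U w" and ?k = "weak_gradient U z"
  have gh: "is_weak_gradient U (\<lambda>x. u x + t * w x) (\<lambda>x. ?g x + t *\<^sub>R ?h x)"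
    using H1_imp_L2[OF u] H1_imp_L2[OF H1_cmult[OF w, of t]] by (intro is_weak_gradient_add[OF U] g is_weak_gradient_cmult h)
  have L2: "u \<in> L2 (lebesgue_on U)" "w \<in> L2 (lebesgue_on U)" "z \<in> L2 (lebesgue_on U)"
    using u w z by (auto dest: H1_imp_L2 simp: L2_on_eq)
  have "(LINT x|lebesgue_on U. (u x + t * w x) * z x) = (LINT x|lebesgue_on U. u x * z x) + t * (LINT x|lebesgue_on U. w x * z x)"
    using L2_mult_integrable[OF L2(1,3)] L2_mult_integrable[OF L2(2,3)] by (simp add: distrib_right mult.assoc)
  moreover have "(LINT x|lebesgue_on U. (?g x + t *\<^sub>R ?h x) \<bullet> ?k x) = (LINT x|lebesgue_on U. ?g x \<bullet> ?k x) + t * (LINT x|lebesgue_on U. ?h x \<bullet> ?k x)"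
    using integrable_inner_weak_gradients(1)[OF g k] integrable_inner_weak_gradients(1)[OF h k] by (simp add: inner_add_left)
  ultimately show ?thesis
    unfolding scaled_H1_inner_eq[OF U gh k] scaled_H1_inner_eq[OF U g k] scaled_H1_inner_eq[OF U h k]
    by (simp add: algebra_simps)
qed

lemma scaled_H1_inner_expand:
  assumes U: "open U" "bounded U" and u: "u \<in> H1 U" and w: "w \<in> H1 U"
  shows "scaled_H1_inner \<epsilon> U (\<lambda>x. u x + t * w x) (\<lambda>x. u x + t * w x)
    = scaled_H1_inner \<epsilon> U u u + 2 * t * scaled_H1_inner \<epsilon> U u w + t\<^sup>2 * scaled_H1_inner \<epsilon> U w w"
proof -
  have uw: "(\<lambda>x. u x + t * w x) \<in> H1 U" by (intro H1_add[OF U] u H1_cmult w)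
  have "scaled_H1_inner \<epsilon> U (\<lambda>x. u x + t * w x) (\<lambda>x. u x + t * w x)
    = scaled_H1_inner \<epsilon> U (\<lambda>x. u x + t * w x) u + t * scaled_H1_inner \<epsilon> U (\<lambda>x. u x + t * w x) w"
    unfolding scaled_H1_inner_commute[of \<epsilon> U "\<lambda>x. u x + t * w x" u] scaled_H1_inner_commute[of \<epsilon> U "\<lambda>x. u x + t * w x" w]
    by (rule scaled_H1_inner_add_cmult[OF U u w uw])
  then show ?thesis
    using scaled_H1_inner_add_cmult[OF U u w u, of \<epsilon> t] scaled_H1_inner_add_cmult[OF U u w w, of \<epsilon> t]
      scaled_H1_inner_commute[of \<epsilon> U w u]
    by (simp add: algebra_simps power2_eq_square)
qed

lemma scaled_H1_norm_cmult:
  assumes U: "open U" "bounded U" and u: "u \<in> H1 U"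
  shows "scaled_H1_norm \<epsilon> U (\<lambda>x. c * u x) = \<bar>c\<bar> * scaled_H1_norm \<epsilon> U u"
proof -
  note g = u[THEN H1_weak_gradient]
  have "scaled_H1_inner \<epsilon> U (\<lambda>x. c * u x) (\<lambda>x. c * u x) = c\<^sup>2 * scaled_H1_inner \<epsilon> U u u"
    unfolding scaled_H1_inner_eq[OF U is_weak_gradient_cmult[OF g] is_weak_gradient_cmult[OF g]] scaled_H1_inner_eq[OF U g g]
    by (simp add: algebra_simps power2_eq_square)
  then show ?thesis by (simp add: scaled_H1_norm_def real_sqrt_mult)
qed

lemma scaled_H1_norm_triangle:
  assumes U: "open U" "bounded U" and u: "u \<in> H1 U" and w: "w \<in> H1 U"
  shows "scaled_H1_norm \<epsilon> U (\<lambda>x. u x + w x) \<le> scaled_H1_norm \<epsilon> U u + scaled_H1_norm \<epsilon> U w"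
proof (rule power2_le_imp_le)
  have "(scaled_H1_inner \<epsilon> U u w)\<^sup>2 \<le> scaled_H1_inner \<epsilon> U u u * scaled_H1_inner \<epsilon> U w w"
  proof (rule discriminant_bound)
    show "0 \<le> scaled_H1_inner \<epsilon> U u u + 2 * t * scaled_H1_inner \<epsilon> U u w + t\<^sup>2 * scaled_H1_inner \<epsilon> U w w" for t
      using scaled_H1_inner_nonneg[of \<epsilon> U "\<lambda>x. u x + t * w x"] scaled_H1_inner_expand[OF U u w, of \<epsilon> t] by simp
  qed (rule scaled_H1_inner_nonneg)
  also have "\<dots> = (scaled_H1_norm \<epsilon> U u * scaled_H1_norm \<epsilon> U w)\<^sup>2"
    by (simp add: scaled_H1_norm_square power_mult_distrib)
  finally have "scaled_H1_inner \<epsilon> U u w \<le> scaled_H1_norm \<epsilon> U u * scaled_H1_norm \<epsilon> U w"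
    by (rule power2_le_imp_le) (simp add: scaled_H1_norm_nonneg)
  then show "(scaled_H1_norm \<epsilon> U (\<lambda>x. u x + w x))\<^sup>2 \<le> (scaled_H1_norm \<epsilon> U u + scaled_H1_norm \<epsilon> U w)\<^sup>2"
    using scaled_H1_inner_expand[OF U u w, of \<epsilon> 1] by (simp add: scaled_H1_norm_square power2_sum)
qed (simp add: scaled_H1_norm_nonneg)

lemma scaled_H1_norm_AE_zero:
  assumes U: "open U" "bounded U" and u: "u \<in> borel_measurable (lebesgue_on U)" and ae: "AE x in lebesgue_on U. u x = 0"
  shows "scaled_H1_norm \<epsilon> U u = 0"
proof -
  have "is_weak_gradient U (\<lambda>x. 0) (\<lambda>x. 0)" by (simp add: is_weak_gradient_def L2_on_def)
  then have "is_weak_gradient U u (\<lambda>x. 0)"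
    by (rule is_weak_gradient_cong_AE) (use u ae in \<open>auto elim: eventually_mono\<close>)
  from scaled_H1_inner_eq[OF U this this, of \<epsilon>] have "scaled_H1_inner \<epsilon> U u u = (LINT x|lebesgue_on U. u x * u x)" by simp
  also have "\<dots> = (LINT x|lebesgue_on U. 0)" by (rule integral_cong_AE) (use u ae in \<open>auto elim: eventually_mono\<close>)
  finally show ?thesis by (simp add: scaled_H1_norm_def)
qed

section \<open>Hausdorff measure\<close>

definition hausdorff_weight :: "nat \<Rightarrow> 'a::metric_space set \<Rightarrow> ennreal" where
  "hausdorff_weight d S = (if S = {} then 0 else ennreal (unit_ball_vol (real d) * (diameter S / 2) ^ d))"

definition small_covers :: "real \<Rightarrow> 'a::metric_space set \<Rightarrow> (nat \<Rightarrow> 'a set) set" where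
  "small_covers \<delta> A = {S. A \<subseteq> (\<Union>i. S i) \<and> (\<forall>i. bounded (S i) \<and> diameter (S i) \<le> \<delta>)}"

lemma hausdorff_premeasure_eq:
  "hausdorff_premeasure d \<delta> A = (INF S\<in>small_covers \<delta> A. \<Sum>i. hausdorff_weight d (S i))"
  by (simp add: hausdorff_premeasure_def small_covers_def hausdorff_weight_def)

lemma hausdorff_premeasure_le:
  "S \<in> small_covers \<delta> A \<Longrightarrow> hausdorff_premeasure d \<delta> A \<le> (\<Sum>i. hausdorff_weight d (S i))"
  unfolding hausdorff_premeasure_eq by (rule INF_lower)

lemma hausdorff_premeasure_mono: "A \<subseteq> B \<Longrightarrow> hausdorff_premeasure d \<delta> A \<le> hausdorff_premeasure d \<delta> B"
  unfolding hausdorff_premeasure_eq by (rule INF_superset_mono) (auto simp: small_covers_def)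

lemma hausdorff_premeasure_antimono:
  "\<delta>' \<le> \<delta> \<Longrightarrow> hausdorff_premeasure d \<delta> A \<le> hausdorff_premeasure d \<delta>' A"
  unfolding hausdorff_premeasure_eq
  by (rule INF_superset_mono) (auto simp: small_covers_def intro: order_trans)

lemma hausdorff_premeasure_empty: "0 \<le> \<delta> \<Longrightarrow> hausdorff_premeasure d \<delta> {} = 0"
  using hausdorff_premeasure_le[of "\<lambda>_. {}" \<delta> "{}" d]
  by (simp add: small_covers_def hausdorff_weight_def diameter_empty)

text \<open>Covers of the sets A n that are optimal up to e/2^(n+1) are merged into one
  sequence by means of a pairing function.\<close>

lemma hausdorff_premeasure_countably_subadditive:
  "hausdorff_premeasure d \<delta> (\<Union>n. A n) \<le> (\<Sum>n. hausdorff_premeasure d \<delta> (A n))"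
proof (rule ennreal_le_epsilon)
  fix e :: real
  assume "0 < e" and fin: "(\<Sum>n. hausdorff_premeasure d \<delta> (A n)) < top"
  have "hausdorff_premeasure d \<delta> (A n) < hausdorff_premeasure d \<delta> (A n) + e * (1/2) ^ Suc n" for n
    using fin \<open>0 < e\<close> by (auto simp: less_top dest!: ennreal_suminf_lessD)
  then have "\<exists>S\<in>small_covers \<delta> (A n). (\<Sum>i. hausdorff_weight d (S i)) < hausdorff_premeasure d \<delta> (A n) + e * (1/2) ^ Suc n" for n
    unfolding hausdorff_premeasure_eq[of d \<delta>] INF_less_iff by blast
  then obtain S where S: "\<And>n. S n \<in> small_covers \<delta> (A n)"
    and le: "\<And>n. (\<Sum>i. hausdorff_weight d (S n i)) < hausdorff_premeasure d \<delta> (A n) + e * (1/2) ^ Suc n"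
    by metis
  have "(\<lambda>k. case_prod S (prod_decode k)) \<in> small_covers \<delta> (\<Union>n. A n)"
    unfolding small_covers_def
  proof (intro CollectI conjI allI)
    show "(\<Union>n. A n) \<subseteq> (\<Union>k. case_prod S (prod_decode k))"
    proof
      fix x assume "x \<in> (\<Union>n. A n)"
      then obtain n i where "x \<in> S n i" using S unfolding small_covers_def by blast
      then have "x \<in> case_prod S (prod_decode (prod_encode (n, i)))" by simp
      then show "x \<in> (\<Union>k. case_prod S (prod_decode k))" by (rule UN_I[OF UNIV_I])
    qed
    fix k
    show "bounded (case prod_decode k of (x, xa) \<Rightarrow> S x xa)" "diameter (case prod_decode k of (x, xa) \<Rightarrow> S x xa) \<le> \<delta>"
      using S by (auto simp: small_covers_def split: prod.split)
  qed
  then have "hausdorff_premeasure d \<delta> (\<Union>n. A n) \<le> (\<Sum>k. hausdorff_weight d (case_prod S (prod_decode k)))"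
    by (rule hausdorff_premeasure_le)
  also have "\<dots> = (\<Sum>n. \<Sum>i. hausdorff_weight d (S n i))"
    by (rule suminf_ennreal_2dimen[where f="\<lambda>p. hausdorff_weight d (case_prod S p)"]) simp
  also have "\<dots> \<le> (\<Sum>n. hausdorff_premeasure d \<delta> (A n) + e * (1/2) ^ Suc n)"
    by (intro suminf_le less_imp_le le) auto
  also have "\<dots> = (\<Sum>n. hausdorff_premeasure d \<delta> (A n)) + (\<Sum>n. ennreal e * ennreal ((1/2) ^ Suc n))"
    using \<open>0 < e\<close> by (subst suminf_add[symmetric])
      (auto simp del: ennreal_suminf_cmult simp add: ennreal_mult[symmetric])
  also have "\<dots> = (\<Sum>n. hausdorff_premeasure d \<delta> (A n)) + e"
    unfolding ennreal_suminf_cmult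
    by (subst suminf_ennreal_eq[OF zero_le_power power_half_series]) auto
  finally show "hausdorff_premeasure d \<delta> (\<Union>n. A n) \<le> (\<Sum>n. hausdorff_premeasure d \<delta> (A n)) + e" .
qed

text \<open>A set of diameter less than \<eta> cannot meet both A and B. Hence every cover
  of the union by such sets splits into a cover of A and a cover of B.\<close>

lemma hausdorff_premeasure_separated:
  assumes \<delta>: "0 \<le> \<delta>" "\<delta> < \<eta>" and sep: "\<And>x y. x \<in> A \<Longrightarrow> y \<in> B \<Longrightarrow> \<eta> \<le> dist x y"
  shows "hausdorff_premeasure d \<delta> A + hausdorff_premeasure d \<delta> B \<le> hausdorff_premeasure d \<delta> (A \<union> B)"
  unfolding hausdorff_premeasure_eq[of d \<delta> "A \<union> B"]
proof (rule INF_greatest)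
  fix S assume "S \<in> small_covers \<delta> (A \<union> B)"
  then have cov: "A \<union> B \<subseteq> (\<Union>i. S i)" and S: "\<And>i. bounded (S i)" "\<And>i. diameter (S i) \<le> \<delta>"
    by (auto simp: small_covers_def)
  define SA where "SA i = (if S i \<inter> A = {} then {} else S i)" for i
  define SB where "SB i = (if S i \<inter> B = {} then {} else S i)" for i
  have "SA \<in> small_covers \<delta> A" "SB \<in> small_covers \<delta> B"
    using cov S \<delta> by (auto simp: small_covers_def SA_def SB_def diameter_empty) blast+
  then have "hausdorff_premeasure d \<delta> A + hausdorff_premeasure d \<delta> B
    \<le> (\<Sum>i. hausdorff_weight d (SA i)) + (\<Sum>i. hausdorff_weight d (SB i))"
    by (intro add_mono hausdorff_premeasure_le)
  also have "\<dots> = (\<Sum>i. hausdorff_weight d (SA i) + hausdorff_weight d (SB i))"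
    by (rule suminf_add) auto
  also have "\<dots> \<le> (\<Sum>i. hausdorff_weight d (S i))"
  proof (intro suminf_le)
    fix i
    have "S i \<inter> A = {} \<or> S i \<inter> B = {}"
    proof (rule ccontr)
      assume "\<not> (S i \<inter> A = {} \<or> S i \<inter> B = {})"
      then obtain x y where xy: "x \<in> S i" "x \<in> A" "y \<in> S i" "y \<in> B" by blast
      have "dist x y \<le> diameter (S i)" by (rule diameter_bounded_bound[OF S(1) xy(1,3)])
      then show False using sep[OF xy(2,4)] S(2)[of i] \<delta> by linarith
    qed
    then show "hausdorff_weight d (SA i) + hausdorff_weight d (SB i) \<le> hausdorff_weight d (S i)"
      by (auto simp: SA_def SB_def hausdorff_weight_def)
  qed auto
  finally show "hausdorff_premeasure d \<delta> A + hausdorff_premeasure d \<delta> B \<le> (\<Sum>i. hausdorff_weight d (S i))" .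
qed

lemma hausdorff_premeasure_le_outer: "0 < \<delta> \<Longrightarrow> hausdorff_premeasure d \<delta> A \<le> hausdorff_outer d A"
  unfolding hausdorff_outer_def by (rule SUP_upper) simp

lemma hausdorff_outer_empty: "hausdorff_outer d {} = 0"
  unfolding hausdorff_outer_def by (simp add: hausdorff_premeasure_empty SUP_eq_const)

lemma hausdorff_outer_mono: "A \<subseteq> B \<Longrightarrow> hausdorff_outer d A \<le> hausdorff_outer d B"
  unfolding hausdorff_outer_def by (intro SUP_mono') (rule hausdorff_premeasure_mono)

lemma hausdorff_outer_countably_subadditive: "hausdorff_outer d (\<Union>n. A n) \<le> (\<Sum>n. hausdorff_outer d (A n))"
  unfolding hausdorff_outer_def[of d "\<Union>n. A n"]
proof (rule SUP_least)
  fix \<delta> :: real assume "\<delta> \<in> {0<..}"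
  then show "hausdorff_premeasure d \<delta> (\<Union>n. A n) \<le> (\<Sum>n. hausdorff_outer d (A n))"
    by (intro order_trans[OF hausdorff_premeasure_countably_subadditive] suminf_le hausdorff_premeasure_le_outer) auto
qed

lemma hausdorff_outer_subadditive: "hausdorff_outer d (A \<union> B) \<le> hausdorff_outer d A + hausdorff_outer d B"
proof -
  define F where "F n = (if n = 0 then A else if n = 1 then B else {})" for n :: nat
  have "A \<union> B = (\<Union>n. F n)" by (auto simp: F_def split: if_splits)
  then have "hausdorff_outer d (A \<union> B) \<le> (\<Sum>n. hausdorff_outer d (F n))"
    using hausdorff_outer_countably_subadditive[of d F] by simp
  also have "\<dots> = (\<Sum>n<2. hausdorff_outer d (F n))"
    by (rule suminf_finite) (auto simp: hausdorff_outer_empty F_def)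
  also have "\<dots> = hausdorff_outer d A + hausdorff_outer d B" by (simp add: numeral_2_eq_2 F_def)
  finally show ?thesis .
qed

text \<open>The premeasures increase as the bound on the diameters decreases, so the two
  suprema may be taken together and over bounds smaller than \<eta>.\<close>

lemma hausdorff_outer_separated:
  assumes \<eta>: "0 < \<eta>" and sep: "\<And>x y. x \<in> A \<Longrightarrow> y \<in> B \<Longrightarrow> \<eta> \<le> dist x y"
  shows "hausdorff_outer d A + hausdorff_outer d B \<le> hausdorff_outer d (A \<union> B)"
proof -
  have "hausdorff_outer d A + hausdorff_outer d B
    = (SUP \<delta>\<in>{0<..}. hausdorff_premeasure d \<delta> A + hausdorff_premeasure d \<delta> B)"
    unfolding hausdorff_outer_def
  proof (rule SUP_add_directed_ennreal[symmetric])
    fix \<delta> \<delta>' :: real assume "\<delta> \<in> {0<..}" "\<delta>' \<in> {0<..}"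
    then show "\<exists>k\<in>{0<..}. hausdorff_premeasure d \<delta> A + hausdorff_premeasure d \<delta>' B
        \<le> hausdorff_premeasure d k A + hausdorff_premeasure d k B"
      by (intro bexI[of _ "min \<delta> \<delta>'"] add_mono hausdorff_premeasure_antimono) auto
  qed
  also have "\<dots> \<le> hausdorff_outer d (A \<union> B)"
  proof (rule SUP_least)
    fix \<delta> :: real assume "\<delta> \<in> {0<..}"
    then have k: "0 < min \<delta> (\<eta> / 2)" "min \<delta> (\<eta> / 2) < \<eta>" using \<eta> by auto
    have "hausdorff_premeasure d \<delta> A + hausdorff_premeasure d \<delta> B
      \<le> hausdorff_premeasure d (min \<delta> (\<eta> / 2)) A + hausdorff_premeasure d (min \<delta> (\<eta> / 2)) B"
      by (intro add_mono hausdorff_premeasure_antimono) auto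
    also have "\<dots> \<le> hausdorff_premeasure d (min \<delta> (\<eta> / 2)) (A \<union> B)"
      using k sep by (intro hausdorff_premeasure_separated[of _ \<eta>]) auto
    also have "\<dots> \<le> hausdorff_outer d (A \<union> B)" by (rule hausdorff_premeasure_le_outer[OF k(1)])
    finally show "hausdorff_premeasure d \<delta> A + hausdorff_premeasure d \<delta> B \<le> hausdorff_outer d (A \<union> B)" .
  qed
  finally show ?thesis .
qed

text \<open>The distance of R m from its predecessors may tend to zero as m grows.\<close>

lemma separated_family_sum_le:
  fixes X :: "'a::metric_space set" and R :: "nat \<Rightarrow> 'a set"
  assumes R: "\<And>k. R k \<subseteq> X"
    and sep: "\<And>m. \<exists>\<eta>>0. \<forall>j<m. \<forall>x\<in>R j. \<forall>y\<in>R m. \<eta> \<le> dist x y"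
  shows "(\<Sum>k. hausdorff_outer d (R k)) \<le> hausdorff_outer d X"
proof -
  have "(\<Sum>k<m. hausdorff_outer d (R k)) \<le> hausdorff_outer d (\<Union>k<m. R k)" for m
  proof (induction m)
    case (Suc m)
    obtain \<eta> where \<eta>: "\<eta> > 0" "\<And>j x y. j < m \<Longrightarrow> x \<in> R j \<Longrightarrow> y \<in> R m \<Longrightarrow> \<eta> \<le> dist x y"
      using sep[of m] by metis
    have "(\<Sum>k<Suc m. hausdorff_outer d (R k)) \<le> hausdorff_outer d (\<Union>k<m. R k) + hausdorff_outer d (R m)"
      using Suc by (simp add: add_right_mono)
    also have "\<dots> \<le> hausdorff_outer d ((\<Union>k<m. R k) \<union> R m)"
      by (rule hausdorff_outer_separated[OF \<eta>(1)]) (use \<eta>(2) in blast)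
    also have "(\<Union>k<m. R k) \<union> R m = (\<Union>k<Suc m. R k)" by (auto simp: less_Suc_eq)
    finally show ?case .
  qed simp
  then have "(\<Sum>k<m. hausdorff_outer d (R k)) \<le> hausdorff_outer d X" for m
    by (rule order_trans) (use R in \<open>blast intro: hausdorff_outer_mono\<close>)
  then show ?thesis by (intro suminf_le_const) auto
qed

text \<open>Caratheodory's criterion for metric outer measures. The points of X outside C
  with distance at least r n from C form a set XX n that is separated from C. The remaining
  ones lie in the shells R k with k \<ge> n. Two shells whose indices differ by at least 2
  are separated, so the sums over the even and over the odd shells are bounded by the
  measure of X; hence the tails of the series of all shells tend to zero.\<close>

lemma hausdorff_outer_closed_split:
  fixes C :: "'a::metric_space set"
  assumes C: "closed C"
  shows "hausdorff_outer d (X \<inter> C) + hausdorff_outer d (X - C) \<le> hausdorff_outer d X"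
proof (cases "C = {} \<or> hausdorff_outer d X = top")
  case True
  then show ?thesis by (auto simp: hausdorff_outer_empty)
next
  case False
  then have ne: "C \<noteq> {}" and fin: "hausdorff_outer d X \<noteq> top" by auto
  define r where "r k = 1 / (real k + 1)" for k :: nat
  have r: "r k > 0" "r (Suc k) < r k" for k by (auto simp: r_def field_simps)
  have r_anti: "r k \<le> r j" if "j \<le> k" for j k using that by (auto simp: r_def field_simps)
  define XX where "XX n = {x \<in> X. infdist x C \<ge> r n}" for n
  define R where "R k = {x \<in> X. r (Suc k) \<le> infdist x C \<and> infdist x C < r k}" for k
  define a where "a k = hausdorff_outer d (R k)" for k
  have sepR: "\<exists>\<eta>>0. \<forall>x\<in>R j. \<forall>y\<in>R k. \<eta> \<le> dist x y" if "j + 2 \<le> k" for j k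
  proof (intro exI conjI ballI)
    show "r (Suc j) - r (Suc (Suc j)) > 0" using r by simp
    fix x y assume "x \<in> R j" "y \<in> R k"
    then have "r (Suc j) \<le> infdist x C" "infdist y C < r k" by (auto simp: R_def)
    moreover have "r k \<le> r (Suc (Suc j))" using that by (intro r_anti) auto
    ultimately show "r (Suc j) - r (Suc (Suc j)) \<le> dist x y"
      using infdist_triangle[of x C y] by linarith
  qed
  \<comment> \<open>Shells of equal parity are separated. For m = 0 there is no earlier
    shell, and any positive \<eta> will do.\<close>
  have half: "(\<Sum>k. a (2 * k + c)) \<le> hausdorff_outer d X" for c
    unfolding a_def
  proof (rule separated_family_sum_le)
    show "R (2 * k + c) \<subseteq> X" for k by (auto simp: R_def)
    fix m
    define \<eta> where "\<eta> = (if m = 0 then 1 else r (2 * m + c - 1) - r (2 * m + c))"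
    show "\<exists>\<eta>>0. \<forall>j<m. \<forall>x\<in>R (2 * j + c). \<forall>y\<in>R (2 * m + c). \<eta> \<le> dist x y"
    proof (intro exI conjI allI impI ballI)
      show "\<eta> > 0" using r(2)[of "2 * m + c - 1"] by (auto simp: \<eta>_def)
      fix j x y assume j: "j < m" and "x \<in> R (2 * j + c)" "y \<in> R (2 * m + c)"
      then have "r (Suc (2 * j + c)) \<le> infdist x C" "infdist y C < r (2 * m + c)" by (auto simp: R_def)
      moreover have "r (2 * m + c - 1) \<le> r (Suc (2 * j + c))" using j by (intro r_anti) auto
      ultimately show "\<eta> \<le> dist x y" using infdist_triangle[of x C y] j by (simp add: \<eta>_def)
    qed
  qed
  have partial: "(\<Sum>k<m. a k) \<le> hausdorff_outer d X + hausdorff_outer d X" for m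
  proof -
    have "(\<Sum>k<m. a k) \<le> (\<Sum>k<2 * m. a k)" by (intro sum_mono2) auto
    also have "\<dots> = (\<Sum>k<m. a (2 * k + 0)) + (\<Sum>k<m. a (2 * k + 1))"
      by (induction m) (auto simp: algebra_simps)
    also have "\<dots> \<le> (\<Sum>k. a (2 * k + 0)) + (\<Sum>k. a (2 * k + 1))"
      by (intro add_mono sum_le_suminf) auto
    also have "\<dots> \<le> hausdorff_outer d X + hausdorff_outer d X" by (intro add_mono half)
    finally show ?thesis .
  qed
  have a_fin: "(\<Sum>k. a k) \<noteq> top"
  proof -
    have "(\<Sum>k. a k) \<le> hausdorff_outer d X + hausdorff_outer d X"
      by (intro suminf_le_const partial) auto
    also have "\<dots> < top" using fin by (simp add: less_top)
    finally show ?thesis by simp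
  qed
  then have a_top: "a k \<noteq> top" for k
    using ennreal_suminf_lessD[of a top k] by (simp add: less_top)
  then have a_eq: "a k = ennreal (enn2real (a k))" for k by (simp add: less_top)
  have summ: "summable (\<lambda>k. enn2real (a k))"
    using a_fin a_eq by (intro summable_suminf_not_top) auto
  have tail: "\<exists>n. (\<Sum>k. a (k + n)) \<le> ennreal e" if e: "e > 0" for e
  proof -
    obtain n where "norm (\<Sum>k. enn2real (a (k + n))) < e"
      using suminf_exist_split[OF e summ] by blast
    moreover have "(\<Sum>k. a (k + n)) = ennreal (\<Sum>k. enn2real (a (k + n)))"
      by (subst a_eq, rule suminf_ennreal2) (auto intro: summable_ignore_initial_segment[OF summ])
    ultimately show ?thesis by (intro exI[of _ n]) (auto intro: ennreal_leI)
  qed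
  have cover: "X - C \<subseteq> XX n \<union> (\<Union>k. R (k + n))" for n
  proof
    fix x assume x: "x \<in> X - C"
    define \<delta> where "\<delta> = infdist x C"
    have "\<delta> > 0" using x C ne infdist_nonneg[of x C] in_closed_iff_infdist_zero[OF C ne, of x] by (auto simp: \<delta>_def)
    show "x \<in> XX n \<union> (\<Union>k. R (k + n))"
    proof (cases "\<delta> \<ge> r n")
      case True then show ?thesis using x by (auto simp: XX_def \<delta>_def)
    next
      case False
      obtain k0 where "inverse (real (Suc k0)) < \<delta>" using reals_Archimedean[OF \<open>\<delta> > 0\<close>] by blast
      moreover have "inverse (real (Suc k0)) = r k0" by (simp add: r_def inverse_eq_divide)
      ultimately have "r (Suc k0) \<le> \<delta>" using r(2)[of k0] by linarith
      \<comment> \<open>The first index whose shell reaches down to the distance of x from C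
        is the index of the shell of x.\<close>
      define K where "K = (LEAST k. r (Suc k) \<le> \<delta>)"
      have K: "r (Suc K) \<le> \<delta>" unfolding K_def by (rule LeastI) fact
      have Kn: "n \<le> K"
      proof (rule ccontr)
        assume "\<not> n \<le> K"
        then have "r n \<le> r (Suc K)" by (intro r_anti) auto
        then show False using K False by simp
      qed
      have "\<delta> < r K"
      proof (cases K)
        case 0
        then show ?thesis using False r_anti[of 0 n] by auto
      next
        case (Suc k)
        then have "\<not> r (Suc k) \<le> \<delta>" using not_less_Least[of k "\<lambda>k. r (Suc k) \<le> \<delta>"] by (simp add: K_def)
        then show ?thesis using Suc by simp
      qed
      then have "x \<in> R ((K - n) + n)" using x K Kn by (auto simp: R_def \<delta>_def)
      then show ?thesis by blast
    qed
  qed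
  show ?thesis
  proof (rule ennreal_le_epsilon)
    fix e :: real assume e: "0 < e"
    obtain n where n: "(\<Sum>k. a (k + n)) \<le> ennreal e" using tail[OF e] by blast
    have "hausdorff_outer d (X - C) \<le> hausdorff_outer d (XX n \<union> (\<Union>k. R (k + n)))"
      by (rule hausdorff_outer_mono[OF cover])
    also have "\<dots> \<le> hausdorff_outer d (XX n) + (\<Sum>k. a (k + n))"
      unfolding a_def by (intro order_trans[OF hausdorff_outer_subadditive] add_left_mono hausdorff_outer_countably_subadditive)
    also have "\<dots> \<le> hausdorff_outer d (XX n) + e" by (intro add_left_mono n)
    finally have "hausdorff_outer d (X \<inter> C) + hausdorff_outer d (X - C)
      \<le> hausdorff_outer d (X \<inter> C) + (hausdorff_outer d (XX n) + e)" by (rule add_left_mono)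
    also have "\<dots> = (hausdorff_outer d (X \<inter> C) + hausdorff_outer d (XX n)) + e" by (simp add: add.assoc)
    also have "\<dots> \<le> hausdorff_outer d ((X \<inter> C) \<union> XX n) + e"
    proof (intro add_right_mono hausdorff_outer_separated[OF r(1)[of n]])
      fix x y assume "x \<in> X \<inter> C" "y \<in> XX n"
      then show "r n \<le> dist x y" using infdist_le[of x C y] by (auto simp: XX_def dist_commute)
    qed
    also have "\<dots> \<le> hausdorff_outer d X + e"
      by (intro add_right_mono hausdorff_outer_mono) (auto simp: XX_def)
    finally show "hausdorff_outer d (X \<inter> C) + hausdorff_outer d (X - C) \<le> hausdorff_outer d X + ennreal e" .
  qed
qed

text \<open>Without countable additivity on the Borel sets, the surface measure built from
  this set function would degenerate to the zero measure, and a vanishing trace would carry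
  no information.\<close>

lemma measure_space_hausdorff: "measure_space UNIV (sets borel) (hausdorff_outer d :: 'a::metric_space set \<Rightarrow> ennreal)"
proof -
  let ?H = "hausdorff_outer d :: 'a set \<Rightarrow> ennreal"
  interpret P: sigma_algebra "UNIV :: 'a set" "Pow UNIV" by (rule sigma_algebra_Pow)
  have "outer_measure_space (Pow UNIV) ?H"
    unfolding outer_measure_space_def positive_def increasing_def countably_subadditive_def
    by (auto simp: hausdorff_outer_empty intro: hausdorff_outer_mono hausdorff_outer_countably_subadditive)
  then have L: "measure_space UNIV (lambda_system UNIV (Pow UNIV) ?H) ?H" by (rule P.caratheodory_lemma)
  then interpret L: sigma_algebra UNIV "lambda_system UNIV (Pow UNIV) ?H" by (simp add: measure_space_def)
  have "Collect closed \<subseteq> lambda_system UNIV (Pow UNIV) ?H"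
  proof
    fix C :: "'a set" assume "C \<in> Collect closed"
    then have "?H (X \<inter> C) + ?H (X - C) = ?H X" for X
      using hausdorff_outer_closed_split[of C d X] hausdorff_outer_subadditive[of d "X \<inter> C" "X - C"]
      by (intro antisym) (auto simp: Int_Diff_Un)
    then show "C \<in> lambda_system UNIV (Pow UNIV) ?H" unfolding P.lambda_system_eq by blast
  qed
  then have "sets borel \<subseteq> lambda_system UNIV (Pow UNIV) ?H"
    using L.sigma_sets_subset[of "Collect closed"] unfolding borel_eq_closed by simp
  moreover have "sigma_algebra UNIV (sets (borel :: 'a measure))"
    using sets.sigma_algebra_axioms[of "borel :: 'a measure"] by simp
  ultimately show ?thesis using L by (blast intro: measure_down)
qed

lemma sets_surface_measure [simp, measurable_cong]: "sets surface_measure = sets borel"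
  unfolding surface_measure_def by (metis sets.sets_measure_of_eq space_borel)

lemma emeasure_surface_measure:
  "A \<in> sets borel \<Longrightarrow> emeasure (surface_measure :: 'a::euclidean_space measure) A = hausdorff_outer (DIM('a) - 1) A"
  unfolding surface_measure_def
  using measure_space_hausdorff[of "DIM('a) - 1", where 'a='a]
  by (intro emeasure_measure_of_sigma) (auto simp: measure_space_def)

section \<open>Surface measure of a flat face\<close>

text \<open>The points of the slab whose projection to a hyperplane orthogonal to i lies in
  S are contained in a box with one edge of length 1 and all others of length twice the
  diameter of S.\<close>

lemma emeasure_prism_le_weight:
  fixes S :: "'a::euclidean_space set"
  assumes i: "i \<in> Basis" and S: "bounded S"
  obtains B where "B \<in> sets borel" "{x. 0 \<le> x \<bullet> i \<and> x \<bullet> i \<le> 1 \<and> x + (c - x \<bullet> i) *\<^sub>R i \<in> S} \<subseteq> B"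
    "ennreal (unit_ball_vol (real (DIM('a) - 1)) / 4 ^ (DIM('a) - 1)) * emeasure lborel B \<le> hausdorff_weight (DIM('a) - 1) S"
proof (cases "S = {}")
  case True
  then show ?thesis by (intro that[of "{}"]) auto
next
  case False
  then obtain p where p: "p \<in> S" by blast
  define D where "D = diameter S"
  have D: "0 \<le> D" unfolding D_def by (rule diameter_ge_0[OF S])
  define l where "l = (\<Sum>b\<in>Basis. (if b = i then 0 else p \<bullet> b - D) *\<^sub>R b)"
  define u where "u = (\<Sum>b\<in>Basis. (if b = i then 1 else p \<bullet> b + D) *\<^sub>R b)"
  have l: "l \<bullet> b = (if b = i then 0 else p \<bullet> b - D)" and u: "u \<bullet> b = (if b = i then 1 else p \<bullet> b + D)"
    if "b \<in> Basis" for b using that by (auto simp: l_def u_def)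
  show ?thesis
  proof
    show "cbox l u \<in> sets borel" by simp
    show "{x. 0 \<le> x \<bullet> i \<and> x \<bullet> i \<le> 1 \<and> x + (c - x \<bullet> i) *\<^sub>R i \<in> S} \<subseteq> cbox l u"
    proof
      fix x assume x: "x \<in> {x. 0 \<le> x \<bullet> i \<and> x \<bullet> i \<le> 1 \<and> x + (c - x \<bullet> i) *\<^sub>R i \<in> S}"
      have "l \<bullet> b \<le> x \<bullet> b \<and> x \<bullet> b \<le> u \<bullet> b" if b: "b \<in> Basis" for b
      proof (cases "b = i")
        case False
        let ?q = "x + (c - x \<bullet> i) *\<^sub>R i"
        have "\<bar>(?q - p) \<bullet> b\<bar> \<le> norm (?q - p)" by (rule Basis_le_norm[OF b])
        also have "\<dots> \<le> D" unfolding D_def using diameter_bounded_bound[OF S _ p, of ?q] x by (simp add: dist_norm)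
        finally have "\<bar>x \<bullet> b - p \<bullet> b\<bar> \<le> D" using False b i by (simp add: inner_simps inner_Basis)
        then show ?thesis using False b by (auto simp: l u)
      qed (use x i in \<open>auto simp: l u\<close>)
      then show "x \<in> cbox l u" by (simp add: mem_box)
    qed
    have "emeasure lborel (cbox l u) = ennreal (\<Prod>b\<in>Basis. (u - l) \<bullet> b)"
      using D by (intro emeasure_lborel_cbox) (auto simp: l u)
    also have "(\<Prod>b\<in>Basis. (u - l) \<bullet> b) = (\<Prod>b\<in>Basis - {i}. 2 * D)"
      using i by (subst prod.remove[OF finite_Basis i]) (auto simp: inner_diff_left l u intro!: prod.cong)
    also have "\<dots> = (2 * D) ^ (DIM('a) - 1)" using i by (simp add: card_Diff_singleton)
    finally have eq: "emeasure lborel (cbox l u) = ennreal ((2 * D) ^ (DIM('a) - 1))" .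
    have "ennreal (unit_ball_vol (real (DIM('a) - 1)) / 4 ^ (DIM('a) - 1)) * emeasure lborel (cbox l u)
      = ennreal (unit_ball_vol (real (DIM('a) - 1)) / 4 ^ (DIM('a) - 1) * (2 * D) ^ (DIM('a) - 1))"
    proof -
      have "0 \<le> unit_ball_vol (real (DIM('a) - 1)) / 4 ^ (DIM('a) - 1)" "0 \<le> (2 * D) ^ (DIM('a) - 1)"
        using D by (auto intro!: divide_nonneg_nonneg unit_ball_vol_nonneg zero_le_power simp del: power_mult_distrib)
      then have "ennreal (unit_ball_vol (real (DIM('a) - 1)) / 4 ^ (DIM('a) - 1) * (2 * D) ^ (DIM('a) - 1))
        = ennreal (unit_ball_vol (real (DIM('a) - 1)) / 4 ^ (DIM('a) - 1)) * ennreal ((2 * D) ^ (DIM('a) - 1))"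
        by (rule ennreal_mult)
      then show ?thesis by (simp only: eq)
    qed
    also have "unit_ball_vol (real (DIM('a) - 1)) / 4 ^ (DIM('a) - 1) * (2 * D) ^ (DIM('a) - 1)
      = unit_ball_vol (real (DIM('a) - 1)) * ((2 * D) / 4) ^ (DIM('a) - 1)"
      by (simp only: power_divide) simp
    also have "(2 * D) / 4 = D / 2" by simp
    finally show "ennreal (unit_ball_vol (real (DIM('a) - 1)) / 4 ^ (DIM('a) - 1)) * emeasure lborel (cbox l u)
      \<le> hausdorff_weight (DIM('a) - 1) S"
      using False by (simp add: hausdorff_weight_def D_def)
  qed
qed

text \<open>A flat subset of a hyperplane is measured by the volume of the prism of height
  one above it, which avoids Lebesgue measure on hyperplanes. The constant compares the
  volume of a cube with that of a ball.\<close>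

lemma emeasure_prism_le_surface_measure:
  fixes A Y :: "'a::euclidean_space set"
  assumes i: "i \<in> Basis" and Y: "Y \<in> sets borel" "Y \<subseteq> {x. 0 \<le> x \<bullet> i \<and> x \<bullet> i \<le> 1}" and A: "A \<in> sets borel"
  shows "ennreal (unit_ball_vol (real (DIM('a) - 1)) / 4 ^ (DIM('a) - 1)) * emeasure lborel {x \<in> Y. x + (c - x \<bullet> i) *\<^sub>R i \<in> A}
    \<le> emeasure surface_measure A"
    (is "?K * _ \<le> _")
proof -
  have "?K * emeasure lborel {x \<in> Y. x + (c - x \<bullet> i) *\<^sub>R i \<in> A} \<le> (\<Sum>k. hausdorff_weight (DIM('a) - 1) (S k))"
    if S: "S \<in> small_covers 1 A" for S
  proof -
    have "\<exists>B\<in>sets borel. {x. 0 \<le> x \<bullet> i \<and> x \<bullet> i \<le> 1 \<and> x + (c - x \<bullet> i) *\<^sub>R i \<in> S k} \<subseteq> B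
        \<and> ?K * emeasure lborel B \<le> hausdorff_weight (DIM('a) - 1) (S k)" for k
    proof -
      have "bounded (S k)" using S by (simp add: small_covers_def)
      then show ?thesis by (rule emeasure_prism_le_weight[OF i, of "S k" c]) blast
    qed
    then have "\<forall>k. \<exists>B. B \<in> sets borel \<and> {x. 0 \<le> x \<bullet> i \<and> x \<bullet> i \<le> 1 \<and> x + (c - x \<bullet> i) *\<^sub>R i \<in> S k} \<subseteq> B
        \<and> ?K * emeasure lborel B \<le> hausdorff_weight (DIM('a) - 1) (S k)" by blast
    then obtain B where B0: "\<forall>k. B k \<in> sets borel \<and> {x. 0 \<le> x \<bullet> i \<and> x \<bullet> i \<le> 1 \<and> x + (c - x \<bullet> i) *\<^sub>R i \<in> S k} \<subseteq> B k
        \<and> ?K * emeasure lborel (B k) \<le> hausdorff_weight (DIM('a) - 1) (S k)" unfolding choice_iff by blast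
    then have B: "\<And>k. B k \<in> sets borel"
      "\<And>k. {x. 0 \<le> x \<bullet> i \<and> x \<bullet> i \<le> 1 \<and> x + (c - x \<bullet> i) *\<^sub>R i \<in> S k} \<subseteq> B k"
      "\<And>k. ?K * emeasure lborel (B k) \<le> hausdorff_weight (DIM('a) - 1) (S k)"
      by simp_all
    have "{x \<in> Y. x + (c - x \<bullet> i) *\<^sub>R i \<in> A} \<subseteq> (\<Union>k. B k)"
      using S Y(2) B(2) unfolding small_covers_def by blast
    then have "emeasure lborel {x \<in> Y. x + (c - x \<bullet> i) *\<^sub>R i \<in> A} \<le> emeasure lborel (\<Union>k. B k)"
      using B(1) by (intro emeasure_mono) auto
    also have "\<dots> \<le> (\<Sum>k. emeasure lborel (B k))"
      using B(1) by (intro emeasure_subadditive_countably) auto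
    finally have "?K * emeasure lborel {x \<in> Y. x + (c - x \<bullet> i) *\<^sub>R i \<in> A} \<le> ?K * (\<Sum>k. emeasure lborel (B k))"
      by (rule mult_left_mono) simp
    also have "\<dots> = (\<Sum>k. ?K * emeasure lborel (B k))" by simp
    also have "\<dots> \<le> (\<Sum>k. hausdorff_weight (DIM('a) - 1) (S k))"
      by (intro suminf_le B(3)) auto
    finally show ?thesis .
  qed
  then have "?K * emeasure lborel {x \<in> Y. x + (c - x \<bullet> i) *\<^sub>R i \<in> A} \<le> hausdorff_premeasure (DIM('a) - 1) 1 A"
    unfolding hausdorff_premeasure_eq by (rule INF_greatest)
  also have "\<dots> \<le> emeasure surface_measure A"
    unfolding emeasure_surface_measure[OF A] by (rule hausdorff_premeasure_le_outer) simp
  finally show ?thesis .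
qed

lemma nn_integral_prism_le_surface_measure:
  fixes f :: "'a::euclidean_space \<Rightarrow> ennreal"
  assumes i: "i \<in> Basis" and Y: "Y \<in> sets borel" "Y \<subseteq> {x. 0 \<le> x \<bullet> i \<and> x \<bullet> i \<le> 1}" and f: "f \<in> borel_measurable borel"
  shows "ennreal (unit_ball_vol (real (DIM('a) - 1)) / 4 ^ (DIM('a) - 1)) *
      (\<integral>\<^sup>+x. f (x + (c - x \<bullet> i) *\<^sub>R i) * indicator Y x \<partial>lborel) \<le> (\<integral>\<^sup>+x. f x \<partial>surface_measure)"
    (is "?K * ?I \<le> _")
proof -
  define q where "q x = x + (c - x \<bullet> i) *\<^sub>R i" for x
  have q[measurable]: "q \<in> borel_measurable borel" unfolding q_def by measurable
  note f[measurable] and Y(1)[measurable]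
  define \<mu> where "\<mu> = distr (restrict_space lborel Y) borel q"
  have mq: "q \<in> restrict_space lborel Y \<rightarrow>\<^sub>M borel" by (rule measurable_restrict_space1) simp
  have "(\<integral>\<^sup>+x. f x \<partial>\<mu>) = (\<integral>\<^sup>+x. f (q x) \<partial>restrict_space lborel Y)"
    unfolding \<mu>_def by (rule nn_integral_distr[OF mq]) simp
  also have "\<dots> = ?I" by (subst nn_integral_restrict_space) (auto simp: q_def)
  finally have "?K * ?I = (\<integral>\<^sup>+x. f x \<partial>scale_measure ?K \<mu>)"
    by (subst nn_integral_scale_measure) (auto simp: \<mu>_def)
  also have "\<dots> \<le> (\<integral>\<^sup>+x. f x \<partial>surface_measure)"
  proof (rule nn_integral_mono_measure)
    show s: "sets (scale_measure ?K \<mu>) = sets surface_measure" by (simp add: \<mu>_def)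
    show "scale_measure ?K \<mu> \<le> surface_measure"
      unfolding le_measure[OF s]
    proof
      fix A assume "A \<in> sets (scale_measure ?K \<mu>)"
      then have A[measurable]: "A \<in> sets borel" by (simp add: \<mu>_def)
      have "emeasure \<mu> A = emeasure lborel {x \<in> Y. q x \<in> A}"
        unfolding \<mu>_def using mq
        by (subst emeasure_distr) (auto simp: emeasure_restrict_space space_restrict_space intro!: arg_cong[where f="emeasure lborel"])
      then show "emeasure (scale_measure ?K \<mu>) A \<le> emeasure surface_measure A"
        using emeasure_prism_le_surface_measure[OF i Y A, of c] by (simp add: q_def)
    qed
  qed
  finally show ?thesis .
qed

section \<open>Lipschitz boundaries\<close>

lemma tangential_inner: "norm \<nu> = 1 \<Longrightarrow> tangential \<nu> z \<bullet> \<nu> = 0"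
  by (simp add: tangential_def inner_diff_left dot_square_norm)

lemma tangential_add_normal: "norm \<nu> = 1 \<Longrightarrow> tangential \<nu> (z + s *\<^sub>R \<nu>) = tangential \<nu> z"
  by (simp add: tangential_def inner_add_left dot_square_norm algebra_simps)

lemma open_cylinder: "open (cylinder p \<nu> r h)"
proof -
  have "cylinder p \<nu> r h = {z. norm (tangential \<nu> (z - p)) < r} \<inter> {z. \<bar>(z - p) \<bullet> \<nu>\<bar> < h}"
    by (auto simp: cylinder_def)
  moreover have "open {z. norm (tangential \<nu> (z - p)) < r}" "open {z. \<bar>(z - p) \<bullet> \<nu>\<bar> < h}"
    unfolding tangential_def by (intro open_Collect_less continuous_intros)+
  ultimately show ?thesis by (simp add: open_Int)
qed

text \<open>The function f is the height above the graph that bounds U: it grows with unit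
  speed in the direction \<nu>, is negative exactly on U, and vanishes on the frontier by
  continuity.\<close>

lemma lipschitz_boundary_chart:
  fixes U :: "'a::euclidean_space set"
  assumes lip: "lipschitz_boundary U" and U: "open U" and p: "p \<in> frontier U"
  obtains \<nu> N f where "norm \<nu> = 1" "open N" "p \<in> N" "continuous_on N f" "U \<inter> N = {z \<in> N. f z < (0::real)}"
    "\<And>z s. z \<in> N \<Longrightarrow> z + s *\<^sub>R \<nu> \<in> N \<Longrightarrow> f (z + s *\<^sub>R \<nu>) = f z + s"
    "\<And>q. q \<in> frontier U \<inter> N \<Longrightarrow> f q = 0"
proof -
  obtain \<nu> r h L \<gamma> where \<nu>: "norm \<nu> = 1" and r: "r > 0" "h > 0"
    and L: "L-lipschitz_on {w. w \<bullet> \<nu> = 0 \<and> norm w < r} \<gamma>"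
    and eq: "U \<inter> cylinder p \<nu> r h = {z \<in> cylinder p \<nu> r h. (z - p) \<bullet> \<nu> < \<gamma> (tangential \<nu> (z - p))}"
    using lip p unfolding lipschitz_boundary_def by blast
  define N where "N = cylinder p \<nu> r h"
  define f where "f z = (z - p) \<bullet> \<nu> - \<gamma> (tangential \<nu> (z - p))" for z
  have N: "open N" unfolding N_def by (rule open_cylinder)
  have pN: "p \<in> N" using r by (simp add: N_def cylinder_def tangential_def)
  have cont: "continuous_on N f"
    unfolding f_def
  proof (intro continuous_intros continuous_on_compose2[OF lipschitz_on_continuous_on[OF L]])
    show "continuous_on N (\<lambda>z. tangential \<nu> (z - p))" unfolding tangential_def by (intro continuous_intros)
    show "(\<lambda>z. tangential \<nu> (z - p)) ` N \<subseteq> {w. w \<bullet> \<nu> = 0 \<and> norm w < r}"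
      using tangential_inner[OF \<nu>] by (auto simp: N_def cylinder_def)
  qed
  have UN: "U \<inter> N = {z \<in> N. f z < 0}" using eq by (auto simp: N_def f_def)
  have shift: "f (z + s *\<^sub>R \<nu>) = f z + s" for z s
    using tangential_add_normal[OF \<nu>, of "z - p" s] \<nu>
    by (simp add: f_def inner_add_left inner_diff_left dot_square_norm algebra_simps)
  have "f q = 0" if q: "q \<in> frontier U \<inter> N" for q
  proof -
    have "q \<notin> U" using q U by (simp add: frontier_def interior_open)
    then have "f q \<ge> 0" using UN q by force
    moreover have "\<not> f q > 0"
    proof
      assume pos: "f q > 0"
      have "open (N \<inter> f -` {0<..})" using continuous_open_preimage[OF cont N open_greaterThan] .
      moreover have "q \<in> N \<inter> f -` {0<..}" using q pos by simp
      moreover have "q \<in> closure U" using q by (simp add: frontier_def)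
      ultimately obtain z where "z \<in> U" "z \<in> N \<inter> f -` {0<..}" unfolding closure_iff_nhds_not_empty by blast
      then show False using UN by force
    qed
    ultimately show ?thesis by simp
  qed
  from that[OF \<nu> N pN cont UN shift this] show ?thesis by blast
qed

text \<open>Arbitrarily close to a frontier point there are points above the graph, and
  these do not belong to the closure of U.\<close>

lemma lipschitz_boundary_interior_closure:
  fixes U :: "'a::euclidean_space set"
  assumes lip: "lipschitz_boundary U" and U: "open U"
  shows "interior (closure U) = U"
proof
  show "U \<subseteq> interior (closure U)" using U by (simp add: closure_subset interior_maximal)
  show "interior (closure U) \<subseteq> U"
  proof
    fix p assume p: "p \<in> interior (closure U)"
    show "p \<in> U"
    proof (rule ccontr)
      assume "p \<notin> U"
      then have "p \<in> frontier U" using p U interior_subset by (auto simp: frontier_def interior_open)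
      then obtain \<nu> N f where \<nu>: "norm \<nu> = 1" and N: "open N" "p \<in> N" and cont: "continuous_on N f"
        and UN: "U \<inter> N = {z \<in> N. f z < (0::real)}"
        and shift: "\<And>z s. z \<in> N \<Longrightarrow> z + s *\<^sub>R \<nu> \<in> N \<Longrightarrow> f (z + s *\<^sub>R \<nu>) = f z + s"
        and zero: "\<And>q. q \<in> frontier U \<inter> N \<Longrightarrow> f q = 0"
        using lipschitz_boundary_chart[OF lip U] by blast
      have "open (N \<inter> interior (closure U))" using N by (simp add: open_Int)
      then obtain e where e: "e > 0" "ball p e \<subseteq> N \<inter> interior (closure U)"
        using N p open_contains_ball by (metis IntI)
      define q where "q = p + (e / 2) *\<^sub>R \<nu>"
      have "q \<in> ball p e" using e \<nu> by (simp add: q_def dist_norm)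
      then have q: "q \<in> N" "q \<in> closure U" using e interior_subset by blast+
      have "f q > 0" using shift[OF N(2), of "e / 2"] q(1) zero[of p] \<open>p \<in> frontier U\<close> N(2) e by (simp add: q_def)
      moreover have "q \<in> frontier U \<or> q \<in> U" using q(2) U by (auto simp: frontier_def interior_open)
      moreover have "q \<in> U \<Longrightarrow> f q < 0" using UN q(1) by blast
      ultimately show False using zero[of q] q(1) by force
    qed
  qed
qed

text \<open>Tonelli's theorem, applied to the translates of G by s times \<nu> with s
  between 0 and 1: all translates have the same measure, while for fixed x at most one s
  contributes.\<close>

lemma null_set_if_thin_along_direction:
  fixes G :: "'a::euclidean_space set"
  assumes G: "G \<in> sets borel" and thin: "\<And>x s t. x + s *\<^sub>R \<nu> \<in> G \<Longrightarrow> x + t *\<^sub>R \<nu> \<in> G \<Longrightarrow> s = t"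
  shows "G \<in> null_sets lborel"
proof -
  note G[measurable]
  define k where "k = (\<lambda>(s::real, x). indicator G (x + s *\<^sub>R \<nu>) * indicator {0..1} s :: ennreal)"
  have [measurable]: "k \<in> borel_measurable (lborel \<Otimes>\<^sub>M lborel)" unfolding k_def by measurable
  have "(\<integral>\<^sup>+s. \<integral>\<^sup>+x. k (s, x) \<partial>lborel \<partial>lborel) = (\<integral>\<^sup>+s. emeasure lborel G * indicator {0..1::real} s \<partial>lborel)"
  proof (rule nn_integral_cong)
    fix s :: real
    have "(\<integral>\<^sup>+x. k (s, x) \<partial>lborel) = (\<integral>\<^sup>+x. indicator G (s *\<^sub>R \<nu> + x) \<partial>lborel) * indicator {0..1} s"
      unfolding k_def by (simp add: nn_integral_multc add.commute)
    also have "(\<integral>\<^sup>+x. indicator G (s *\<^sub>R \<nu> + x) \<partial>lborel) = emeasure lborel G"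
      using nn_integral_lborel_translate[of "indicator G" "s *\<^sub>R \<nu>"] by simp
    finally show "(\<integral>\<^sup>+x. k (s, x) \<partial>lborel) = emeasure lborel G * indicator {0..1} s" .
  qed
  also have "\<dots> = emeasure lborel G" by (simp add: nn_integral_cmult)
  finally have "emeasure lborel G = (\<integral>\<^sup>+s. \<integral>\<^sup>+x. k (s, x) \<partial>lborel \<partial>lborel)" by simp
  also have "\<dots> = (\<integral>\<^sup>+x. \<integral>\<^sup>+s. k (s, x) \<partial>lborel \<partial>lborel)"
    using lborel_pair.Fubini'[of "\<lambda>s x. k (s, x)"] by simp
  also have "\<dots> = (\<integral>\<^sup>+x. 0 \<partial>(lborel :: 'a measure))"
  proof (rule nn_integral_cong)
    fix x :: 'a
    have "AE s in lborel. k (s, x) = 0"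
    proof (cases "\<exists>s. x + s *\<^sub>R \<nu> \<in> G")
      case True
      then obtain s where s: "x + s *\<^sub>R \<nu> \<in> G" by blast
      show ?thesis using AE_lborel_singleton[of s] by eventually_elim (use thin[OF s] in \<open>auto simp: k_def indicator_def\<close>)
    qed (auto simp: k_def)
    then show "(\<integral>\<^sup>+s. k (s, x) \<partial>lborel) = 0" by (subst nn_integral_0_iff_AE) auto
  qed
  finally show ?thesis using G by (simp add: null_sets_def)
qed

text \<open>In a chart the height vanishes on the frontier and is strictly increasing along
  the direction \<nu>, so every line in this direction meets the frontier at most once.
  Countably many charts cover the frontier by Lindelof's theorem.\<close>

lemma lipschitz_boundary_null_sets:
  fixes U :: "'a::euclidean_space set"
  assumes lip: "lipschitz_boundary U" and U: "open U"
  shows "frontier U \<in> null_sets lborel"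
proof -
  have "\<exists>N. open N \<and> p \<in> N \<and> frontier U \<inter> N \<in> null_sets lborel" if p: "p \<in> frontier U" for p
  proof -
    obtain \<nu> N and f :: "'a \<Rightarrow> real" where N: "open N" "p \<in> N"
      and shift: "\<And>z s. z \<in> N \<Longrightarrow> z + s *\<^sub>R \<nu> \<in> N \<Longrightarrow> f (z + s *\<^sub>R \<nu>) = f z + (s::real)"
      and zero: "\<And>q. q \<in> frontier U \<inter> N \<Longrightarrow> f q = 0"
      by (rule lipschitz_boundary_chart[OF lip U p]) blast
    have "frontier U \<inter> N \<in> null_sets lborel"
    proof (rule null_set_if_thin_along_direction)
      show "frontier U \<inter> N \<in> sets borel" using N by (intro sets.Int borel_closed borel_open frontier_closed)
      fix x s t assume "x + s *\<^sub>R \<nu> \<in> frontier U \<inter> N" "x + t *\<^sub>R \<nu> \<in> frontier U \<inter> N"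
      then show "s = t"
        using shift[of "x + s *\<^sub>R \<nu>" "t - s"] zero[of "x + s *\<^sub>R \<nu>"] zero[of "x + t *\<^sub>R \<nu>"]
        by (simp add: algebra_simps)
    qed
    then show ?thesis using N by blast
  qed
  then obtain N where "\<forall>p\<in>frontier U. open (N p) \<and> p \<in> N p \<and> frontier U \<inter> N p \<in> null_sets lborel"
    using bchoice[of "frontier U" "\<lambda>p N. open N \<and> p \<in> N \<and> frontier U \<inter> N \<in> null_sets lborel"] by blast
  then have N: "\<And>p. p \<in> frontier U \<Longrightarrow> open (N p)" "\<And>p. p \<in> frontier U \<Longrightarrow> p \<in> N p"
    "\<And>p. p \<in> frontier U \<Longrightarrow> frontier U \<inter> N p \<in> null_sets lborel" by simp_all
  obtain F where F: "F \<subseteq> N ` frontier U" "countable F" "\<Union>F = \<Union>(N ` frontier U)"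
    using Lindelof[of "N ` frontier U"] N(1) by blast
  have "(\<Union>V\<in>F. frontier U \<inter> V) \<in> null_sets lborel"
    using F(1,2) N(3) by (intro null_sets_UN') auto
  moreover have "(\<Union>V\<in>F. frontier U \<inter> V) = frontier U" using F(3) N(2) by blast
  ultimately show ?thesis by simp
qed

section \<open>Integration by parts on the perforated cell\<close>

lemma continuous_on_line:
  fixes f :: "'a::real_normed_vector \<Rightarrow> 'b::topological_space"
  shows "continuous_on UNIV f \<Longrightarrow> continuous_on S (\<lambda>s. f (x + s *\<^sub>R i))"
  by (rule continuous_on_compose2[of UNIV f]) (auto intro!: continuous_intros)

text \<open>The fundamental theorem of calculus on the line through x in the direction i. By
  the assumption on the support of \<theta>, a point of the support in the closed unit cell
  has a neighbourhood in which Z fills the cell. So the extension of s \<theta> by zero from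
  the closure of Z is differentiable on the open segment and continuous up to its two end
  points on the faces.\<close>

lemma integral_cell_line:
  fixes s \<theta> :: "'a::euclidean_space \<Rightarrow> real" and Z :: "'a set"
  defines "Y \<equiv> box 0 One"
  assumes Z: "open Z" "Z \<subseteq> Y" and s: "smooth_fun s" and \<theta>: "smooth_fun \<theta>" and i: "i \<in> Basis"
    and near: "\<And>p. p \<in> closure Y \<Longrightarrow> p \<in> closure {y. \<theta> y \<noteq> 0} \<Longrightarrow> \<exists>\<delta>>0. ball p \<delta> \<inter> Y \<subseteq> Z"
    and x: "x \<in> Y"
  defines "D \<equiv> \<lambda>y. s y * frechet_derivative \<theta> (at y) i + frechet_derivative s (at y) i * \<theta> y"
  defines "e \<equiv> \<lambda>y. indicator (closure Z) y * (s y * \<theta> y)"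
  shows "(LINT r|lborel. indicator Z (x + r *\<^sub>R i) * D (x + r *\<^sub>R i))
    = e (x + (1 - x \<bullet> i) *\<^sub>R i) - e (x + (0 - x \<bullet> i) *\<^sub>R i)"
proof -
  define q where "q = x - (x \<bullet> i) *\<^sub>R i"
  define K where "K = closure {y. \<theta> y \<noteq> 0}"
  define F where "F y = indicator Z y * D y" for y
  have contD: "continuous_on UNIV D"
    unfolding D_def by (intro continuous_intros smooth_fun_continuous smooth_fun_partial_continuous s \<theta> i)
  have K0: "\<theta> y = 0" if "y \<notin> K" for y using that closure_subset[of "{y. \<theta> y \<noteq> 0}"] by (auto simp: K_def)
  have KD: "D y = 0" if "y \<notin> K" for y
  proof -
    have "frechet_derivative \<theta> (at y) i = 0"
    proof (rule frechet_derivative_zero_on_open)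
      show "open (- K)" by (simp add: K_def open_Compl)
      show "y \<in> - K" using that by simp
    qed (simp add: K0)
    then show ?thesis using K0[OF that] by (simp add: D_def)
  qed
  have qc: "q \<bullet> j = (if j = i then 0 else x \<bullet> j)" if "j \<in> Basis" for j
    using that i by (auto simp: q_def inner_diff_left inner_Basis)
  have qr: "(q + r *\<^sub>R i) \<bullet> j = (if j = i then r else x \<bullet> j)" if "j \<in> Basis" for j r
    using that i qc by (auto simp: inner_add_left inner_Basis)
  have inY: "q + r *\<^sub>R i \<in> Y \<longleftrightarrow> 0 < r \<and> r < 1" for r
    using x i qr by (auto simp: Y_def mem_box)
  have Yne: "Y \<noteq> {}" using x by auto
  have clY: "closure Y = cbox 0 One" unfolding Y_def by (rule closure_box) (use Yne in \<open>simp add: Y_def\<close>)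
  have inclY: "q + r *\<^sub>R i \<in> closure Y" if "0 \<le> r" "r \<le> 1" for r
    using x i qr that by (auto simp: clY mem_box Y_def less_imp_le)
  have out: "F (q + r *\<^sub>R i) = 0" if "\<not> (0 < r \<and> r < 1)" for r
    using inY[of r] that Z(2) by (auto simp: F_def indicator_def)
  \<comment> \<open>Off the support of \<theta> the extension vanishes near r; on the
    support the line stays in the closure of Z near r.\<close>
  have loc0: "\<exists>d>0. \<forall>r'. dist r' r < d \<longrightarrow> q + r' *\<^sub>R i \<notin> K" if "q + r *\<^sub>R i \<notin> K" for r
  proof -
    have "open (- K)" by (simp add: K_def open_Compl)
    then obtain d where d: "d > 0" "ball (q + r *\<^sub>R i) d \<subseteq> - K" using \<open>q + r *\<^sub>R i \<notin> K\<close> open_contains_ball by (metis ComplI)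
    have "q + r' *\<^sub>R i \<in> ball (q + r *\<^sub>R i) d" if "dist r' r < d" for r'
      using that i by (simp add: dist_norm scaleR_diff_left[symmetric] norm_Basis abs_minus_commute)
    then show ?thesis using d by blast
  qed
  have loc1: "\<exists>d>0. \<forall>r'. dist r' r < d \<longrightarrow> 0 \<le> r' \<longrightarrow> r' \<le> 1 \<longrightarrow> q + r' *\<^sub>R i \<in> closure Z"
    if K: "q + r *\<^sub>R i \<in> K" and r: "0 \<le> r" "r \<le> 1" for r
  proof -
    obtain d where d: "d > 0" "ball (q + r *\<^sub>R i) d \<inter> Y \<subseteq> Z" using near[OF inclY[OF r]] K by (auto simp: K_def)
    have "ball (q + r *\<^sub>R i) d \<inter> closure Y \<subseteq> closure (ball (q + r *\<^sub>R i) d \<inter> Y)"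
      by (rule open_Int_closure_subset) simp
    then have sub: "ball (q + r *\<^sub>R i) d \<inter> closure Y \<subseteq> closure Z" using closure_mono[OF d(2)] by blast
    have "q + r' *\<^sub>R i \<in> ball (q + r *\<^sub>R i) d" if "dist r' r < d" for r'
      using that i by (simp add: dist_norm scaleR_diff_left[symmetric] norm_Basis abs_minus_commute)
    then show ?thesis using d(1) sub inclY by blast
  qed
  have cont_line: "continuous_on S (\<lambda>r. s (q + r *\<^sub>R i) * \<theta> (q + r *\<^sub>R i))" for S
    by (intro continuous_intros continuous_on_line smooth_fun_continuous s \<theta>)
  have "((\<lambda>r. F (q + r *\<^sub>R i)) has_integral e (q + 1 *\<^sub>R i) - e (q + 0 *\<^sub>R i)) {0..1}"
  proof (rule fundamental_theorem_of_calculus_interior)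
    show "continuous_on {0..1} (\<lambda>r. e (q + r *\<^sub>R i))"
      unfolding continuous_on_eq_continuous_within
    proof
      fix r :: real assume r: "r \<in> {0..1}"
      show "continuous (at r within {0..1}) (\<lambda>r. e (q + r *\<^sub>R i))"
      proof (cases "q + r *\<^sub>R i \<in> K")
        case True
        obtain d where d: "d > 0" "\<And>r'. dist r' r < d \<Longrightarrow> 0 \<le> r' \<Longrightarrow> r' \<le> 1 \<Longrightarrow> q + r' *\<^sub>R i \<in> closure Z"
          using loc1[OF True] r by auto
        show ?thesis
        proof (rule continuous_transform_within[where f="\<lambda>r. s (q + r *\<^sub>R i) * \<theta> (q + r *\<^sub>R i)"])
          show "continuous (at r within {0..1}) (\<lambda>r. s (q + r *\<^sub>R i) * \<theta> (q + r *\<^sub>R i))"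
            using cont_line[of "{0..1}"] r by (simp add: continuous_on_eq_continuous_within)
          show "s (q + r' *\<^sub>R i) * \<theta> (q + r' *\<^sub>R i) = e (q + r' *\<^sub>R i)" if "r' \<in> {0..1}" "dist r' r < d" for r'
            using d(2)[OF that(2)] that(1) by (simp add: e_def)
        qed (use d r in auto)
      next
        case False
        obtain d where d: "d > 0" "\<And>r'. dist r' r < d \<Longrightarrow> q + r' *\<^sub>R i \<notin> K" using loc0[OF False] by auto
        show ?thesis
          by (rule continuous_transform_within[OF continuous_const[of _ 0] d(1) r]) (use d(2) K0 in \<open>auto simp: e_def\<close>)
      qed
    qed
    fix r :: real assume r: "r \<in> {0<..<1}"
    show "((\<lambda>r. e (q + r *\<^sub>R i)) has_vector_derivative F (q + r *\<^sub>R i)) (at r)"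
    proof (cases "q + r *\<^sub>R i \<in> K")
      case True
      have "q + r *\<^sub>R i \<in> Y" using inY r by simp
      moreover have "q + r *\<^sub>R i \<in> closure Y" using inclY[of r] r by simp
      from near[OF this True[unfolded K_def]] obtain \<delta> where "\<delta> > 0" "ball (q + r *\<^sub>R i) \<delta> \<inter> Y \<subseteq> Z" by blast
      ultimately have zZ: "q + r *\<^sub>R i \<in> Z" by auto
      obtain d where d: "d > 0" "ball (q + r *\<^sub>R i) d \<subseteq> Z" using Z(1) zZ open_contains_ball by blast
      have "((\<lambda>r. s (q + r *\<^sub>R i) * \<theta> (q + r *\<^sub>R i)) has_real_derivative
          frechet_derivative (\<lambda>y. s y * \<theta> y) (at (q + r *\<^sub>R i)) i) (at r)"
        by (rule has_derivative_line[where f="\<lambda>y. s y * \<theta> y"]) (rule smooth_fun_has_derivative[OF smooth_fun_mult[OF s \<theta>]])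
      then have "((\<lambda>r. s (q + r *\<^sub>R i) * \<theta> (q + r *\<^sub>R i)) has_vector_derivative F (q + r *\<^sub>R i)) (at r)"
        using zZ by (simp add: frechet_derivative_mult[OF s \<theta>] F_def D_def has_real_derivative_iff_has_vector_derivative)
      then show ?thesis
      proof (rule has_vector_derivative_transform_within[OF _ d(1)])
        fix r' assume "dist r' r < d"
        then have "q + r' *\<^sub>R i \<in> ball (q + r *\<^sub>R i) d"
          using i by (simp add: dist_norm scaleR_diff_left[symmetric] norm_Basis abs_minus_commute)
        then have "q + r' *\<^sub>R i \<in> closure Z" using d(2) closure_subset by blast
        then show "s (q + r' *\<^sub>R i) * \<theta> (q + r' *\<^sub>R i) = e (q + r' *\<^sub>R i)" by (simp add: e_def)
      qed simp
    next
      case False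
      obtain d where d: "d > 0" "\<And>r'. dist r' r < d \<Longrightarrow> q + r' *\<^sub>R i \<notin> K" using loc0[OF False] by auto
      have "((\<lambda>r. 0) has_vector_derivative F (q + r *\<^sub>R i)) (at r)" using KD[OF False] by (simp add: F_def)
      then show ?thesis
        by (rule has_vector_derivative_transform_within[OF _ d(1)]) (use d(2) K0 in \<open>auto simp: e_def\<close>)
    qed
  qed simp
  then have hi: "((\<lambda>r. F (q + r *\<^sub>R i)) has_integral e (q + i) - e q) UNIV"
    using out by (subst (asm) has_integral_restrict_UNIV[symmetric]) (auto simp: if_distrib cong: if_cong elim!: has_integral_eq[rotated])
  have Zm: "Z \<in> sets borel" using Z(1) by simp
  have Fm: "(\<lambda>r. F (q + r *\<^sub>R i)) \<in> borel_measurable borel"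
    using borel_measurable_continuous_onI[OF contD] Zm unfolding F_def by measurable
  have "integrable lborel (\<lambda>r. F (q + r *\<^sub>R i))"
  proof (rule Bochner_Integration.integrable_bound)
    show "integrable lborel (\<lambda>r. indicator {0..1} r *\<^sub>R D (q + r *\<^sub>R i))"
      by (rule borel_integrable_compact) (auto intro: continuous_on_line contD)
    show "AE r in lborel. norm (F (q + r *\<^sub>R i)) \<le> norm (indicator {0..1} r *\<^sub>R D (q + r *\<^sub>R i))"
      using out by (auto simp: F_def indicator_def)
  qed (use Fm in simp)
  from has_integral_unique[OF has_integral_integral_lborel[OF this] hi]
  have "(LINT r|lborel. F (q + r *\<^sub>R i)) = e (q + i) - e q" .
  moreover have "(LINT r|lborel. F (q + (x \<bullet> i + r) *\<^sub>R i)) = (LINT r|lborel. F (q + r *\<^sub>R i))"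
    by (rule integral_lborel_translate[OF Fm])
  ultimately show ?thesis by (simp add: F_def q_def algebra_simps)
qed

text \<open>Integrating over all lines in the direction i leaves only boundary terms on the
  two faces orthogonal to i. A face is parametrised by the whole cell through the projection
  x + (c - x \<bullet> i) i, with c = 0 and c = 1.\<close>

lemma integral_cell_partial_derivative_le:
  fixes s \<theta> :: "'a::euclidean_space \<Rightarrow> real" and Z :: "'a set"
  defines "Y \<equiv> box 0 One"
  assumes Z: "open Z" "Z \<subseteq> Y" and s: "smooth_fun s" and \<theta>: "smooth_fun \<theta>" and i: "i \<in> Basis"
    and near: "\<And>p. p \<in> closure Y \<Longrightarrow> p \<in> closure {y. \<theta> y \<noteq> 0} \<Longrightarrow> \<exists>\<delta>>0. ball p \<delta> \<inter> Y \<subseteq> Z"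
  defines "D \<equiv> \<lambda>y. s y * frechet_derivative \<theta> (at y) i + frechet_derivative s (at y) i * \<theta> y"
  defines "e \<equiv> \<lambda>c x. indicator Y x * (indicator (closure Z) (x + (c - x \<bullet> i) *\<^sub>R i) * (s (x + (c - x \<bullet> i) *\<^sub>R i) * \<theta> (x + (c - x \<bullet> i) *\<^sub>R i)))"
  shows "\<bar>LINT y|lebesgue_on Z. D y\<bar> \<le> (LINT x|lborel. \<bar>e 1 x\<bar>) + (LINT x|lborel. \<bar>e 0 x\<bar>)"
    and "c \<in> {0..1} \<Longrightarrow> e c \<in> L2 lborel"
proof -
  define W where "W = {x :: 'a. 0 < x \<bullet> i \<and> x \<bullet> i < 1}"
  have Zm[measurable]: "Z \<in> sets borel" and Ym[measurable]: "Y \<in> sets borel" and cZ[measurable]: "closure Z \<in> sets borel"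
    using Z(1) by (auto simp: Y_def)
  have contD: "continuous_on UNIV D"
    unfolding D_def by (intro continuous_intros smooth_fun_continuous smooth_fun_partial_continuous s \<theta> i)
  have Dm[measurable]: "D \<in> borel_measurable borel" by (rule borel_measurable_continuous_onI[OF contD])
  have sm[measurable]: "s \<in> borel_measurable borel" "\<theta> \<in> borel_measurable borel"
    by (auto intro!: borel_measurable_continuous_onI smooth_fun_continuous s \<theta>)
  define F where "F y = indicator Z y * D y" for y
  have Fm: "F \<in> borel_measurable borel" unfolding F_def by measurable
  have bY: "bounded Y" by (simp add: Y_def)
  have Yfin: "emeasure lborel Y < \<infinity>" unfolding Y_def by (rule emeasure_lborel_box_finite)
  have em[measurable]: "e c \<in> borel_measurable borel" for c unfolding e_def by measurable
  obtain C where C: "\<And>x. x \<in> cbox 0 One \<Longrightarrow> \<bar>s x * \<theta> x\<bar> \<le> C"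
  proof -
    have "bounded ((\<lambda>x. s x * \<theta> x) ` cbox 0 One)"
      by (intro compact_imp_bounded compact_continuous_image continuous_intros compact_cbox
          continuous_on_subset[OF smooth_fun_continuous[OF s]] continuous_on_subset[OF smooth_fun_continuous[OF \<theta>]]) auto
    then show ?thesis using that unfolding bounded_real by blast
  qed
  have e_le: "\<bar>e c x\<bar> \<le> \<bar>C\<bar> * indicator Y x" if c: "c \<in> {0..1}" for c x
  proof (cases "x \<in> Y")
    case True
    have "(x + (c - x \<bullet> i) *\<^sub>R i) \<bullet> j = (if j = i then c else x \<bullet> j)" if "j \<in> Basis" for j
      using that i by (auto simp: inner_add_left inner_Basis)
    then have "x + (c - x \<bullet> i) *\<^sub>R i \<in> cbox 0 One" using True c i by (auto simp: Y_def mem_box less_imp_le)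
    from C[OF this] show ?thesis using True by (auto simp: e_def indicator_def)
  qed (simp add: e_def)
  have e_int: "integrable lborel (\<lambda>x. \<bar>e c x\<bar>)" if "c \<in> {0..1}" for c
    by (rule Bochner_Integration.integrable_bound[where f="\<lambda>x. \<bar>C\<bar> * indicator Y x"])
       (use e_le[OF that] Yfin in \<open>auto simp: Y_def\<close>)
  show "e c \<in> L2 lborel" if "c \<in> {0..1}"
  proof -
    have "integrable lborel (\<lambda>x. (e c x)\<^sup>2)"
    proof (rule Bochner_Integration.integrable_bound[where f="\<lambda>x. C\<^sup>2 * indicator Y x"])
      show "AE x in lborel. norm ((e c x)\<^sup>2) \<le> norm (C\<^sup>2 * indicator Y x :: real)"
      proof (rule AE_I2)
        fix x
        have "\<bar>e c x\<bar>\<^sup>2 \<le> (\<bar>C\<bar> * indicator Y x)\<^sup>2" by (rule power_mono[OF e_le[OF that]]) simp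
        then show "norm ((e c x)\<^sup>2) \<le> norm (C\<^sup>2 * indicator Y x :: real)"
          by (cases "x \<in> Y") (simp_all add: e_def)
      qed
    qed (use Yfin in \<open>auto simp: Y_def\<close>)
    then show ?thesis by (simp add: L2_def)
  qed
  have Fint: "integrable lborel F"
  proof (rule Bochner_Integration.integrable_bound)
    show "integrable lborel (\<lambda>x. indicator (cbox 0 One) x *\<^sub>R D x)"
      by (rule borel_integrable_compact) (auto intro: continuous_on_subset[OF contD])
    show "AE x in lborel. norm (F x) \<le> norm (indicator (cbox 0 One) x *\<^sub>R D x)"
      using Z(2) box_subset_cbox[of 0 "One :: 'a"] by (auto simp: F_def Y_def indicator_def)
  qed (use Fm in simp)
  \<comment> \<open>For x in the slab but outside the cell the whole line misses the cell.\<close>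
  have line: "indicator W x * (LINT r|lborel. F (x + r *\<^sub>R i)) = e 1 x - e 0 x" for x
  proof (cases "x \<in> Y")
    case True
    then have "x \<in> W" using i by (auto simp: W_def Y_def mem_box)
    moreover have "(LINT r|lborel. F (x + r *\<^sub>R i)) = e 1 x - e 0 x"
      unfolding F_def D_def e_def
      using integral_cell_line[OF Z(1) Z(2)[unfolded Y_def] s \<theta> i near[unfolded Y_def], of x] True
      by (simp add: Y_def)
    ultimately show ?thesis by simp
  next
    case False
    have "F (x + r *\<^sub>R i) = 0" if "x \<in> W" for r
    proof -
      obtain j where j: "j \<in> Basis" "\<not> (0 < x \<bullet> j \<and> x \<bullet> j < 1)" using False by (auto simp: Y_def mem_box)
      then have "j \<noteq> i" using that by (auto simp: W_def)
      then have "(x + r *\<^sub>R i) \<bullet> j = x \<bullet> j" using i j(1) by (simp add: inner_add_left inner_Basis)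
      then have "x + r *\<^sub>R i \<notin> Y" using j by (auto simp: Y_def mem_box intro!: bexI[of _ j])
      then have "x + r *\<^sub>R i \<notin> Z" using Z(2) by blast
      then show ?thesis by (simp add: F_def)
    qed
    then show ?thesis using False by (cases "x \<in> W") (auto simp: e_def)
  qed
  have "(LINT y|lebesgue_on Z. D y) = (LINT y|lborel. F y)"
    using integral_lebesgue_on_cong_AE(2)[OF Zm Dm, of D] by (simp add: F_def)
  also have "\<dots> = (LINT x|lborel. e 1 x - e 0 x)"
    using integral_lborel_line(2)[OF Fint Fm i] line by (simp add: W_def)
  also have "\<bar>\<dots>\<bar> \<le> (LINT x|lborel. \<bar>e 1 x - e 0 x\<bar>)" by (rule integral_abs_bound)
  also have "\<dots> \<le> (LINT x|lborel. \<bar>e 1 x\<bar> + \<bar>e 0 x\<bar>)"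
  proof (rule integral_mono)
    show "integrable lborel (\<lambda>x. \<bar>e 1 x - e 0 x\<bar>)"
      using e_int[of 1] e_int[of 0] by (auto intro!: integrable_abs Bochner_Integration.integrable_diff simp: integrable_abs_iff)
  qed (use e_int[of 1] e_int[of 0] in auto)
  also have "\<dots> = (LINT x|lborel. \<bar>e 1 x\<bar>) + (LINT x|lborel. \<bar>e 0 x\<bar>)"
    using e_int[of 1] e_int[of 0] by (intro Bochner_Integration.integral_add) auto
  finally show "\<bar>LINT y|lebesgue_on Z. D y\<bar> \<le> (LINT x|lborel. \<bar>e 1 x\<bar>) + (LINT x|lborel. \<bar>e 0 x\<bar>)" .
qed

text \<open>Since the cell has volume one, Cauchy-Schwarz bounds the mean of the face term
  by its mean square. The points of the face where the term is nonzero lie both in the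
  frontier of the cell and in the frontier of Z, where the surface measure dominates.\<close>

lemma face_term_le_surface_integral:
  fixes s \<theta> :: "'a::euclidean_space \<Rightarrow> real" and Z :: "'a set"
  defines "Y \<equiv> box 0 One"
  assumes Z: "open Z" "Z \<subseteq> Y" and s: "smooth_fun s" and C: "\<And>y. \<bar>\<theta> y\<bar> \<le> C" and i: "i \<in> Basis" and c: "c = 0 \<or> c = 1"
  defines "e \<equiv> \<lambda>x. indicator Y x * (indicator (closure Z) (x + (c - x \<bullet> i) *\<^sub>R i) * (s (x + (c - x \<bullet> i) *\<^sub>R i) * \<theta> (x + (c - x \<bullet> i) *\<^sub>R i)))"
  assumes e: "e \<in> L2 lborel"
  shows "ennreal (unit_ball_vol (real (DIM('a) - 1)) / 4 ^ (DIM('a) - 1) * (LINT x|lborel. \<bar>e x\<bar>)\<^sup>2)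
    \<le> ennreal (C\<^sup>2) * (\<integral>\<^sup>+y. ennreal ((s y)\<^sup>2) * indicator (frontier Y \<inter> frontier Z) y \<partial>surface_measure)"
proof -
  define K where "K = unit_ball_vol (real (DIM('a) - 1)) / 4 ^ (DIM('a) - 1)"
  have K: "0 \<le> K" unfolding K_def by (intro divide_nonneg_nonneg unit_ball_vol_nonneg) auto
  have Ym[measurable]: "Y \<in> sets borel" by (simp add: Y_def)
  have sm[measurable]: "s \<in> borel_measurable borel"
    by (auto intro!: borel_measurable_continuous_onI smooth_fun_continuous s)
  define q where "q x = x + (c - x \<bullet> i) *\<^sub>R i" for x
  define f where "f y = ennreal ((s y)\<^sup>2) * indicator (frontier Y \<inter> frontier Z) y" for y
  have [measurable]: "frontier Y \<inter> frontier Z \<in> sets borel" by auto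
  have fm: "f \<in> borel_measurable borel" unfolding f_def by measurable
  have bound: "ennreal ((e x)\<^sup>2) \<le> ennreal (C\<^sup>2) * (f (q x) * indicator Y x)" for x
  proof (cases "x \<in> Y \<and> q x \<in> closure Z")
    case True
    have qj: "q x \<bullet> j = (if j = i then c else x \<bullet> j)" if "j \<in> Basis" for j
      using that i by (auto simp: q_def inner_add_left inner_Basis)
    have "q x \<notin> Y" using qj[OF i] c i by (auto simp: Y_def mem_box intro!: bexI[of _ i])
    moreover have "q x \<in> cbox 0 One" using True c i qj by (auto simp: Y_def mem_box less_imp_le)
    moreover have "Y \<noteq> {}" using True by auto
    ultimately have "q x \<in> frontier Y" by (simp add: Y_def frontier_box)
    moreover have "q x \<in> frontier Z" using True \<open>q x \<notin> Y\<close> Z by (auto simp: frontier_def interior_open)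
    ultimately have fq: "f (q x) = ennreal ((s (q x))\<^sup>2)" by (simp add: f_def)
    have "(\<theta> (q x))\<^sup>2 \<le> C\<^sup>2" using power_mono[OF C[of "q x"] abs_ge_zero, of 2] by simp
    then have "(e x)\<^sup>2 \<le> C\<^sup>2 * (s (q x))\<^sup>2"
      using True mult_left_mono[of "(\<theta> (q x))\<^sup>2" "C\<^sup>2" "(s (q x))\<^sup>2"] by (simp add: e_def q_def power_mult_distrib mult.commute)
    then show ?thesis using True by (simp add: fq ennreal_mult[symmetric] ennreal_leI)
  qed (auto simp: e_def q_def[symmetric])
  have "(LINT x|lborel. \<bar>e x\<bar>)\<^sup>2 \<le> (LINT x|lborel. (e x)\<^sup>2)"
  proof -
    have 1: "(\<lambda>x. \<bar>e x\<bar>) \<in> L2 lborel" using e by (auto simp: L2_def)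
    have sqi: "(indicator Y x)\<^sup>2 = (indicator Y x :: real)" for x by (simp add: indicator_def)
    have "integrable lborel (indicator Y :: 'a \<Rightarrow> real)" using emeasure_lborel_box_finite[of 0 "One :: 'a"] by (simp add: Y_def)
    then have 2: "(\<lambda>x. indicator Y x) \<in> L2 lborel" by (simp add: L2_def sqi)
    have "(\<lambda>x. \<bar>e x\<bar> * indicator Y x) = (\<lambda>x. \<bar>e x\<bar>)" by (auto simp: e_def indicator_def fun_eq_iff)
    moreover have "(LINT x|lborel. (indicator Y x)\<^sup>2 :: real) = 1"
      unfolding sqi using measure_lborel_box_eq[of 0 "One :: 'a"] by (simp add: Y_def)
    ultimately show ?thesis using L2_cauchy_schwarz[OF 1 2] by simp
  qed
  then have "ennreal (K * (LINT x|lborel. \<bar>e x\<bar>)\<^sup>2) \<le> ennreal (K * (LINT x|lborel. (e x)\<^sup>2))"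
    using K by (intro ennreal_leI mult_left_mono)
  also have "\<dots> = ennreal K * (\<integral>\<^sup>+x. ennreal ((e x)\<^sup>2) \<partial>lborel)"
    using K by (simp add: nn_integral_square_eq[OF e] ennreal_mult)
  also have "\<dots> \<le> ennreal K * (\<integral>\<^sup>+x. ennreal (C\<^sup>2) * (f (q x) * indicator Y x) \<partial>lborel)"
    by (intro mult_left_mono nn_integral_mono bound) simp
  also have "\<dots> = ennreal (C\<^sup>2) * (ennreal K * (\<integral>\<^sup>+x. f (q x) * indicator Y x \<partial>lborel))"
    using fm by (subst nn_integral_cmult) (auto simp: q_def ac_simps)
  also have "\<dots> \<le> ennreal (C\<^sup>2) * (\<integral>\<^sup>+y. f y \<partial>surface_measure)"
    unfolding K_def q_def
    by (intro mult_left_mono nn_integral_prism_le_surface_measure i Ym fm) (auto simp: Y_def mem_box i less_imp_le)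
  finally show ?thesis by (simp add: K_def f_def)
qed

text \<open>For the smooth functions s k that define the trace g of u, the boundary terms
  are controlled by the surface integral of (s k)^2 over the common part of the two
  frontiers. There g vanishes, so this integral is at most that of (s k - g)^2 and tends to
  zero.\<close>

theorem cell_integration_by_parts:
  fixes u \<theta> :: "'a::euclidean_space \<Rightarrow> real" and Z :: "'a set"
  assumes Z: "open Z" "Z \<subseteq> box 0 One" and u: "u \<in> H1_vanishing_on Z (frontier (box 0 One) \<inter> frontier Z)"
    and \<theta>: "smooth_fun \<theta>" and i: "i \<in> Basis" and C: "\<And>y. \<bar>\<theta> y\<bar> \<le> C"
    and near: "\<And>p. p \<in> closure (box 0 One) \<Longrightarrow> p \<in> closure {y. \<theta> y \<noteq> 0} \<Longrightarrow> \<exists>\<delta>>0. ball p \<delta> \<inter> box 0 One \<subseteq> Z"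
  shows "(LINT y|lebesgue_on Z. u y * frechet_derivative \<theta> (at y) i) = - (LINT y|lebesgue_on Z. (weak_gradient Z u y \<bullet> i) * \<theta> y)"
proof -
  let ?Y = "box 0 One :: 'a set"
  let ?S = "frontier ?Y \<inter> frontier Z"
  have bZ: "bounded Z" by (rule bounded_subset[OF bounded_box Z(2)])
  note UZ = Z(1) bZ
  obtain g s where u1: "u \<in> H1 Z" and gm: "g \<in> borel_measurable borel"
    and g0: "AE x in surface_measure. x \<in> ?S \<longrightarrow> g x = 0" and s: "\<And>k. smooth_fun (s k)"
    and lim1: "(\<lambda>k. H1_norm Z (s k - u)) \<longlonglongrightarrow> 0"
    and lim2: "(\<lambda>k. \<integral>\<^sup>+x\<in>frontier Z. ennreal ((s k x - g x)\<^sup>2) \<partial>surface_measure) \<longlonglongrightarrow> 0"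
    using u unfolding H1_vanishing_on_def has_trace_def by blast
  note gu = H1_weak_gradient[OF u1] and gs = smooth_fun_weak_gradient[OF UZ s]
  let ?gu = "weak_gradient Z u" and ?gs = "\<lambda>k x. \<Sum>j\<in>Basis. frechet_derivative (s k) (at x) j *\<^sub>R j"
  have coord: "?gs k x \<bullet> i = frechet_derivative (s k) (at x) i" for k x
    using i by (simp add: inner_sum_left inner_Basis if_distrib cong: if_cong)
  have s1: "s k \<in> H1 Z" for k by (rule smooth_fun_H1[OF UZ s])
  have L2s: "s k \<in> L2 (lebesgue_on Z)" and L2u: "u \<in> L2 (lebesgue_on Z)" for k
    using H1_imp_L2[OF s1] H1_imp_L2[OF u1] by (auto simp: L2_on_eq)
  have L2gs: "(\<lambda>x. frechet_derivative (s k) (at x) i) \<in> L2 (lebesgue_on Z)" for k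
    using is_weak_gradient_L2[OF gs i, of k] unfolding coord L2_on_eq .
  have L2gu: "(\<lambda>x. ?gu x \<bullet> i) \<in> L2 (lebesgue_on Z)"
    using is_weak_gradient_L2[OF gu i] unfolding L2_on_eq .
  have L2\<theta>: "\<theta> \<in> L2 (lebesgue_on Z)" and L2d\<theta>: "(\<lambda>y. frechet_derivative \<theta> (at y) i) \<in> L2 (lebesgue_on Z)"
    unfolding L2_on_eq[symmetric] by (intro L2_on_continuous[OF UZ] smooth_fun_continuous smooth_fun_partial_continuous \<theta> i)+
  have gd: "is_weak_gradient Z (\<lambda>x. s k x - u x) (\<lambda>x. ?gs k x - ?gu x)" for k
    by (intro is_weak_gradient_diff[OF UZ] H1_imp_L2 s1 u1 gs gu)
  have sq: "(H1_norm Z (s k - u))\<^sup>2 = (LINT x|lebesgue_on Z. (s k x - u x)\<^sup>2) + (\<Sum>j\<in>Basis. LINT x|lebesgue_on Z. ((?gs k x - ?gu x) \<bullet> j)\<^sup>2)" for k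
  proof -
    have "(H1_norm Z (s k - u))\<^sup>2 = scaled_H1_inner 1 Z (\<lambda>x. s k x - u x) (\<lambda>x. s k x - u x)"
      by (simp add: H1_norm_def scaled_H1_norm_square fun_diff_def)
    then show ?thesis
      unfolding scaled_H1_inner_eq[OF UZ gd gd] integrable_inner_weak_gradients(2)[OF gd gd] by (simp add: power2_eq_square)
  qed
  have sq0: "(\<lambda>k. (H1_norm Z (s k - u))\<^sup>2) \<longlonglongrightarrow> 0" using tendsto_power[OF lim1, of 2] by simp
  have nn: "0 \<le> (LINT x|lebesgue_on Z. (f x)\<^sup>2)" for f :: "'a \<Rightarrow> real" by (rule integral_nonneg_AE) simp
  have l1: "(\<lambda>k. LINT x|lebesgue_on Z. (s k x - u x)\<^sup>2) \<longlonglongrightarrow> 0"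
    by (rule tendsto_sandwich[OF _ _ tendsto_const sq0]) (auto simp: sq nn intro!: always_eventually sum_nonneg)
  have l2: "(\<lambda>k. LINT x|lebesgue_on Z. (frechet_derivative (s k) (at x) i - ?gu x \<bullet> i)\<^sup>2) \<longlonglongrightarrow> 0"
  proof (rule tendsto_sandwich[OF _ _ tendsto_const sq0])
    show "\<forall>\<^sub>F k in sequentially. (LINT x|lebesgue_on Z. (frechet_derivative (s k) (at x) i - ?gu x \<bullet> i)\<^sup>2) \<le> (H1_norm Z (s k - u))\<^sup>2"
    proof (rule always_eventually, rule allI)
      fix k
      have "(LINT x|lebesgue_on Z. ((?gs k x - ?gu x) \<bullet> i)\<^sup>2) \<le> (\<Sum>j\<in>Basis. LINT x|lebesgue_on Z. ((?gs k x - ?gu x) \<bullet> j)\<^sup>2)"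
        by (rule member_le_sum[OF i]) (auto simp: nn)
      then show "(LINT x|lebesgue_on Z. (frechet_derivative (s k) (at x) i - ?gu x \<bullet> i)\<^sup>2) \<le> (H1_norm Z (s k - u))\<^sup>2"
        unfolding sq inner_diff_left coord using nn[of "\<lambda>x. s k x - u x"] by linarith
    qed
  qed (auto simp: nn)
  define D where "D k y = s k y * frechet_derivative \<theta> (at y) i + frechet_derivative (s k) (at y) i * \<theta> y" for k y
  \<comment> \<open>D k is the derivative of the product of s k and \<theta> in the
    direction i; its integral is computed once in the limit and once by boundary terms.\<close>
  have Dlim: "(\<lambda>k. LINT y|lebesgue_on Z. D k y) \<longlonglongrightarrow>
     (LINT y|lebesgue_on Z. u y * frechet_derivative \<theta> (at y) i) + (LINT y|lebesgue_on Z. (?gu y \<bullet> i) * \<theta> y)"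
  proof -
    have "(LINT y|lebesgue_on Z. D k y) = (LINT y|lebesgue_on Z. s k y * frechet_derivative \<theta> (at y) i) + (LINT y|lebesgue_on Z. frechet_derivative (s k) (at y) i * \<theta> y)" for k
      unfolding D_def
      by (rule Bochner_Integration.integral_add[OF L2_mult_integrable[OF L2s[of k] L2d\<theta>] L2_mult_integrable[OF L2gs[of k] L2\<theta>]])
    then show ?thesis
      using tendsto_add[OF L2_tendsto_integral_mult[OF L2s L2u L2d\<theta> l1] L2_tendsto_integral_mult[OF L2gs L2gu L2\<theta> l2]] by simp
  qed
  define e where "e k c x = indicator ?Y x * (indicator (closure Z) (x + (c - x \<bullet> i) *\<^sub>R i) * (s k (x + (c - x \<bullet> i) *\<^sub>R i) * \<theta> (x + (c - x \<bullet> i) *\<^sub>R i)))" for k c x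
  define J where "J k = (\<integral>\<^sup>+y. ennreal ((s k y)\<^sup>2) * indicator ?S y \<partial>surface_measure)" for k
  have "J k \<le> (\<integral>\<^sup>+x\<in>frontier Z. ennreal ((s k x - g x)\<^sup>2) \<partial>surface_measure)" for k
    unfolding J_def by (rule nn_integral_mono_AE) (use g0 in \<open>auto elim!: eventually_mono simp: indicator_def\<close>)
  then have J0: "J \<longlonglongrightarrow> 0"
    by (intro tendsto_sandwich[OF _ _ tendsto_const lim2]) auto
  have face: "(\<lambda>k. LINT x|lborel. \<bar>e k c x\<bar>) \<longlonglongrightarrow> 0" if c: "c = 0 \<or> c = 1" for c
  proof -
    define K where "K = unit_ball_vol (real (DIM('a) - 1)) / 4 ^ (DIM('a) - 1)"
    have K: "K > 0" unfolding K_def by (intro divide_pos_pos unit_ball_vol_pos) auto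
    have L2e: "e k c \<in> L2 lborel" for k
      using integral_cell_partial_derivative_le(2)[OF Z s \<theta> i near, of c k] c unfolding e_def[abs_def] by auto
    have "ennreal (K * (LINT x|lborel. \<bar>e k c x\<bar>)\<^sup>2) \<le> ennreal (C\<^sup>2) * J k" for k
      using face_term_le_surface_integral[OF Z s C i c L2e[of k, unfolded e_def[abs_def]]]
      unfolding K_def J_def e_def by blast
    then have le: "\<forall>\<^sub>F k in sequentially. ennreal (K * (LINT x|lborel. \<bar>e k c x\<bar>)\<^sup>2) \<le> ennreal (C\<^sup>2) * J k"
      by (intro always_eventually) blast
    have up: "(\<lambda>k. ennreal (C\<^sup>2) * J k) \<longlonglongrightarrow> 0"
      using ennreal_tendsto_cmult[OF _ J0, of "ennreal (C\<^sup>2)"] by simp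
    have lo: "\<forall>\<^sub>F k in sequentially. 0 \<le> ennreal (K * (LINT x|lborel. \<bar>e k c x\<bar>)\<^sup>2)" by simp
    have "(\<lambda>k. ennreal (K * (LINT x|lborel. \<bar>e k c x\<bar>)\<^sup>2)) \<longlonglongrightarrow> ennreal 0"
      using tendsto_sandwich[OF lo le tendsto_const up] by simp
    then have "(\<lambda>k. K * (LINT x|lborel. \<bar>e k c x\<bar>)\<^sup>2) \<longlonglongrightarrow> 0"
      using K by (intro tendsto_ennrealD[of _ 0]) (auto intro!: always_eventually)
    then have "(\<lambda>k. inverse K * (K * (LINT x|lborel. \<bar>e k c x\<bar>)\<^sup>2)) \<longlonglongrightarrow> inverse K * 0"
      by (intro tendsto_mult_left)
    then have "(\<lambda>k. (LINT x|lborel. \<bar>e k c x\<bar>)\<^sup>2) \<longlonglongrightarrow> 0"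
      using K by (simp add: mult.assoc[symmetric])
    then show ?thesis by (subst (asm) power_tendsto_0_iff) auto
  qed
  have "(\<lambda>k. LINT y|lebesgue_on Z. D k y) \<longlonglongrightarrow> 0"
  proof (rule Lim_null_comparison)
    show "\<forall>\<^sub>F k in sequentially. norm (LINT y|lebesgue_on Z. D k y) \<le> (LINT x|lborel. \<bar>e k 1 x\<bar>) + (LINT x|lborel. \<bar>e k 0 x\<bar>)"
      using integral_cell_partial_derivative_le(1)[OF Z s \<theta> i near] by (auto simp: D_def e_def)
    show "(\<lambda>k. (LINT x|lborel. \<bar>e k 1 x\<bar>) + (LINT x|lborel. \<bar>e k 0 x\<bar>)) \<longlonglongrightarrow> 0"
      using tendsto_add[OF face[of 1] face[of 0]] by simp
  qed
  from LIMSEQ_unique[OF Dlim this] show ?thesis by simp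
qed

section \<open>Fubini for completed Lebesgue measure\<close>

lemma sets_borel_Times: "A \<in> sets borel \<Longrightarrow> B \<in> sets borel \<Longrightarrow> A \<times> B \<in> sets (borel :: ('a::euclidean_space \<times> 'b::euclidean_space) measure)"
  unfolding borel_prod[symmetric] by (rule pair_measureI)

lemma AE_lborel_pair:
  fixes P :: "'a::euclidean_space \<times> 'b::euclidean_space \<Rightarrow> bool"
  assumes "AE z in lborel. P z"
  shows "AE x in lborel. AE y in lborel. P (x, y)"
  using lborel_pair.AE_pair[of P] assms unfolding lborel_prod .

lemma borel_measurable_slice:
  fixes f :: "'a::euclidean_space \<times> 'b::euclidean_space \<Rightarrow> 'c::topological_space"
  assumes "f \<in> borel_measurable borel"
  shows "(\<lambda>y. f (x, y)) \<in> borel_measurable borel"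
  by (rule measurable_compose[OF borel_measurable_continuous_onI assms]) (intro continuous_intros)

lemma slice_borel_version:
  fixes f f' :: "'a::euclidean_space \<times> 'b::euclidean_space \<Rightarrow> real"
  assumes "AE z in lborel. z \<in> A \<times> B \<longrightarrow> f z = f' z"
  shows "AE x in lborel. x \<in> A \<longrightarrow> (AE y in lborel. y \<in> B \<longrightarrow> f (x, y) = f' (x, y))"
  using AE_lborel_pair[OF assms] by eventually_elim (auto elim: eventually_mono)

lemma AE_measurable_lebesgue_on_slice:
  fixes f :: "'a::euclidean_space \<times> 'b::euclidean_space \<Rightarrow> real"
  assumes A: "A \<in> sets borel" and B: "B \<in> sets borel" and f: "f \<in> borel_measurable (lebesgue_on (A \<times> B))"
  shows "AE x in lebesgue_on A. (\<lambda>y. f (x, y)) \<in> borel_measurable (lebesgue_on B)"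
proof -
  obtain f' where f': "f' \<in> borel_measurable borel" "AE z in lborel. z \<in> A \<times> B \<longrightarrow> f z = f' z" "\<And>z. z \<notin> A \<times> B \<Longrightarrow> f' z = 0"
    by (rule borel_version[OF sets_borel_Times[OF A B] f]) (rule that; assumption)
  show ?thesis
    unfolding AE_lebesgue_on_iff[OF A] using slice_borel_version[OF f'(2)]
    by eventually_elim (intro impI borel_measurable_lebesgue_onI[OF B borel_measurable_slice[OF f'(1)]]; simp)
qed

text \<open>A product of completed measures is not complete, so Fubini's theorem for Lebesgue measurable
  functions is obtained from a Borel version of the integrand.\<close>

lemma
  fixes f :: "'a::euclidean_space \<times> 'b::euclidean_space \<Rightarrow> real"
  assumes A: "A \<in> sets borel" and B: "B \<in> sets borel" and f: "integrable (lebesgue_on (A \<times> B)) f"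
  shows AE_integrable_lebesgue_on_slice: "AE x in lebesgue_on A. integrable (lebesgue_on B) (\<lambda>y. f (x, y))"
    and integrable_lebesgue_on_fst: "integrable (lebesgue_on A) (\<lambda>x. LINT y|lebesgue_on B. f (x, y))"
    and integral_lebesgue_on_fst: "(LINT x|lebesgue_on A. LINT y|lebesgue_on B. f (x, y)) = (LINT z|lebesgue_on (A \<times> B). f z)"
proof -
  note AB = sets_borel_Times[OF A B]
  obtain f' where f': "f' \<in> borel_measurable borel" "AE z in lborel. z \<in> A \<times> B \<longrightarrow> f z = f' z" "\<And>z. z \<notin> A \<times> B \<Longrightarrow> f' z = 0"
    using borel_version[OF AB borel_measurable_integrable[OF f]] by blast
  have f'0: "(\<lambda>z. indicator (A \<times> B) z * f' z) = f'" using f'(3) by (auto simp: indicator_def fun_eq_iff)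
  have f'1: "(\<lambda>y. indicator B y * f' (x, y)) = (\<lambda>y. f' (x, y))" for x using f'(3) by (auto simp: indicator_def fun_eq_iff)
  have f'2: "(\<lambda>x. indicator A x * (LINT y|lborel. f' (x, y))) = (\<lambda>x. LINT y|lborel. f' (x, y))"
  proof
    fix x show "indicator A x * (LINT y|lborel. f' (x, y)) = (LINT y|lborel. f' (x, y))"
      using f'(3) by (cases "x \<in> A") auto
  qed
  have int: "integrable (lborel \<Otimes>\<^sub>M lborel) f'"
    using integral_lebesgue_on_cong_AE(1)[OF AB f'(1,2)] f by (simp add: f'0 lborel_prod)
  note ae = slice_borel_version[OF f'(2)]
  show "AE x in lebesgue_on A. integrable (lebesgue_on B) (\<lambda>y. f (x, y))"
    unfolding AE_lebesgue_on_iff[OF A] using ae lborel_pair.AE_integrable_fst'[OF int]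
  proof eventually_elim
    case (elim x)
    show ?case
    proof
      assume "x \<in> A"
      with elim have "AE y in lborel. y \<in> B \<longrightarrow> f (x, y) = f' (x, y)" by simp
      from integral_lebesgue_on_cong_AE(1)[OF B borel_measurable_slice[OF f'(1)] this]
      show "integrable (lebesgue_on B) (\<lambda>y. f (x, y))" using elim by (simp add: f'1)
    qed
  qed
  have ae2: "AE x in lborel. x \<in> A \<longrightarrow> (LINT y|lebesgue_on B. f (x, y)) = (LINT y|lborel. f' (x, y))"
    using ae
  proof eventually_elim
    case (elim x)
    show ?case
    proof
      assume "x \<in> A"
      with elim have "AE y in lborel. y \<in> B \<longrightarrow> f (x, y) = f' (x, y)" by simp
      from integral_lebesgue_on_cong_AE(2)[OF B borel_measurable_slice[OF f'(1)] this]
      show "(LINT y|lebesgue_on B. f (x, y)) = (LINT y|lborel. f' (x, y))" by (simp add: f'1)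
    qed
  qed
  have m: "(\<lambda>x. LINT y|lborel. f' (x, y)) \<in> borel_measurable borel"
    using borel_measurable_integrable[OF lborel_pair.integrable_fst'[OF int]] by simp
  show "integrable (lebesgue_on A) (\<lambda>x. LINT y|lebesgue_on B. f (x, y))"
    unfolding integral_lebesgue_on_cong_AE(1)[OF A m ae2] f'2 by (rule lborel_pair.integrable_fst'[OF int])
  show "(LINT x|lebesgue_on A. LINT y|lebesgue_on B. f (x, y)) = (LINT z|lebesgue_on (A \<times> B). f z)"
    unfolding integral_lebesgue_on_cong_AE(2)[OF A m ae2] f'2 integral_lebesgue_on_cong_AE(2)[OF AB f'(1,2)] f'0
    using lborel_pair.integral_fst'[OF int] by (simp add: lborel_prod)
qed

section \<open>Measure preserving maps\<close>

text \<open>The map q sends Lebesgue measure on A to Lebesgue measure on B. The integral of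
  nonnegative Borel functions is the form in which this is computed, composed and extended
  to products.\<close>

definition measure_preserving_on :: "('a::euclidean_space \<Rightarrow> 'b::euclidean_space) \<Rightarrow> 'a set \<Rightarrow> 'b set \<Rightarrow> bool" where
  "measure_preserving_on q A B \<longleftrightarrow> A \<in> sets borel \<and> B \<in> sets borel \<and> q \<in> borel_measurable borel \<and> (\<forall>x\<in>A. q x \<in> B) \<and>
    (\<forall>F\<in>borel_measurable borel. (\<integral>\<^sup>+x. F (q x) * indicator A x \<partial>lborel) = (\<integral>\<^sup>+y. F y * indicator B y \<partial>lborel))"

context
  fixes q :: "'a::euclidean_space \<Rightarrow> 'b::euclidean_space" and A B
  assumes mp: "measure_preserving_on q A B"
begin

lemma measure_preservingD: "A \<in> sets borel" "B \<in> sets borel" "q \<in> borel_measurable borel" "\<And>x. x \<in> A \<Longrightarrow> q x \<in> B"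
  "\<And>F. F \<in> borel_measurable borel \<Longrightarrow> (\<integral>\<^sup>+x. F (q x) * indicator A x \<partial>lborel) = (\<integral>\<^sup>+y. F y * indicator B y \<partial>lborel)"
  using mp by (auto simp: measure_preserving_on_def)

text \<open>The equivalence serves both ways: null sets of B have null preimages, and a
  Borel subset of B is null as soon as its preimage is.\<close>

lemma measure_preserving_AE_notin_iff:
  assumes N: "N \<in> sets borel"
  shows "(AE x in lborel. x \<in> A \<longrightarrow> q x \<notin> N) \<longleftrightarrow> (AE y in lborel. y \<in> B \<longrightarrow> y \<notin> N)"
proof -
  note [measurable] = measure_preservingD(1-3) N
  have "(AE x in lborel. x \<in> A \<longrightarrow> q x \<notin> N) \<longleftrightarrow> (AE x in lborel. indicator N (q x) * indicator A x = (0::ennreal))"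
    by (intro AE_cong) (auto simp: indicator_def)
  also have "\<dots> \<longleftrightarrow> (\<integral>\<^sup>+x. indicator N (q x) * indicator A x \<partial>lborel) = 0"
    by (rule nn_integral_0_iff_AE[symmetric]) measurable
  also have "(\<integral>\<^sup>+x. indicator N (q x) * indicator A x \<partial>lborel) = (\<integral>\<^sup>+y. indicator N y * indicator B y \<partial>lborel)"
    by (rule measure_preservingD(5)) measurable
  also have "\<dots> = 0 \<longleftrightarrow> (AE y in lborel. indicator N y * indicator B y = (0::ennreal))"
    by (rule nn_integral_0_iff_AE) measurable
  also have "\<dots> \<longleftrightarrow> (AE y in lborel. y \<in> B \<longrightarrow> y \<notin> N)"
    by (intro AE_cong) (auto simp: indicator_def)
  finally show ?thesis .
qed

lemma measure_preserving_AE: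
  assumes "AE y in lborel. y \<in> B \<longrightarrow> P y"
  shows "AE x in lborel. x \<in> A \<longrightarrow> P (q x)"
proof -
  obtain N where N: "\<And>y. y \<notin> N \<Longrightarrow> y \<in> B \<Longrightarrow> P y" "N \<in> null_sets lborel"
    using AE_E3[OF assms] by auto
  have "AE y in lborel. y \<in> B \<longrightarrow> y \<notin> N" using AE_not_in[OF N(2)] by eventually_elim simp
  then have "AE x in lborel. x \<in> A \<longrightarrow> q x \<notin> N" using N(2) by (subst measure_preserving_AE_notin_iff) auto
  then show ?thesis by eventually_elim (use N(1) measure_preservingD(4) in blast)
qed

lemma measure_preserving_borel_version:
  fixes w :: "'b \<Rightarrow> real"
  assumes w: "w \<in> borel_measurable (lebesgue_on B)"
  obtains w' where "w' \<in> borel_measurable borel" "AE y in lborel. y \<in> B \<longrightarrow> w y = w' y"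
    "(\<lambda>x. w' (q x)) \<in> borel_measurable borel" "AE x in lborel. x \<in> A \<longrightarrow> w (q x) = w' (q x)"
proof -
  obtain w' where w': "w' \<in> borel_measurable borel" "AE y in lborel. y \<in> B \<longrightarrow> w y = w' y"
    using borel_version[OF measure_preservingD(2) w] by blast
  show ?thesis
    by (rule that[OF w' measurable_compose[OF measure_preservingD(3) w'(1)] measure_preserving_AE[OF w'(2)]])
qed

lemma measure_preserving_measurable:
  fixes w :: "'b \<Rightarrow> real"
  assumes w: "w \<in> borel_measurable (lebesgue_on B)"
  shows "(\<lambda>x. w (q x)) \<in> borel_measurable (lebesgue_on A)"
  by (rule measure_preserving_borel_version[OF w]) (rule borel_measurable_lebesgue_onI[OF measure_preservingD(1)])

lemma measure_preserving_distr: "distr (density lborel (\<lambda>x. ennreal (indicator A x))) borel q = density lborel (\<lambda>y. ennreal (indicator B y))"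
proof (rule measure_eqI)
  note [measurable] = measure_preservingD(1-3)
  fix X assume "X \<in> sets (distr (density lborel (\<lambda>x. ennreal (indicator A x))) borel q)"
  then have [measurable]: "X \<in> sets borel" by simp
  have "emeasure (distr (density lborel (\<lambda>x. ennreal (indicator A x))) borel q) X
    = emeasure (density lborel (\<lambda>x. ennreal (indicator A x))) (q -` X)"
    by (subst emeasure_distr) auto
  also have "\<dots> = (\<integral>\<^sup>+x. indicator X (q x) * indicator A x \<partial>lborel)"
    using measurable_sets[OF measure_preservingD(3), of X] by (subst emeasure_density) (auto simp: indicator_def intro!: nn_integral_cong)
  also have "\<dots> = (\<integral>\<^sup>+y. indicator X y * indicator B y \<partial>lborel)"
    by (rule measure_preservingD(5)) measurable
  also have "\<dots> = emeasure (density lborel (\<lambda>y. ennreal (indicator B y))) X"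
    by (subst emeasure_density) (auto simp: indicator_def intro!: nn_integral_cong)
  finally show "emeasure (distr (density lborel (\<lambda>x. ennreal (indicator A x))) borel q) X = emeasure (density lborel (\<lambda>y. ennreal (indicator B y))) X" .
qed simp

lemma measure_preserving_integral:
  fixes w :: "'b \<Rightarrow> real"
  assumes w: "w \<in> borel_measurable (lebesgue_on B)"
  shows "integrable (lebesgue_on A) (\<lambda>x. w (q x)) \<longleftrightarrow> integrable (lebesgue_on B) w"
    and "(LINT x|lebesgue_on A. w (q x)) = (LINT y|lebesgue_on B. w y)"
proof -
  note [measurable] = measure_preservingD(1-3)
  obtain w' where w'[measurable]: "w' \<in> borel_measurable borel" and ae: "AE y in lborel. y \<in> B \<longrightarrow> w y = w' y"
    and m: "(\<lambda>x. w' (q x)) \<in> borel_measurable borel" and aeq: "AE x in lborel. x \<in> A \<longrightarrow> w (q x) = w' (q x)"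
    by (rule measure_preserving_borel_version[OF w])
  note iA = integral_lebesgue_on_cong_AE[OF measure_preservingD(1) m aeq] and iB = integral_lebesgue_on_cong_AE[OF measure_preservingD(2) w' ae]
  have qd: "q \<in> density lborel (\<lambda>x. ennreal (indicator A x)) \<rightarrow>\<^sub>M borel" by simp
  have "integrable lborel (\<lambda>x. indicator A x * w' (q x)) \<longleftrightarrow> integrable (density lborel (\<lambda>x. ennreal (indicator A x))) (\<lambda>x. w' (q x))"
    using m by (subst integrable_density) auto
  also have "\<dots> \<longleftrightarrow> integrable (density lborel (\<lambda>y. ennreal (indicator B y))) w'"
    unfolding measure_preserving_distr[symmetric] by (rule integrable_distr_eq[OF qd w', symmetric])
  also have "\<dots> \<longleftrightarrow> integrable lborel (\<lambda>y. indicator B y * w' y)"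
    by (subst integrable_density) auto
  finally show "integrable (lebesgue_on A) (\<lambda>x. w (q x)) \<longleftrightarrow> integrable (lebesgue_on B) w"
    unfolding iA iB .
  have "(LINT x|lborel. indicator A x * w' (q x)) = (LINT x|density lborel (\<lambda>x. ennreal (indicator A x)). w' (q x))"
    using m by (subst integral_density) auto
  also have "\<dots> = (LINT y|density lborel (\<lambda>y. ennreal (indicator B y)). w' y)"
    unfolding measure_preserving_distr[symmetric] by (rule integral_distr[OF qd w', symmetric])
  also have "\<dots> = (LINT y|lborel. indicator B y * w' y)"
    by (subst integral_density) auto
  finally show "(LINT x|lebesgue_on A. w (q x)) = (LINT y|lebesgue_on B. w y)"
    unfolding iA iB .
qed

lemma measure_preserving_L2:
  assumes "w \<in> L2_on B"
  shows "(\<lambda>x. w (q x)) \<in> L2_on A" "(LINT x|lebesgue_on A. (w (q x))\<^sup>2) = (LINT y|lebesgue_on B. (w y)\<^sup>2)"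
  using assms measure_preserving_measurable[of w] measure_preserving_integral[of "\<lambda>y. (w y)\<^sup>2"] by (auto simp: L2_on_def)

lemma measure_preserving_prod_right:
  fixes C :: "'c::euclidean_space set"
  assumes C: "C \<in> sets borel"
  shows "measure_preserving_on (\<lambda>z. (fst z, q (snd z))) (C \<times> A) (C \<times> B)"
  unfolding measure_preserving_on_def
proof (intro conjI ballI)
  note [measurable] = measure_preservingD(1-3) C
  show "(\<lambda>z::'c \<times> 'a. (fst z, q (snd z))) \<in> borel_measurable borel"
    unfolding borel_prod[symmetric] by measurable
  fix F :: "'c \<times> 'b \<Rightarrow> ennreal" assume F: "F \<in> borel_measurable borel"
  then have [measurable]: "F \<in> borel_measurable (borel \<Otimes>\<^sub>M borel)" by (simp add: borel_prod)
  have [measurable]: "C \<times> A \<in> sets (borel \<Otimes>\<^sub>M borel)" "C \<times> B \<in> sets (borel \<Otimes>\<^sub>M borel)"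
    by (auto intro: pair_measureI)
  have "(\<integral>\<^sup>+z. F (fst z, q (snd z)) * indicator (C \<times> A) z \<partial>lborel)
    = (\<integral>\<^sup>+t. \<integral>\<^sup>+x. F (t, q x) * indicator (C \<times> A) (t, x) \<partial>lborel \<partial>lborel)"
    unfolding lborel_prod[symmetric] by (subst lborel.nn_integral_fst[symmetric]) auto
  also have "\<dots> = (\<integral>\<^sup>+t. (\<integral>\<^sup>+x. F (t, q x) * indicator A x \<partial>lborel) * indicator C t \<partial>lborel)"
  proof (intro nn_integral_cong)
    fix t
    have [measurable]: "(\<lambda>x. F (t, q x)) \<in> borel_measurable borel"
      by (rule measurable_compose[OF measure_preservingD(3) borel_measurable_slice[OF F]])
    have "(\<integral>\<^sup>+x. F (t, q x) * indicator A x * indicator C t \<partial>lborel) = (\<integral>\<^sup>+x. F (t, q x) * indicator A x \<partial>lborel) * indicator C t"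
      by (rule nn_integral_multc) measurable
    then show "(\<integral>\<^sup>+x. F (t, q x) * indicator (C \<times> A) (t, x) \<partial>lborel) = (\<integral>\<^sup>+x. F (t, q x) * indicator A x \<partial>lborel) * indicator C t"
      by (simp add: indicator_times mult.assoc mult.commute[of "indicator C t"])
  qed
  also have "\<dots> = (\<integral>\<^sup>+t. (\<integral>\<^sup>+y. F (t, y) * indicator B y \<partial>lborel) * indicator C t \<partial>lborel)"
    using borel_measurable_slice[OF F] by (simp add: measure_preservingD(5)[of "\<lambda>y. F (_, y)"])
  also have "\<dots> = (\<integral>\<^sup>+t. \<integral>\<^sup>+y. F (t, y) * indicator (C \<times> B) (t, y) \<partial>lborel \<partial>lborel)"
  proof (intro nn_integral_cong)
    fix t
    have [measurable]: "(\<lambda>y. F (t, y)) \<in> borel_measurable borel"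
      by (rule borel_measurable_slice[OF F])
    have "(\<integral>\<^sup>+y. F (t, y) * indicator B y * indicator C t \<partial>lborel) = (\<integral>\<^sup>+y. F (t, y) * indicator B y \<partial>lborel) * indicator C t"
      by (rule nn_integral_multc) measurable
    then show "(\<integral>\<^sup>+y. F (t, y) * indicator B y \<partial>lborel) * indicator C t = (\<integral>\<^sup>+y. F (t, y) * indicator (C \<times> B) (t, y) \<partial>lborel)"
      by (simp add: indicator_times mult.assoc mult.commute[of "indicator C t"])
  qed
  also have "\<dots> = (\<integral>\<^sup>+z. F z * indicator (C \<times> B) z \<partial>lborel)"
    unfolding lborel_prod[symmetric] by (subst lborel.nn_integral_fst[symmetric]) auto
  finally show "(\<integral>\<^sup>+z. F (fst z, q (snd z)) * indicator (C \<times> A) z \<partial>lborel) = (\<integral>\<^sup>+z. F z * indicator (C \<times> B) z \<partial>lborel)" .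
qed (use C measure_preservingD in \<open>auto intro: sets_borel_Times\<close>)

end

lemma measure_preserving_comp:
  fixes p :: "'a::euclidean_space \<Rightarrow> 'b::euclidean_space" and q :: "'b \<Rightarrow> 'c::euclidean_space"
  assumes "measure_preserving_on p A B" "measure_preserving_on q B C"
  shows "measure_preserving_on (\<lambda>x. q (p x)) A C"
  unfolding measure_preserving_on_def
proof (intro conjI ballI)
  note p = measure_preservingD[OF assms(1)] and q = measure_preservingD[OF assms(2)]
  show "A \<in> sets borel" "C \<in> sets borel" by fact+
  show "(\<lambda>x. q (p x)) \<in> borel_measurable borel" by (rule measurable_compose[OF p(3) q(3)])
  show "q (p x) \<in> C" if "x \<in> A" for x using p(4) q(4) that by blast
  fix F :: "'c \<Rightarrow> ennreal" assume F: "F \<in> borel_measurable borel"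
  show "(\<integral>\<^sup>+x. F (q (p x)) * indicator A x \<partial>lborel) = (\<integral>\<^sup>+z. F z * indicator C z \<partial>lborel)"
    using p(5)[OF measurable_compose[OF q(3) F]] q(5)[OF F] by simp
qed

lemma measure_preserving_swap:
  fixes A :: "'a::euclidean_space set" and B :: "'b::euclidean_space set"
  assumes "A \<in> sets borel" "B \<in> sets borel"
  shows "measure_preserving_on (\<lambda>z. (snd z, fst z)) (A \<times> B) (B \<times> A)"
  unfolding measure_preserving_on_def
proof (intro conjI ballI)
  show "A \<times> B \<in> sets borel" "B \<times> A \<in> sets borel" using assms by (auto intro: sets_borel_Times)
  show "(\<lambda>z::'a \<times> 'b. (snd z, fst z)) \<in> borel_measurable borel"
    by (intro borel_measurable_continuous_onI continuous_intros)
  fix F :: "'b \<times> 'a \<Rightarrow> ennreal" assume F: "F \<in> borel_measurable borel"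
  note [measurable] = assms
  have [measurable]: "F \<in> borel_measurable (borel \<Otimes>\<^sub>M borel)" using F by (simp add: borel_prod)
  have [measurable]: "A \<times> B \<in> sets (borel \<Otimes>\<^sub>M borel)" "B \<times> A \<in> sets (borel \<Otimes>\<^sub>M borel)"
    by (auto intro: pair_measureI)
  have "(\<integral>\<^sup>+z. F (snd z, fst z) * indicator (A \<times> B) z \<partial>lborel)
    = (\<integral>\<^sup>+x. \<integral>\<^sup>+y. F (y, x) * indicator (A \<times> B) (x, y) \<partial>lborel \<partial>lborel)"
    unfolding lborel_prod[symmetric] by (subst lborel.nn_integral_fst[symmetric]) auto
  also have "\<dots> = (\<integral>\<^sup>+y. \<integral>\<^sup>+x. F (y, x) * indicator (A \<times> B) (x, y) \<partial>lborel \<partial>lborel)"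
    by (rule lborel_pair.Fubini') measurable
  also have "\<dots> = (\<integral>\<^sup>+y. \<integral>\<^sup>+x. F (y, x) * indicator (B \<times> A) (y, x) \<partial>lborel \<partial>lborel)"
    by (intro nn_integral_cong) (simp add: indicator_times mult.commute)
  also have "\<dots> = (\<integral>\<^sup>+z. F z * indicator (B \<times> A) z \<partial>lborel)"
    unfolding lborel_prod[symmetric] by (subst lborel.nn_integral_fst[symmetric]) auto
  finally show "(\<integral>\<^sup>+z. F (snd z, fst z) * indicator (A \<times> B) z \<partial>lborel) = (\<integral>\<^sup>+z. F z * indicator (B \<times> A) z \<partial>lborel)" .
qed auto

section \<open>The unfolding map\<close>

lemma Basis_vec_iff: "(i :: real ^ 'n) \<in> Basis \<longleftrightarrow> (\<exists>j. i = axis j 1)"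
  by (auto simp: Basis_vec_def)

lemma One_vec: "(One :: real ^ 'n) = 1"
  by (rule euclidean_eqI) (auto simp: Basis_vec_iff inner_axis inner_sum_left_Basis)

lemma unit_cell_eq: "unit_cell = box 0 (One :: real ^ 'n)"
  by (simp add: unit_cell_def One_vec)

lemma mem_unit_cell: "y \<in> unit_cell \<longleftrightarrow> (\<forall>i. 0 < y $ i \<and> y $ i < 1)"
  by (simp add: unit_cell_def mem_box_cart)

lemma emeasure_unit_cell: "emeasure lborel (unit_cell :: (real ^ 'n) set) = 1"
  unfolding unit_cell_eq by (subst emeasure_lborel_box_eq) auto

definition floor_index :: "real ^ 'n \<Rightarrow> int ^ 'n" where
  "floor_index z = (\<chi> i. \<lfloor>z $ i\<rfloor>)"

lemma floor_vec_eq: "floor_vec z = int_vec (floor_index z)"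
  by (simp add: floor_vec_def int_vec_def floor_index_def vec_eq_iff)

lemma floor_index_cell: "y \<in> unit_cell \<Longrightarrow> floor_index (y + int_vec k) = k"
  by (auto simp: floor_index_def int_vec_def vec_eq_iff mem_unit_cell floor_unique intro!: floor_unique less_imp_le)

lemma floor_vec_cell: "y \<in> unit_cell \<Longrightarrow> floor_vec (y + int_vec k) = int_vec k"
  by (simp add: floor_vec_eq floor_index_cell)

lemma frac_vec_cell: "y \<in> unit_cell \<Longrightarrow> frac_vec (y + int_vec k) = y"
  by (simp add: frac_vec_def floor_vec_cell)

lemma floor_vec_measurable [measurable]: "floor_vec \<in> borel_measurable borel"
proof -
  have "(\<lambda>z :: real ^ 'n. floor_vec z \<bullet> i) \<in> borel_measurable borel" if "i \<in> Basis" for i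
  proof -
    obtain j where j: "i = axis j 1" using \<open>i \<in> Basis\<close> by (auto simp: Basis_vec_iff)
    have "(\<lambda>z :: real ^ 'n. real_of_int \<lfloor>z \<bullet> i\<rfloor>) \<in> borel_measurable borel" by measurable
    then show ?thesis by (simp add: j inner_axis floor_vec_def)
  qed
  then show ?thesis by (subst borel_measurable_euclidean_space) blast
qed

lemma floor_index_eq_set: "floor_index z = k \<longleftrightarrow> floor_vec z = int_vec k"
  by (auto simp: floor_vec_eq int_vec_def vec_eq_iff)

lemma nn_integral_affine:
  fixes G :: "'a::euclidean_space \<Rightarrow> ennreal"
  assumes e: "e > 0" and G: "G \<in> borel_measurable borel"
  shows "(\<integral>\<^sup>+z. G z \<partial>lborel) = ennreal (e ^ DIM('a)) * (\<integral>\<^sup>+y. G (c + e *\<^sub>R y) \<partial>lborel)"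
proof -
  have "(\<integral>\<^sup>+z. G z \<partial>lborel) = (\<integral>\<^sup>+z. G z \<partial>density (distr lborel borel (\<lambda>x. c + e *\<^sub>R x)) (\<lambda>_. \<bar>e\<bar> ^ DIM('a)))"
    using lborel_affine[of e c] e by simp
  also have "\<dots> = (\<integral>\<^sup>+z. ennreal (e ^ DIM('a)) * G z \<partial>distr lborel borel (\<lambda>x. c + e *\<^sub>R x))"
    using e G by (subst nn_integral_density) auto
  also have "\<dots> = (\<integral>\<^sup>+y. ennreal (e ^ DIM('a)) * G (c + e *\<^sub>R y) \<partial>lborel)"
    using G by (subst nn_integral_distr) auto
  also have "\<dots> = ennreal (e ^ DIM('a)) * (\<integral>\<^sup>+y. G (c + e *\<^sub>R y) \<partial>lborel)"
    using measurable_compose[OF _ G, of "\<lambda>y. c + e *\<^sub>R y" lborel] by (intro nn_integral_cmult) simp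
  finally show ?thesis .
qed

text \<open>The corners of the box \<Omega> have integer coordinates and 1/\<epsilon> is an integer. So the cells of size
  \<epsilon> that lie in \<Omega> tile it up to a null set.\<close>

locale unfolding_cells =
  fixes a b :: "nat ^ 'n" and \<epsilon> :: real and \<Omega> :: "(real ^ 'n) set"
  assumes Omega: "\<Omega> = box_domain a b"
    and eps: "\<epsilon> > 0" "inverse \<epsilon> \<in> \<nat>"
begin

text \<open>Unfolding a function w means composing it with this map.\<close>

definition unfold_map :: "(real ^ 'n) \<times> (real ^ 'n) \<Rightarrow> real ^ 'n" where
  "unfold_map z = \<epsilon> *\<^sub>R floor_vec (fst z /\<^sub>R \<epsilon>) + \<epsilon> *\<^sub>R snd z"

definition cell_union :: "(real ^ 'n) set \<Rightarrow> (real ^ 'n) set" where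
  "cell_union A = (\<Union>k\<in>cell_indices \<epsilon> \<Omega>. (\<lambda>y. \<epsilon> *\<^sub>R (y + int_vec k)) ` A)"

lemma mem_Omega: "x \<in> \<Omega> \<longleftrightarrow> (\<forall>i. real (a $ i) < x $ i \<and> x $ i < real (b $ i))"
  by (simp add: Omega box_domain_def mem_box_cart)

lemma eps_div: "\<exists>m::int. real j / \<epsilon> = of_int m"
proof -
  obtain m :: nat where "inverse \<epsilon> = real m" using eps(2) by (auto simp: Nats_def)
  then have "real j / \<epsilon> = of_int (int j * int m)" by (simp add: divide_inverse)
  then show ?thesis by blast
qed

text \<open>Divided by \<epsilon>, the bounds of \<Omega> become integers, and an integer
  bound for a real number is a bound for the cell that contains the number.\<close>

lemma floor_index_in_cell_indices:
  assumes x: "x \<in> \<Omega>"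
  shows "floor_index (x /\<^sub>R \<epsilon>) \<in> cell_indices \<epsilon> \<Omega>"
  unfolding cell_indices_def
proof (intro CollectI image_subsetI)
  fix y :: "real ^ 'n" assume y: "y \<in> unit_cell"
  have "real (a $ i) < \<epsilon> * (y $ i + of_int \<lfloor>x $ i / \<epsilon>\<rfloor>) \<and> \<epsilon> * (y $ i + of_int \<lfloor>x $ i / \<epsilon>\<rfloor>) < real (b $ i)" for i
  proof -
    obtain ma where ma: "real (a $ i) / \<epsilon> = of_int ma" using eps_div by blast
    obtain mb where mb: "real (b $ i) / \<epsilon> = of_int mb" using eps_div by blast
    have "real (a $ i) / \<epsilon> < x $ i / \<epsilon>" "x $ i / \<epsilon> < real (b $ i) / \<epsilon>"
      using x eps by (auto simp: mem_Omega divide_strict_right_mono)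
    then have "ma \<le> \<lfloor>x $ i / \<epsilon>\<rfloor>" "\<lfloor>x $ i / \<epsilon>\<rfloor> + 1 \<le> mb"
      unfolding ma mb by (simp_all add: le_floor_iff floor_less_iff[symmetric] flip: add1_zle_eq)
    then have "of_int ma \<le> real_of_int \<lfloor>x $ i / \<epsilon>\<rfloor>" "real_of_int \<lfloor>x $ i / \<epsilon>\<rfloor> + 1 \<le> of_int mb" by linarith+
    moreover have "0 < y $ i" "y $ i < 1" using y by (auto simp: mem_unit_cell)
    ultimately have "real (a $ i) / \<epsilon> < y $ i + of_int \<lfloor>x $ i / \<epsilon>\<rfloor>" "y $ i + of_int \<lfloor>x $ i / \<epsilon>\<rfloor> < real (b $ i) / \<epsilon>"
      unfolding ma mb by linarith+
    then show ?thesis using eps by (simp add: field_simps)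
  qed
  then show "\<epsilon> *\<^sub>R (y + int_vec (floor_index (x /\<^sub>R \<epsilon>))) \<in> \<Omega>"
    by (simp add: mem_Omega int_vec_def floor_index_def divide_inverse mult.commute)
qed

lemma cell_subset: "k \<in> cell_indices \<epsilon> \<Omega> \<Longrightarrow> y \<in> unit_cell \<Longrightarrow> \<epsilon> *\<^sub>R (y + int_vec k) \<in> \<Omega>"
  by (auto simp: cell_indices_def)

lemma floor_cell [simp]:
  assumes "y \<in> unit_cell"
  shows "floor_index ((\<epsilon> *\<^sub>R (y + int_vec k)) /\<^sub>R \<epsilon>) = k" "floor_vec ((\<epsilon> *\<^sub>R (y + int_vec k)) /\<^sub>R \<epsilon>) = int_vec k"
    "frac_vec ((\<epsilon> *\<^sub>R (y + int_vec k)) /\<^sub>R \<epsilon>) = y"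
  using eps assms by (simp_all add: floor_index_cell floor_vec_cell frac_vec_cell)

lemma finite_cell_indices: "finite (cell_indices \<epsilon> \<Omega>)"
proof -
  define y :: "real ^ 'n" where "y = (\<chi> i. 1/2)"
  have y: "y \<in> unit_cell" by (simp add: y_def mem_unit_cell)
  define R where "R = (\<Sum>i\<in>UNIV. real (b $ i)) / \<epsilon> + 1"
  have sub: "cell_indices \<epsilon> \<Omega> \<subseteq> vec_lambda ` (\<Pi>\<^sub>E i\<in>UNIV. {- \<lceil>R\<rceil>..\<lceil>R\<rceil>})"
  proof
    fix k assume k: "k \<in> cell_indices \<epsilon> \<Omega>"
    have "k $ i \<in> {- \<lceil>R\<rceil>..\<lceil>R\<rceil>}" for i
    proof -
      have "real (a $ i) < \<epsilon> * (1/2 + of_int (k $ i))" "\<epsilon> * (1/2 + of_int (k $ i)) < real (b $ i)"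
        using cell_subset[OF k y] by (auto simp: mem_Omega y_def int_vec_def)
      then have "0 < \<epsilon> * (1/2 + of_int (k $ i))" "1/2 + of_int (k $ i) < real (b $ i) / \<epsilon>"
        using eps by (auto simp: field_simps intro: le_less_trans[of 0 "real (a $ i)"])
      moreover have "real (b $ i) \<le> (\<Sum>i\<in>UNIV. real (b $ i))" by (rule member_le_sum) auto
      then have "real (b $ i) / \<epsilon> \<le> R - 1" using eps by (simp add: R_def divide_right_mono)
      moreover have "0 < 1/2 + real_of_int (k $ i)" using calculation(1) eps by (simp add: zero_less_mult_iff)
      ultimately have "\<bar>real_of_int (k $ i)\<bar> \<le> R" by linarith
      then show ?thesis by (simp add: abs_le_iff) linarith
    qed
    then have "(\<lambda>i. k $ i) \<in> (\<Pi>\<^sub>E i\<in>UNIV. {- \<lceil>R\<rceil>..\<lceil>R\<rceil>})" by auto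
    then show "k \<in> vec_lambda ` (\<Pi>\<^sub>E i\<in>UNIV. {- \<lceil>R\<rceil>..\<lceil>R\<rceil>})" by (rule rev_image_eqI) simp
  qed
  have "finite (vec_lambda ` (\<Pi>\<^sub>E i\<in>(UNIV :: 'n set). {- \<lceil>R\<rceil>..\<lceil>R\<rceil>}))"
    by (intro finite_imageI finite_PiE) auto
  then show ?thesis using sub by (rule finite_subset[rotated])
qed

lemma Omega_borel [measurable]: "\<Omega> \<in> sets borel"
  by (simp add: Omega box_domain_def)

lemma unfold_map_measurable [measurable]: "unfold_map \<in> borel_measurable borel"
  unfolding unfold_map_def[abs_def] borel_prod[symmetric] by measurable

lemma unfold_map_eq: "unfold_map (x, y) = \<epsilon> *\<^sub>R (y + int_vec (floor_index (x /\<^sub>R \<epsilon>)))"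
  by (simp add: unfold_map_def floor_vec_eq algebra_simps)

lemma cell_union_iff:
  assumes A: "A \<subseteq> unit_cell"
  shows "z \<in> cell_union A \<longleftrightarrow> floor_index (z /\<^sub>R \<epsilon>) \<in> cell_indices \<epsilon> \<Omega> \<and> frac_vec (z /\<^sub>R \<epsilon>) \<in> A"
proof
  assume "z \<in> cell_union A"
  then obtain k y where k: "k \<in> cell_indices \<epsilon> \<Omega>" and y: "y \<in> A" and z: "z = \<epsilon> *\<^sub>R (y + int_vec k)"
    unfolding cell_union_def by blast
  have "y \<in> unit_cell" using y A by blast
  then show "floor_index (z /\<^sub>R \<epsilon>) \<in> cell_indices \<epsilon> \<Omega> \<and> frac_vec (z /\<^sub>R \<epsilon>) \<in> A"
    unfolding z using k y by (simp only: floor_cell simp_thms)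
next
  assume r: "floor_index (z /\<^sub>R \<epsilon>) \<in> cell_indices \<epsilon> \<Omega> \<and> frac_vec (z /\<^sub>R \<epsilon>) \<in> A"
  have "z = \<epsilon> *\<^sub>R (frac_vec (z /\<^sub>R \<epsilon>) + int_vec (floor_index (z /\<^sub>R \<epsilon>)))"
    using eps by (simp add: frac_vec_def floor_vec_eq[symmetric])
  then show "z \<in> cell_union A" using r unfolding cell_union_def by blast
qed

lemma emeasure_floor_cell:
  assumes k: "k \<in> cell_indices \<epsilon> \<Omega>"
  shows "emeasure lborel {x \<in> \<Omega>. floor_index (x /\<^sub>R \<epsilon>) = k} = ennreal (\<epsilon> ^ CARD('n))"
proof (rule antisym)
  have m: "{x \<in> \<Omega>. floor_index (x /\<^sub>R \<epsilon>) = k} \<in> sets borel"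
    unfolding floor_index_eq_set by measurable
  let ?l = "\<epsilon> *\<^sub>R int_vec k" and ?u = "\<epsilon> *\<^sub>R (int_vec k + 1)"
  have le: "?l \<bullet> i \<le> ?u \<bullet> i" and diff: "(?u - ?l) \<bullet> i = \<epsilon>" if "i \<in> Basis" for i
    using that eps by (auto simp: Basis_vec_iff inner_axis algebra_simps)
  have prod: "(\<Prod>i\<in>Basis. (?u - ?l) \<bullet> i) = \<epsilon> ^ CARD('n)"
    using diff by (simp add: DIM_cart)
  have "box ?l ?u \<subseteq> {x \<in> \<Omega>. floor_index (x /\<^sub>R \<epsilon>) = k}"
  proof
    fix x assume x: "x \<in> box ?l ?u"
    define y where "y = x /\<^sub>R \<epsilon> - int_vec k"
    have "y \<in> unit_cell" using x eps by (auto simp: y_def mem_unit_cell mem_box_cart field_simps)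
    moreover have "x = \<epsilon> *\<^sub>R (y + int_vec k)" using eps by (simp add: y_def)
    ultimately show "x \<in> {x \<in> \<Omega>. floor_index (x /\<^sub>R \<epsilon>) = k}" using cell_subset[OF k] floor_cell(1) by simp
  qed
  then have "emeasure lborel (box ?l ?u) \<le> emeasure lborel {x \<in> \<Omega>. floor_index (x /\<^sub>R \<epsilon>) = k}"
    using m by (intro emeasure_mono) auto
  then show "ennreal (\<epsilon> ^ CARD('n)) \<le> emeasure lborel {x \<in> \<Omega>. floor_index (x /\<^sub>R \<epsilon>) = k}"
    using emeasure_lborel_box[OF le] prod by simp
  have "{x \<in> \<Omega>. floor_index (x /\<^sub>R \<epsilon>) = k} \<subseteq> cbox ?l ?u"
  proof
    fix x assume "x \<in> {x \<in> \<Omega>. floor_index (x /\<^sub>R \<epsilon>) = k}"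
    then have "\<lfloor>x $ i / \<epsilon>\<rfloor> = k $ i" for i by (auto simp: floor_index_def vec_eq_iff divide_inverse mult.commute)
    then have "of_int (k $ i) \<le> x $ i / \<epsilon>" "x $ i / \<epsilon> < of_int (k $ i) + 1" for i
      using floor_correct[of "x $ i / \<epsilon>"] by simp_all
    then show "x \<in> cbox ?l ?u" using eps by (auto simp: mem_box_cart int_vec_def field_simps less_imp_le)
  qed
  then have "emeasure lborel {x \<in> \<Omega>. floor_index (x /\<^sub>R \<epsilon>) = k} \<le> emeasure lborel (cbox ?l ?u)"
    by (intro emeasure_mono) auto
  then show "emeasure lborel {x \<in> \<Omega>. floor_index (x /\<^sub>R \<epsilon>) = k} \<le> ennreal (\<epsilon> ^ CARD('n))"
    using emeasure_lborel_cbox[OF le] prod by simp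
qed

lemma cell_union_borel:
  assumes "A \<in> sets borel" "A \<subseteq> unit_cell"
  shows "cell_union A \<in> sets borel"
proof -
  have [measurable]: "A \<in> sets borel" by fact
  have "cell_union A = (\<Union>k\<in>cell_indices \<epsilon> \<Omega>. {z. floor_vec (z /\<^sub>R \<epsilon>) = int_vec k \<and> frac_vec (z /\<^sub>R \<epsilon>) \<in> A})"
    unfolding floor_index_eq_set[symmetric] using cell_union_iff[OF assms(2)] by blast
  also have "\<dots> \<in> sets borel"
    unfolding frac_vec_def by (intro sets.finite_UN finite_cell_indices) measurable
  finally show ?thesis .
qed

text \<open>For fixed second argument the map is constant on each cell of \<Omega>, which
  has volume \<epsilon>^n; in the second argument it is a scaling by \<epsilon>. The two
  factors \<epsilon>^n coincide.\<close>

lemma unfold_map_measure_preserving: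
  assumes A: "A \<in> sets borel" "A \<subseteq> unit_cell"
  shows "measure_preserving_on unfold_map (\<Omega> \<times> A) (cell_union A)"
  unfolding measure_preserving_on_def
proof (intro conjI ballI)
  show "\<Omega> \<times> A \<in> sets borel" by (intro sets_borel_Times A Omega_borel)
  show "cell_union A \<in> sets borel" by (rule cell_union_borel[OF A])
  show "unfold_map \<in> borel_measurable borel" by measurable
  show "unfold_map z \<in> cell_union A" if z: "z \<in> \<Omega> \<times> A" for z
  proof -
    obtain x y where xy: "z = (x, y)" "x \<in> \<Omega>" "y \<in> A" using z by auto
    show ?thesis
      unfolding cell_union_def xy(1) unfold_map_eq using floor_index_in_cell_indices[OF xy(2)] xy(3) by blast
  qed
  fix F :: "real ^ 'n \<Rightarrow> ennreal" assume F[measurable]: "F \<in> borel_measurable borel"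
  note [measurable] = A(1)
  let ?K = "cell_indices \<epsilon> \<Omega>"
  define J where "J k = (\<integral>\<^sup>+y. F (\<epsilon> *\<^sub>R (y + int_vec k)) * indicator A y \<partial>lborel)" for k
  define S where "S k = {x \<in> \<Omega>. floor_index (x /\<^sub>R \<epsilon>) = k}" for k
  have Sm[measurable]: "S k \<in> sets borel" for k unfolding S_def floor_index_eq_set by measurable
  have [measurable]: "\<Omega> \<times> A \<in> sets (borel \<Otimes>\<^sub>M borel)" by (auto intro: pair_measureI A(1) Omega_borel)
  have um: "unfold_map \<in> borel_measurable (borel \<Otimes>\<^sub>M borel)" by (simp add: borel_prod)
  have "(\<integral>\<^sup>+z. F (unfold_map z) * indicator (\<Omega> \<times> A) z \<partial>lborel)
    = (\<integral>\<^sup>+x. \<integral>\<^sup>+y. F (unfold_map (x, y)) * indicator (\<Omega> \<times> A) (x, y) \<partial>lborel \<partial>lborel)"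
    unfolding lborel_prod[symmetric] using um by (subst lborel.nn_integral_fst[symmetric]) auto
  also have "\<dots> = (\<integral>\<^sup>+x. (\<Sum>k\<in>?K. J k * indicator (S k) x) \<partial>lborel)"
  proof (rule nn_integral_cong)
    fix x
    show "(\<integral>\<^sup>+y. F (unfold_map (x, y)) * indicator (\<Omega> \<times> A) (x, y) \<partial>lborel) = (\<Sum>k\<in>?K. J k * indicator (S k) x)"
    proof (cases "x \<in> \<Omega>")
      case True
      define k where "k = floor_index (x /\<^sub>R \<epsilon>)"
      have k: "k \<in> ?K" unfolding k_def by (rule floor_index_in_cell_indices[OF True])
      have "(\<integral>\<^sup>+y. F (unfold_map (x, y)) * indicator (\<Omega> \<times> A) (x, y) \<partial>lborel) = J k"
        using True by (simp add: J_def unfold_map_eq k_def indicator_times)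
      also have "\<dots> = (\<Sum>l\<in>?K. if l = k then J k else 0)" using k finite_cell_indices by simp
      also have "\<dots> = (\<Sum>l\<in>?K. J l * indicator (S l) x)"
        using True by (intro sum.cong) (auto simp: S_def k_def)
      finally show ?thesis .
    qed (simp add: S_def indicator_times)
  qed
  also have "\<dots> = (\<Sum>k\<in>?K. \<integral>\<^sup>+x. J k * indicator (S k) x \<partial>lborel)"
    by (rule nn_integral_sum) measurable
  also have "\<dots> = (\<Sum>k\<in>?K. J k * ennreal (\<epsilon> ^ CARD('n)))"
    using emeasure_floor_cell by (intro sum.cong) (auto simp: nn_integral_cmult S_def[symmetric])
  also have "\<dots> = (\<Sum>k\<in>?K. \<integral>\<^sup>+z. F z * indicator (cell_union A) z * indicator {z. floor_vec (z /\<^sub>R \<epsilon>) = int_vec k} z \<partial>lborel)"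
  proof (rule sum.cong[OF refl])
    fix k assume k: "k \<in> ?K"
    define G where "G z = F z * indicator (cell_union A) z * indicator {z. floor_vec (z /\<^sub>R \<epsilon>) = int_vec k} z" for z
    have [measurable]: "cell_union A \<in> sets borel" by (rule cell_union_borel[OF A])
    have [measurable]: "G \<in> borel_measurable borel" unfolding G_def by measurable
    have "G (\<epsilon> *\<^sub>R int_vec k + \<epsilon> *\<^sub>R y) = F (\<epsilon> *\<^sub>R (y + int_vec k)) * indicator A y" for y
    proof -
      have z: "\<epsilon> *\<^sub>R int_vec k + \<epsilon> *\<^sub>R y = \<epsilon> *\<^sub>R (y + int_vec k)" by (simp add: algebra_simps)
      have "\<epsilon> *\<^sub>R (y + int_vec k) \<in> cell_union A \<and> floor_vec ((\<epsilon> *\<^sub>R (y + int_vec k)) /\<^sub>R \<epsilon>) = int_vec k \<longleftrightarrow> y \<in> A"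
      proof
        assume l: "\<epsilon> *\<^sub>R (y + int_vec k) \<in> cell_union A \<and> floor_vec ((\<epsilon> *\<^sub>R (y + int_vec k)) /\<^sub>R \<epsilon>) = int_vec k"
        then have "frac_vec ((\<epsilon> *\<^sub>R (y + int_vec k)) /\<^sub>R \<epsilon>) \<in> A" using cell_union_iff[OF A(2)] by blast
        moreover have "frac_vec ((\<epsilon> *\<^sub>R (y + int_vec k)) /\<^sub>R \<epsilon>) = y"
          using l eps unfolding frac_vec_def by simp
        ultimately show "y \<in> A" by simp
      next
        assume "y \<in> A"
        then show "\<epsilon> *\<^sub>R (y + int_vec k) \<in> cell_union A \<and> floor_vec ((\<epsilon> *\<^sub>R (y + int_vec k)) /\<^sub>R \<epsilon>) = int_vec k"
          using k A(2) floor_cell(2)[of y k] by (auto simp: cell_union_def)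
      qed
      then show ?thesis unfolding G_def z by (auto simp: indicator_def)
    qed
    then have "(\<integral>\<^sup>+z. G z \<partial>lborel) = ennreal (\<epsilon> ^ CARD('n)) * J k"
      using nn_integral_affine[OF eps(1), of G "\<epsilon> *\<^sub>R int_vec k"] by (simp add: J_def DIM_cart)
    then show "J k * ennreal (\<epsilon> ^ CARD('n)) = (\<integral>\<^sup>+z. F z * indicator (cell_union A) z * indicator {z. floor_vec (z /\<^sub>R \<epsilon>) = int_vec k} z \<partial>lborel)"
      by (simp add: G_def mult.commute)
  qed
  also have "\<dots> = (\<integral>\<^sup>+z. (\<Sum>k\<in>?K. F z * indicator (cell_union A) z * indicator {z. floor_vec (z /\<^sub>R \<epsilon>) = int_vec k} z) \<partial>lborel)"
  proof (rule nn_integral_sum[symmetric])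
    have [measurable]: "cell_union A \<in> sets borel" by (rule cell_union_borel[OF A])
    show "(\<lambda>z. F z * indicator (cell_union A) z * indicator {z. floor_vec (z /\<^sub>R \<epsilon>) = int_vec k} z) \<in> borel_measurable lborel" for k
      by measurable
  qed
  also have "\<dots> = (\<integral>\<^sup>+z. F z * indicator (cell_union A) z \<partial>lborel)"
  proof (rule nn_integral_cong)
    fix z
    show "(\<Sum>k\<in>?K. F z * indicator (cell_union A) z * indicator {z. floor_vec (z /\<^sub>R \<epsilon>) = int_vec k} z) = F z * indicator (cell_union A) z"
    proof (cases "z \<in> cell_union A")
      case True
      then have k: "floor_index (z /\<^sub>R \<epsilon>) \<in> ?K" using cell_union_iff[OF A(2)] by blast
      have "(\<Sum>k\<in>?K. F z * indicator (cell_union A) z * indicator {z. floor_vec (z /\<^sub>R \<epsilon>) = int_vec k} z)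
        = (\<Sum>k\<in>?K. if k = floor_index (z /\<^sub>R \<epsilon>) then F z else 0)"
        using True by (intro sum.cong) (auto simp: indicator_def floor_index_eq_set[symmetric])
      then show ?thesis using True k finite_cell_indices by simp
    qed simp
  qed
  finally show "(\<integral>\<^sup>+z. F (unfold_map z) * indicator (\<Omega> \<times> A) z \<partial>lborel) = (\<integral>\<^sup>+z. F z * indicator (cell_union A) z \<partial>lborel)" .
qed

end

section \<open>The averaging operator\<close>

lemma nn_integral_lborel_pair:
  fixes F :: "'a::euclidean_space \<times> 'b::euclidean_space \<Rightarrow> ennreal"
  assumes "F \<in> borel_measurable borel"
  shows "(\<integral>\<^sup>+z. F z \<partial>lborel) = (\<integral>\<^sup>+x. \<integral>\<^sup>+y. F (x, y) \<partial>lborel \<partial>lborel)"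
proof -
  have "F \<in> borel_measurable (borel \<Otimes>\<^sub>M lborel)" using assms by (simp add: borel_prod[symmetric] cong: measurable_cong_sets)
  then have "F \<in> borel_measurable (lborel \<Otimes>\<^sub>M lborel)" by (simp cong: measurable_cong_sets)
  from lborel.nn_integral_fst[OF this] show ?thesis by (simp add: lborel_prod)
qed

lemma borel_measurable_nn_integral_slice:
  fixes F :: "'a::euclidean_space \<times> 'b::euclidean_space \<Rightarrow> ennreal"
  assumes "F \<in> borel_measurable borel"
  shows "(\<lambda>x. \<integral>\<^sup>+y. F (x, y) \<partial>lborel) \<in> borel_measurable borel"
proof -
  have "F \<in> borel_measurable (borel \<Otimes>\<^sub>M lborel)" using assms by (simp add: borel_prod[symmetric] cong: measurable_cong_sets)
  then show ?thesis by (intro lborel.borel_measurable_nn_integral) (simp add: case_prod_beta')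
qed

lemma nn_integral_lborel_swap:
  fixes F :: "'a::euclidean_space \<times> 'b::euclidean_space \<Rightarrow> ennreal"
  assumes "F \<in> borel_measurable borel"
  shows "(\<integral>\<^sup>+x. \<integral>\<^sup>+y. F (x, y) \<partial>lborel \<partial>lborel) = (\<integral>\<^sup>+y. \<integral>\<^sup>+x. F (x, y) \<partial>lborel \<partial>lborel)"
proof -
  have "F \<in> borel_measurable (lborel \<Otimes>\<^sub>M lborel)" using assms by (simp add: borel_prod[symmetric] cong: measurable_cong_sets)
  then show ?thesis using lborel_pair.Fubini'[of "\<lambda>x y. F (x, y)"] by (simp add: case_prod_beta')
qed

lemma measure_preserving_permute:
  fixes A :: "'a::euclidean_space set" and B :: "'b::euclidean_space set" and C :: "'c::euclidean_space set"
  assumes A: "A \<in> sets borel" and B: "B \<in> sets borel" and C: "C \<in> sets borel"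
  shows "measure_preserving_on (\<lambda>w. (snd (fst w), (fst (fst w), snd w))) ((A \<times> B) \<times> C) (B \<times> (A \<times> C))"
  unfolding measure_preserving_on_def
proof (intro conjI ballI)
  show "(A \<times> B) \<times> C \<in> sets borel" "B \<times> (A \<times> C) \<in> sets borel" by (intro sets_borel_Times assms)+
  show m: "(\<lambda>w::('a \<times> 'b) \<times> 'c. (snd (fst w), (fst (fst w), snd w))) \<in> borel_measurable borel"
    by (intro borel_measurable_continuous_onI continuous_intros)
  fix F :: "'b \<times> ('a \<times> 'c) \<Rightarrow> ennreal" assume F: "F \<in> borel_measurable borel"
  define G where "G z = F z * indicator (B \<times> (A \<times> C)) z" for z
  have G: "G \<in> borel_measurable borel"
    unfolding G_def by (intro borel_measurable_times_ennreal F borel_measurable_indicator sets_borel_Times assms)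
  define H where "H w = G (snd (fst w), (fst (fst w), snd w))" for w :: "('a \<times> 'b) \<times> 'c"
  have H: "H \<in> borel_measurable borel" unfolding H_def by (rule measurable_compose[OF m G])
  have "(\<integral>\<^sup>+w. F (snd (fst w), (fst (fst w), snd w)) * indicator ((A \<times> B) \<times> C) w \<partial>lborel) = (\<integral>\<^sup>+w. H w \<partial>lborel)"
    by (intro nn_integral_cong) (auto simp: H_def G_def indicator_def)
  also have "\<dots> = (\<integral>\<^sup>+p. \<integral>\<^sup>+z. H (p, z) \<partial>lborel \<partial>lborel)" by (rule nn_integral_lborel_pair[OF H])
  also have "\<dots> = (\<integral>\<^sup>+x. \<integral>\<^sup>+y. \<integral>\<^sup>+z. H ((x, y), z) \<partial>lborel \<partial>lborel \<partial>lborel)"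
    by (rule nn_integral_lborel_pair[OF borel_measurable_nn_integral_slice[OF H]])
  also have "\<dots> = (\<integral>\<^sup>+y. \<integral>\<^sup>+x. \<integral>\<^sup>+z. H ((x, y), z) \<partial>lborel \<partial>lborel \<partial>lborel)"
    by (rule nn_integral_lborel_swap[OF borel_measurable_nn_integral_slice[OF H]])
  also have "\<dots> = (\<integral>\<^sup>+y. \<integral>\<^sup>+p. G (y, p) \<partial>lborel \<partial>lborel)"
    using nn_integral_lborel_pair[OF borel_measurable_slice[OF G]] by (simp add: H_def)
  also have "\<dots> = (\<integral>\<^sup>+z. G z \<partial>lborel)" by (rule nn_integral_lborel_pair[OF G, symmetric])
  finally show "(\<integral>\<^sup>+w. F (snd (fst w), (fst (fst w), snd w)) * indicator ((A \<times> B) \<times> C) w \<partial>lborel)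
    = (\<integral>\<^sup>+z. F z * indicator (B \<times> (A \<times> C)) z \<partial>lborel)" by (simp add: G_def)
qed auto

lemma measure_preserving_enlarge:
  fixes q :: "'a::euclidean_space \<Rightarrow> 'b::euclidean_space"
  assumes mp: "measure_preserving_on q A B" and B': "B' \<in> sets borel" "B \<subseteq> B'" and null: "AE z in lborel. z \<in> B' \<longrightarrow> z \<in> B"
  shows "measure_preserving_on q A B'"
  unfolding measure_preserving_on_def
proof (intro conjI ballI)
  show "A \<in> sets borel" "q \<in> borel_measurable borel" by (rule measure_preservingD[OF mp])+
  show "q x \<in> B'" if "x \<in> A" for x using measure_preservingD(4)[OF mp that] B' by blast
  fix F :: "'b \<Rightarrow> ennreal" assume F: "F \<in> borel_measurable borel"
  have "(\<integral>\<^sup>+y. F y * indicator B y \<partial>lborel) = (\<integral>\<^sup>+y. F y * indicator B' y \<partial>lborel)"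
    by (rule nn_integral_cong_AE) (use null B' in \<open>auto elim!: eventually_mono simp: indicator_def\<close>)
  then show "(\<integral>\<^sup>+x. F (q x) * indicator A x \<partial>lborel) = (\<integral>\<^sup>+y. F y * indicator B' y \<partial>lborel)"
    using measure_preservingD(5)[OF mp F] by simp
qed fact

lemma square_integral_le_integral_square:
  fixes g :: "'a \<Rightarrow> real"
  assumes "integrable M (\<lambda>x. (g x)\<^sup>2)" "g \<in> borel_measurable M" "measure M (space M) = 1" "finite_measure M"
  shows "(LINT x|M. g x)\<^sup>2 \<le> (LINT x|M. (g x)\<^sup>2)"
proof -
  interpret finite_measure M by fact
  have "g \<in> L2 M" "(\<lambda>x. 1) \<in> L2 M" using assms by (auto simp: L2_def)
  from L2_cauchy_schwarz[OF this] show ?thesis using assms(3) by simp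
qed

lemma finite_measure_lebesgue_on_unit_cell: "finite_measure (lebesgue_on (unit_cell :: (real ^ 'n) set))"
  unfolding unit_cell_def by (intro finite_measure_lebesgue_on) auto

lemma measure_lebesgue_on_unit_cell: "measure (lebesgue_on (unit_cell :: (real ^ 'n) set)) unit_cell = 1"
proof -
  have "measure (lebesgue_on (unit_cell :: (real ^ 'n) set)) unit_cell = measure lborel (unit_cell :: (real ^ 'n) set)"
    by (subst measure_restrict_space) (auto simp: unit_cell_def)
  then show ?thesis by (simp add: measure_def emeasure_unit_cell)
qed

locale perforation = unfolding_cells a b \<epsilon> \<Omega>
  for a b :: "nat ^ 'n" and \<epsilon> :: real and \<Omega> :: "(real ^ 'n) set" +
  fixes Ystar \<Omega>\<^sub>\<epsilon> :: "(real ^ 'n) set"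
  assumes Ystar: "Ystar \<subseteq> unit_cell" "open Ystar" "lipschitz_boundary Ystar"
    and Omega_eps: "\<Omega>\<^sub>\<epsilon> = perforated \<epsilon> \<Omega> Ystar"
begin

lemma Omega_eps_eq: "\<Omega>\<^sub>\<epsilon> = interior (cell_union (closure Ystar))"
  by (simp add: Omega_eps perforated_def cell_union_def)

lemma open_Omega_eps: "open \<Omega>\<^sub>\<epsilon>"
  by (simp add: Omega_eps_eq)

lemma bounded_Ystar: "bounded Ystar"
  using Ystar(1) bounded_box bounded_subset unfolding unit_cell_def by blast

lemma affine_cell: "\<epsilon> *\<^sub>R (y + int_vec k) = \<epsilon> *\<^sub>R int_vec k + \<epsilon> *\<^sub>R y"
  by (simp add: algebra_simps)

lemma bounded_Omega_eps: "bounded \<Omega>\<^sub>\<epsilon>"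
proof -
  have "bounded (cell_union (closure Ystar))"
    unfolding cell_union_def
  proof (intro bounded_UN finite_cell_indices ballI)
    fix k
    have "bounded ((\<lambda>y. \<epsilon> *\<^sub>R y) ` closure Ystar)"
      by (intro bounded_scaling bounded_closure bounded_Ystar)
    from bounded_translation[OF this, of "\<epsilon> *\<^sub>R int_vec k"]
    have "bounded ((\<lambda>y. \<epsilon> *\<^sub>R int_vec k + \<epsilon> *\<^sub>R y) ` closure Ystar)"
      by (simp add: image_image)
    then show "bounded ((\<lambda>y. \<epsilon> *\<^sub>R (y + int_vec k)) ` closure Ystar)" by (simp add: affine_cell)
  qed
  then show ?thesis unfolding Omega_eps_eq using interior_subset bounded_subset by blast
qed

lemma open_cell_union: "open A \<Longrightarrow> open (cell_union A)"
proof -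
  assume A: "open A"
  have "open ((\<lambda>y. \<epsilon> *\<^sub>R (y + int_vec k)) ` A)" for k
  proof -
    have "open ((+) (\<epsilon> *\<^sub>R int_vec k) ` ((*\<^sub>R) \<epsilon> ` A))"
      using eps A by (intro open_translation open_scaling) auto
    then show ?thesis by (simp add: image_image affine_cell)
  qed
  then show ?thesis unfolding cell_union_def by blast
qed

lemma cell_union_subset_Omega_eps: "cell_union Ystar \<subseteq> \<Omega>\<^sub>\<epsilon>"
  unfolding Omega_eps_eq
  by (rule interior_maximal[OF _ open_cell_union[OF Ystar(2)]]) (use closure_subset in \<open>auto simp: cell_union_def\<close>)

text \<open>A point of the perforated domain outside all open perforated cells lies on a
  scaled copy of the frontier of Ystar, which is a null set.\<close>

lemma AE_Omega_eps: "AE z in lborel. z \<in> \<Omega>\<^sub>\<epsilon> \<longrightarrow> z \<in> cell_union Ystar"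
proof -
  have "{z. z /\<^sub>R \<epsilon> - int_vec k \<in> frontier Ystar} \<in> null_sets lborel" for k
  proof -
    let ?B = "{z. z /\<^sub>R \<epsilon> - int_vec k \<in> frontier Ystar}"
    have fr: "frontier Ystar \<in> null_sets lborel" by (rule lipschitz_boundary_null_sets[OF Ystar(3,2)])
    then have [measurable]: "frontier Ystar \<in> sets borel" by auto
    have B[measurable]: "?B \<in> sets borel" by measurable
    have "emeasure lborel ?B = ennreal (\<epsilon> ^ CARD('n)) * (\<integral>\<^sup>+y. indicator ?B (\<epsilon> *\<^sub>R int_vec k + \<epsilon> *\<^sub>R y) \<partial>lborel)"
      using nn_integral_affine[OF eps(1), of "indicator ?B" "\<epsilon> *\<^sub>R int_vec k"] by (simp add: DIM_cart)
    also have "(\<integral>\<^sup>+y. indicator ?B (\<epsilon> *\<^sub>R int_vec k + \<epsilon> *\<^sub>R y) \<partial>lborel) = (\<integral>\<^sup>+y. indicator (frontier Ystar) y \<partial>lborel)"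
      using eps by (intro nn_integral_cong) (simp add: indicator_def scaleR_add_right[symmetric])
    also have "\<dots> = 0" using fr by (simp add: null_setsD1)
    finally show ?thesis using B by (simp add: null_sets_def)
  qed
  then have "AE z in lborel. \<forall>k\<in>cell_indices \<epsilon> \<Omega>. z \<notin> {z. z /\<^sub>R \<epsilon> - int_vec k \<in> frontier Ystar}"
    unfolding AE_ball_countable[OF countable_finite[OF finite_cell_indices]] by (blast intro: AE_not_in)
  then show ?thesis
  proof eventually_elim
    case (elim z)
    show ?case
    proof
      assume "z \<in> \<Omega>\<^sub>\<epsilon>"
      then have "z \<in> cell_union (closure Ystar)" using interior_subset by (auto simp: Omega_eps_eq)
      then obtain k y where k: "k \<in> cell_indices \<epsilon> \<Omega>" and y: "y \<in> closure Ystar" and z: "z = \<epsilon> *\<^sub>R (y + int_vec k)"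
        unfolding cell_union_def by blast
      have "z /\<^sub>R \<epsilon> - int_vec k = y" using eps by (simp add: z)
      then have "y \<notin> frontier Ystar" using elim k by auto
      then have "y \<in> Ystar" using y Ystar(2) by (auto simp: frontier_def interior_open)
      then show "z \<in> cell_union Ystar" using k z unfolding cell_union_def by blast
    qed
  qed
qed

lemma Ystar_borel: "Ystar \<in> sets borel"
  using Ystar(2) by simp

lemma Omega_eps_borel: "\<Omega>\<^sub>\<epsilon> \<in> sets borel"
  using open_Omega_eps by simp

lemma unit_cell_borel: "unit_cell \<in> sets borel"
  by (simp add: unit_cell_def)

lemma unfold_map_measure_preserving_Ystar: "measure_preserving_on unfold_map (\<Omega> \<times> Ystar) \<Omega>\<^sub>\<epsilon>"
  by (rule measure_preserving_enlarge[OF unfold_map_measure_preserving[OF Ystar_borel Ystar(1)] Omega_eps_borel cell_union_subset_Omega_eps AE_Omega_eps])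

text \<open>With the full unit cell in place of Ystar, the image of the unfolding map is
  \<Omega> up to a null set: both have the same finite volume.\<close>

lemma unfold_map_measure_preserving_full: "measure_preserving_on unfold_map (\<Omega> \<times> unit_cell) \<Omega>"
proof (rule measure_preserving_enlarge[OF unfold_map_measure_preserving[OF unit_cell_borel order_refl] Omega_borel])
  note mp = unfold_map_measure_preserving[OF unit_cell_borel order_refl]
  show sub: "cell_union unit_cell \<subseteq> \<Omega>"
    using cell_subset by (auto simp: cell_union_def)
  have cb: "cell_union unit_cell \<in> sets borel" by (rule measure_preservingD(2)[OF mp])
  have "emeasure lborel (cell_union unit_cell) = emeasure lborel (\<Omega> \<times> (unit_cell :: (real ^ 'n) set))"
    using measure_preservingD(5)[OF mp, of "\<lambda>_. 1"] measure_preservingD(1)[OF mp] cb by simp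
  also have "\<dots> = emeasure lborel \<Omega>"
    unfolding lborel_prod[symmetric] using Omega_borel unit_cell_borel
    by (subst lborel.emeasure_pair_measure_Times) (auto simp: emeasure_unit_cell)
  finally have eq: "emeasure lborel (cell_union unit_cell) = emeasure lborel \<Omega>" .
  have fin: "emeasure lborel \<Omega> < \<infinity>" unfolding Omega box_domain_def by (rule emeasure_lborel_box_finite)
  have "emeasure lborel (\<Omega> - cell_union unit_cell) = 0"
    using emeasure_Diff[of lborel "cell_union unit_cell" \<Omega>] eq fin sub cb Omega_borel by simp
  then have "\<Omega> - cell_union unit_cell \<in> null_sets lborel" using cb Omega_borel by (intro null_setsI) auto
  then show "AE z in lborel. z \<in> \<Omega> \<longrightarrow> z \<in> cell_union unit_cell"
    by (auto dest: AE_not_in elim: eventually_mono)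
qed

text \<open>The first component is replaced by the point with relative position z in the
  same cell. Averaging over z is the averaging operator, because the unfolding map does not
  notice the replacement.\<close>

definition block_map :: "((real ^ 'n) \<times> (real ^ 'n)) \<times> (real ^ 'n) \<Rightarrow> (real ^ 'n) \<times> (real ^ 'n)" where
  "block_map w = (unfold_map (fst (fst w), snd w), snd (fst w))"

lemma block_map_measure_preserving: "measure_preserving_on block_map ((\<Omega> \<times> Ystar) \<times> unit_cell) (\<Omega> \<times> Ystar)"
proof -
  have "measure_preserving_on (\<lambda>w. (fst (snd (fst w), (fst (fst w), snd w)), unfold_map (snd (snd (fst w), (fst (fst w), snd w)))))
      ((\<Omega> \<times> Ystar) \<times> unit_cell) (Ystar \<times> \<Omega>)"
    by (rule measure_preserving_comp[OF measure_preserving_permute[OF Omega_borel Ystar_borel unit_cell_borel] measure_preserving_prod_right[OF unfold_map_measure_preserving_full Ystar_borel]])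
  from measure_preserving_comp[OF this measure_preserving_swap[OF Ystar_borel Omega_borel]]
  show ?thesis by (simp add: block_map_def[abs_def])
qed

lemma floor_unfold_map:
  assumes "y \<in> unit_cell"
  shows "floor_vec (unfold_map (x, y) /\<^sub>R \<epsilon>) = floor_vec (x /\<^sub>R \<epsilon>)" "frac_vec (unfold_map (x, y) /\<^sub>R \<epsilon>) = y"
  by (simp_all only: unfold_map_eq floor_cell[OF assms] floor_vec_eq)

lemma unfold_map_block_map:
  assumes "z \<in> unit_cell"
  shows "unfold_map (block_map (p, z)) = unfold_map p"
  by (simp only: block_map_def unfold_map_def[of "(unfold_map (_, _), _)"] unfold_map_def[of p] fst_conv snd_conv floor_unfold_map[OF assms])

lemma averaging_op_unfold_map:
  assumes "p \<in> \<Omega> \<times> Ystar"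
  shows "averaging_op \<epsilon> f (unfold_map p) = (LINT z|lebesgue_on unit_cell. f (block_map (p, z)))"
proof -
  obtain x y where p: "p = (x, y)" "y \<in> unit_cell" using assms Ystar(1) by auto
  show ?thesis
    unfolding averaging_op_def p(1) block_map_def floor_unfold_map[OF p(2)]
    by (simp add: unfold_map_def scaleR_add_right add.commute)
qed

text \<open>The block map preserves measure. Hence for almost every point of the perforated
  domain the average only meets points where f coincides with a Borel version, and averages
  of Borel functions are measurable.\<close>

lemma averaging_op_measurable:
  assumes f: "f \<in> borel_measurable (lebesgue_on (\<Omega> \<times> Ystar))"
  shows "averaging_op \<epsilon> f \<in> borel_measurable (lebesgue_on \<Omega>\<^sub>\<epsilon>)"
proof -
  have OY: "\<Omega> \<times> Ystar \<in> sets borel" by (intro sets_borel_Times Omega_borel Ystar_borel)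
  obtain f' where f': "f' \<in> borel_measurable borel" and ff': "AE z in lborel. z \<in> \<Omega> \<times> Ystar \<longrightarrow> f z = f' z" and "\<And>z. z \<notin> \<Omega> \<times> Ystar \<Longrightarrow> f' z = 0"
    by (rule borel_version[OF OY f]) (rule that; assumption)
  obtain N where N: "\<And>z. z \<notin> N \<Longrightarrow> z \<in> \<Omega> \<times> Ystar \<Longrightarrow> f z = f' z" "N \<in> null_sets lborel"
    using AE_E3[OF ff'] by auto
  \<comment> \<open>S (x, z) is the argument of f in the average at x. The value h x is the
    measure of the set of z whose argument lies in the exceptional set N, where f differs
    from the Borel version.\<close>
  define S where "S w = (\<epsilon> *\<^sub>R (snd w + floor_vec (fst w /\<^sub>R \<epsilon>)), frac_vec (fst w /\<^sub>R \<epsilon>))" for w :: "(real ^ 'n) \<times> (real ^ 'n)"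
  have S: "S \<in> borel_measurable borel"
    unfolding S_def[abs_def] frac_vec_def borel_prod[symmetric] by measurable
  have NY: "N \<inter> (\<Omega> \<times> Ystar) \<in> sets borel" using N(2) OY by auto
  define h where "h x = (\<integral>\<^sup>+z. indicator (N \<inter> (\<Omega> \<times> Ystar)) (S (x, z)) * indicator unit_cell z \<partial>lborel)" for x
  have hm0: "(\<lambda>w. indicator (N \<inter> (\<Omega> \<times> Ystar)) (S w) * indicator unit_cell (snd w) :: ennreal) \<in> borel_measurable borel"
    by (intro borel_measurable_times_ennreal measurable_compose[OF S] borel_measurable_indicator NY
        measurable_compose[of snd borel borel, OF borel_measurable_continuous_onI] unit_cell_borel continuous_intros)
  have h: "h \<in> borel_measurable borel"
    using borel_measurable_nn_integral_slice[OF hm0] by (simp add: h_def[abs_def])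
  have "AE w in lborel. w \<in> (\<Omega> \<times> Ystar) \<times> unit_cell \<longrightarrow> block_map w \<notin> N \<inter> (\<Omega> \<times> Ystar)"
    unfolding measure_preserving_AE_notin_iff[OF block_map_measure_preserving NY] using AE_not_in[OF N(2)] by eventually_elim simp
  then have "AE p in lborel. AE z in lborel. (p, z) \<in> (\<Omega> \<times> Ystar) \<times> unit_cell \<longrightarrow> block_map (p, z) \<notin> N \<inter> (\<Omega> \<times> Ystar)"
    by (rule AE_lborel_pair)
  then have "AE p in lborel. p \<in> \<Omega> \<times> Ystar \<longrightarrow> unfold_map p \<notin> {x. h x \<noteq> 0}"
  proof eventually_elim
    case (elim p)
    show ?case
    proof
      assume p: "p \<in> \<Omega> \<times> Ystar"
      have "h (unfold_map p) = (\<integral>\<^sup>+z. 0 \<partial>(lborel :: (real ^ 'n) measure))"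
        unfolding h_def
      proof (rule nn_integral_cong_AE, use elim in eventually_elim)
        case (elim z)
        obtain x y where xy: "p = (x, y)" "y \<in> unit_cell" using p Ystar(1) by auto
        have "S (unfold_map p, z) = block_map (p, z)" if "z \<in> unit_cell"
          unfolding S_def block_map_def xy(1) fst_conv snd_conv floor_unfold_map[OF xy(2)]
          by (simp add: unfold_map_def scaleR_add_right add.commute)
        moreover have "block_map (p, z) \<notin> N \<inter> (\<Omega> \<times> Ystar)" if "z \<in> unit_cell"
          using mp[OF elim SigmaI[OF p that]] .
        ultimately show ?case by (cases "z \<in> unit_cell") simp_all
      qed
      then show "unfold_map p \<notin> {x. h x \<noteq> 0}" by simp
    qed
  qed
  moreover have "{x. h x \<noteq> 0} \<in> sets borel" using h by measurable
  ultimately have ae: "AE x in lborel. x \<in> \<Omega>\<^sub>\<epsilon> \<longrightarrow> x \<notin> {x. h x \<noteq> 0}"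
    using measure_preserving_AE_notin_iff[OF unfold_map_measure_preserving_Ystar] by blast
  have f'S: "(\<lambda>w. f' (S w) * indicator unit_cell (snd w)) \<in> borel_measurable (borel \<Otimes>\<^sub>M lborel)"
  proof -
    have "(\<lambda>w. f' (S w) * indicator unit_cell (snd w)) \<in> borel_measurable borel"
      by (intro borel_measurable_times measurable_compose[OF S f'] borel_measurable_indicator
          measurable_compose[of snd borel borel, OF borel_measurable_continuous_onI] unit_cell_borel continuous_intros)
    then show ?thesis by (simp add: borel_prod[symmetric] cong: measurable_cong_sets)
  qed
  have "(\<lambda>x. LINT z|lborel. f' (S (x, z)) * indicator unit_cell z) \<in> borel_measurable borel"
    using lborel.borel_measurable_lebesgue_integral[of "\<lambda>x z. f' (S (x, z)) * indicator unit_cell z" borel] f'S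
    by (simp add: case_prod_beta')
  moreover have "AE x in lborel. x \<in> \<Omega>\<^sub>\<epsilon> \<longrightarrow> averaging_op \<epsilon> f x = (LINT z|lborel. f' (S (x, z)) * indicator unit_cell z)"
    using ae AE_Omega_eps
  proof eventually_elim
    case (elim x)
    show ?case
    proof
      assume x: "x \<in> \<Omega>\<^sub>\<epsilon>"
      then have h0: "h x = 0" and xc: "x \<in> cell_union Ystar" using elim by auto
      have k: "floor_index (x /\<^sub>R \<epsilon>) \<in> cell_indices \<epsilon> \<Omega>" "frac_vec (x /\<^sub>R \<epsilon>) \<in> Ystar"
        using xc cell_union_iff[OF Ystar(1)] by auto
      have SO: "S (x, z) \<in> \<Omega> \<times> Ystar" if "z \<in> unit_cell" for z
        using k that cell_subset[OF k(1) that] by (simp add: S_def floor_vec_eq)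
      have slice: "(\<lambda>z. indicator (N \<inter> (\<Omega> \<times> Ystar)) (S (x, z)) * indicator unit_cell z :: ennreal) \<in> borel_measurable lborel"
        using borel_measurable_slice[OF hm0, of x] by simp
      have "AE z in lborel. z \<in> unit_cell \<longrightarrow> f (S (x, z)) = f' (S (x, z))"
        using h0[unfolded h_def nn_integral_0_iff_AE[OF slice]]
      proof eventually_elim
        case (elim z)
        show ?case
        proof
          assume z: "z \<in> unit_cell"
          then have "S (x, z) \<notin> N" using elim SO[OF z] by (auto simp: indicator_def split: if_splits)
          then show "f (S (x, z)) = f' (S (x, z))" by (rule N(1)[OF _ SO[OF z]])
        qed
      qed
      from integral_lebesgue_on_cong_AE(2)[OF unit_cell_borel _ this]
      show "averaging_op \<epsilon> f x = (LINT z|lborel. f' (S (x, z)) * indicator unit_cell z)"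
        using borel_measurable_slice[OF measurable_compose[OF S f'], of x]
        by (simp add: averaging_op_def S_def mult.commute)
    qed
  qed
  ultimately show ?thesis by (rule borel_measurable_lebesgue_onI[OF Omega_eps_borel])
qed

text \<open>Composition with the block map leaves the integral of (w o unfold_map) f
  unchanged and does not alter w o unfold_map. Integrating over z first produces the average
  of f.\<close>

theorem averaging_op_adjoint:
  assumes f: "f \<in> L2_on (\<Omega> \<times> Ystar)" and w: "w \<in> L2_on \<Omega>\<^sub>\<epsilon>"
  shows "(LINT p|lebesgue_on (\<Omega> \<times> Ystar). w (unfold_map p) * f p) = (LINT x|lebesgue_on \<Omega>\<^sub>\<epsilon>. w x * averaging_op \<epsilon> f x)"
proof -
  have OY: "\<Omega> \<times> Ystar \<in> sets borel" by (intro sets_borel_Times Omega_borel Ystar_borel)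
  have wu: "(\<lambda>p. w (unfold_map p)) \<in> L2_on (\<Omega> \<times> Ystar)" by (rule measure_preserving_L2(1)[OF unfold_map_measure_preserving_Ystar w])
  define h where "h p = w (unfold_map p) * f p" for p
  have hint: "integrable (lebesgue_on (\<Omega> \<times> Ystar)) h"
    unfolding h_def using wu f by (intro L2_mult_integrable) (auto simp: L2_on_eq)
  note hm = borel_measurable_integrable[OF hint]
  have int3: "integrable (lebesgue_on ((\<Omega> \<times> Ystar) \<times> unit_cell)) (\<lambda>v. h (block_map v))"
    using measure_preserving_integral(1)[OF block_map_measure_preserving hm] hint by simp
  have "(LINT p|lebesgue_on (\<Omega> \<times> Ystar). h p) = (LINT v|lebesgue_on ((\<Omega> \<times> Ystar) \<times> unit_cell). h (block_map v))"
    by (rule measure_preserving_integral(2)[OF block_map_measure_preserving hm, symmetric])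
  also have "\<dots> = (LINT p|lebesgue_on (\<Omega> \<times> Ystar). LINT z|lebesgue_on unit_cell. h (block_map (p, z)))"
    by (rule integral_lebesgue_on_fst[OF OY unit_cell_borel int3, symmetric])
  also have "\<dots> = (LINT p|lebesgue_on (\<Omega> \<times> Ystar). w (unfold_map p) * averaging_op \<epsilon> f (unfold_map p))"
  proof (rule Bochner_Integration.integral_cong[OF refl])
    fix p assume "p \<in> space (lebesgue_on (\<Omega> \<times> Ystar))"
    then have p: "p \<in> \<Omega> \<times> Ystar" by simp
    have "(LINT z|lebesgue_on unit_cell. h (block_map (p, z))) = (LINT z|lebesgue_on unit_cell. w (unfold_map p) * f (block_map (p, z)))"
      by (rule Bochner_Integration.integral_cong[OF refl]) (simp add: h_def unfold_map_block_map)
    then show "(LINT z|lebesgue_on unit_cell. h (block_map (p, z))) = w (unfold_map p) * averaging_op \<epsilon> f (unfold_map p)"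
      by (simp add: averaging_op_unfold_map[OF p])
  qed
  also have "\<dots> = (LINT x|lebesgue_on \<Omega>\<^sub>\<epsilon>. w x * averaging_op \<epsilon> f x)"
  proof (rule measure_preserving_integral(2)[OF unfold_map_measure_preserving_Ystar])
    show "(\<lambda>x. w x * averaging_op \<epsilon> f x) \<in> borel_measurable (lebesgue_on \<Omega>\<^sub>\<epsilon>)"
      using w f by (intro borel_measurable_times averaging_op_measurable) (auto simp: L2_on_def)
  qed
  finally show ?thesis by (simp add: h_def)
qed

text \<open>Jensen's inequality for the average over z.\<close>

theorem averaging_op_L2:
  assumes f: "f \<in> L2_on (\<Omega> \<times> Ystar)"
  shows "averaging_op \<epsilon> f \<in> L2_on \<Omega>\<^sub>\<epsilon>"
    and "(LINT x|lebesgue_on \<Omega>\<^sub>\<epsilon>. (averaging_op \<epsilon> f x)\<^sup>2) \<le> (LINT p|lebesgue_on (\<Omega> \<times> Ystar). (f p)\<^sup>2)"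
proof -
  have OY: "\<Omega> \<times> Ystar \<in> sets borel" by (intro sets_borel_Times Omega_borel Ystar_borel)
  have fm: "f \<in> borel_measurable (lebesgue_on (\<Omega> \<times> Ystar))" and fint: "integrable (lebesgue_on (\<Omega> \<times> Ystar)) (\<lambda>p. (f p)\<^sup>2)"
    using f by (auto simp: L2_on_def)
  note Um = averaging_op_measurable[OF fm]
  have int3: "integrable (lebesgue_on ((\<Omega> \<times> Ystar) \<times> unit_cell)) (\<lambda>v. (f (block_map v))\<^sup>2)"
    using measure_preserving_integral(1)[OF block_map_measure_preserving borel_measurable_integrable[OF fint]] fint by simp
  define g where "g p = (LINT z|lebesgue_on unit_cell. (f (block_map (p, z)))\<^sup>2)" for p
  have gint: "integrable (lebesgue_on (\<Omega> \<times> Ystar)) g"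
    unfolding g_def by (rule integrable_lebesgue_on_fst[OF OY unit_cell_borel int3])
  have "AE p in lebesgue_on (\<Omega> \<times> Ystar). (averaging_op \<epsilon> f (unfold_map p))\<^sup>2 \<le> g p"
    using AE_integrable_lebesgue_on_slice[OF OY unit_cell_borel int3]
      AE_measurable_lebesgue_on_slice[OF OY unit_cell_borel measure_preserving_measurable[OF block_map_measure_preserving fm]] AE_space
  proof eventually_elim
    case (elim p)
    then have p: "p \<in> \<Omega> \<times> Ystar" by simp
    show ?case
      unfolding averaging_op_unfold_map[OF p] g_def
      by (rule square_integral_le_integral_square)
         (use elim measure_lebesgue_on_unit_cell finite_measure_lebesgue_on_unit_cell in simp_all)
  qed
  then have ae: "AE p in lebesgue_on (\<Omega> \<times> Ystar). (averaging_op \<epsilon> f (unfold_map p))\<^sup>2 \<le> g p" .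
  have Uu: "(\<lambda>p. (averaging_op \<epsilon> f (unfold_map p))\<^sup>2) \<in> borel_measurable (lebesgue_on (\<Omega> \<times> Ystar))"
    by (intro borel_measurable_power measure_preserving_measurable[OF unfold_map_measure_preserving_Ystar Um])
  have Uint: "integrable (lebesgue_on (\<Omega> \<times> Ystar)) (\<lambda>p. (averaging_op \<epsilon> f (unfold_map p))\<^sup>2)"
    by (rule Bochner_Integration.integrable_bound[OF gint Uu]) (use ae in \<open>auto elim!: eventually_mono\<close>)
  have Um2: "(\<lambda>x. (averaging_op \<epsilon> f x)\<^sup>2) \<in> borel_measurable (lebesgue_on \<Omega>\<^sub>\<epsilon>)" using Um by simp
  show "averaging_op \<epsilon> f \<in> L2_on \<Omega>\<^sub>\<epsilon>"
    using Um measure_preserving_integral(1)[OF unfold_map_measure_preserving_Ystar Um2] Uint by (simp add: L2_on_def)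
  have "(LINT x|lebesgue_on \<Omega>\<^sub>\<epsilon>. (averaging_op \<epsilon> f x)\<^sup>2) = (LINT p|lebesgue_on (\<Omega> \<times> Ystar). (averaging_op \<epsilon> f (unfold_map p))\<^sup>2)"
    by (rule measure_preserving_integral(2)[OF unfold_map_measure_preserving_Ystar Um2, symmetric])
  also have "\<dots> \<le> (LINT p|lebesgue_on (\<Omega> \<times> Ystar). g p)"
    by (rule integral_mono_AE[OF Uint gint ae])
  also have "\<dots> = (LINT v|lebesgue_on ((\<Omega> \<times> Ystar) \<times> unit_cell). (f (block_map v))\<^sup>2)"
    unfolding g_def by (rule integral_lebesgue_on_fst[OF OY unit_cell_borel int3])
  also have "\<dots> = (LINT p|lebesgue_on (\<Omega> \<times> Ystar). (f p)\<^sup>2)"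
    by (rule measure_preserving_integral(2)[OF block_map_measure_preserving borel_measurable_integrable[OF fint]])
  finally show "(LINT x|lebesgue_on \<Omega>\<^sub>\<epsilon>. (averaging_op \<epsilon> f x)\<^sup>2) \<le> (LINT p|lebesgue_on (\<Omega> \<times> Ystar). (f p)\<^sup>2)" .
qed

end

section \<open>Square integrable functions with values in a Sobolev space\<close>

lemma lebesgue_on_measurable_cong_AE:
  fixes u w :: "'a::euclidean_space \<Rightarrow> real"
  assumes S: "S \<in> sets borel" and u: "u \<in> borel_measurable (lebesgue_on S)" and ae: "AE x in lebesgue_on S. u x = w x"
  shows "w \<in> borel_measurable (lebesgue_on S)"
proof -
  obtain u' where u': "u' \<in> borel_measurable borel" "AE x in lborel. x \<in> S \<longrightarrow> u x = u' x" and "\<And>x. x \<notin> S \<Longrightarrow> u' x = 0"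
    by (rule borel_version[OF S u]) (rule that; assumption)
  show ?thesis
    by (rule borel_measurable_lebesgue_onI[OF S u'(1)])
       (use u'(2) ae[unfolded AE_lebesgue_on_iff[OF S]] in \<open>eventually_elim, auto\<close>)
qed

lemma H1_norm_nonneg: "0 \<le> H1_norm Z u"
  by (simp add: H1_norm_def scaled_H1_norm_nonneg)

context
  fixes Z :: "'z::euclidean_space set"
  assumes Z: "open Z" "bounded Z"
begin

lemma H1_fun_diff: "u \<in> H1 Z \<Longrightarrow> w \<in> H1 Z \<Longrightarrow> u - w \<in> H1 Z"
  by (simp add: fun_diff_def H1_diff[OF Z])

lemma H1_norm_minus: "u \<in> H1 Z \<Longrightarrow> w \<in> H1 Z \<Longrightarrow> H1_norm Z (u - w) = H1_norm Z (w - u)"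
proof -
  assume u: "u \<in> H1 Z" and w: "w \<in> H1 Z"
  have "u - w = (\<lambda>x. - 1 * (w - u) x)" by (auto simp: fun_eq_iff)
  then show ?thesis
    using scaled_H1_norm_cmult[OF Z H1_fun_diff[OF w u], of 1 "-1"] by (simp only: H1_norm_def abs_minus abs_one mult_1)
qed

lemma H1_norm_diff_triangle:
  assumes "u \<in> H1 Z" "v \<in> H1 Z" "w \<in> H1 Z"
  shows "H1_norm Z (u - w) \<le> H1_norm Z (u - v) + H1_norm Z (v - w)"
proof -
  have "u - w = (\<lambda>x. (u - v) x + (v - w) x)" by (auto simp: fun_eq_iff)
  then show ?thesis
    using scaled_H1_norm_triangle[OF Z H1_fun_diff[OF assms(1,2)] H1_fun_diff[OF assms(2,3)], of 1] by (simp only: H1_norm_def)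
qed

lemma zero_H1: "(\<lambda>x. 0) \<in> H1 Z"
  by (rule H1_I[of _ _ "\<lambda>x. 0"]) (auto simp: is_weak_gradient_def L2_on_def)

lemma H1_norm_zero: "H1_norm Z (\<lambda>x. 0) = 0"
  unfolding H1_norm_def by (rule scaled_H1_norm_AE_zero[OF Z]) auto

lemma H1_norm_diff_bounds:
  assumes u: "u \<in> H1 Z" and w: "w \<in> H1 Z"
  shows "H1_norm Z (u - w) \<le> H1_norm Z u + H1_norm Z w" "H1_norm Z u \<le> H1_norm Z (u - w) + H1_norm Z w"
    "H1_norm Z ((\<lambda>x. 0) - w) = H1_norm Z w"
proof -
  have z: "f - (\<lambda>x. 0) = f" for f :: "'z \<Rightarrow> real" by (auto simp: fun_eq_iff)
  show 3: "H1_norm Z ((\<lambda>x. 0) - w) = H1_norm Z w" using H1_norm_minus[OF zero_H1 w] by (simp only: z)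
  show "H1_norm Z (u - w) \<le> H1_norm Z u + H1_norm Z w" using H1_norm_diff_triangle[OF u zero_H1 w] by (simp only: z 3)
  show "H1_norm Z u \<le> H1_norm Z (u - w) + H1_norm Z w" using H1_norm_diff_triangle[OF u w zero_H1] by (simp only: z)
qed

text \<open>The approximating functions t k of a strongly measurable function converge only
  almost everywhere. Setting them to zero where their norm exceeds twice that of \<phi>
  keeps the convergence and bounds the error by three times the norm of \<phi>, so that
  dominated convergence applies.\<close>

lemma bochner_L2_simple_approximation:
  fixes \<Omega> :: "'x::euclidean_space set" and \<phi> :: "'x \<Rightarrow> 'z \<Rightarrow> real"
  assumes Om: "\<Omega> \<in> sets borel" and V: "V \<subseteq> H1 Z" "(\<lambda>x. 0) \<in> V"
    and \<phi>: "\<phi> \<in> bochner_L2 (lebesgue_on \<Omega>) V (H1_norm Z)"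
  obtains s where "\<And>k. simple_function (lebesgue_on \<Omega>) (s k)" "\<And>k x. x \<in> \<Omega> \<Longrightarrow> s k x \<in> V"
    "\<And>k. integrable (lebesgue_on \<Omega>) (\<lambda>x. (H1_norm Z (s k x - \<phi> x))\<^sup>2)"
    "(\<lambda>k. LINT x|lebesgue_on \<Omega>. (H1_norm Z (s k x - \<phi> x))\<^sup>2) \<longlonglongrightarrow> 0"
proof -
  let ?M = "lebesgue_on \<Omega>" and ?N = "H1_norm Z"
  obtain t where t: "\<And>k. simple_function ?M (t k)" "\<And>k. t k ` space ?M \<subseteq> V"
    and lim: "AE x in ?M. \<phi> x \<in> V \<and> (\<lambda>k. ?N (t k x - \<phi> x)) \<longlonglongrightarrow> 0"
    and int: "integrable ?M (\<lambda>x. (?N (\<phi> x))\<^sup>2)"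
    using \<phi> unfolding bochner_L2_def strongly_measurable_def by blast
  have N\<phi>: "(\<lambda>x. ?N (\<phi> x)) \<in> borel_measurable ?M"
  proof -
    have "(\<lambda>x. sqrt ((?N (\<phi> x))\<^sup>2)) \<in> borel_measurable ?M" using int by measurable
    then show ?thesis by (simp add: H1_norm_nonneg)
  qed
  \<comment> \<open>The norm of the difference to \<phi> is a limit of norms of differences
    of simple functions, hence measurable.\<close>
  have meas: "(\<lambda>x. ?N (s x - \<phi> x)) \<in> borel_measurable ?M"
    if s: "simple_function ?M s" "\<And>x. x \<in> \<Omega> \<Longrightarrow> s x \<in> V" for s
  proof (rule lebesgue_on_measurable_cong_AE[OF Om])
    have sm: "(\<lambda>x. ?N (s x - t k x)) \<in> borel_measurable ?M" for k
      by (rule borel_measurable_simple_function) (rule simple_function_compose2[OF s(1) t(1), of "\<lambda>u w. ?N (u - w)"])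
    show "(\<lambda>x. lim (\<lambda>k. ?N (s x - t k x))) \<in> borel_measurable ?M" by (rule borel_measurable_lim_metric[OF sm])
    show "AE x in ?M. lim (\<lambda>k. ?N (s x - t k x)) = ?N (s x - \<phi> x)"
      using lim AE_space
    proof eventually_elim
      case (elim x)
      then have sx: "s x \<in> H1 Z" and px: "\<phi> x \<in> H1 Z" and tx: "\<And>k. t k x \<in> H1 Z" and l0: "(\<lambda>k. ?N (t k x - \<phi> x)) \<longlonglongrightarrow> 0"
        using s(2) t(2) V(1) by auto
      have "norm (?N (s x - t k x) - ?N (s x - \<phi> x)) \<le> ?N (t k x - \<phi> x)" for k
        using H1_norm_diff_triangle[OF sx tx[of k] px] H1_norm_diff_triangle[OF sx px tx[of k]] H1_norm_minus[OF px tx[of k]]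
        by (simp add: abs_le_iff)
      then have "(\<lambda>k. ?N (s x - t k x) - ?N (s x - \<phi> x)) \<longlonglongrightarrow> 0"
        by (intro Lim_null_comparison[OF _ l0] always_eventually) blast
      then have "(\<lambda>k. ?N (s x - t k x)) \<longlonglongrightarrow> ?N (s x - \<phi> x)" by (simp add: LIM_zero_iff)
      then show ?case by (rule limI)
    qed
  qed
  define s where "s k x = (if ?N (t k x) \<le> 2 * ?N (\<phi> x) then t k x else (\<lambda>y. 0))" for k x
  have s1: "simple_function ?M (s k)" for k
  proof -
    have Nt: "(\<lambda>x. ?N (t k x)) \<in> borel_measurable ?M"
      by (rule borel_measurable_simple_function) (rule simple_function_compose1[OF t(1)])
    have "{x \<in> space ?M. ?N (t k x) \<le> 2 * ?N (\<phi> x)} \<in> sets ?M"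
      using Nt N\<phi> by measurable
    then show ?thesis unfolding s_def[abs_def]
      by (intro simple_function_If t(1) simple_function_const) auto
  qed
  have s2: "s k x \<in> V" if "x \<in> \<Omega>" for k x using that t(2)[of k] V(2) by (auto simp: s_def)
  have bounds: "AE x in ?M. \<forall>k. ?N (s k x - \<phi> x) \<le> ?N (t k x - \<phi> x) \<and> ?N (s k x - \<phi> x) \<le> 3 * ?N (\<phi> x)"
    using lim AE_space
  proof eventually_elim
    case (elim x)
    then have px: "\<phi> x \<in> H1 Z" and tx: "\<And>k. t k x \<in> H1 Z" using t(2) V(1) by auto
    show ?case
    proof
      fix k
      show "?N (s k x - \<phi> x) \<le> ?N (t k x - \<phi> x) \<and> ?N (s k x - \<phi> x) \<le> 3 * ?N (\<phi> x)"
      proof (cases "?N (t k x) \<le> 2 * ?N (\<phi> x)")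
        case True
        then show ?thesis using H1_norm_diff_bounds(1)[OF tx[of k] px] by (simp add: s_def)
      next
        case False
        then have "?N (s k x - \<phi> x) = ?N (\<phi> x)" using H1_norm_diff_bounds(3)[OF px px] by (simp add: s_def)
        then show ?thesis using False H1_norm_diff_bounds(2)[OF tx[of k] px] H1_norm_nonneg[of Z "\<phi> x"] by linarith
      qed
    qed
  qed
  have dom: "integrable ?M (\<lambda>x. 9 * (?N (\<phi> x))\<^sup>2)" using int by simp
  have m2: "(\<lambda>x. (?N (s k x - \<phi> x))\<^sup>2) \<in> borel_measurable ?M" for k
    using meas[OF s1 s2, of k] by measurable
  have le9: "AE x in ?M. norm ((?N (s k x - \<phi> x))\<^sup>2) \<le> 9 * (?N (\<phi> x))\<^sup>2" for k
    using bounds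
  proof eventually_elim
    case (elim x)
    then have "(?N (s k x - \<phi> x))\<^sup>2 \<le> (3 * ?N (\<phi> x))\<^sup>2" by (intro power_mono H1_norm_nonneg) blast
    then show ?case by (simp add: power_mult_distrib)
  qed
  have conv: "AE x in ?M. (\<lambda>k. (?N (s k x - \<phi> x))\<^sup>2) \<longlonglongrightarrow> 0"
    using bounds lim
  proof eventually_elim
    case (elim x)
    have "\<forall>\<^sub>F k in sequentially. norm (?N (s k x - \<phi> x)) \<le> ?N (t k x - \<phi> x)"
      by (intro always_eventually allI) (use elim in \<open>simp add: abs_of_nonneg H1_norm_nonneg\<close>)
    moreover have "(\<lambda>k. ?N (t k x - \<phi> x)) \<longlonglongrightarrow> 0" using elim by blast
    ultimately have "(\<lambda>k. ?N (s k x - \<phi> x)) \<longlonglongrightarrow> 0" by (rule Lim_null_comparison)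
    then show ?case using tendsto_power[of _ 0 _ 2] by fastforce
  qed
  have "integrable ?M (\<lambda>x. (?N (s k x - \<phi> x))\<^sup>2)" for k
    by (rule Bochner_Integration.integrable_bound[OF dom m2]) (use le9[of k] in \<open>auto elim!: eventually_mono\<close>)
  moreover have "(\<lambda>k. LINT x|?M. (?N (s k x - \<phi> x))\<^sup>2) \<longlonglongrightarrow> (LINT x|?M. 0)"
    by (rule integral_dominated_convergence[OF _ m2 dom conv le9]) simp
  ultimately show ?thesis using that[of s] s1 s2 by simp
qed

end

lemma AE_lborel_fst:
  assumes "AE x in lborel. P x"
  shows "AE z in (lborel :: ('a::euclidean_space \<times> 'b::euclidean_space) measure). P (fst z)"
proof -
  obtain N where N: "\<And>x. x \<notin> N \<Longrightarrow> P x" "N \<in> null_sets lborel" using AE_E3[OF assms] by auto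
  have "N \<times> (UNIV :: 'b set) \<in> null_sets (lborel \<Otimes>\<^sub>M lborel)"
    using N(2) by (auto simp: null_sets_def lborel.emeasure_pair_measure_Times)
  from AE_not_in[OF this] show ?thesis unfolding lborel_prod by eventually_elim (rule N(1), auto simp: mem_Times_iff)
qed

lemma AE_lborel_snd:
  assumes "AE x in lborel. P x"
  shows "AE z in (lborel :: ('a::euclidean_space \<times> 'b::euclidean_space) measure). P (snd z)"
proof -
  obtain N where N: "\<And>x. x \<notin> N \<Longrightarrow> P x" "N \<in> null_sets lborel" using AE_E3[OF assms] by auto
  have "(UNIV :: 'a set) \<times> N \<in> null_sets (lborel \<Otimes>\<^sub>M lborel)"
    using N(2) by (auto simp: null_sets_def lborel.emeasure_pair_measure_Times)
  from AE_not_in[OF this] show ?thesis unfolding lborel_prod by eventually_elim (rule N(1), auto simp: mem_Times_iff)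
qed

lemma L2_on_tensor:
  fixes f :: "'a::euclidean_space \<Rightarrow> real" and g :: "'b::euclidean_space \<Rightarrow> real"
  assumes A: "A \<in> sets borel" and B: "B \<in> sets borel" and f: "f \<in> L2_on A" and g: "g \<in> L2_on B"
  shows "(\<lambda>z. f (fst z) * g (snd z)) \<in> L2_on (A \<times> B)"
proof -
  note AB = sets_borel_Times[OF A B]
  have fm: "f \<in> borel_measurable (lebesgue_on A)" and fi: "integrable (lebesgue_on A) (\<lambda>x. (f x)\<^sup>2)"
    and gm: "g \<in> borel_measurable (lebesgue_on B)" and gi: "integrable (lebesgue_on B) (\<lambda>x. (g x)\<^sup>2)"
    using f g by (auto simp: L2_on_def)
  obtain f' where f'[measurable]: "f' \<in> borel_measurable borel" and ff: "AE x in lborel. x \<in> A \<longrightarrow> f x = f' x" and f0: "\<And>x. x \<notin> A \<Longrightarrow> f' x = 0"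
    by (rule borel_version[OF A fm]) (rule that; assumption)
  obtain g' where g'[measurable]: "g' \<in> borel_measurable borel" and gg: "AE x in lborel. x \<in> B \<longrightarrow> g x = g' x" and g0: "\<And>x. x \<notin> B \<Longrightarrow> g' x = 0"
    by (rule borel_version[OF B gm]) (rule that; assumption)
  define h where "h z = f' (fst z) * g' (snd z)" for z
  have hm: "h \<in> borel_measurable borel" unfolding h_def[abs_def] borel_prod[symmetric] by measurable
  have ae: "AE z in lborel. z \<in> A \<times> B \<longrightarrow> f (fst z) * g (snd z) = h z"
    using AE_lborel_fst[OF ff, where 'b='b] AE_lborel_snd[OF gg, where 'a='a] by eventually_elim (auto simp: h_def)
  have ae2: "AE z in lborel. z \<in> A \<times> B \<longrightarrow> (f (fst z) * g (snd z))\<^sup>2 = (h z)\<^sup>2" using ae by eventually_elim simp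
  have fi': "integrable lborel (\<lambda>x. (f' x)\<^sup>2)"
  proof -
    have "(\<lambda>x. indicator A x * (f' x)\<^sup>2) = (\<lambda>x. (f' x)\<^sup>2)" using f0 by (auto simp: indicator_def fun_eq_iff)
    moreover have "AE x in lborel. x \<in> A \<longrightarrow> (f x)\<^sup>2 = (f' x)\<^sup>2" using ff by eventually_elim simp
    ultimately show ?thesis using integral_lebesgue_on_cong_AE(1)[OF A, of "\<lambda>x. (f' x)\<^sup>2" "\<lambda>x. (f x)\<^sup>2"] fi by simp
  qed
  have gi': "integrable lborel (\<lambda>x. (g' x)\<^sup>2)"
  proof -
    have "(\<lambda>x. indicator B x * (g' x)\<^sup>2) = (\<lambda>x. (g' x)\<^sup>2)" using g0 by (auto simp: indicator_def fun_eq_iff)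
    moreover have "AE x in lborel. x \<in> B \<longrightarrow> (g x)\<^sup>2 = (g' x)\<^sup>2" using gg by eventually_elim simp
    ultimately show ?thesis using integral_lebesgue_on_cong_AE(1)[OF B, of "\<lambda>x. (g' x)\<^sup>2" "\<lambda>x. (g x)\<^sup>2"] gi by simp
  qed
  have "(\<integral>\<^sup>+z. ennreal ((h z)\<^sup>2) \<partial>lborel) = (\<integral>\<^sup>+x. \<integral>\<^sup>+y. ennreal ((h (x, y))\<^sup>2) \<partial>lborel \<partial>lborel)"
    by (rule nn_integral_lborel_pair) (use hm in measurable)
  also have "\<dots> = (\<integral>\<^sup>+x. ennreal ((f' x)\<^sup>2) * (\<integral>\<^sup>+y. ennreal ((g' y)\<^sup>2) \<partial>lborel) \<partial>lborel)"
    by (intro nn_integral_cong) (simp add: h_def power_mult_distrib ennreal_mult nn_integral_cmult)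
  also have "\<dots> = (\<integral>\<^sup>+x. ennreal ((f' x)\<^sup>2) \<partial>lborel) * (\<integral>\<^sup>+y. ennreal ((g' y)\<^sup>2) \<partial>lborel)"
    by (rule nn_integral_multc) measurable
  also have "\<dots> < \<infinity>" using fi' gi' by (simp add: integrable_iff_bounded ennreal_mult_less_top)
  finally have "integrable lborel (\<lambda>z. (h z)\<^sup>2)" using hm by (simp add: integrable_iff_bounded)
  moreover have "(\<lambda>z. indicator (A \<times> B) z * (h z)\<^sup>2) = (\<lambda>z. (h z)\<^sup>2)" using f0 g0 by (auto simp: h_def indicator_def fun_eq_iff)
  moreover have "(\<lambda>z. (h z)\<^sup>2) \<in> borel_measurable borel" using hm by measurable
  ultimately have "integrable (lebesgue_on (A \<times> B)) (\<lambda>z. (f (fst z) * g (snd z))\<^sup>2)"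
    using integral_lebesgue_on_cong_AE(1)[OF AB _ ae2] by simp
  then show ?thesis using borel_measurable_lebesgue_onI[OF AB hm ae] by (simp add: L2_on_def)
qed

lemma L2_on_simple_function:
  fixes \<Omega> :: "'x::euclidean_space set" and Z :: "'z::euclidean_space set" and s :: "'x \<Rightarrow> 'c" and h :: "'c \<Rightarrow> 'z \<Rightarrow> real"
  assumes Om: "\<Omega> \<in> sets borel" "bounded \<Omega>" and Z: "Z \<in> sets borel"
    and s: "simple_function (lebesgue_on \<Omega>) s" and h: "\<And>x. x \<in> \<Omega> \<Longrightarrow> h (s x) \<in> L2_on Z"
  shows "(\<lambda>z. h (s (fst z)) (snd z)) \<in> L2_on (\<Omega> \<times> Z)"
proof -
  have fin: "finite (s ` \<Omega>)" and meas: "\<And>x. x \<in> \<Omega> \<Longrightarrow> s -` {s x} \<inter> \<Omega> \<in> sets (lebesgue_on \<Omega>)"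
    using s by (auto simp: simple_function_def)
  have fm: "finite_measure (lebesgue_on \<Omega>)"
    using Om by (intro finite_measure_lebesgue_on bounded_set_imp_lmeasurable) auto
  have "(\<lambda>z. \<Sum>c\<in>s ` \<Omega>. indicator (s -` {c} \<inter> \<Omega>) (fst z) * h c (snd z)) \<in> L2 (lebesgue_on (\<Omega> \<times> Z))"
  proof (rule L2_sum[OF fin])
    fix c assume c: "c \<in> s ` \<Omega>"
    have "indicator (s -` {c} \<inter> \<Omega>) \<in> L2_on \<Omega>"
    proof -
      have m: "indicator (s -` {c} \<inter> \<Omega>) \<in> borel_measurable (lebesgue_on \<Omega>)" using c meas by auto
      have "(\<lambda>x. 1) \<in> L2 (lebesgue_on \<Omega>)" using fm by (auto simp: L2_def finite_measure.integrable_const)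
      from L2_bounded_mult[OF this m, of 1] show ?thesis unfolding L2_on_eq mult_1_left by (simp add: indicator_le_1)
    qed
    moreover have "h c \<in> L2_on Z" using c h by auto
    ultimately show "(\<lambda>z. indicator (s -` {c} \<inter> \<Omega>) (fst z) * h c (snd z)) \<in> L2 (lebesgue_on (\<Omega> \<times> Z))"
      using L2_on_tensor[OF Om(1) Z] unfolding L2_on_eq by blast
  qed
  moreover have eq: "(\<Sum>c\<in>s ` \<Omega>. indicator (s -` {c} \<inter> \<Omega>) (fst z) * h c (snd z)) = h (s (fst z)) (snd z)"
    if "z \<in> \<Omega> \<times> Z" for z
  proof -
    have "(\<Sum>c\<in>s ` \<Omega>. indicator (s -` {c} \<inter> \<Omega>) (fst z) * h c (snd z)) = (\<Sum>c\<in>s ` \<Omega>. if c = s (fst z) then h c (snd z) else 0)"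
      using that by (intro sum.cong) (auto simp: indicator_def)
    also have "\<dots> = h (s (fst z)) (snd z)" using that fin by (auto simp: sum.delta)
    finally show ?thesis .
  qed
  ultimately show ?thesis
    unfolding L2_on_eq L2_def mem_Collect_eq
    by (subst (asm) measurable_cong[OF eq], simp, subst (asm) Bochner_Integration.integrable_cong[OF refl, of _ _ "\<lambda>z. (h (s (fst z)) (snd z))\<^sup>2"]) (auto simp: eq)
qed

lemma H1_norm_square:
  assumes "open Z" "bounded Z" "is_weak_gradient Z u g"
  shows "(H1_norm Z u)\<^sup>2 = (LINT y|lebesgue_on Z. (u y)\<^sup>2) + (\<Sum>i\<in>Basis. LINT y|lebesgue_on Z. (g y \<bullet> i)\<^sup>2)"
  unfolding H1_norm_def scaled_H1_norm_square scaled_H1_inner_eq[OF assms(1,2,3,3)] integrable_inner_weak_gradients(2)[OF assms(3,3)]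
  by (simp add: power2_eq_square)

lemma integral_square_nonneg: "0 \<le> (LINT x|M. (f x)\<^sup>2 :: real)"
  by (rule integral_nonneg_AE) simp

text \<open>The weak gradients of the sections \<phi>(x,.) are chosen separately for each x,
  so they need not form a jointly measurable function. For a simple function only finitely
  many choices occur, and the gradients of approximating simple functions form a Cauchy
  sequence in the joint L2 space. Their limit G plays the role of the gradient of \<phi> in
  the second variable. The last property transfers an integration by parts that holds for
  every element of V to \<phi>.\<close>

theorem bochner_L2_joint_gradient:
  fixes \<Omega> :: "'x::euclidean_space set" and Z :: "'z::euclidean_space set"
  assumes Om: "\<Omega> \<in> sets borel" "bounded \<Omega>" and Z: "open Z" "bounded Z"
    and V: "V \<subseteq> H1 Z" "(\<lambda>x. 0) \<in> V"
    and \<phi>: "\<phi> \<in> L2_fun_valued \<Omega> Z V (H1_norm Z)"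
  obtains G :: "'z \<Rightarrow> 'x \<times> 'z \<Rightarrow> real" where "\<And>i. i \<in> Basis \<Longrightarrow> G i \<in> L2_on (\<Omega> \<times> Z)"
    "(LINT p|lebesgue_on (\<Omega> \<times> Z). (\<phi> p)\<^sup>2) + (\<Sum>i\<in>Basis. LINT p|lebesgue_on (\<Omega> \<times> Z). (G i p)\<^sup>2)
      = (L2_fun_valued_norm \<Omega> (H1_norm Z) \<phi>)\<^sup>2"
    "\<And>i w w'. i \<in> Basis \<Longrightarrow> w \<in> L2_on (\<Omega> \<times> Z) \<Longrightarrow> w' \<in> L2_on (\<Omega> \<times> Z) \<Longrightarrow>
      (\<forall>x\<in>\<Omega>. \<forall>c\<in>V. (LINT y|lebesgue_on Z. c y * w (x, y)) = - (LINT y|lebesgue_on Z. (weak_gradient Z c y \<bullet> i) * w' (x, y))) \<Longrightarrow>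
      (LINT p|lebesgue_on (\<Omega> \<times> Z). \<phi> p * w p) = - (LINT p|lebesgue_on (\<Omega> \<times> Z). G i p * w' p)"
proof -
  let ?N = "H1_norm Z"
  have Zb: "Z \<in> sets borel" using Z by simp
  let ?P = "lebesgue_on (\<Omega> \<times> Z)"
  have \<phi>L2: "\<phi> \<in> L2 ?P" and \<phi>B: "(\<lambda>x y. \<phi> (x, y)) \<in> bochner_L2 (lebesgue_on \<Omega>) V ?N"
    using \<phi> by (auto simp: L2_fun_valued_def L2_on_eq)
  obtain s where s: "\<And>k. simple_function (lebesgue_on \<Omega>) (s k)" and sV: "\<And>k x. x \<in> \<Omega> \<Longrightarrow> s k x \<in> V"
    and sint: "\<And>k. integrable (lebesgue_on \<Omega>) (\<lambda>x. (?N (s k x - (\<lambda>y. \<phi> (x, y))))\<^sup>2)"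
    and slim: "(\<lambda>k. LINT x|lebesgue_on \<Omega>. (?N (s k x - (\<lambda>y. \<phi> (x, y))))\<^sup>2) \<longlonglongrightarrow> 0"
    by (rule bochner_L2_simple_approximation[OF Z Om(1) V \<phi>B]) (rule that; assumption)
  have fm: "finite_measure (lebesgue_on \<Omega>)"
    using Om by (intro finite_measure_lebesgue_on bounded_set_imp_lmeasurable) auto
  have sH: "s k x \<in> H1 Z" if "x \<in> \<Omega>" for k x using sV[OF that] V(1) by blast
  have \<phi>V: "AE x in lebesgue_on \<Omega>. (\<lambda>y. \<phi> (x, y)) \<in> H1 Z"
    using \<phi>B V(1) unfolding bochner_L2_def strongly_measurable_def by (auto elim!: eventually_mono)
  have \<phi>int: "integrable (lebesgue_on \<Omega>) (\<lambda>x. (?N (\<lambda>y. \<phi> (x, y)))\<^sup>2)"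
    using \<phi>B by (simp add: bochner_L2_def)
  define S where "S k p = s k (fst p) (snd p)" for k p
  define g where "g k i p = weak_gradient Z (s k (fst p)) (snd p) \<bullet> i" for k i p
  have SL2: "S k \<in> L2 ?P" for k
    using L2_on_simple_function[OF Om Zb s[of k], of "\<lambda>c. c"] sH H1_imp_L2 unfolding L2_on_eq S_def[abs_def] by blast
  have gL2: "g k i \<in> L2 ?P" if "i \<in> Basis" for k i
    using L2_on_simple_function[OF Om Zb s[of k], of "\<lambda>c y. weak_gradient Z c y \<bullet> i"] is_weak_gradient_L2[OF H1_weak_gradient[OF sH] that]
    unfolding L2_on_eq g_def[abs_def] by blast
  have fubini: "integrable (lebesgue_on \<Omega>) (\<lambda>x. LINT y|lebesgue_on Z. (f (x, y))\<^sup>2)"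
    "(LINT p|?P. (f p)\<^sup>2) = (LINT x|lebesgue_on \<Omega>. LINT y|lebesgue_on Z. (f (x, y))\<^sup>2)" if "f \<in> L2 ?P" for f
    using integrable_lebesgue_on_fst[OF Om(1) Zb, of "\<lambda>p. (f p)\<^sup>2"] integral_lebesgue_on_fst[OF Om(1) Zb, of "\<lambda>p. (f p)\<^sup>2"] L2_square_integrable[OF that]
    by simp_all
  have fubini2: "(LINT p|?P. f p * h p) = (LINT x|lebesgue_on \<Omega>. LINT y|lebesgue_on Z. f (x, y) * h (x, y))"
    if "f \<in> L2 ?P" "h \<in> L2 ?P" for f h
    using integral_lebesgue_on_fst[OF Om(1) Zb L2_mult_integrable[OF that]] by simp
  \<comment> \<open>the simple functions converge in the joint space\<close>
  have Slim: "(\<lambda>k. LINT p|?P. (S k p - \<phi> p)\<^sup>2) \<longlonglongrightarrow> 0"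
  proof (rule tendsto_sandwich[OF always_eventually always_eventually tendsto_const slim])
    show "\<forall>k. 0 \<le> (LINT p|?P. (S k p - \<phi> p)\<^sup>2)" by (simp add: integral_square_nonneg)
    show "\<forall>k. (LINT p|?P. (S k p - \<phi> p)\<^sup>2) \<le> (LINT x|lebesgue_on \<Omega>. (?N (s k x - (\<lambda>y. \<phi> (x, y))))\<^sup>2)"
    proof
      fix k
      have "AE x in lebesgue_on \<Omega>. (LINT y|lebesgue_on Z. (S k (x, y) - \<phi> (x, y))\<^sup>2) \<le> (?N (s k x - (\<lambda>y. \<phi> (x, y))))\<^sup>2"
        using \<phi>V AE_space
      proof eventually_elim
        case (elim x)
        then have "s k x - (\<lambda>y. \<phi> (x, y)) \<in> H1 Z" using sH by (intro H1_fun_diff[OF Z]) auto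
        from H1_norm_square[OF Z H1_weak_gradient[OF this]]
        show ?case by (simp add: S_def sum_nonneg integral_square_nonneg)
      qed
      then show "(LINT p|?P. (S k p - \<phi> p)\<^sup>2) \<le> (LINT x|lebesgue_on \<Omega>. (?N (s k x - (\<lambda>y. \<phi> (x, y))))\<^sup>2)"
        unfolding fubini(2)[OF L2_diff[OF SL2 \<phi>L2]] by (intro integral_mono_AE fubini(1)[OF L2_diff[OF SL2 \<phi>L2]] sint)
    qed
  qed
  \<comment> \<open>and so do their gradients, by completeness\<close>
  have gdiff: "(LINT p|?P. (g k i p - g l i p)\<^sup>2) \<le> 2 * (LINT x|lebesgue_on \<Omega>. (?N (s k x - (\<lambda>y. \<phi> (x, y))))\<^sup>2) + 2 * (LINT x|lebesgue_on \<Omega>. (?N (s l x - (\<lambda>y. \<phi> (x, y))))\<^sup>2)"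
    if i: "i \<in> Basis" for i k l
  proof -
    have "AE x in lebesgue_on \<Omega>. (LINT y|lebesgue_on Z. (g k i (x, y) - g l i (x, y))\<^sup>2)
      \<le> 2 * (?N (s k x - (\<lambda>y. \<phi> (x, y))))\<^sup>2 + 2 * (?N (s l x - (\<lambda>y. \<phi> (x, y))))\<^sup>2"
      using \<phi>V AE_space
    proof eventually_elim
      case (elim x)
      then have x: "x \<in> \<Omega>" and ph: "(\<lambda>y. \<phi> (x, y)) \<in> H1 Z" by auto
      let ?a = "?N (s k x - (\<lambda>y. \<phi> (x, y)))" and ?b = "?N (s l x - (\<lambda>y. \<phi> (x, y)))"
      have wg: "is_weak_gradient Z (s k x - s l x) (\<lambda>y. weak_gradient Z (s k x) y - weak_gradient Z (s l x) y)"
        unfolding fun_diff_def using sH[OF x] by (intro is_weak_gradient_diff[OF Z] H1_imp_L2 H1_weak_gradient)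
      have "(LINT y|lebesgue_on Z. (g k i (x, y) - g l i (x, y))\<^sup>2)
        \<le> (\<Sum>j\<in>Basis. LINT y|lebesgue_on Z. ((weak_gradient Z (s k x) y - weak_gradient Z (s l x) y) \<bullet> j)\<^sup>2)"
        using member_le_sum[OF i, of "\<lambda>j. LINT y|lebesgue_on Z. ((weak_gradient Z (s k x) y - weak_gradient Z (s l x) y) \<bullet> j)\<^sup>2"]
        by (simp add: g_def inner_diff_left integral_square_nonneg)
      also have "\<dots> \<le> (?N (s k x - s l x))\<^sup>2"
        unfolding H1_norm_square[OF Z wg] by (simp add: integral_square_nonneg)
      also have "\<dots> \<le> (?a + ?b)\<^sup>2"
        using H1_norm_diff_triangle[OF Z sH[OF x, of k] ph sH[OF x, of l]] H1_norm_minus[OF Z ph sH[OF x, of l]]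
        by (intro power_mono H1_norm_nonneg) simp
      also have "\<dots> \<le> 2 * ?a\<^sup>2 + 2 * ?b\<^sup>2"
        using sum_squares_bound[of ?a ?b] by (simp add: power2_sum)
      finally show ?case .
    qed
    then have "(LINT p|?P. (g k i p - g l i p)\<^sup>2) \<le> (LINT x|lebesgue_on \<Omega>. 2 * (?N (s k x - (\<lambda>y. \<phi> (x, y))))\<^sup>2 + 2 * (?N (s l x - (\<lambda>y. \<phi> (x, y))))\<^sup>2)"
      unfolding fubini(2)[OF L2_diff[OF gL2[OF i] gL2[OF i]]]
      by (intro integral_mono_AE fubini(1)[OF L2_diff[OF gL2[OF i] gL2[OF i]]] Bochner_Integration.integrable_add integrable_mult_right sint)
    also have "\<dots> = 2 * (LINT x|lebesgue_on \<Omega>. (?N (s k x - (\<lambda>y. \<phi> (x, y))))\<^sup>2) + 2 * (LINT x|lebesgue_on \<Omega>. (?N (s l x - (\<lambda>y. \<phi> (x, y))))\<^sup>2)"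
      using sint[of k] sint[of l] by simp
    finally show ?thesis .
  qed
  have "\<exists>G\<in>L2 ?P. (\<lambda>k. LINT p|?P. (g k i p - G p)\<^sup>2) \<longlonglongrightarrow> 0" if i: "i \<in> Basis" for i
  proof (rule L2_complete[OF gL2[OF i]])
    fix e :: real assume e: "e > 0"
    have "\<forall>\<^sub>F k in sequentially. (LINT x|lebesgue_on \<Omega>. (?N (s k x - (\<lambda>y. \<phi> (x, y))))\<^sup>2) < e / 4"
      using e by (intro order_tendstoD(2)[OF slim]) simp
    then obtain K where K: "\<And>k. k \<ge> K \<Longrightarrow> (LINT x|lebesgue_on \<Omega>. (?N (s k x - (\<lambda>y. \<phi> (x, y))))\<^sup>2) < e / 4"
      by (auto simp: eventually_sequentially)
    have "(LINT p|?P. (g m i p - g n i p)\<^sup>2) < e" if "m \<ge> K" "n \<ge> K" for m n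
      using gdiff[OF i, of m n] K[OF that(1)] K[OF that(2)] by linarith
    then show "\<exists>K. \<forall>m\<ge>K. \<forall>n\<ge>K. (LINT p|?P. (g m i p - g n i p)\<^sup>2) < e" by blast
  qed
  then obtain G where "\<forall>i\<in>Basis. G i \<in> L2 ?P \<and> (\<lambda>k. LINT p|?P. (g k i p - G i p)\<^sup>2) \<longlonglongrightarrow> 0"
    using bchoice[of Basis "\<lambda>i G. G \<in> L2 ?P \<and> (\<lambda>k. LINT p|?P. (g k i p - G p)\<^sup>2) \<longlonglongrightarrow> 0"] by blast
  then have G: "\<And>i. i \<in> Basis \<Longrightarrow> G i \<in> L2 ?P"
    and Glim: "\<And>i. i \<in> Basis \<Longrightarrow> (\<lambda>k. LINT p|?P. (g k i p - G i p)\<^sup>2) \<longlonglongrightarrow> 0" by simp_all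
  show ?thesis
  proof
    show "G i \<in> L2_on (\<Omega> \<times> Z)" if "i \<in> Basis" for i using G[OF that] by (simp add: L2_on_eq)
    \<comment> \<open>the norm identity holds for the simple functions by Fubini\<close>
    have Nint: "integrable (lebesgue_on \<Omega>) (\<lambda>x. (?N (s k x))\<^sup>2)" for k
      by (rule finite_measure.integrable_const_bound[OF fm, where B="Max ((\<lambda>c. (?N c)\<^sup>2) ` (s k ` \<Omega>))"])
         (use s[of k] in \<open>auto simp: simple_function_def intro!: AE_I2 Max_ge borel_measurable_simple_function simple_function_compose1[OF s]\<close>)
    have Sk: "(LINT p|?P. (S k p)\<^sup>2) + (\<Sum>i\<in>Basis. LINT p|?P. (g k i p)\<^sup>2) = (LINT x|lebesgue_on \<Omega>. (?N (s k x))\<^sup>2)" for k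
    proof -
      have "(LINT p|?P. (S k p)\<^sup>2) + (\<Sum>i\<in>Basis. LINT p|?P. (g k i p)\<^sup>2)
        = (LINT x|lebesgue_on \<Omega>. LINT y|lebesgue_on Z. (S k (x, y))\<^sup>2) + (\<Sum>i\<in>Basis. LINT x|lebesgue_on \<Omega>. LINT y|lebesgue_on Z. (g k i (x, y))\<^sup>2)"
        using fubini(2)[OF SL2[of k]] fubini(2)[OF gL2[of _ k]] by simp
      also have "\<dots> = (LINT x|lebesgue_on \<Omega>. (LINT y|lebesgue_on Z. (S k (x, y))\<^sup>2) + (\<Sum>i\<in>Basis. LINT y|lebesgue_on Z. (g k i (x, y))\<^sup>2))"
        using fubini(1)[OF SL2[of k]] fubini(1)[OF gL2[of _ k]]
        by (subst Bochner_Integration.integral_add) (auto simp: Bochner_Integration.integral_sum intro!: Bochner_Integration.integrable_sum)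
      also have "\<dots> = (LINT x|lebesgue_on \<Omega>. (?N (s k x))\<^sup>2)"
        by (rule Bochner_Integration.integral_cong[OF refl]) (simp add: H1_norm_square[OF Z H1_weak_gradient[OF sH]] S_def g_def)
      finally show ?thesis .
    qed
    have "(\<lambda>k. LINT x|lebesgue_on \<Omega>. (?N (s k x))\<^sup>2) \<longlonglongrightarrow> (LINT p|?P. (\<phi> p)\<^sup>2) + (\<Sum>i\<in>Basis. LINT p|?P. (G i p)\<^sup>2)"
      unfolding Sk[symmetric] by (intro tendsto_add tendsto_sum L2_tendsto_integral_square SL2 \<phi>L2 Slim gL2 G Glim)
    moreover have "(\<lambda>k. LINT x|lebesgue_on \<Omega>. (?N (s k x))\<^sup>2) \<longlonglongrightarrow> (LINT x|lebesgue_on \<Omega>. (?N (\<lambda>y. \<phi> (x, y)))\<^sup>2)"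
    proof (rule L2_tendsto_integral_square)
      show sN: "(\<lambda>x. ?N (s k x)) \<in> L2 (lebesgue_on \<Omega>)" for k
        using Nint[of k] borel_measurable_simple_function[OF simple_function_compose1[OF s[of k], of ?N]] by (simp add: L2_def)
      show pN: "(\<lambda>x. ?N (\<lambda>y. \<phi> (x, y))) \<in> L2 (lebesgue_on \<Omega>)"
      proof -
        have "(\<lambda>x. sqrt ((?N (\<lambda>y. \<phi> (x, y)))\<^sup>2)) \<in> borel_measurable (lebesgue_on \<Omega>)" using \<phi>int by measurable
        then show ?thesis using \<phi>int by (simp add: H1_norm_nonneg L2_def)
      qed
      show "(\<lambda>k. LINT x|lebesgue_on \<Omega>. (?N (s k x) - ?N (\<lambda>y. \<phi> (x, y)))\<^sup>2) \<longlonglongrightarrow> 0"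
      proof (rule tendsto_sandwich[OF always_eventually always_eventually tendsto_const slim])
        show "\<forall>k. 0 \<le> (LINT x|lebesgue_on \<Omega>. (?N (s k x) - ?N (\<lambda>y. \<phi> (x, y)))\<^sup>2)" by (simp add: integral_square_nonneg)
        show "\<forall>k. (LINT x|lebesgue_on \<Omega>. (?N (s k x) - ?N (\<lambda>y. \<phi> (x, y)))\<^sup>2) \<le> (LINT x|lebesgue_on \<Omega>. (?N (s k x - (\<lambda>y. \<phi> (x, y))))\<^sup>2)"
        proof (intro allI integral_mono_AE sint L2_square_integrable L2_diff sN pN)
          fix k
          show "AE x in lebesgue_on \<Omega>. (?N (s k x) - ?N (\<lambda>y. \<phi> (x, y)))\<^sup>2 \<le> (?N (s k x - (\<lambda>y. \<phi> (x, y))))\<^sup>2"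
            using \<phi>V AE_space
          proof eventually_elim
            case (elim x)
            then have x: "x \<in> \<Omega>" and ph: "(\<lambda>y. \<phi> (x, y)) \<in> H1 Z" by auto
            have "\<bar>?N (s k x) - ?N (\<lambda>y. \<phi> (x, y))\<bar> \<le> ?N (s k x - (\<lambda>y. \<phi> (x, y)))"
              using H1_norm_diff_bounds(2)[OF Z sH[OF x, of k] ph] H1_norm_diff_bounds(2)[OF Z ph sH[OF x, of k]] H1_norm_minus[OF Z ph sH[OF x, of k]]
              by (simp add: abs_le_iff)
            then show ?case using power_mono[OF _ abs_ge_zero, of _ _ 2] by fastforce
          qed
        qed
      qed
    qed
    ultimately have "(LINT p|?P. (\<phi> p)\<^sup>2) + (\<Sum>i\<in>Basis. LINT p|?P. (G i p)\<^sup>2) = (LINT x|lebesgue_on \<Omega>. (?N (\<lambda>y. \<phi> (x, y)))\<^sup>2)"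
      by (rule LIMSEQ_unique)
    then show "(LINT p|?P. (\<phi> p)\<^sup>2) + (\<Sum>i\<in>Basis. LINT p|?P. (G i p)\<^sup>2) = (L2_fun_valued_norm \<Omega> ?N \<phi>)\<^sup>2"
      by (simp add: L2_fun_valued_norm_def bochner_L2_norm_def integral_square_nonneg)
  next
    fix i w w'
    assume i: "i \<in> Basis" and w: "w \<in> L2_on (\<Omega> \<times> Z)" and w': "w' \<in> L2_on (\<Omega> \<times> Z)"
      and pair: "\<forall>x\<in>\<Omega>. \<forall>c\<in>V. (LINT y|lebesgue_on Z. c y * w (x, y)) = - (LINT y|lebesgue_on Z. (weak_gradient Z c y \<bullet> i) * w' (x, y))"
    have wL2: "w \<in> L2 ?P" "w' \<in> L2 ?P" using w w' by (auto simp: L2_on_eq)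
    have eq: "(LINT p|?P. S k p * w p) = - (LINT p|?P. g k i p * w' p)" for k
    proof -
      have "(LINT p|?P. S k p * w p) = (LINT x|lebesgue_on \<Omega>. LINT y|lebesgue_on Z. S k (x, y) * w (x, y))"
        by (rule fubini2[OF SL2 wL2(1)])
      also have "\<dots> = (LINT x|lebesgue_on \<Omega>. - (LINT y|lebesgue_on Z. g k i (x, y) * w' (x, y)))"
        by (rule Bochner_Integration.integral_cong[OF refl]) (simp add: S_def g_def pair[rule_format, OF _ sV])
      also have "\<dots> = - (LINT p|?P. g k i p * w' p)"
        using fubini2[OF gL2[OF i, of k] wL2(2)] by simp
      finally show ?thesis .
    qed
    have "(\<lambda>k. LINT p|?P. S k p * w p) \<longlonglongrightarrow> (LINT p|?P. \<phi> p * w p)"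
      by (rule L2_tendsto_integral_mult[OF SL2 \<phi>L2 wL2(1) Slim])
    moreover have "(\<lambda>k. LINT p|?P. S k p * w p) \<longlonglongrightarrow> - (LINT p|?P. G i p * w' p)"
      unfolding eq by (intro tendsto_minus L2_tendsto_integral_mult[OF gL2[OF i] G[OF i] wL2(2) Glim[OF i]])
    ultimately show "(LINT p|?P. \<phi> p * w p) = - (LINT p|?P. G i p * w' p)" by (rule LIMSEQ_unique)
  qed
qed

section \<open>Averages of functions with values in a Sobolev space\<close>

lemma zero_H1_vanishing_on:
  fixes U :: "'a::euclidean_space set"
  assumes U: "open U" "bounded U"
  shows "(\<lambda>x. 0) \<in> H1_vanishing_on U S"
proof -
  have d: "(\<lambda>x. 0) - (\<lambda>x. 0) = (\<lambda>x::'a. 0::real)" by (auto simp: fun_eq_iff)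
  have "has_trace U (\<lambda>x. 0) (\<lambda>x. 0)"
    unfolding has_trace_def
    by (intro conjI exI[of _ "\<lambda>_ _. 0"]) (simp_all add: d H1_norm_zero[OF U] smooth_fun_def Ck_fun_const)
  then show ?thesis
    unfolding H1_vanishing_on_def using zero_H1[OF U] by (auto intro!: exI[of _ "\<lambda>x. 0"])
qed

context perforation
begin

lemma closure_Ystar_subset: "closure Ystar \<subseteq> cbox 0 1"
  using closure_mono[OF Ystar(1)] closure_minimal[OF box_subset_cbox, of 0 1] unfolding unit_cell_def by fastforce

text \<open>In the open cell with index k, the perforated domain only consists of points of
  the scaled closure of Ystar, since the closed cells of other indices do not reach into it.
  A Lipschitz domain is the interior of its closure, so near a point of the support all
  points of the cell belong to Ystar.\<close>

lemma test_function_support_in_cell: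
  assumes \<theta>: "\<theta> \<in> test_functions \<Omega>\<^sub>\<epsilon>"
    and p: "p \<in> closure {y. \<theta> (\<epsilon> *\<^sub>R int_vec k + \<epsilon> *\<^sub>R y) \<noteq> 0}"
  shows "\<exists>\<delta>>0. ball p \<delta> \<inter> box 0 One \<subseteq> Ystar"
proof -
  let ?c = "\<epsilon> *\<^sub>R int_vec k"
  define B where "B = {y. ?c + \<epsilon> *\<^sub>R y \<in> \<Omega>\<^sub>\<epsilon>}"
  have cont: "continuous_on UNIV (\<lambda>y :: real ^ 'n. ?c + \<epsilon> *\<^sub>R y)" by (intro continuous_intros)
  have "closed ((\<lambda>y. ?c + \<epsilon> *\<^sub>R y) -` closure {x. \<theta> x \<noteq> 0})"
    by (rule closed_vimage[OF closed_closure]) (intro continuous_intros)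
  moreover have "{y. \<theta> (?c + \<epsilon> *\<^sub>R y) \<noteq> 0} \<subseteq> (\<lambda>y. ?c + \<epsilon> *\<^sub>R y) -` closure {x. \<theta> x \<noteq> 0}"
    using closure_subset[of "{x. \<theta> x \<noteq> 0}"] by auto
  ultimately have "p \<in> (\<lambda>y. ?c + \<epsilon> *\<^sub>R y) -` closure {x. \<theta> x \<noteq> 0}" using p closure_minimal by blast
  then have "p \<in> B" using \<theta> by (auto simp: B_def test_functions_def)
  moreover have "open B"
  proof -
    have "B = (\<lambda>y. ?c + \<epsilon> *\<^sub>R y) -` \<Omega>\<^sub>\<epsilon>" by (auto simp: B_def)
    then show ?thesis using open_vimage[OF open_Omega_eps cont] by simp
  qed
  ultimately obtain \<delta> where \<delta>: "\<delta> > 0" "ball p \<delta> \<subseteq> B" using open_contains_ball by blast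
  have sub: "B \<inter> box 0 One \<subseteq> closure Ystar"
  proof
    fix y assume y: "y \<in> B \<inter> box 0 One"
    then have yc: "y \<in> unit_cell" by (simp add: unit_cell_eq)
    have "?c + \<epsilon> *\<^sub>R y \<in> cell_union (closure Ystar)"
      using y interior_subset unfolding B_def Omega_eps_eq by blast
    then obtain k' y' where y': "y' \<in> closure Ystar" and eq: "?c + \<epsilon> *\<^sub>R y = \<epsilon> *\<^sub>R (y' + int_vec k')"
      unfolding cell_union_def by blast
    have "\<epsilon> *\<^sub>R (y + int_vec k) = \<epsilon> *\<^sub>R (y' + int_vec k')" using eq by (simp add: affine_cell)
    then have sum: "y + int_vec k = y' + int_vec k'" using eps by simp
    have "y $ i = y' $ i" for i
    proof -
      have e: "y $ i + of_int (k $ i) = y' $ i + of_int (k' $ i)"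
        using arg_cong[OF sum, of "\<lambda>v. v $ i"] by (simp add: int_vec_def)
      have "0 < y $ i" "y $ i < 1" using yc by (auto simp: mem_unit_cell)
      moreover have "0 \<le> y' $ i" "y' $ i \<le> 1" using closure_Ystar_subset y' by (auto simp: mem_box_cart)
      ultimately have "real_of_int (k $ i) < of_int (k' $ i) + 1" "real_of_int (k' $ i) < of_int (k $ i) + 1"
        using e by linarith+
      then have "k $ i = k' $ i" by linarith
      then show ?thesis using e by simp
    qed
    then have "y = y'" by (simp add: vec_eq_iff)
    then show "y \<in> closure Ystar" using y' by simp
  qed
  have "ball p \<delta> \<inter> box 0 One \<subseteq> interior (closure Ystar)"
    by (rule interior_maximal) (use \<delta>(2) sub in \<open>auto intro!: open_Int\<close>)
  then show ?thesis using \<delta>(1) lipschitz_boundary_interior_closure[OF Ystar(3,2)] by auto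
qed

lemma H10_cell_subset_H1: "H10_cell Ystar \<subseteq> H1 Ystar"
  by (auto simp: H10_cell_def H1_vanishing_on_def)

lemma zero_H10_cell: "(\<lambda>x. 0) \<in> H10_cell Ystar"
  unfolding H10_cell_def by (rule zero_H1_vanishing_on[OF Ystar(2) bounded_Ystar])

lemma unfolded_integration_by_parts:
  assumes \<theta>: "\<theta> \<in> test_functions \<Omega>\<^sub>\<epsilon>" and u: "u \<in> H10_cell Ystar" and i: "i \<in> Basis"
  shows "(LINT y|lebesgue_on Ystar. u y * frechet_derivative \<theta> (at (unfold_map (x, y))) i)
    = - (LINT y|lebesgue_on Ystar. (weak_gradient Ystar u y \<bullet> i) * (inverse \<epsilon> * \<theta> (unfold_map (x, y))))"
proof -
  define k where "k = floor_index (x /\<^sub>R \<epsilon>)"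
  let ?c = "\<epsilon> *\<^sub>R int_vec k"
  have um: "unfold_map (x, y) = ?c + \<epsilon> *\<^sub>R y" for y by (simp add: unfold_map_eq k_def affine_cell)
  note sm = test_functionsD(1)[OF \<theta>]
  obtain C where C: "\<And>x. \<bar>\<theta> x\<bar> \<le> C" using test_functionsD(4)[OF \<theta>] by blast
  have "(LINT y|lebesgue_on Ystar. u y * frechet_derivative (\<lambda>y. \<theta> (?c + \<epsilon> *\<^sub>R y)) (at y) i)
    = - (LINT y|lebesgue_on Ystar. (weak_gradient Ystar u y \<bullet> i) * \<theta> (?c + \<epsilon> *\<^sub>R y))"
  proof (rule cell_integration_by_parts[OF Ystar(2) _ _ smooth_fun_affine[OF sm] i])
    show "Ystar \<subseteq> box 0 One" using Ystar(1) by (simp add: unit_cell_eq)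
    show "u \<in> H1_vanishing_on Ystar (frontier (box 0 One) \<inter> frontier Ystar)" using u by (simp add: H10_cell_def unit_cell_eq)
    show "\<bar>\<theta> (?c + \<epsilon> *\<^sub>R y)\<bar> \<le> C" for y by (rule C)
  qed (rule test_function_support_in_cell[OF \<theta>])
  then have "\<epsilon> * (LINT y|lebesgue_on Ystar. u y * frechet_derivative \<theta> (at (?c + \<epsilon> *\<^sub>R y)) i)
    = - (LINT y|lebesgue_on Ystar. (weak_gradient Ystar u y \<bullet> i) * \<theta> (?c + \<epsilon> *\<^sub>R y))"
    by (simp add: frechet_derivative_affine[OF sm] mult.left_commute[of _ \<epsilon>])
  then have "(LINT y|lebesgue_on Ystar. u y * frechet_derivative \<theta> (at (?c + \<epsilon> *\<^sub>R y)) i)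
    = - (inverse \<epsilon> * (LINT y|lebesgue_on Ystar. (weak_gradient Ystar u y \<bullet> i) * \<theta> (?c + \<epsilon> *\<^sub>R y)))"
    using eps by (simp add: field_simps)
  then show ?thesis by (simp add: um mult.left_commute[of _ "inverse \<epsilon>"])
qed

lemma bounded_Omega: "bounded \<Omega>"
  by (simp add: Omega box_domain_def)

text \<open>The weak gradient of the average is 1/\<epsilon> times the average of the
  gradient in y. Adjointness moves a test function to the unfolded side, where integration
  by parts takes place on Ystar for each fixed x. The weight \<epsilon>^2 of the scaled norm
  cancels the factor 1/\<epsilon>.\<close>

theorem averaging_op_H1:
  assumes \<phi>: "\<phi> \<in> L2_H10 \<Omega> Ystar"
  shows "averaging_op \<epsilon> \<phi> \<in> H1 \<Omega>\<^sub>\<epsilon>"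
    and "scaled_H1_norm \<epsilon> \<Omega>\<^sub>\<epsilon> (averaging_op \<epsilon> \<phi>) \<le> L2_H10_norm \<Omega> Ystar \<phi>"
proof -
  note OE = open_Omega_eps bounded_Omega_eps
  let ?P = "lebesgue_on (\<Omega> \<times> Ystar)"
  have \<phi>2: "\<phi> \<in> L2_fun_valued \<Omega> Ystar (H10_cell Ystar) (H1_norm Ystar)" using \<phi> by (simp add: L2_H10_def)
  then have \<phi>L2: "\<phi> \<in> L2_on (\<Omega> \<times> Ystar)" by (simp add: L2_fun_valued_def)
  obtain G where G: "\<And>i. i \<in> Basis \<Longrightarrow> G i \<in> L2_on (\<Omega> \<times> Ystar)"
    and Gnorm: "(LINT p|?P. (\<phi> p)\<^sup>2) + (\<Sum>i\<in>Basis. LINT p|?P. (G i p)\<^sup>2) = (L2_fun_valued_norm \<Omega> (H1_norm Ystar) \<phi>)\<^sup>2"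
    and Gpair: "\<And>i w w'. i \<in> Basis \<Longrightarrow> w \<in> L2_on (\<Omega> \<times> Ystar) \<Longrightarrow> w' \<in> L2_on (\<Omega> \<times> Ystar) \<Longrightarrow>
      (\<forall>x\<in>\<Omega>. \<forall>c\<in>H10_cell Ystar. (LINT y|lebesgue_on Ystar. c y * w (x, y)) = - (LINT y|lebesgue_on Ystar. (weak_gradient Ystar c y \<bullet> i) * w' (x, y))) \<Longrightarrow>
      (LINT p|?P. \<phi> p * w p) = - (LINT p|?P. G i p * w' p)"
    by (rule bochner_L2_joint_gradient[OF Omega_borel bounded_Omega Ystar(2) bounded_Ystar H10_cell_subset_H1 zero_H10_cell \<phi>2]) (rule that; assumption)
  define g where "g x = (\<Sum>i\<in>Basis. (inverse \<epsilon> * averaging_op \<epsilon> (G i) x) *\<^sub>R i)" for x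
  have gi: "g x \<bullet> i = inverse \<epsilon> * averaging_op \<epsilon> (G i) x" if "i \<in> Basis" for x i
    using that by (simp add: g_def)
  have wg: "is_weak_gradient \<Omega>\<^sub>\<epsilon> (averaging_op \<epsilon> \<phi>) g"
    unfolding is_weak_gradient_def
  proof (intro ballI conjI)
    fix i :: "real ^ 'n" assume i: "i \<in> Basis"
    show "(\<lambda>x. g x \<bullet> i) \<in> L2_on \<Omega>\<^sub>\<epsilon>"
      using L2_cmult[of "averaging_op \<epsilon> (G i)" "lebesgue_on \<Omega>\<^sub>\<epsilon>" "inverse \<epsilon>"] averaging_op_L2(1)[OF G[OF i]] by (simp add: gi[OF i] L2_on_eq)
    fix \<theta> assume \<theta>: "\<theta> \<in> test_functions \<Omega>\<^sub>\<epsilon>"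
    note tL2 = L2_on_test_function[OF OE \<theta>]
    have i\<theta>: "(\<lambda>x. inverse \<epsilon> * \<theta> x) \<in> L2_on \<Omega>\<^sub>\<epsilon>" using tL2(1) L2_cmult by (simp add: L2_on_eq)
    have "(LINT x|lebesgue_on \<Omega>\<^sub>\<epsilon>. averaging_op \<epsilon> \<phi> x * frechet_derivative \<theta> (at x) i)
      = (LINT p|?P. \<phi> p * frechet_derivative \<theta> (at (unfold_map p)) i)"
      using averaging_op_adjoint[OF \<phi>L2 tL2(2)[OF i]] by (simp add: mult.commute)
    also have "\<dots> = - (LINT p|?P. G i p * (inverse \<epsilon> * \<theta> (unfold_map p)))"
      by (rule Gpair[OF i measure_preserving_L2(1)[OF unfold_map_measure_preserving_Ystar tL2(2)[OF i]] measure_preserving_L2(1)[OF unfold_map_measure_preserving_Ystar i\<theta>]])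
         (intro ballI unfolded_integration_by_parts[OF \<theta> _ i])
    also have "\<dots> = - (LINT x|lebesgue_on \<Omega>\<^sub>\<epsilon>. averaging_op \<epsilon> (G i) x * (inverse \<epsilon> * \<theta> x))"
      using averaging_op_adjoint[OF G[OF i] i\<theta>] by (simp add: mult.commute)
    also have "\<dots> = - (LINT x|lebesgue_on \<Omega>\<^sub>\<epsilon>. g x \<bullet> i * \<theta> x)"
      by (simp add: gi[OF i] mult.left_commute mult.assoc)
    finally show "(LINT x|lebesgue_on \<Omega>\<^sub>\<epsilon>. averaging_op \<epsilon> \<phi> x * frechet_derivative \<theta> (at x) i)
      = - (LINT x|lebesgue_on \<Omega>\<^sub>\<epsilon>. g x \<bullet> i * \<theta> x)" .
  qed
  show "averaging_op \<epsilon> \<phi> \<in> H1 \<Omega>\<^sub>\<epsilon>" by (rule H1_I[OF averaging_op_L2(1)[OF \<phi>L2] wg])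
  have "(scaled_H1_norm \<epsilon> \<Omega>\<^sub>\<epsilon> (averaging_op \<epsilon> \<phi>))\<^sup>2
    = (LINT x|lebesgue_on \<Omega>\<^sub>\<epsilon>. (averaging_op \<epsilon> \<phi> x)\<^sup>2) + \<epsilon>\<^sup>2 * (\<Sum>i\<in>Basis. LINT x|lebesgue_on \<Omega>\<^sub>\<epsilon>. (g x \<bullet> i)\<^sup>2)"
    unfolding scaled_H1_norm_square scaled_H1_inner_eq[OF OE wg wg] integrable_inner_weak_gradients(2)[OF wg wg]
    by (simp add: power2_eq_square)
  also have "\<epsilon>\<^sup>2 * (\<Sum>i\<in>Basis. LINT x|lebesgue_on \<Omega>\<^sub>\<epsilon>. (g x \<bullet> i)\<^sup>2) = (\<Sum>i\<in>Basis. LINT x|lebesgue_on \<Omega>\<^sub>\<epsilon>. (averaging_op \<epsilon> (G i) x)\<^sup>2)"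
    unfolding sum_distrib_left
  proof (rule sum.cong[OF refl])
    fix i :: "real ^ 'n" assume i: "i \<in> Basis"
    have "\<epsilon>\<^sup>2 * (inverse \<epsilon>)\<^sup>2 = 1" using eps by (simp add: power_mult_distrib[symmetric])
    then show "\<epsilon>\<^sup>2 * (LINT x|lebesgue_on \<Omega>\<^sub>\<epsilon>. (g x \<bullet> i)\<^sup>2) = (LINT x|lebesgue_on \<Omega>\<^sub>\<epsilon>. (averaging_op \<epsilon> (G i) x)\<^sup>2)"
      by (simp only: gi[OF i] power_mult_distrib integral_mult_right_zero mult.assoc[symmetric] mult_1_left)
  qed
  also have "(LINT x|lebesgue_on \<Omega>\<^sub>\<epsilon>. (averaging_op \<epsilon> \<phi> x)\<^sup>2) + (\<Sum>i\<in>Basis. LINT x|lebesgue_on \<Omega>\<^sub>\<epsilon>. (averaging_op \<epsilon> (G i) x)\<^sup>2)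
    \<le> (LINT p|?P. (\<phi> p)\<^sup>2) + (\<Sum>i\<in>Basis. LINT p|?P. (G i p)\<^sup>2)"
    by (intro add_mono sum_mono averaging_op_L2(2) \<phi>L2 G)
  also have "\<dots> = (L2_H10_norm \<Omega> Ystar \<phi>)\<^sup>2" by (simp add: Gnorm L2_H10_norm_def)
  finally show "scaled_H1_norm \<epsilon> \<Omega>\<^sub>\<epsilon> (averaging_op \<epsilon> \<phi>) \<le> L2_H10_norm \<Omega> Ystar \<phi>"
    by (rule power2_le_imp_le) (simp add: L2_H10_norm_def L2_fun_valued_norm_def bochner_L2_norm_def integral_square_nonneg)
qed

text \<open>Sections of a function need not be integrable, so additivity can fail on a null
  set. By adjointness the defect d is orthogonal to every square integrable function, in
  particular to itself.\<close>

lemma averaging_op_add_AE: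
  assumes f: "f \<in> L2_on (\<Omega> \<times> Ystar)" and h: "h \<in> L2_on (\<Omega> \<times> Ystar)"
  shows "AE x in lebesgue_on \<Omega>\<^sub>\<epsilon>. averaging_op \<epsilon> (\<lambda>p. f p + h p) x = averaging_op \<epsilon> f x + averaging_op \<epsilon> h x"
proof -
  have fh: "(\<lambda>p. f p + h p) \<in> L2_on (\<Omega> \<times> Ystar)" using f h by (simp add: L2_on_eq L2_add)
  define d where "d x = averaging_op \<epsilon> (\<lambda>p. f p + h p) x - (averaging_op \<epsilon> f x + averaging_op \<epsilon> h x)" for x
  note A = averaging_op_L2(1)[OF f] averaging_op_L2(1)[OF h] averaging_op_L2(1)[OF fh]
  have d: "d \<in> L2_on \<Omega>\<^sub>\<epsilon>" unfolding d_def[abs_def] using A by (simp add: L2_on_eq L2_add L2_diff)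
  have du: "(\<lambda>p. d (unfold_map p)) \<in> L2_on (\<Omega> \<times> Ystar)" by (rule measure_preserving_L2(1)[OF unfold_map_measure_preserving_Ystar d])
  note i1 = L2_mult_integrable[of _ "lebesgue_on \<Omega>\<^sub>\<epsilon>", folded L2_on_eq, OF d]
  note i2 = L2_mult_integrable[of _ "lebesgue_on (\<Omega> \<times> Ystar)", folded L2_on_eq, OF du]
  have "(LINT x|lebesgue_on \<Omega>\<^sub>\<epsilon>. (d x)\<^sup>2) = (LINT x|lebesgue_on \<Omega>\<^sub>\<epsilon>. d x * averaging_op \<epsilon> (\<lambda>p. f p + h p) x - (d x * averaging_op \<epsilon> f x + d x * averaging_op \<epsilon> h x))"
    by (rule Bochner_Integration.integral_cong[OF refl]) (simp add: d_def power2_eq_square algebra_simps)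
  also have "\<dots> = (LINT p|lebesgue_on (\<Omega> \<times> Ystar). d (unfold_map p) * (f p + h p))
      - ((LINT p|lebesgue_on (\<Omega> \<times> Ystar). d (unfold_map p) * f p) + (LINT p|lebesgue_on (\<Omega> \<times> Ystar). d (unfold_map p) * h p))"
    using i1[OF A(1)] i1[OF A(2)] i1[OF A(3)]
    by (simp add: averaging_op_adjoint[OF f d] averaging_op_adjoint[OF h d] averaging_op_adjoint[OF fh d])
  also have "\<dots> = 0" using i2[OF f] i2[OF h] by (simp add: distrib_left)
  finally have "(LINT x|lebesgue_on \<Omega>\<^sub>\<epsilon>. (d x)\<^sup>2) = 0" .
  then have "AE x in lebesgue_on \<Omega>\<^sub>\<epsilon>. (d x)\<^sup>2 = 0"
    using d by (subst (asm) integral_nonneg_eq_0_iff_AE) (auto simp: L2_on_def)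
  then show ?thesis by eventually_elim (simp add: d_def)
qed

lemma averaging_op_cmult: "averaging_op \<epsilon> (\<lambda>p. c * f p) = (\<lambda>x. c * averaging_op \<epsilon> f x)"
  by (simp add: averaging_op_def fun_eq_iff)

end

section \<open>Transposition of functionals\<close>

lemma dual_spaceD:
  assumes "F \<in> dual_space V N"
  shows "u \<in> V \<Longrightarrow> w \<in> V \<Longrightarrow> F (\<lambda>x. u x + w x) = F u + F w" "u \<in> V \<Longrightarrow> F (\<lambda>x. c * u x) = c * F u"
    "\<exists>C. \<forall>u\<in>V. \<bar>F u\<bar> \<le> C * N u"
  using assms by (auto simp: dual_space_def)

lemma dual_norm_bdd_above:
  assumes F: "F \<in> dual_space V N" and N: "\<And>u. 0 \<le> N u"
  shows "bdd_above ((\<lambda>u. \<bar>F u\<bar>) ` {u \<in> V. N u \<le> 1})"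
proof -
  obtain C where C: "\<And>u. u \<in> V \<Longrightarrow> \<bar>F u\<bar> \<le> C * N u" using dual_spaceD(3)[OF F] by blast
  have "\<bar>F u\<bar> \<le> \<bar>C\<bar>" if "u \<in> V" "N u \<le> 1" for u
  proof -
    have "C * N u \<le> \<bar>C\<bar> * N u" using N[of u] by (intro mult_right_mono) auto
    also have "\<dots> \<le> \<bar>C\<bar>" using that(2) mult_left_mono[of "N u" 1 "\<bar>C\<bar>"] by simp
    finally show ?thesis using C[OF that(1)] by linarith
  qed
  then show ?thesis by (intro bdd_aboveI2) auto
qed

lemma dual_norm_upper:
  assumes "F \<in> dual_space V N" "\<And>u. 0 \<le> N u" "u \<in> V" "N u \<le> 1"
  shows "\<bar>F u\<bar> \<le> dual_norm V N F"
  unfolding dual_norm_def by (rule cSUP_upper[OF _ dual_norm_bdd_above[OF assms(1,2)]]) (use assms in auto)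

lemma dual_norm_nonneg:
  assumes "F \<in> dual_space V N" "\<And>u. 0 \<le> N u" "z \<in> V" "N z \<le> 1"
  shows "0 \<le> dual_norm V N F"
  using dual_norm_upper[OF assms] by linarith

lemma dual_norm_least:
  assumes "z \<in> V" "N z \<le> 1" "\<And>u. u \<in> V \<Longrightarrow> N u \<le> 1 \<Longrightarrow> \<bar>F u\<bar> \<le> B"
  shows "dual_norm V N F \<le> B"
  unfolding dual_norm_def by (rule cSUP_least) (use assms in auto)

lemma dual_space_diff:
  assumes F: "F \<in> dual_space V N" and G: "G \<in> dual_space V N" and N: "\<And>u. 0 \<le> N u"
  shows "F - G \<in> dual_space V N"
proof -
  obtain C where C: "\<And>u. u \<in> V \<Longrightarrow> \<bar>F u\<bar> \<le> C * N u" using dual_spaceD(3)[OF F] by blast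
  obtain D where D: "\<And>u. u \<in> V \<Longrightarrow> \<bar>G u\<bar> \<le> D * N u" using dual_spaceD(3)[OF G] by blast
  have "\<bar>(F - G) u\<bar> \<le> (C + D) * N u" if "u \<in> V" for u
    using C[OF that] D[OF that] by (simp add: distrib_right)
  then have "\<exists>C. \<forall>u\<in>V. \<bar>(F - G) u\<bar> \<le> C * N u" by blast
  then show ?thesis using F G by (simp add: dual_space_def algebra_simps)
qed

lemma dual_norm_triangle:
  assumes F: "F \<in> dual_space V N" and G: "G \<in> dual_space V N" and N: "\<And>u. 0 \<le> N u" and z: "z \<in> V" "N z \<le> 1"
  shows "dual_norm V N F \<le> dual_norm V N (F - G) + dual_norm V N G"
proof (rule dual_norm_least[where V=V and N=N, OF z])
  fix u assume u: "u \<in> V" "N u \<le> 1"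
  show "\<bar>F u\<bar> \<le> dual_norm V N (F - G) + dual_norm V N G"
    using dual_norm_upper[OF dual_space_diff[OF F G N] N u] dual_norm_upper[OF G N u] by simp
qed

lemma dual_norm_diff_commute: "dual_norm V N (F - G) = dual_norm V N (G - F)"
  by (simp add: dual_norm_def abs_minus_commute)

lemma dual_norm_measurable:
  fixes S :: "real set"
  assumes S: "S \<in> sets borel" and N: "\<And>u. 0 \<le> N u" and z: "z \<in> V" "N z \<le> 1"
    and u: "strongly_measurable (lebesgue_on S) (dual_space V N) (dual_norm V N) u"
  shows "(\<lambda>t. dual_norm V N (u t)) \<in> borel_measurable (lebesgue_on S)"
proof -
  let ?D = "dual_norm V N"
  obtain s where s: "\<And>k. simple_function (lebesgue_on S) (s k)" "\<And>k. s k ` space (lebesgue_on S) \<subseteq> dual_space V N"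
    and lim: "AE t in lebesgue_on S. u t \<in> dual_space V N \<and> (\<lambda>k. ?D (s k t - u t)) \<longlonglongrightarrow> 0"
    using u unfolding strongly_measurable_def by blast
  show ?thesis
  proof (rule lebesgue_on_measurable_cong_AE[OF S])
    have "(\<lambda>t. ?D (s k t)) \<in> borel_measurable (lebesgue_on S)" for k
      by (rule borel_measurable_simple_function[OF simple_function_compose1[OF s(1)]])
    then show "(\<lambda>t. lim (\<lambda>k. ?D (s k t))) \<in> borel_measurable (lebesgue_on S)" by (rule borel_measurable_lim_metric)
    show "AE t in lebesgue_on S. lim (\<lambda>k. ?D (s k t)) = ?D (u t)"
      using lim AE_space
    proof eventually_elim
      case (elim t)
      then have ut: "u t \<in> dual_space V N" and st: "\<And>k. s k t \<in> dual_space V N" and l0: "(\<lambda>k. ?D (s k t - u t)) \<longlonglongrightarrow> 0"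
        using s(2) by auto
      have "norm (?D (s k t) - ?D (u t)) \<le> ?D (s k t - u t)" for k
        using dual_norm_triangle[OF st[of k] ut N z] dual_norm_triangle[OF ut st[of k] N z] dual_norm_diff_commute[of V N "u t" "s k t"]
        by (simp add: abs_le_iff)
      then have "(\<lambda>k. ?D (s k t) - ?D (u t)) \<longlonglongrightarrow> 0"
        by (intro Lim_null_comparison[OF _ l0] always_eventually) blast
      then show ?case by (intro limI) (simp add: LIM_zero_iff)
    qed
  qed
qed

text \<open>The functionals are compared on W rather than on V, because membership in the
  dual space involves the values at sums and multiples of elements of V.\<close>

lemma L2_time_dual_cong:
  assumes W: "V \<subseteq> W" "\<And>u w. u \<in> V \<Longrightarrow> w \<in> V \<Longrightarrow> (\<lambda>x. u x + w x) \<in> W" "\<And>u c. u \<in> V \<Longrightarrow> (\<lambda>x. c * u x) \<in> W"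
    and u: "u \<in> L2_time_dual T V N" and eq: "AE t in lebesgue_on {0<..<T}. \<forall>w\<in>W. u t w = u' t w"
    and N: "\<And>u. 0 \<le> N u" and z: "z \<in> V" "N z \<le> 1"
  shows "u' \<in> L2_time_dual T V N"
proof -
  let ?M = "lebesgue_on {0<..<T}" and ?D = "dual_norm V N"
  have dn: "?D (F - u t) = ?D (F - u' t)" if "\<forall>w\<in>W. u t w = u' t w" for F t
    unfolding dual_norm_def using that W(1) by (intro SUP_cong) auto
  have dn0: "?D (u t) = ?D (u' t)" if "\<forall>w\<in>W. u t w = u' t w" for t
    unfolding dual_norm_def using that W(1) by (intro SUP_cong) auto
  have ds: "u' t \<in> dual_space V N" if e: "\<forall>w\<in>W. u t w = u' t w" and d: "u t \<in> dual_space V N" for t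
  proof -
    have V: "u' t w = u t w" if "w \<in> V" for w using e W(1) that by auto
    moreover have "u' t (\<lambda>x. f x + h x) = u t (\<lambda>x. f x + h x)" if "f \<in> V" "h \<in> V" for f h
      using e W(2)[OF that] by simp
    moreover have "u' t (\<lambda>x. c * f x) = u t (\<lambda>x. c * f x)" if "f \<in> V" for f c
      using e W(3)[OF that, of c] by simp
    ultimately show ?thesis using d by (simp add: dual_space_def)
  qed
  have sm: "strongly_measurable ?M (dual_space V N) ?D u" and int: "integrable ?M (\<lambda>t. (?D (u t))\<^sup>2)"
    using u by (auto simp: L2_time_dual_def bochner_L2_def)
  obtain s where s: "\<forall>k. simple_function ?M (s k) \<and> s k ` space ?M \<subseteq> dual_space V N"
    and lim: "AE t in ?M. u t \<in> dual_space V N \<and> (\<lambda>k. ?D (s k t - u t)) \<longlonglongrightarrow> 0"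
    using sm unfolding strongly_measurable_def by blast
  have "AE t in ?M. u' t \<in> dual_space V N \<and> (\<lambda>k. ?D (s k t - u' t)) \<longlonglongrightarrow> 0"
    using lim eq
  proof eventually_elim
    case (elim t)
    then show ?case using ds[of t] dn[of t] by simp
  qed
  then have sm': "strongly_measurable ?M (dual_space V N) ?D u'" unfolding strongly_measurable_def using s by blast
  have m: "(\<lambda>t. ?D (u' t)) \<in> borel_measurable ?M" by (rule dual_norm_measurable[where V=V and N=N, OF _ N z sm']) simp
  have "integrable ?M (\<lambda>t. (?D (u t))\<^sup>2) \<longleftrightarrow> integrable ?M (\<lambda>t. (?D (u' t))\<^sup>2)"
  proof (rule integrable_cong_AE)
    show "AE t in ?M. (?D (u t))\<^sup>2 = (?D (u' t))\<^sup>2" using eq by eventually_elim (simp add: dn0)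
  qed (use int m in auto)
  then show ?thesis using int sm' by (simp add: L2_time_dual_def bochner_L2_def)
qed

text \<open>Composition with an operator of norm at most one maps functionals to functionals
  and does not increase their norms. So it maps simple functions that approximate u to
  simple functions that approximate the composition. Additivity of A is only required as far
  as continuous functionals see it, since A may be additive only almost everywhere.\<close>

lemma L2_time_dual_transpose:
  fixes A :: "('y \<Rightarrow> real) \<Rightarrow> 'x \<Rightarrow> real"
  assumes N1: "\<And>u. 0 \<le> N1 u" and N2: "\<And>u. 0 \<le> N2 u" and z: "z \<in> V2" "N2 z \<le> 1"
    and AV: "\<And>\<phi>. \<phi> \<in> V2 \<Longrightarrow> A \<phi> \<in> V1" and AN: "\<And>\<phi>. \<phi> \<in> V2 \<Longrightarrow> N1 (A \<phi>) \<le> N2 \<phi>"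
    and Aadd: "\<And>F \<phi> \<psi>. F \<in> dual_space V1 N1 \<Longrightarrow> \<phi> \<in> V2 \<Longrightarrow> \<psi> \<in> V2 \<Longrightarrow> F (A (\<lambda>x. \<phi> x + \<psi> x)) = F (A \<phi>) + F (A \<psi>)"
    and Acmult: "\<And>c \<phi>. A (\<lambda>x. c * \<phi> x) = (\<lambda>x. c * A \<phi> x)"
    and u: "u \<in> L2_time_dual T V1 N1"
  shows "(\<lambda>t \<phi>. u t (A \<phi>)) \<in> L2_time_dual T V2 N2"
    and "L2_time_dual_norm T V2 N2 (\<lambda>t \<phi>. u t (A \<phi>)) \<le> L2_time_dual_norm T V1 N1 u"
proof -
  let ?M = "lebesgue_on {0<..<T}" and ?D1 = "dual_norm V1 N1" and ?D2 = "dual_norm V2 N2"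
  have t1: "(\<lambda>\<phi>. F (A \<phi>)) \<in> dual_space V2 N2" if F: "F \<in> dual_space V1 N1" for F
  proof -
    obtain C where C: "\<And>u. u \<in> V1 \<Longrightarrow> \<bar>F u\<bar> \<le> C * N1 u" using dual_spaceD(3)[OF F] by blast
    have "\<bar>F (A \<phi>)\<bar> \<le> \<bar>C\<bar> * N2 \<phi>" if "\<phi> \<in> V2" for \<phi>
    proof -
      have "\<bar>F (A \<phi>)\<bar> \<le> C * N1 (A \<phi>)" by (rule C[OF AV[OF that]])
      also have "\<dots> \<le> \<bar>C\<bar> * N1 (A \<phi>)" using N1 by (intro mult_right_mono) auto
      also have "\<dots> \<le> \<bar>C\<bar> * N2 \<phi>" using AN[OF that] by (intro mult_left_mono) auto
      finally show ?thesis .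
    qed
    then have "\<exists>C. \<forall>\<phi>\<in>V2. \<bar>F (A \<phi>)\<bar> \<le> C * N2 \<phi>" by blast
    then show ?thesis using Aadd[OF F] dual_spaceD(2)[OF F AV] by (simp add: dual_space_def Acmult)
  qed
  have t2: "?D2 (\<lambda>\<phi>. F (A \<phi>)) \<le> ?D1 F" if F: "F \<in> dual_space V1 N1" for F
  proof (rule dual_norm_least[where V=V2 and N=N2, OF z])
    fix \<phi> assume "\<phi> \<in> V2" "N2 \<phi> \<le> 1"
    then show "\<bar>F (A \<phi>)\<bar> \<le> ?D1 F" using AN[of \<phi>] by (intro dual_norm_upper[OF F N1 AV]) auto
  qed
  have t0: "0 \<le> ?D2 (\<lambda>\<phi>. F (A \<phi>))" if F: "F \<in> dual_space V1 N1" for F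
    by (rule dual_norm_nonneg[OF t1[OF F] N2 z])
  have sm: "strongly_measurable ?M (dual_space V1 N1) ?D1 u" and int: "integrable ?M (\<lambda>t. (?D1 (u t))\<^sup>2)"
    using u by (auto simp: L2_time_dual_def bochner_L2_def)
  obtain s where s: "\<And>k. simple_function ?M (s k)" "\<And>k. s k ` space ?M \<subseteq> dual_space V1 N1"
    and lim: "AE t in ?M. u t \<in> dual_space V1 N1 \<and> (\<lambda>k. ?D1 (s k t - u t)) \<longlonglongrightarrow> 0"
    using sm unfolding strongly_measurable_def by blast
  have lim2: "AE t in ?M. (\<lambda>\<phi>. u t (A \<phi>)) \<in> dual_space V2 N2 \<and> (\<lambda>k. ?D2 ((\<lambda>\<phi>. s k t (A \<phi>)) - (\<lambda>\<phi>. u t (A \<phi>)))) \<longlonglongrightarrow> 0"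
    using lim AE_space
  proof eventually_elim
    case (elim t)
    then have ut: "u t \<in> dual_space V1 N1" and l0: "(\<lambda>k. ?D1 (s k t - u t)) \<longlonglongrightarrow> 0" by auto
    have st: "s k t \<in> dual_space V1 N1" for k using s(2)[of k] elim(2) by (simp add: image_subset_iff)
    have d: "(\<lambda>\<phi>. s k t (A \<phi>)) - (\<lambda>\<phi>. u t (A \<phi>)) = (\<lambda>\<phi>. (s k t - u t) (A \<phi>))" for k by (auto simp: fun_eq_iff)
    have "norm (?D2 ((\<lambda>\<phi>. s k t (A \<phi>)) - (\<lambda>\<phi>. u t (A \<phi>)))) \<le> ?D1 (s k t - u t)" for k
      unfolding d using t2[OF dual_space_diff[OF st[of k] ut N1]] t0[OF dual_space_diff[OF st[of k] ut N1]] by simp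
    then have "(\<lambda>k. ?D2 ((\<lambda>\<phi>. s k t (A \<phi>)) - (\<lambda>\<phi>. u t (A \<phi>)))) \<longlonglongrightarrow> 0"
      by (intro Lim_null_comparison[OF _ l0] always_eventually) blast
    then show ?case using t1[OF ut] by blast
  qed
  have "strongly_measurable ?M (dual_space V2 N2) ?D2 (\<lambda>t \<phi>. u t (A \<phi>))"
    unfolding strongly_measurable_def
  proof (intro exI[of _ "\<lambda>k t \<phi>. s k t (A \<phi>)"] conjI allI lim2)
    show "simple_function ?M (\<lambda>t \<phi>. s k t (A \<phi>))" for k
      by (rule simple_function_compose1[OF s(1), of "\<lambda>F \<phi>. F (A \<phi>)"])
    show "(\<lambda>t \<phi>. s k t (A \<phi>)) ` space ?M \<subseteq> dual_space V2 N2" for k using s(2)[of k] t1 by auto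
  qed
  note sm2 = this
  have m2: "(\<lambda>t. ?D2 (\<lambda>\<phi>. u t (A \<phi>))) \<in> borel_measurable ?M" by (rule dual_norm_measurable[where V=V2 and N=N2, OF _ N2 z sm2]) simp
  have le: "AE t in ?M. (?D2 (\<lambda>\<phi>. u t (A \<phi>)))\<^sup>2 \<le> (?D1 (u t))\<^sup>2"
    using lim by eventually_elim (auto intro!: power_mono t2 t0)
  have int2: "integrable ?M (\<lambda>t. (?D2 (\<lambda>\<phi>. u t (A \<phi>)))\<^sup>2)"
    by (rule Bochner_Integration.integrable_bound[OF int]) (use m2 le in \<open>auto elim!: eventually_mono\<close>)
  show "(\<lambda>t \<phi>. u t (A \<phi>)) \<in> L2_time_dual T V2 N2" using sm2 int2 by (simp add: L2_time_dual_def bochner_L2_def)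
  show "L2_time_dual_norm T V2 N2 (\<lambda>t \<phi>. u t (A \<phi>)) \<le> L2_time_dual_norm T V1 N1 u"
    unfolding L2_time_dual_norm_def bochner_L2_norm_def by (intro real_sqrt_le_mono integral_mono_AE int int2 le)
qed

text \<open>By completeness of Lebesgue measure, f and h are either both measurable or both
  not measurable, and in the latter case both integrals are zero by convention.\<close>

lemma integral_lebesgue_on_cong_AE_any:
  fixes f h :: "'a::euclidean_space \<Rightarrow> real"
  assumes S: "S \<in> sets borel" and ae: "AE x in lebesgue_on S. f x = h x"
  shows "(LINT x|lebesgue_on S. f x) = (LINT x|lebesgue_on S. h x)"
proof (cases "f \<in> borel_measurable (lebesgue_on S)")
  case True
  then show ?thesis using lebesgue_on_measurable_cong_AE[OF S True ae] ae by (intro integral_cong_AE)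
next
  case False
  have "AE x in lebesgue_on S. h x = f x" using ae by eventually_elim simp
  then have "h \<notin> borel_measurable (lebesgue_on S)" using lebesgue_on_measurable_cong_AE[OF S] False by blast
  then have "\<not> integrable (lebesgue_on S) h" "\<not> integrable (lebesgue_on S) f" using False by auto
  then show ?thesis by (simp add: not_integrable_integral_eq)
qed

text \<open>The difference of w and u has norm zero, so a bounded functional vanishes on it.\<close>

lemma dual_space_cong_AE:
  assumes U: "open U" "bounded U" and F: "F \<in> dual_space (H1 U) (scaled_H1_norm \<epsilon> U)"
    and u: "u \<in> H1 U" and w: "w \<in> H1 U" and ae: "AE x in lebesgue_on U. w x = u x"
  shows "F w = F u"
proof -
  define d where "d x = w x - u x" for x
  have d: "d \<in> H1 U" unfolding d_def[abs_def] by (rule H1_diff[OF U w u])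
  have "scaled_H1_norm \<epsilon> U d = 0"
  proof (rule scaled_H1_norm_AE_zero[OF U])
    show "d \<in> borel_measurable (lebesgue_on U)" using H1_imp_L2[OF d] by (simp add: L2_on_def)
    show "AE x in lebesgue_on U. d x = 0" using ae by eventually_elim (simp add: d_def)
  qed
  then have "F d = 0" using dual_spaceD(3)[OF F] d by force
  moreover have "F (\<lambda>x. u x + d x) = F u + F d" by (rule dual_spaceD(1)[OF F u d])
  moreover have "(\<lambda>x. u x + d x) = w" by (simp add: d_def fun_eq_iff)
  ultimately show ?thesis by simp
qed

context perforation
begin

lemma dual_averaging_add:
  assumes F: "F \<in> dual_space (H1 \<Omega>\<^sub>\<epsilon>) (scaled_H1_norm \<epsilon> \<Omega>\<^sub>\<epsilon>)" and \<phi>: "\<phi> \<in> L2_H10 \<Omega> Ystar" and \<psi>: "\<psi> \<in> L2_H10 \<Omega> Ystar"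
  shows "F (averaging_op \<epsilon> (\<lambda>p. \<phi> p + \<psi> p)) = F (averaging_op \<epsilon> \<phi>) + F (averaging_op \<epsilon> \<psi>)"
proof -
  note OE = open_Omega_eps bounded_Omega_eps
  have L2: "\<phi> \<in> L2_on (\<Omega> \<times> Ystar)" "\<psi> \<in> L2_on (\<Omega> \<times> Ystar)" using \<phi> \<psi> by (auto simp: L2_H10_def L2_fun_valued_def)
  then have L2s: "(\<lambda>p. \<phi> p + \<psi> p) \<in> L2_on (\<Omega> \<times> Ystar)" by (simp add: L2_on_eq L2_add)
  note A = averaging_op_H1(1)[OF \<phi>] averaging_op_H1(1)[OF \<psi>]
  have sum: "(\<lambda>x. averaging_op \<epsilon> \<phi> x + averaging_op \<epsilon> \<psi> x) \<in> H1 \<Omega>\<^sub>\<epsilon>" by (rule H1_add[OF OE A])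
  have m: "averaging_op \<epsilon> (\<lambda>p. \<phi> p + \<psi> p) \<in> borel_measurable (lebesgue_on \<Omega>\<^sub>\<epsilon>)"
    using averaging_op_L2(1)[OF L2s] by (simp add: L2_on_def)
  note ae = averaging_op_add_AE[OF L2]
  have "AE x in lebesgue_on \<Omega>\<^sub>\<epsilon>. averaging_op \<epsilon> \<phi> x + averaging_op \<epsilon> \<psi> x = averaging_op \<epsilon> (\<lambda>p. \<phi> p + \<psi> p) x"
    using ae by eventually_elim simp
  then have "averaging_op \<epsilon> (\<lambda>p. \<phi> p + \<psi> p) \<in> H1 \<Omega>\<^sub>\<epsilon>" by (rule H1_cong_AE[OF sum m])
  from dual_space_cong_AE[OF OE F sum this ae] show ?thesis using dual_spaceD(1)[OF F A] by simp
qed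

lemma unfolding_op_eq: "unfolding_op \<epsilon> v = (\<lambda>z. v (fst z, unfold_map (snd z)))"
  by (simp add: unfolding_op_def unfold_map_def fun_eq_iff)

lemma unfolding_op_L2:
  assumes v: "v \<in> L2_on ({0<..<T} \<times> \<Omega>\<^sub>\<epsilon>)"
  shows "unfolding_op \<epsilon> v \<in> L2_on ({0<..<T} \<times> \<Omega> \<times> Ystar)"
  unfolding unfolding_op_eq using measure_preserving_L2(1)[OF measure_preserving_prod_right[OF unfold_map_measure_preserving_Ystar, of "{0<..<T}"] v] by simp

text \<open>For almost every t the section v(t,.) is square integrable, and then the claim
  is adjointness of unfolding and averaging.\<close>

lemma L2_embed_unfolding_op:
  assumes v: "v \<in> L2_on ({0<..<T} \<times> \<Omega>\<^sub>\<epsilon>)"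
  shows "AE t in lebesgue_on {0<..<T}. \<forall>\<phi>\<in>L2_on (\<Omega> \<times> Ystar).
    L2_embed \<Omega>\<^sub>\<epsilon> v t (averaging_op \<epsilon> \<phi>) = L2_embed (\<Omega> \<times> Ystar) (unfolding_op \<epsilon> v) t \<phi>"
proof -
  have T: "{0<..<T} \<in> sets borel" by simp
  have m: "v \<in> borel_measurable (lebesgue_on ({0<..<T} \<times> \<Omega>\<^sub>\<epsilon>))" and i: "integrable (lebesgue_on ({0<..<T} \<times> \<Omega>\<^sub>\<epsilon>)) (\<lambda>z. (v z)\<^sup>2)"
    using v by (auto simp: L2_on_def)
  show ?thesis
    using AE_integrable_lebesgue_on_slice[OF T Omega_eps_borel i] AE_measurable_lebesgue_on_slice[OF T Omega_eps_borel m]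
  proof eventually_elim
    case (elim t)
    then have vt: "(\<lambda>x. v (t, x)) \<in> L2_on \<Omega>\<^sub>\<epsilon>" by (simp add: L2_on_def)
    show ?case
      using averaging_op_adjoint[OF _ vt] by (simp add: L2_embed_def unfolding_op_eq)
  qed
qed

lemma zero_L2_H10: "(\<lambda>p. 0) \<in> L2_H10 \<Omega> Ystar" "L2_H10_norm \<Omega> Ystar (\<lambda>p. 0) \<le> 1"
proof -
  have N0: "H1_norm Ystar (\<lambda>y. 0) = 0" by (rule H1_norm_zero[OF Ystar(2) bounded_Ystar])
  have d: "(\<lambda>y. 0) - (\<lambda>y. 0) = (\<lambda>y :: real ^ 'n. 0 :: real)" by (auto simp: fun_eq_iff)
  have "strongly_measurable (lebesgue_on \<Omega>) (H10_cell Ystar) (H1_norm Ystar) (\<lambda>x y. 0)"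
    unfolding strongly_measurable_def using zero_H10_cell by (intro exI[of _ "\<lambda>_ _ _. 0"]) (simp add: d N0 image_subset_iff)
  then show "(\<lambda>p. 0) \<in> L2_H10 \<Omega> Ystar"
    by (simp add: L2_H10_def L2_fun_valued_def L2_on_def bochner_L2_def N0)
  show "L2_H10_norm \<Omega> Ystar (\<lambda>p. 0) \<le> 1"
    by (simp add: L2_H10_norm_def L2_fun_valued_norm_def bochner_L2_norm_def N0)
qed

text \<open>For almost every t the transpose of the averaging operator maps the functional
  of v to the functional of the unfolded v on square integrable functions. The first claim
  and the distributional identity follow from this agreement; the remaining assertions are
  properties of the transpose.\<close>

theorem unfolding_time_derivative:
  assumes v: "v \<in> L2_on ({0<..<T} \<times> \<Omega>\<^sub>\<epsilon>)"
    and emb: "L2_embed \<Omega>\<^sub>\<epsilon> v \<in> L2_time_dual T (H1 \<Omega>\<^sub>\<epsilon>) (scaled_H1_norm \<epsilon> \<Omega>\<^sub>\<epsilon>)"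
    and dv: "is_time_derivative T (H1 \<Omega>\<^sub>\<epsilon>) (scaled_H1_norm \<epsilon> \<Omega>\<^sub>\<epsilon>) (L2_embed \<Omega>\<^sub>\<epsilon> v) dv"
  shows "L2_embed (\<Omega> \<times> Ystar) (unfolding_op \<epsilon> v) \<in> L2_time_dual T (L2_H10 \<Omega> Ystar) (L2_H10_norm \<Omega> Ystar)"
    and "is_time_derivative T (L2_H10 \<Omega> Ystar) (L2_H10_norm \<Omega> Ystar)
      (L2_embed (\<Omega> \<times> Ystar) (unfolding_op \<epsilon> v)) (\<lambda>t \<phi>. dv t (averaging_op \<epsilon> \<phi>))"
    and "L2_time_dual_norm T (L2_H10 \<Omega> Ystar) (L2_H10_norm \<Omega> Ystar) (\<lambda>t \<phi>. dv t (averaging_op \<epsilon> \<phi>))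
      \<le> L2_time_dual_norm T (H1 \<Omega>\<^sub>\<epsilon>) (scaled_H1_norm \<epsilon> \<Omega>\<^sub>\<epsilon>) dv"
proof -
  have N2: "0 \<le> L2_H10_norm \<Omega> Ystar u" for u
    by (simp add: L2_H10_norm_def L2_fun_valued_norm_def bochner_L2_norm_def integral_square_nonneg)
  have tr: "(\<lambda>t \<phi>. u t (averaging_op \<epsilon> \<phi>)) \<in> L2_time_dual T (L2_H10 \<Omega> Ystar) (L2_H10_norm \<Omega> Ystar)"
    "L2_time_dual_norm T (L2_H10 \<Omega> Ystar) (L2_H10_norm \<Omega> Ystar) (\<lambda>t \<phi>. u t (averaging_op \<epsilon> \<phi>))
      \<le> L2_time_dual_norm T (H1 \<Omega>\<^sub>\<epsilon>) (scaled_H1_norm \<epsilon> \<Omega>\<^sub>\<epsilon>) u"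
    if u: "u \<in> L2_time_dual T (H1 \<Omega>\<^sub>\<epsilon>) (scaled_H1_norm \<epsilon> \<Omega>\<^sub>\<epsilon>)" for u
    by (rule L2_time_dual_transpose[where ?N1.0 = "scaled_H1_norm \<epsilon> \<Omega>\<^sub>\<epsilon>" and ?V1.0 = "H1 \<Omega>\<^sub>\<epsilon>"
          and ?N2.0 = "L2_H10_norm \<Omega> Ystar" and ?V2.0 = "L2_H10 \<Omega> Ystar" and A = "averaging_op \<epsilon>" and z = "\<lambda>p. 0"];
        (rule scaled_H1_norm_nonneg | rule N2 | rule zero_L2_H10 | rule averaging_op_cmult | rule u
          | (rule averaging_op_H1; assumption) | (rule dual_averaging_add; assumption)))+
  have sub: "L2_H10 \<Omega> Ystar \<subseteq> L2_on (\<Omega> \<times> Ystar)" by (auto simp: L2_H10_def L2_fun_valued_def)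
  note ae = L2_embed_unfolding_op[OF v]
  show "L2_embed (\<Omega> \<times> Ystar) (unfolding_op \<epsilon> v) \<in> L2_time_dual T (L2_H10 \<Omega> Ystar) (L2_H10_norm \<Omega> Ystar)"
  proof (rule L2_time_dual_cong[where N = "L2_H10_norm \<Omega> Ystar" and z = "\<lambda>p. 0", OF sub _ _ tr(1)[OF emb] ae N2 zero_L2_H10])
    show "(\<lambda>x. u x + w x) \<in> L2_on (\<Omega> \<times> Ystar)" if "u \<in> L2_H10 \<Omega> Ystar" "w \<in> L2_H10 \<Omega> Ystar" for u w
      using that sub by (auto simp: L2_on_eq intro!: L2_add)
    show "(\<lambda>x. c * u x) \<in> L2_on (\<Omega> \<times> Ystar)" if "u \<in> L2_H10 \<Omega> Ystar" for u c
      using that sub by (auto simp: L2_on_eq intro!: L2_cmult)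
  qed
  have dvL2: "dv \<in> L2_time_dual T (H1 \<Omega>\<^sub>\<epsilon>) (scaled_H1_norm \<epsilon> \<Omega>\<^sub>\<epsilon>)" using dv by (simp add: is_time_derivative_def)
  show "L2_time_dual_norm T (L2_H10 \<Omega> Ystar) (L2_H10_norm \<Omega> Ystar) (\<lambda>t \<phi>. dv t (averaging_op \<epsilon> \<phi>))
      \<le> L2_time_dual_norm T (H1 \<Omega>\<^sub>\<epsilon>) (scaled_H1_norm \<epsilon> \<Omega>\<^sub>\<epsilon>) dv"
    by (rule tr(2)[OF dvL2])
  show "is_time_derivative T (L2_H10 \<Omega> Ystar) (L2_H10_norm \<Omega> Ystar)
      (L2_embed (\<Omega> \<times> Ystar) (unfolding_op \<epsilon> v)) (\<lambda>t \<phi>. dv t (averaging_op \<epsilon> \<phi>))"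
    unfolding is_time_derivative_def
  proof (intro conjI ballI tr(1)[OF dvL2])
    fix \<psi> \<phi> assume \<psi>: "\<psi> \<in> test_functions {0<..<T}" and \<phi>: "\<phi> \<in> L2_H10 \<Omega> Ystar"
    have "(LINT t|lebesgue_on {0<..<T}. L2_embed (\<Omega> \<times> Ystar) (unfolding_op \<epsilon> v) t \<phi> * deriv \<psi> t)
      = (LINT t|lebesgue_on {0<..<T}. L2_embed \<Omega>\<^sub>\<epsilon> v t (averaging_op \<epsilon> \<phi>) * deriv \<psi> t)"
    proof (rule integral_lebesgue_on_cong_AE_any)
      show "AE t in lebesgue_on {0<..<T}. L2_embed (\<Omega> \<times> Ystar) (unfolding_op \<epsilon> v) t \<phi> * deriv \<psi> t
        = L2_embed \<Omega>\<^sub>\<epsilon> v t (averaging_op \<epsilon> \<phi>) * deriv \<psi> t"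
        using ae by eventually_elim (use \<phi> sub in auto)
    qed simp
    also have "\<dots> = - (LINT t|lebesgue_on {0<..<T}. dv t (averaging_op \<epsilon> \<phi>) * \<psi> t)"
      using dv \<psi> averaging_op_H1(1)[OF \<phi>] by (simp add: is_time_derivative_def)
    finally show "(LINT t|lebesgue_on {0<..<T}. L2_embed (\<Omega> \<times> Ystar) (unfolding_op \<epsilon> v) t \<phi> * deriv \<psi> t)
      = - (LINT t|lebesgue_on {0<..<T}. dv t (averaging_op \<epsilon> \<phi>) * \<psi> t)" .
  qed
qed

end

section \<open>The time derivative of an unfolded function\<close>

theorem proposition3:
  fixes a b :: "nat ^ 'n"
    and T \<epsilon> :: real
    and \<Omega> Ystar \<Omega>\<^sub>\<epsilon> :: "(real ^ 'n) set"
    and v :: "real \<times> (real ^ 'n) \<Rightarrow> real"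
    and dv :: "real \<Rightarrow> ((real ^ 'n) \<Rightarrow> real) \<Rightarrow> real"
  assumes dim: "CARD('n) > 1"
    and ab: "\<And>i. a $ i < b $ i"
    and Omega: "\<Omega> = box_domain a b"
    and T: "T > 0"
    and eps: "\<epsilon> > 0" "inverse \<epsilon> \<in> \<nat>"
    and Ystar: "Ystar \<subseteq> unit_cell" "open Ystar" "connected Ystar" "Ystar \<noteq> {}"
      "lipschitz_boundary Ystar"
    and faces: "\<And>i. (\<lambda>x. x + axis i 1) ` (frontier Ystar \<inter> {x. x $ i = 0}) =
                      frontier Ystar \<inter> {x. x $ i = 1}"
    and Gamma: "lipschitz_hypersurface (frontier Ystar - frontier unit_cell)"
    and Omega_eps: "\<Omega>\<^sub>\<epsilon> = perforated \<epsilon> \<Omega> Ystar" "connected \<Omega>\<^sub>\<epsilon>" "lipschitz_boundary \<Omega>\<^sub>\<epsilon>"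
    and v: "v \<in> L2_on ({0<..<T} \<times> \<Omega>\<^sub>\<epsilon>)"
      "L2_embed \<Omega>\<^sub>\<epsilon> v \<in> H1_time_dual T (H1 \<Omega>\<^sub>\<epsilon>) (scaled_H1_norm \<epsilon> \<Omega>\<^sub>\<epsilon>)"
    and dv: "is_time_derivative T (H1 \<Omega>\<^sub>\<epsilon>) (scaled_H1_norm \<epsilon> \<Omega>\<^sub>\<epsilon>) (L2_embed \<Omega>\<^sub>\<epsilon> v) dv"
  shows "unfolding_op \<epsilon> v \<in> L2_on ({0<..<T} \<times> \<Omega> \<times> Ystar) \<and>
    L2_embed (\<Omega> \<times> Ystar) (unfolding_op \<epsilon> v)
      \<in> H1_time_dual T (L2_H10 \<Omega> Ystar) (L2_H10_norm \<Omega> Ystar) \<and>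
    (\<exists>dTv. is_time_derivative T (L2_H10 \<Omega> Ystar) (L2_H10_norm \<Omega> Ystar)
              (L2_embed (\<Omega> \<times> Ystar) (unfolding_op \<epsilon> v)) dTv \<and>
       (\<forall>\<phi>\<in>L2_H10 \<Omega> Ystar. averaging_op \<epsilon> \<phi> \<in> H1 \<Omega>\<^sub>\<epsilon> \<and>
          (AE t in lebesgue_on {0<..<T}. dTv t \<phi> = dv t (averaging_op \<epsilon> \<phi>))) \<and>
       L2_time_dual_norm T (L2_H10 \<Omega> Ystar) (L2_H10_norm \<Omega> Ystar) dTv
         \<le> L2_time_dual_norm T (H1 \<Omega>\<^sub>\<epsilon>) (scaled_H1_norm \<epsilon> \<Omega>\<^sub>\<epsilon>) dv)"
proof -
  interpret perforation a b \<epsilon> \<Omega> Ystar \<Omega>\<^sub>\<epsilon>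
    by unfold_locales (fact Omega eps Ystar Omega_eps)+
  have emb: "L2_embed \<Omega>\<^sub>\<epsilon> v \<in> L2_time_dual T (H1 \<Omega>\<^sub>\<epsilon>) (scaled_H1_norm \<epsilon> \<Omega>\<^sub>\<epsilon>)"
    using v(2) by (simp add: H1_time_dual_def)
  note td = unfolding_time_derivative[OF v(1) emb dv]
  show ?thesis
  proof (intro conjI exI[of _ "\<lambda>t \<phi>. dv t (averaging_op \<epsilon> \<phi>)"] ballI)
    show "unfolding_op \<epsilon> v \<in> L2_on ({0<..<T} \<times> \<Omega> \<times> Ystar)"
      by (rule unfolding_op_L2[OF v(1)])
    show "L2_embed (\<Omega> \<times> Ystar) (unfolding_op \<epsilon> v)
      \<in> H1_time_dual T (L2_H10 \<Omega> Ystar) (L2_H10_norm \<Omega> Ystar)"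
      using td(1,2) unfolding H1_time_dual_def by blast
    show "averaging_op \<epsilon> \<phi> \<in> H1 \<Omega>\<^sub>\<epsilon>" if "\<phi> \<in> L2_H10 \<Omega> Ystar" for \<phi>
      by (rule averaging_op_H1(1)[OF that])
  qed (use td(2,3) in simp_all)
qed

end
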